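(* Assume $0<k_+<k_-$ and let $R_0>0$ be an arbitrary fixed number. For $y=(y_1,y_2)\in B^+_{R_0}\cup B^-_{R_0}$ and $x=|x|\hat x=|x|(\cos\theta_{\hat x},\sin\theta_{\hat x})\in\mathbb R^2_+$ with $\theta_{\hat x}\in(0,\pi)$, we have the asymptotic behavior $$G(x,y)=\frac{e^{ik_+|x|}}{\sqrt{|x|}}G^\infty(\hat x,y)+G_{Res}(x,y),\qquad \nabla_yG(x,y)=\frac{e^{ik_+|x|}}{\sqrt{|x|}}H^\infty(\hat x,y)+H_{Res}(x,y),$$ where $$G^\infty(\hat x,y):=\frac{e^{i\pi/4}}{\sqrt{8\pi k_+}}\begin{cases}e^{-ik_+\hat x\cdot y}+\mathcal R(\theta_{\hat x})e^{-ik_+\hat x\cdot y'}, & y\in\mathbb R^2_+,\\ \mathcal T(\theta_{\hat x})e^{-ik_+(y_1\cos\theta_{\hat x}+iy_2\mathcal S(\cos\theta_{\hat x},n))}, & y\in\mathbb R^2_-,\end{cases}$$ $$H^\infty(\hat x,y):=e^{-i\pi/4}\sqrt{\frac{k_+}{8\pi}}\begin{cases}e^{-ik_+\hat x\cdot y}(\cos\theta_{\hat x},\sin\theta_{\hat x})+\mathcal R(\theta_{\hat x})e^{-ik_+\hat x\cdot y'}(\cos\theta_{\hat x},-\sin\theta_{\hat x}), & y\in\mathbb R^2_+,\\ \mathcal T(\theta_{\hat x})e^{-ik_+(y_1\cos\theta_{\hat x}+iy_2\mathcal S(\cos\theta_{\hat x},n))}(\cos\theta_{\hat x},i\mathcal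 S(\cos\theta_{\hat x},n)), & y\in\mathbb R^2_-,\end{cases}$$ and $G_{Res}$, $H_{Res}$ satisfy $$|G_{Res}(x,y)|,\ |H_{Res}(x,y)|\le C_{R_0}|x|^{-3/2},\qquad |x|\to+\infty,$$ uniformly for all $\theta_{\hat x}\in(0,\pi)$ and $y\in B^+_{R_0}\cup B^-_{R_0}$. Here the constant $C_{R_0}>0$ is independent of $x$ and $y$ but depends on $R_0$.
   Context: Notation. $\mathbb R^2_\pm=\{(x_1,x_2)\in\mathbb R^2: x_2\gtrless 0\}$, $\Gamma_0=\{(x_1,0):x_1\in\mathbb R\}$, $\mathbb S^1_\pm=\{x\in\mathbb R^2_\pm:|x|=1\}$, $B^\pm_{R_0}=\{y\in\mathbb R^2_\pm:|y|<R_0\}$, $\hat x=x/|x|$, and $y'=(y_1,-y_2)$ for $y=(y_1,y_2)$. $k_\pm>0$ are two different wave numbers and $n:=k_-/k_+$. Function $\mathcal S$. For $z=|z|e^{i\theta_1}\ne0$ with $\theta_1\in(-\frac{3\pi}2,\frac\pi2)$ let $\mathcal S_1(z)=\sqrt{|z|}e^{i\theta_1/2}$; for $z=|z|e^{i\theta_2}\neq 0$ with $\theta_2\in(-\frac\pi2,\frac{3\pi}2)$ let $\mathcal S_2(z)=\sqrt{|z|}e^{i\theta_2/2}$; $\mathcal S_1(0)=\mathcal S_2(0)=0$. For $a>0$ let $\mathcal S(z,a)=\mathcal S_1(z-a)\mathcal S_2(z+a)$. (For real $z$: $\mathcal S(z,a)=\sqrt{z^2-a^2}$ if $|z|\ge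 a$ and $\mathcal S(z,a)=-i\sqrt{a^2-z^2}$ if $|z|<a$.) For $\theta\in\mathbb R$, $$\mathcal R(\theta)=\frac{i\sin\theta+\mathcal S(\cos\theta,n)}{i\sin\theta-\mathcal S(\cos\theta,n)},\qquad \mathcal T(\theta)=\mathcal R(\theta)+1.$$ Two-layered Green function. For $y\in\mathbb R^2_+\cup\mathbb R^2_-$, $G(\cdot,y)$ is the solution of $\Delta_xG(x,y)+k_\pm^2G(x,y)=-\delta(x,y)$ in $\mathbb R^2_\pm$, $[G(x,y)]=0$ and $[\partial G(x,y)/\partial\nu(x)]=0$ on $\Gamma_0$ (jumps across $\Gamma_0$, $\nu$ the unit normal pointing into $\mathbb R^2_+$), and the Sommerfeld radiation condition $\lim_{|x|\to\infty}\sqrt{|x|}(\partial G(x,y)/\partial|x|-ik_\pm G(x,y))=0$ uniformly for all $\hat x\in\mathbb S^1_\pm$. Explicitly, for $x\in\mathbb R^2_+$, $$G(x,y)=\frac i4H^{(1)}_0(k_+|x-y|)+\frac1{4\pi}\int_{-\infty}^{\infty}\frac{\mathcal S(\xi,k_+)-\mathcal S(\xi,k_-)}{\mathcal S(\xi,k_+)+\mathcal S(\xi,k_-)}\frac{e^{-\mathcal S(\xi,k_+)|x_2+y_2|}}{\mathcal S(\xi,k_+)}e^{i\xi(x_1-y_1)}d\xi\quad(y\in\mathbb R^2_+),$$ $$G(x,y)=\frac1{2\pi}\int_{-\infty}^{\infty}\frac{e^{\mathcal S(\xi,k_-)y_2-\mathcal S(\xi,k_+)x_2}}{\mathcal S(\xi,k_+)+\mathcal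 S(\xi,k_-)}e^{i\xi(x_1-y_1)}d\xi\quad(y\in\mathbb R^2_-),$$ with $H_0^{(1)}$ the Hankel function of the first kind of order $0$. Convention. A bound "as $|x|\to+\infty$, uniformly for all $\theta_{\hat x}$ and $y$ in given sets" means that it holds for all $|x|$ sufficiently large, with the threshold independent of $\theta_{\hat x}$ and $y$ in these sets. Gradients are written as row vectors. *)

theory Defs
  imports "HOL-Analysis.Analysis"
begin

definition upper_half_plane :: "(real^2) set" where
  "upper_half_plane = {x. x $ 2 > 0}"

definition lower_half_plane :: "(real^2) set" where
  "lower_half_plane = {x. x $ 2 < 0}"

definition upper_half_disc :: "real \<Rightarrow> (real^2) set" where
  "upper_half_disc R = {y \<in> upper_half_plane. norm y < R}"

definition lower_half_disc :: "real \<Rightarrow> (real^2) set" where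
  "lower_half_disc R = {y \<in> lower_half_plane. norm y < R}"

definition direction :: "real \<Rightarrow> real^2" where
  "direction \<theta> = vector [cos \<theta>, sin \<theta>]"

definition reflect :: "real^2 \<Rightarrow> real^2" where
  "reflect y = vector [y $ 1, - (y $ 2)]"

text \<open>
  Branches of the square root, cut along the positive imaginary axis (first branch) and the
  negative imaginary axis (second branch).  The angle is unique for nonzero \<open>z\<close> off the cut;
  at \<open>z = 0\<close> the factor \<open>sqrt (cmod z)\<close> gives the value 0, and on the cut itself the value is
  unspecified.
\<close>

definition S1 :: "complex \<Rightarrow> complex" where
  "S1 z = of_real (sqrt (cmod z)) *
     cis ((THE \<theta>. - 3 * pi / 2 < \<theta> \<and> \<theta> < pi / 2 \<and> z = rcis (cmod z) \<theta>) / 2)"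

definition S2 :: "complex \<Rightarrow> complex" where
  "S2 z = of_real (sqrt (cmod z)) *
     cis ((THE \<theta>. - pi / 2 < \<theta> \<and> \<theta> < 3 * pi / 2 \<and> z = rcis (cmod z) \<theta>) / 2)"

definition SS :: "complex \<Rightarrow> real \<Rightarrow> complex" where
  "SS z a = S1 (z - of_real a) * S2 (z + of_real a)"

lemma S1_rcis:
  assumes "0 \<le> r" "- 3 * pi / 2 < \<theta>" "\<theta> < pi / 2"
  shows "S1 (rcis r \<theta>) = of_real (sqrt r) * cis (\<theta> / 2)"
proof (cases "r = 0")
  case False
  have "(THE t. - 3 * pi / 2 < t \<and> t < pi / 2 \<and> rcis r \<theta> = rcis r t) = \<theta>"
  proof (rule the_equality)
    fix t assume t: "- 3 * pi / 2 < t \<and> t < pi / 2 \<and> rcis r \<theta> = rcis r t"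
    then have "cis \<theta> = cis t" using False by (simp add: rcis_def)
    then have "sin \<theta> = sin t \<and> cos \<theta> = cos t" by (simp add: complex_eq_iff)
    then obtain n :: int where n: "t = \<theta> + 2 * of_int n * pi"
      using sin_cos_eq_iff[of t \<theta>] by (auto simp: algebra_simps)
    have "\<bar>2 * of_int n * pi\<bar> < 2 * pi" using t assms n by linarith
    then have "\<bar>real_of_int n\<bar> < 1" by (simp add: abs_mult)
    then show "t = \<theta>" using n by simp
  qed (use assms in simp)
  then show ?thesis using assms by (simp add: S1_def)
qed (simp add: S1_def)

lemma S2_rcis:
  assumes "0 \<le> r" "- pi / 2 < \<theta>" "\<theta> < 3 * pi / 2"
  shows "S2 (rcis r \<theta>) = of_real (sqrt r) * cis (\<theta> / 2)"
proof (cases "r = 0")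
  case False
  have "(THE t. - pi / 2 < t \<and> t < 3 * pi / 2 \<and> rcis r \<theta> = rcis r t) = \<theta>"
  proof (rule the_equality)
    fix t assume t: "- pi / 2 < t \<and> t < 3 * pi / 2 \<and> rcis r \<theta> = rcis r t"
    then have "cis \<theta> = cis t" using False by (simp add: rcis_def)
    then have "sin \<theta> = sin t \<and> cos \<theta> = cos t" by (simp add: complex_eq_iff)
    then obtain n :: int where n: "t = \<theta> + 2 * of_int n * pi"
      using sin_cos_eq_iff[of t \<theta>] by (auto simp: algebra_simps)
    have "\<bar>2 * of_int n * pi\<bar> < 2 * pi" using t assms n by linarith
    then have "\<bar>real_of_int n\<bar> < 1" by (simp add: abs_mult)
    then show "t = \<theta>" using n by simp
  qed (use assms in simp)
  then show ?thesis using assms by (simp add: S2_def)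
qed (simp add: S2_def)

lemma S1_of_real:
  "S1 (of_real t) = (if t \<ge> 0 then of_real (sqrt t) else - \<i> * of_real (sqrt (- t)))"
proof (cases "t \<ge> 0")
  case True
  then show ?thesis using S1_rcis[of t 0] by simp
next
  case False
  have "rcis (- t) (- pi) = of_real t" by (simp add: rcis_def cis.ctr complex_eq_iff)
  moreover have "cis (- pi / 2) = - \<i>" by (simp add: cis.ctr complex_eq_iff)
  ultimately show ?thesis using S1_rcis[of "- t" "- pi"] False by simp
qed

lemma S2_of_real:
  "S2 (of_real t) = (if t \<ge> 0 then of_real (sqrt t) else \<i> * of_real (sqrt (- t)))"
proof (cases "t \<ge> 0")
  case True
  then show ?thesis using S2_rcis[of t 0] by simp
next
  case False
  have "rcis (- t) pi = of_real t" by (simp add: rcis_def cis.ctr complex_eq_iff)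
  moreover have "cis (pi / 2) = \<i>" by (simp add: cis.ctr complex_eq_iff)
  ultimately show ?thesis using S2_rcis[of "- t" pi] False by simp
qed

lemma SS_of_real:
  assumes "a > 0"
  shows "SS (of_real t) a =
    (if \<bar>t\<bar> \<ge> a then of_real (sqrt (t\<^sup>2 - a\<^sup>2)) else - \<i> * of_real (sqrt (a\<^sup>2 - t\<^sup>2)))"
proof -
  have eq: "SS (of_real t) a = S1 (of_real (t - a)) * S2 (of_real (t + a))"
    by (simp add: SS_def)
  have f: "t\<^sup>2 - a\<^sup>2 = (t - a) * (t + a)" "t\<^sup>2 - a\<^sup>2 = (- (t - a)) * (- (t + a))"
    "a\<^sup>2 - t\<^sup>2 = (- (t - a)) * (t + a)"
    by (simp_all add: power2_eq_square algebra_simps)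
  consider "t \<ge> a" | "t \<le> - a" | "\<bar>t\<bar> < a" by linarith
  then show ?thesis
  proof cases
    case 1
    then show ?thesis using assms unfolding eq S1_of_real S2_of_real f(1) real_sqrt_mult by simp
  next
    case 2
    show ?thesis
    proof (cases "t = - a")
      case True
      then show ?thesis using assms unfolding eq S1_of_real S2_of_real by simp
    next
      case False
      then show ?thesis using 2 assms unfolding eq S1_of_real S2_of_real f(2) real_sqrt_mult
        by (simp add: complex_eq_iff)
    qed
  next
    case 3
    then show ?thesis using assms unfolding eq S1_of_real S2_of_real f(3) real_sqrt_mult
      by (auto simp: abs_less_iff)
  qed
qed

definition refl_coeff :: "real \<Rightarrow> real \<Rightarrow> complex" where
  "refl_coeff n \<theta> = (\<i> * of_real (sin \<theta>) + SS (of_real (cos \<theta>)) n)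
                   / (\<i> * of_real (sin \<theta>) - SS (of_real (cos \<theta>)) n)"

definition trans_coeff :: "real \<Rightarrow> real \<Rightarrow> complex" where
  "trans_coeff n \<theta> = refl_coeff n \<theta> + 1"

text \<open>
  Bessel functions of order 0 for positive real argument, by their standard power series
  (DLMF 10.2.2 and 10.8.2); \<open>harm m\<close> is the harmonic number \<open>1 + 1/2 + ... + 1/m\<close>.
\<close>

definition bessel_J0 :: "real \<Rightarrow> real" where
  "bessel_J0 t = (\<Sum>m. (-1) ^ m * (t\<^sup>2 / 4) ^ m / (fact m)\<^sup>2)"

definition bessel_Y0 :: "real \<Rightarrow> real" where
  "bessel_Y0 t = 2 / pi * (ln (t / 2) + euler_mascheroni) * bessel_J0 t
     - 2 / pi * (\<Sum>m. (-1) ^ m * harm m * (t\<^sup>2 / 4) ^ m / (fact m)\<^sup>2)"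

definition hankel1_0 :: "real \<Rightarrow> complex" where
  "hankel1_0 t = of_real (bessel_J0 t) + \<i> * of_real (bessel_Y0 t)"

text \<open>
  The two-layered Green function by its explicit Fourier representation, for observation points
  \<open>x\<close> in the upper half-plane and sources \<open>y\<close> off the interface; outside this range the value of
  the definition has no meaning.  The integrals converge absolutely; the reflected integrand has
  integrable singularities at \<open>\<xi> = kp\<close> and \<open>\<xi> = - kp\<close>.
\<close>

definition green :: "real \<Rightarrow> real \<Rightarrow> real^2 \<Rightarrow> real^2 \<Rightarrow> complex" where
  "green kp km x y =
    (if y \<in> upper_half_plane then
       \<i> / 4 * hankel1_0 (kp * norm (x - y))
       + 1 / (4 * of_real pi) *
         (LBINT \<xi>. (SS (of_real \<xi>) kp - SS (of_real \<xi>) km) / (SS (of_real \<xi>) kp + SS (of_real \<xi>) km)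
            * (exp (- SS (of_real \<xi>) kp * of_real \<bar>x $ 2 + y $ 2\<bar>) / SS (of_real \<xi>) kp)
            * exp (\<i> * of_real (\<xi> * (x $ 1 - y $ 1))))
     else
       1 / (2 * of_real pi) *
         (LBINT \<xi>. exp (SS (of_real \<xi>) km * of_real (y $ 2) - SS (of_real \<xi>) kp * of_real (x $ 2))
            / (SS (of_real \<xi>) kp + SS (of_real \<xi>) km)
            * exp (\<i> * of_real (\<xi> * (x $ 1 - y $ 1)))))"

text \<open>
  Gradient of a complex-valued function of two real variables: \<open>f\<close> is Frechet differentiable
  at \<open>y\<close> and \<open>v\<close> is the vector of its two partial derivatives.
\<close>

definition has_gradient :: "(real^2 \<Rightarrow> complex) \<Rightarrow> complex^2 \<Rightarrow> real^2 \<Rightarrow> bool" where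
  "has_gradient f v y \<longleftrightarrow>
     (f has_derivative (\<lambda>h. of_real (h $ 1) * v $ 1 + of_real (h $ 2) * v $ 2)) (at y)"

definition G_inf :: "real \<Rightarrow> real \<Rightarrow> real \<Rightarrow> real^2 \<Rightarrow> complex" where
  "G_inf kp km \<theta> y =
    (let n = km / kp in
     exp (\<i> * of_real (pi / 4)) / of_real (sqrt (8 * pi * kp)) *
     (if y \<in> upper_half_plane then
        exp (- \<i> * of_real (kp * (direction \<theta> \<bullet> y)))
        + refl_coeff n \<theta> * exp (- \<i> * of_real (kp * (direction \<theta> \<bullet> reflect y)))
      else
        trans_coeff n \<theta> *
        exp (- \<i> * of_real kp *
             (of_real (y $ 1 * cos \<theta>) + \<i> * of_real (y $ 2) * SS (of_real (cos \<theta>)) n))))"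

definition H_inf :: "real \<Rightarrow> real \<Rightarrow> real \<Rightarrow> real^2 \<Rightarrow> complex^2" where
  "H_inf kp km \<theta> y =
    (let n = km / kp in
     (exp (- \<i> * of_real (pi / 4)) * of_real (sqrt (kp / (8 * pi)))) *s
     (if y \<in> upper_half_plane then
        exp (- \<i> * of_real (kp * (direction \<theta> \<bullet> y))) *s
          vector [of_real (cos \<theta>), of_real (sin \<theta>)]
        + (refl_coeff n \<theta> * exp (- \<i> * of_real (kp * (direction \<theta> \<bullet> reflect y)))) *s
          vector [of_real (cos \<theta>), - of_real (sin \<theta>)]
      else
        (trans_coeff n \<theta> *
         exp (- \<i> * of_real kp *
              (of_real (y $ 1 * cos \<theta>) + \<i> * of_real (y $ 2) * SS (of_real (cos \<theta>)) n))) *s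
        vector [of_real (cos \<theta>), \<i> * SS (of_real (cos \<theta>)) n]))"

end

theory Submission
  imports Defs "HOL-Complex_Analysis.Complex_Analysis" "HOL-Probability.Distributions" "HOL-Real_Asymp.Real_Asymp"
begin

text \<open>
  Write \<open>k < K\<close> for the two wave numbers, \<open>S(\<xi>) = SS \<xi> k\<close> and \<open>T(\<xi>) = SS \<xi> K\<close> for the two vertical wave
  numbers. Since \<open>S\<^sup>2 - T\<^sup>2 = K\<^sup>2 - k\<^sup>2\<close> is constant, the reflection quotient is a quadratic polynomial in
  \<open>S\<close> and \<open>T\<close>. Hence the Green function and its \<open>y\<close>-gradient are, up to the free Hankel wave, finite
  combinations of the integrals
    \<open>F(X1, X2, Y) = \<integral> \<xi>^i S^j T^l exp (T Y - S X2 + \<i> \<xi> X1) / S d\<xi>\<close>   (constant \<open>fourier\<close>),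
  with \<open>Y \<le> 0\<close> and \<open>(X1, X2) = r (cos \<theta>, sin \<theta>)\<close> in the upper half-plane. Such an integral is shown to equal
  its stationary phase value up to \<open>O(r powr (-3/2))\<close>, uniformly up to grazing angles \<open>\<theta> \<rightarrow> 0, \<pi>\<close>
  (\<open>fourier_asymptotics\<close>).

  The substitution \<open>\<xi> = k cos z\<close> turns \<open>S\<close> into \<open>- \<i> k sin z\<close>, \<open>d\<xi> / S\<close> into \<open>- \<i> dz\<close> and the exponential into
  \<open>exp (\<i> k r cos (z - \<theta>))\<close>. The square root singularities at \<open>\<xi> = \<plusminus> k\<close> disappear, and the integration path
  becomes the broken line from \<open>\<pi> - \<i> \<infinity>\<close> via \<open>\<pi>\<close> and \<open>0\<close> to \<open>\<i> \<infinity>\<close>. The points \<open>\<xi> = \<plusminus> K\<close> become branch points of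
  \<open>T\<close> at \<open>\<i> a\<close> and \<open>\<pi> - \<i> a\<close>, where \<open>cosh a = K / k\<close>. In the strip \<open>\<bar>Im z\<bar> \<le> a\<close> one root of \<open>T\<^sup>2\<close> is holomorphic,
  so there the path can be moved to the line of steepest descent through the saddle \<open>z = \<theta>\<close>, which gives the
  main term with error \<open>O(r powr (-3/2))\<close> (\<open>saddle_contribution\<close>); the connecting pieces are exponentially
  small (\<open>box_decay\<close>). The two tails beyond the branch points are moved sideways by a fixed distance \<open>w\<close>, where
  the wave decays at a rate that does not degenerate as \<open>\<theta> \<rightarrow> 0\<close> (\<open>ray_increment\<close>, \<open>arc_vanishes\<close>). What is left is a
  short segment at each branch point, traversed once with each of the two roots. Both roots vanish like
  \<open>sqrt s\<close> at distance \<open>s\<close> from the branch point and the wave decays like \<open>exp (- c r s)\<close>; the integral of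
  \<open>sqrt s exp (- c r s)\<close> is of order \<open>r powr (-3/2)\<close> (\<open>branch_increment\<close>). This is why the exponent in the
  error bound is \<open>- 3/2\<close> even when the saddle is close to \<open>0\<close> or \<open>\<pi>\<close>; the angles in \<open>(\<pi>/2, \<pi>)\<close> follow by the
  reflection \<open>X1 \<mapsto> - X1\<close>.

  The Hankel function is given by its power series at \<open>0\<close>, so its behaviour at infinity needs an argument of
  its own. The Laplace integral \<open>- (2 \<i> / \<pi>) exp (\<i> t) \<integral> exp (- t w) / sqrt (w (w - 2 \<i>)) dw\<close> over \<open>w > 0\<close> solves the
  Bessel equation and has the same limiting behaviour at \<open>0\<close>, so the two functions agree
  (\<open>hankel_eq_lap\<close>); the Laplace integral has an evident expansion for large \<open>t\<close> (\<open>hankel_asymptotics\<close>).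

  Finally the arguments of the integrals are \<open>x - b\<close> with a bounded shift \<open>b\<close> depending on \<open>y\<close>. Replacing \<open>x - b\<close>
  by \<open>x\<close> costs the phase factor \<open>exp (- \<i> k x\<^sub>0 \<bullet> b)\<close>, with \<open>x\<^sub>0\<close> the direction of \<open>x\<close>, and again an error
  \<open>O(r powr (-3/2))\<close> (\<open>far_field_shift\<close>). Adding up the terms gives the two patterns.
\<close>

(* leaves the dollar sign to vector components *)
no_notation fps_nth (infixl "$" 75)

section \<open>The contribution of a saddle point\<close>

text \<open>
  The modulus of the oscillating factor after the substitution \<open>\<xi> = k cos z\<close>: the sign of \<open>sin (Re z) sinh (Im z)\<close>
  tells in which regions of the \<open>z\<close>-plane it decays.
\<close>
lemma norm_exp_i_cos:
  "cmod (exp (\<i> * of_real \<rho> * cos z)) = exp (\<rho> * sin (Re z) * sinh (Im z))"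
  by (simp add: norm_exp_eq_Re Im_cos sinh_field_def algebra_simps diff_divide_distrib)

text \<open>
  The derivative of \<open>exp\<close> is bounded by \<open>exp c\<close> on the half-plane \<open>Re z \<le> c\<close>, which is convex.
\<close>
lemma norm_exp_diff_le:
  fixes a b :: complex
  assumes "Re a \<le> c" "Re b \<le> c"
  shows "cmod (exp a - exp b) \<le> exp c * cmod (a - b)"
proof -
  have "convex {z. Re z \<le> c}" by (rule convex_halfspace_Re_le)
  moreover have "\<And>z. z \<in> {z. Re z \<le> c} \<Longrightarrow> (exp has_field_derivative exp z) (at z within {z. Re z \<le> c})"
    by (auto intro!: derivative_eq_intros)
  moreover have "\<And>z. z \<in> {z. Re z \<le> c} \<Longrightarrow> cmod (exp z) \<le> exp c" by simp
  ultimately show ?thesis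
    using field_differentiable_bound[of "{z. Re z \<le> c}" exp exp "exp c" a b] assms by simp
qed

lemma sin_ge_half:
  fixes t :: real assumes "0 \<le> t" "t \<le> 1" shows "t / 2 \<le> sin t"
proof -
  have "sin 0 - 0 / 2 \<le> sin t - t / 2"
  proof (rule DERIV_nonneg_imp_nondecreasing[OF assms(1)])
    fix x assume x: "0 \<le> x" "x \<le> t"
    then have "x \<le> pi / 3" using assms pi_gt3 by linarith
    then have "cos (pi / 3) \<le> cos x" using x pi_gt3 by (intro cos_monotone_0_pi_le) linarith+
    then show "\<exists>y. ((\<lambda>t. sin t - t / 2) has_real_derivative y) (at x) \<and> 0 \<le> y"
      by (intro exI[of _ "cos x - 1 / 2"]) (auto intro!: derivative_eq_intros simp: cos_60)
  qed
  then show ?thesis by simp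
qed

lemma sinh_ge_self: fixes t :: real assumes "0 \<le> t" shows "t \<le> sinh t"
proof -
  have "sinh 0 - 0 \<le> sinh t - t"
  proof (rule DERIV_nonneg_imp_nondecreasing[OF assms(1)])
    fix x :: real assume x: "0 \<le> x" "x \<le> t"
    show "\<exists>y. ((\<lambda>t. sinh t - t) has_real_derivative y) (at x) \<and> 0 \<le> y"
      using cosh_real_ge_1[of x]
      by (intro exI[of _ "cosh x - 1"]) (auto intro!: derivative_eq_intros)
  qed
  then show ?thesis by simp
qed

lemma cos_taylor_complex:
  fixes z :: complex
  shows "cmod (cos z - 1 + z\<^sup>2 / 2) \<le> exp \<bar>Im z\<bar> * cmod z ^ 4"
proof -
  have "cmod (cos z - (\<Sum>k\<le>3. complex_of_real (cos_coeff k) * z ^ k)) \<le> exp \<bar>Im z\<bar> * cmod z ^ Suc 3 / fact 3"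
    by (rule Taylor_cos)
  also have "(\<Sum>k\<le>3. complex_of_real (cos_coeff k) * z ^ k) = 1 - z\<^sup>2 / 2"
    by (simp add: cos_coeff_def numeral_3_eq_3 power2_eq_square)
  also have "exp \<bar>Im z\<bar> * cmod z ^ Suc 3 / fact 3 \<le> exp \<bar>Im z\<bar> * cmod z ^ 4"
    by (simp add: field_simps fact_numeral)
  finally show ?thesis by (simp add: algebra_simps)
qed

lemma has_bochner_integral_gauss2:
  fixes r :: real assumes r: "r > 0"
  shows "has_bochner_integral lborel (\<lambda>t. exp (- r * t\<^sup>2)) (sqrt (pi / r))"
    "has_bochner_integral lborel (\<lambda>t. t\<^sup>2 * exp (- r * t\<^sup>2)) (sqrt pi / 2 * r powr (-3/2))"
proof -
  let ?c = "1 / sqrt r"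
  have c: "?c \<noteq> 0" using r by simp
  have "has_bochner_integral lborel (\<lambda>x::real. exp (-x\<^sup>2)) (2 * (sqrt pi / 2))"
    using has_bochner_integral_even_function[OF gaussian_moment_0] by simp
  then have "has_bochner_integral lborel (\<lambda>x. exp (-(0 + sqrt r * x)\<^sup>2)) ((2 * (sqrt pi / 2)) /\<^sub>R \<bar>sqrt r\<bar>)"
    using lborel_has_bochner_integral_real_affine_iff[of "sqrt r" "\<lambda>x. exp (-x\<^sup>2)" _ 0] r by simp
  then show "has_bochner_integral lborel (\<lambda>t. exp (- r * t\<^sup>2)) (sqrt (pi / r))"
    using r by (simp add: power_mult_distrib real_sqrt_divide field_simps)
  have "has_bochner_integral lborel (\<lambda>x::real. exp (-x\<^sup>2) * x ^ (2*1)) (2 * (sqrt pi / 2 * (fact (2*1) / (2^(2*1) * fact 1))))"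
    using has_bochner_integral_even_function[OF gaussian_moment_even_pos[where k=1]] by simp
  then have "has_bochner_integral lborel (\<lambda>x::real. exp (-x\<^sup>2) * x\<^sup>2) (sqrt pi / 2)"
    by (simp add: fact_numeral)
  then have "has_bochner_integral lborel (\<lambda>x. exp (-(0 + sqrt r * x)\<^sup>2) * (0 + sqrt r * x)\<^sup>2) ((sqrt pi / 2) /\<^sub>R \<bar>sqrt r\<bar>)"
    using lborel_has_bochner_integral_real_affine_iff[of "sqrt r" "\<lambda>x. exp (-x\<^sup>2) * x\<^sup>2" _ 0] r by simp
  then have "has_bochner_integral lborel (\<lambda>x. (1/r) * (exp (-(0 + sqrt r * x)\<^sup>2) * (0 + sqrt r * x)\<^sup>2)) ((1/r) * ((sqrt pi / 2) /\<^sub>R \<bar>sqrt r\<bar>))"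
    by (rule has_bochner_integral_mult_right)
  moreover have "(1/r) * ((sqrt pi / 2) /\<^sub>R \<bar>sqrt r\<bar>) = sqrt pi / 2 * r powr (-3/2)"
  proof -
    have "r powr (3/2) = r powr (1 + 1/2)" by simp
    also have "\<dots> = r * sqrt r" using r by (subst powr_add) (simp add: powr_half_sqrt)
    finally show ?thesis using r by (simp add: powr_minus_divide field_simps)
  qed
  moreover have "(\<lambda>x. (1/r) * (exp (-(0 + sqrt r * x)\<^sup>2) * (0 + sqrt r * x)\<^sup>2)) = (\<lambda>t. t\<^sup>2 * exp (- r * t\<^sup>2))"
    using r by (simp add: power_mult_distrib fun_eq_iff)
  ultimately show "has_bochner_integral lborel (\<lambda>t. t\<^sup>2 * exp (- r * t\<^sup>2)) (sqrt pi / 2 * r powr (-3/2))"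
    by metis
qed

text \<open>
  In a symmetric second difference the terms of order zero and one cancel, so only the second derivative counts,
  and Cauchy's estimate on discs of radius \<open>w / 2\<close> bounds it by the size of \<open>A\<close> on the larger strip.
\<close>
lemma second_difference_bound:
  assumes w: "0 < w" and B: "\<And>z. \<bar>Im z\<bar> < 2 * w \<Longrightarrow> cmod (A z) \<le> B"
    and hol: "A holomorphic_on {z. \<bar>Im z\<bar> < 2 * w}" and z: "\<bar>Im z\<bar> \<le> w"
  shows "cmod (A (of_real \<theta> + z) + A (of_real \<theta> - z) - 2 * A (of_real \<theta>)) \<le> 16 * (B + 1) / w\<^sup>2 * (cmod z)\<^sup>2"
proof -
  let ?S = "{z. \<bar>Im z\<bar> \<le> w}" let ?T = "{z. \<bar>Im z\<bar> < 2 * w}"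
  have T: "?T = {z. Im z < 2 * w} \<inter> {z. - (2 * w) < Im z}" by auto
  have opT: "open ?T" unfolding T by (intro open_Int open_halfspace_Im_lt open_halfspace_Im_gt)
  have "?S = {z. Im z \<le> w} \<inter> {z. Im z \<ge> - w}" by auto
  then have S: "convex ?S" by (metis convex_Int convex_halfspace_Im_ge convex_halfspace_Im_le)
  have ST: "cball x (w/2) \<subseteq> ?T" if "x \<in> ?S" for x
  proof
    fix y assume "y \<in> cball x (w/2)"
    then have "\<bar>Im (x - y)\<bar> \<le> w/2" using abs_Im_le_cmod[of "x - y"] by (simp add: dist_norm)
    moreover have "\<bar>Im x\<bar> \<le> w" using that by simp
    ultimately have "\<bar>Im y\<bar> < 2 * w" using w by (simp only: minus_complex.sel)
    then show "y \<in> ?T" by simp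
  qed
  have der: "((deriv ^^ i) A has_field_derivative (deriv ^^ Suc i) A x) (at x within ?S)" if "x \<in> ?S" for i x
  proof -
    have "x \<in> ?T" using that w by auto
    then have "((deriv ^^ i) A has_field_derivative deriv ((deriv ^^ i) A) x) (at x)"
      using holomorphic_higher_deriv[OF hol opT, of i] holomorphic_derivI[OF _ opT] by blast
    then show ?thesis by (auto intro: has_field_derivative_at_within)
  qed
  have bd: "cmod ((deriv ^^ Suc 1) A x) \<le> 8 * (B + 1) / w\<^sup>2" if "x \<in> ?S" for x
  proof -
    have "cmod ((deriv ^^ 2) A x) \<le> fact 2 * (B + 1) / (w/2)^2"
    proof (rule Cauchy_higher_deriv_bound[where y = 0])
      show "A holomorphic_on ball x (w/2)"
        using ST[OF that] ball_subset_cball by (blast intro: holomorphic_on_subset[OF hol])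
      show "continuous_on (cball x (w/2)) A"
        using ST[OF that] by (blast intro: holomorphic_on_imp_continuous_on holomorphic_on_subset[OF hol])
      show "A z \<in> ball 0 (B + 1)" if "z \<in> ball x (w/2)" for z
      proof -
        have "z \<in> ?T" using that ST[OF \<open>x \<in> ?S\<close>] ball_subset_cball by blast
        then show ?thesis using B[of z] by (simp add: dist_norm)
      qed
    qed (use w in auto)
    then show ?thesis by (simp add: power_divide numeral_2_eq_2)
  qed
  have *: "cmod (A (of_real \<theta> + u) - (A (of_real \<theta>) + deriv A (of_real \<theta>) * u)) \<le> 8 * (B + 1) / w\<^sup>2 * (cmod u)\<^sup>2"
    if u: "\<bar>Im u\<bar> \<le> w" for u
    using complex_Taylor[OF S, of 1 "\<lambda>i. (deriv ^^ i) A" "8 * (B + 1) / w\<^sup>2" "of_real \<theta>" "of_real \<theta> + u"] der bd u w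
    by (simp add: eval_nat_numeral)
  have "cmod (A (of_real \<theta> + z) + A (of_real \<theta> - z) - 2 * A (of_real \<theta>))
      = cmod ((A (of_real \<theta> + z) - (A (of_real \<theta>) + deriv A (of_real \<theta>) * z))
        + (A (of_real \<theta> + - z) - (A (of_real \<theta>) + deriv A (of_real \<theta>) * - z)))"
    by (simp add: algebra_simps)
  also have "\<dots> \<le> 8 * (B + 1) / w\<^sup>2 * (cmod z)\<^sup>2 + 8 * (B + 1) / w\<^sup>2 * (cmod z)\<^sup>2"
    using *[of z] *[of "- z"] z by (intro norm_triangle_mono) auto
  finally show ?thesis by (simp add: field_simps)
qed

text \<open>
  The direction of steepest descent of \<open>cos z\<close> at its critical point \<open>0\<close>: there
  \<open>\<i> cos z = \<i> - t\<^sup>2 + O(t\<^sup>4)\<close>.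
\<close>
definition saddle_path :: "real \<Rightarrow> complex" where
  "saddle_path t = (1 - \<i>) * of_real t"

text \<open>
  On the steepest descent line the modulus decays like a Gaussian, because \<open>sin t sinh t \<ge> t\<^sup>2 / 2\<close>, and the quartic
  Taylor remainder of the cosine controls the difference from the exact Gaussian.
\<close>
lemma saddle_phase:
  assumes t: "\<bar>t\<bar> \<le> 1" and \<rho>: "0 \<le> \<rho>"
  shows "cmod (exp (\<i> * of_real \<rho> * (cos (saddle_path t) - 1))) \<le> exp (- (\<rho> / 2) * t\<^sup>2)"
    "cmod (exp (\<i> * of_real \<rho> * (cos (saddle_path t) - 1)) - exp (of_real (- \<rho> * t\<^sup>2)))
       \<le> 16 * \<rho> * t ^ 4 * exp (- (\<rho> / 2) * t\<^sup>2)"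
proof -
  let ?z = "\<i> * of_real \<rho> * (cos (saddle_path t) - 1)"
  have im: "Im (saddle_path t) = - t" "Re (saddle_path t) = t" by (simp_all add: saddle_path_def)
  have nm: "cmod (saddle_path t) = sqrt 2 * \<bar>t\<bar>" by (simp add: saddle_path_def norm_mult cmod_def real_sqrt_mult)
  have Re: "Re ?z = - \<rho> * (sin t * sinh t)"
    using im by (simp add: Im_cos sinh_field_def algebra_simps diff_divide_distrib)
  have "t\<^sup>2 / 2 \<le> sin t * sinh t"
  proof -
    have *: "u\<^sup>2 / 2 \<le> sin u * sinh u" if u: "0 \<le> u" "u \<le> 1" for u :: real
    proof -
      have "(u/2) * u \<le> sin u * sinh u"
        using sin_ge_half[OF u] sinh_ge_self[OF u(1)] u by (intro mult_mono) auto
      then show ?thesis by (simp add: power2_eq_square)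
    qed
    show ?thesis using *[of t] *[of "-t"] t by (cases "t \<ge> 0") auto
  qed
  then have le: "Re ?z \<le> - (\<rho> / 2) * t\<^sup>2"
    using mult_left_mono[of "t\<^sup>2 / 2" "sin t * sinh t" \<rho>] \<rho> unfolding Re by simp
  then show "cmod (exp ?z) \<le> exp (- (\<rho> / 2) * t\<^sup>2)" by simp
  have le2: "Re (of_real (- \<rho> * t\<^sup>2) :: complex) \<le> - (\<rho> / 2) * t\<^sup>2"
    using \<rho> by (simp add: field_simps)
  have sq: "saddle_path t ^ 2 = - 2 * \<i> * of_real (t\<^sup>2)"
    by (simp add: saddle_path_def power2_eq_square complex_eq_iff algebra_simps)
  have "?z - of_real (- \<rho> * t\<^sup>2) = \<i> * of_real \<rho> * (cos (saddle_path t) - 1 + saddle_path t ^ 2 / 2)"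
    unfolding sq by (simp add: algebra_simps)
  then have "cmod (?z - of_real (- \<rho> * t\<^sup>2)) = \<rho> * cmod (cos (saddle_path t) - 1 + saddle_path t ^ 2 / 2)"
    using \<rho> by (simp add: norm_mult)
  also have "\<dots> \<le> \<rho> * (exp \<bar>Im (saddle_path t)\<bar> * cmod (saddle_path t) ^ 4)"
    by (intro mult_left_mono cos_taylor_complex \<rho>)
  also have "cmod (saddle_path t) ^ 4 = 4 * t ^ 4"
  proof -
    have "sqrt 2 ^ 4 = ((sqrt 2)\<^sup>2)\<^sup>2" by (simp only: power_mult[symmetric]) simp
    then show ?thesis by (simp add: nm power_mult_distrib power_even_abs)
  qed
  also have "\<rho> * (exp \<bar>Im (saddle_path t)\<bar> * (4 * t ^ 4)) \<le> \<rho> * (exp 1 * (4 * t ^ 4))"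
    using im t \<rho> by (intro mult_left_mono mult_mono) auto
  also have "\<dots> \<le> \<rho> * (4 * (4 * t ^ 4))"
    using exp_le \<rho> by (intro mult_left_mono mult_right_mono) auto
  finally have d: "cmod (?z - of_real (- \<rho> * t\<^sup>2)) \<le> 16 * \<rho> * t ^ 4" by simp
  show "cmod (exp ?z - exp (of_real (- \<rho> * t\<^sup>2))) \<le> 16 * \<rho> * t ^ 4 * exp (- (\<rho> / 2) * t\<^sup>2)"
    using order_trans[OF norm_exp_diff_le[OF le le2] mult_left_mono[OF d, of "exp (- (\<rho> / 2) * t\<^sup>2)"]]
    by (simp add: mult.commute)
qed

text \<open>
  Half of the Gaussian decay pays for the factor \<open>\<rho> t\<^sup>2\<close>, so the quartic error integrates to the same order as
  the second moment of a Gaussian.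
\<close>
lemma quartic_absorb:
  fixes \<rho> t :: real
  assumes "\<rho> > 0" shows "\<rho> * t ^ 4 * exp (- (\<rho> / 2) * t\<^sup>2) \<le> 4 * (t\<^sup>2 * exp (- (\<rho> / 4) * t\<^sup>2))"
proof -
  have "\<rho> / 4 * t\<^sup>2 \<le> exp (\<rho> / 4 * t\<^sup>2)" using exp_ge_add_one_self[of "\<rho> / 4 * t\<^sup>2"] by linarith
  then have "4 * t\<^sup>2 * exp (- (\<rho> / 2) * t\<^sup>2) * (\<rho> / 4 * t\<^sup>2) \<le> 4 * t\<^sup>2 * exp (- (\<rho> / 2) * t\<^sup>2) * exp (\<rho> / 4 * t\<^sup>2)"
    by (intro mult_left_mono) auto
  also have "\<dots> = 4 * (t\<^sup>2 * exp (- (\<rho> / 4) * t\<^sup>2))"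
    by (simp add: mult_exp_exp mult.assoc)
  finally show ?thesis by (simp add: power4_eq_xxxx power2_eq_square mult_ac)
qed

text \<open>
  The reflection \<open>t \<mapsto> - t\<close> leaves the phase unchanged, so the integrand may be replaced by its even part. Then the
  amplitude enters through a second difference, and every error term is a multiple of
  \<open>t\<^sup>2 exp (- \<rho> t\<^sup>2 / 4)\<close>, whose integral has order \<open>\<rho> powr (-3/2)\<close>. The constant depends on the amplitude only through
  the bound \<open>B\<close>, which makes the estimate uniform in \<open>\<theta>\<close> and \<open>A\<close>.
\<close>
lemma saddle_contribution:
  assumes w: "0 < w" "w \<le> 1" and B: "0 \<le> B"
  shows "\<exists>C. \<forall>\<rho> \<theta> A. 1 \<le> \<rho> \<longrightarrow> A holomorphic_on {z. \<bar>Im z\<bar> < 2 * w} \<longrightarrow> (\<forall>z. \<bar>Im z\<bar> < 2 * w \<longrightarrow> cmod (A z) \<le> B) \<longrightarrow>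
    cmod (integral {-w..w} (\<lambda>t. exp (\<i> * of_real \<rho> * cos (saddle_path t)) * A (of_real \<theta> - saddle_path t))
       - exp (\<i> * of_real \<rho>) * of_real (sqrt (pi / \<rho>)) * A (of_real \<theta>)) \<le> C * \<rho> powr (-3/2)"
proof -
  define M where "M = 16 * (B + 1) / w\<^sup>2 + 64 * B + B / w\<^sup>2"
  define C where "C = M * (sqrt pi / 2 * (1/4) powr (-3/2))"
  have "cmod (integral {-w..w} (\<lambda>t. exp (\<i> * of_real \<rho> * cos (saddle_path t)) * A (of_real \<theta> - saddle_path t))
       - exp (\<i> * of_real \<rho>) * of_real (sqrt (pi / \<rho>)) * A (of_real \<theta>)) \<le> C * \<rho> powr (-3/2)"
    if \<rho>: "1 \<le> \<rho>" and hol: "A holomorphic_on {z. \<bar>Im z\<bar> < 2 * w}"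
      and bd: "\<And>z. \<bar>Im z\<bar> < 2 * w \<Longrightarrow> cmod (A z) \<le> B" for \<rho> \<theta> and A :: "complex \<Rightarrow> complex"
  proof -
    define h where "h t = exp (\<i> * of_real \<rho> * (cos (saddle_path t) - 1))" for t
    define f where "f t = h t * A (of_real \<theta> - saddle_path t)" for t
    define F where "F t = indicator {-w..w} t *\<^sub>R f t" for t
    define m where "m t = exp (of_real (- \<rho> * t\<^sup>2)) * A (of_real \<theta>)" for t :: real
    have h_even: "h (- t) = h t" for t by (simp add: h_def saddle_path_def)
    have exp_split: "exp (\<i> * of_real \<rho> * cos (saddle_path t)) = exp (\<i> * of_real \<rho>) * h t" for t
      by (simp add: h_def flip: exp_add) (simp add: algebra_simps)
    have "continuous_on {-w..w} (\<lambda>t. A (of_real \<theta> - saddle_path t))"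
      using w by (intro continuous_on_compose2[OF holomorphic_on_imp_continuous_on[OF hol]])
        (auto intro!: continuous_intros simp: saddle_path_def)
    then have cf: "continuous_on {-w..w} f"
      unfolding f_def h_def by (intro continuous_intros) (auto simp: saddle_path_def intro!: continuous_intros)
    then have siF: "set_integrable lborel {-w..w} f"
      by (intro borel_integrable_compact[unfolded set_integrable_def[symmetric]]) auto
    then have iF: "integrable lborel F" unfolding F_def set_integrable_def .
    have "(f has_integral (LINT t:{-w..w}|lborel. f t)) {-w..w}"
      using set_borel_integral_eq_integral(2)[OF siF] cf integrable_continuous_interval[OF cf]
      by (simp add: has_integral_integral)
    then have intF: "integral {-w..w} f = integral\<^sup>L lborel F"
      by (simp add: F_def[abs_def] set_lebesgue_integral_def integral_unique)
    have refl: "integral\<^sup>L lborel F = integral\<^sup>L lborel (\<lambda>t. F (- t))" "integrable lborel (\<lambda>t. F (- t))"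
      using lborel_integral_real_affine[of "-1" F 0] lborel_integrable_real_affine[OF iF, of "-1" 0] by simp_all
    have im: "has_bochner_integral lborel (\<lambda>t. exp (- \<rho> * t\<^sup>2)) (sqrt (pi / \<rho>))"
      using has_bochner_integral_gauss2(1) \<rho> by simp
    have im': "has_bochner_integral lborel m (of_real (sqrt (pi / \<rho>)) * A (of_real \<theta>))"
      using has_bochner_integral_mult_left[OF has_bochner_integral_of_real[OF im], of "A (of_real \<theta>)"]
      by (simp add: m_def[abs_def] flip: exp_of_real)
    have ig: "has_bochner_integral lborel (\<lambda>t. M * (t\<^sup>2 * exp (- (\<rho>/4) * t\<^sup>2))) (M * (sqrt pi / 2 * (\<rho>/4) powr (-3/2)))"
      by (intro has_bochner_integral_mult_right has_bochner_integral_gauss2(2)) (use \<rho> in auto)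
    have M: "0 \<le> M" using B w by (simp add: M_def)
    \<comment> \<open>outside the interval the Gaussian main term itself is of the size of the error, since there \<open>1 \<le> t\<^sup>2 / w\<^sup>2\<close>\<close>
    have key: "cmod ((F t + F (- t)) / 2 - m t) \<le> M * (t\<^sup>2 * exp (- (\<rho>/4) * t\<^sup>2))" for t
    proof (cases "\<bar>t\<bar> \<le> w")
      case True
      have sd: "cmod (A (of_real \<theta> + saddle_path t) + A (of_real \<theta> - saddle_path t) - 2 * A (of_real \<theta>))
          \<le> 16 * (B + 1) / w\<^sup>2 * (cmod (saddle_path t))\<^sup>2"
        using True by (intro second_difference_bound[OF w(1) bd hol]) (auto simp: saddle_path_def)
      have nm: "(cmod (saddle_path t))\<^sup>2 = 2 * t\<^sup>2" by (simp add: saddle_path_def norm_mult cmod_def power_mult_distrib)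
      have mono: "exp (- (\<rho> / 2) * t\<^sup>2) \<le> exp (- (\<rho> / 4) * t\<^sup>2)" using \<rho> by (simp add: mult_right_mono)
      have "F t + F (- t) = h t * (A (of_real \<theta> + saddle_path t) + A (of_real \<theta> - saddle_path t))"
      proof -
        have "F t = h t * A (of_real \<theta> - saddle_path t)"
          using True by (simp add: F_def f_def indicator_def abs_le_iff)
        moreover have "F (- t) = h t * A (of_real \<theta> + saddle_path t)"
          using True h_even[of t] by (simp add: F_def f_def indicator_def abs_le_iff) (simp add: saddle_path_def)
        ultimately show ?thesis by (simp add: algebra_simps)
      qed
      then have "(F t + F (- t)) / 2 - m t = h t * (A (of_real \<theta> + saddle_path t) + A (of_real \<theta> - saddle_path t) - 2 * A (of_real \<theta>)) / 2
          + (h t - exp (of_real (- \<rho> * t\<^sup>2))) * A (of_real \<theta>)" by (simp add: m_def field_simps)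
      also have "cmod \<dots> \<le> exp (- (\<rho> / 2) * t\<^sup>2) * (16 * (B + 1) / w\<^sup>2 * (2 * t\<^sup>2)) / 2
          + 16 * \<rho> * t ^ 4 * exp (- (\<rho> / 2) * t\<^sup>2) * B"
      proof (intro norm_triangle_mono)
        show "cmod (h t * (A (of_real \<theta> + saddle_path t) + A (of_real \<theta> - saddle_path t) - 2 * A (of_real \<theta>)) / 2)
          \<le> exp (- (\<rho> / 2) * t\<^sup>2) * (16 * (B + 1) / w\<^sup>2 * (2 * t\<^sup>2)) / 2"
        proof -
          have "cmod (h t) \<le> exp (- (\<rho> / 2) * t\<^sup>2)"
            using saddle_phase(1)[of t \<rho>] True w \<rho> unfolding h_def by simp
          from mult_mono[OF this sd[unfolded nm]] show ?thesis by (simp add: norm_mult norm_divide)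
        qed
        show "cmod ((h t - exp (of_real (- \<rho> * t\<^sup>2))) * A (of_real \<theta>)) \<le> 16 * \<rho> * t ^ 4 * exp (- (\<rho> / 2) * t\<^sup>2) * B"
          unfolding norm_mult using saddle_phase(2)[of t \<rho>] True w \<rho> B bd[of "of_real \<theta>"]
          by (intro mult_mono) (auto simp: h_def)
      qed
      also have "exp (- (\<rho> / 2) * t\<^sup>2) * (16 * (B + 1) / w\<^sup>2 * (2 * t\<^sup>2)) / 2 = 16 * (B + 1) / w\<^sup>2 * (t\<^sup>2 * exp (- (\<rho> / 2) * t\<^sup>2))"
        by simp
      also have "\<dots> \<le> 16 * (B + 1) / w\<^sup>2 * (t\<^sup>2 * exp (- (\<rho> / 4) * t\<^sup>2))"
        using mono B by (intro mult_left_mono) auto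
      also have "16 * \<rho> * t ^ 4 * exp (- (\<rho> / 2) * t\<^sup>2) * B = 16 * B * (\<rho> * t ^ 4 * exp (- (\<rho> / 2) * t\<^sup>2))" by simp
      also have "\<dots> \<le> 16 * B * (4 * (t\<^sup>2 * exp (- (\<rho> / 4) * t\<^sup>2)))"
        using \<rho> B by (intro mult_left_mono quartic_absorb) auto
      also have "16 * (B + 1) / w\<^sup>2 * (t\<^sup>2 * exp (- (\<rho> / 4) * t\<^sup>2)) + 16 * B * (4 * (t\<^sup>2 * exp (- (\<rho> / 4) * t\<^sup>2)))
           \<le> M * (t\<^sup>2 * exp (- (\<rho>/4) * t\<^sup>2))"
        unfolding M_def using B w by (simp add: distrib_right)
      finally show ?thesis by simp
    next
      case False
      then have "F t = 0" "F (- t) = 0" by (auto simp: F_def indicator_def)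
      then have "cmod ((F t + F (- t)) / 2 - m t) = exp (- \<rho> * t\<^sup>2) * cmod (A (of_real \<theta>))"
        by (simp add: m_def norm_mult)
      also have "\<dots> \<le> exp (- (\<rho>/4) * t\<^sup>2) * (B * (t\<^sup>2 / w\<^sup>2))"
      proof (rule mult_mono)
        have "w\<^sup>2 \<le> t\<^sup>2" using False w by (simp add: abs_le_square_iff[symmetric])
        then have "1 \<le> t\<^sup>2 / w\<^sup>2" using w by simp
        then show "cmod (A (of_real \<theta>)) \<le> B * (t\<^sup>2 / w\<^sup>2)"
          using bd[of "of_real \<theta>"] w B mult_left_mono[of 1 "t\<^sup>2 / w\<^sup>2" B] by auto
      qed (use \<rho> in \<open>auto simp: mult_right_mono\<close>)
      also have "\<dots> = B / w\<^sup>2 * (t\<^sup>2 * exp (- (\<rho>/4) * t\<^sup>2))" by simp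
      also have "\<dots> \<le> M * (t\<^sup>2 * exp (- (\<rho>/4) * t\<^sup>2))"
        unfolding M_def using B w by (intro mult_right_mono) auto
      finally show ?thesis .
    qed
    have "integral\<^sup>L lborel (\<lambda>t. (F t + F (- t)) / 2 - m t)
        = integral\<^sup>L lborel F - of_real (sqrt (pi / \<rho>)) * A (of_real \<theta>)"
      using iF refl im' by (simp add: has_bochner_integral_iff)
    moreover have "cmod (integral\<^sup>L lborel (\<lambda>t. (F t + F (- t)) / 2 - m t)) \<le> M * (sqrt pi / 2 * (\<rho>/4) powr (-3/2))"
      unfolding has_bochner_integral_integral_eq[OF ig, symmetric]
      by (rule Bochner_Integration.integral_norm_bound_integral)
        (use iF refl(2) integrable.intros[OF im'] in simp, rule integrable.intros[OF ig], rule key)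
    moreover have "(\<rho>/4) powr (-3/2) = (1/4) powr (-3/2) * \<rho> powr (-3/2)"
      using \<rho> by (subst powr_mult[symmetric]) auto
    ultimately have "cmod (integral {-w..w} f - of_real (sqrt (pi / \<rho>)) * A (of_real \<theta>)) \<le> C * \<rho> powr (-3/2)"
      by (simp add: intF C_def mult_ac)
    moreover have "integral {-w..w} (\<lambda>t. exp (\<i> * of_real \<rho> * cos (saddle_path t)) * A (of_real \<theta> - saddle_path t))
        = exp (\<i> * of_real \<rho>) * integral {-w..w} f"
      unfolding exp_split f_def by (simp add: mult.assoc)
    moreover have "cmod (exp (\<i> * of_real \<rho>)) = 1" by simp
    ultimately show ?thesis by (simp add: mult.assoc norm_mult flip: right_diff_distrib)
  qed
  then show ?thesis by blast
qed

section \<open>The two branches of the lower vertical wave number\<close>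

lemma continuous_on_csqrt': "continuous_on {z. z = 0 \<or> z \<notin> \<real>\<^sub>\<le>\<^sub>0} csqrt"
proof -
  have "continuous (at z) csqrt" if "z = 0 \<or> z \<notin> \<real>\<^sub>\<le>\<^sub>0" for z
  proof (cases "z = 0")
    case True
    have "((\<lambda>w. sqrt (cmod w)) \<longlongrightarrow> sqrt (cmod 0)) (at 0)" by (intro tendsto_intros)
    then have "((\<lambda>w. cmod (csqrt w)) \<longlongrightarrow> 0) (at 0)" by (simp add: norm_csqrt)
    then have "(csqrt \<longlongrightarrow> 0) (at 0)" by (rule tendsto_norm_zero_cancel)
    then show ?thesis unfolding True isCont_def by simp
  qed (use that continuous_at_csqrt in auto)
  then show ?thesis by (intro continuous_at_imp_continuous_on) auto
qed

lemma Re_Im_cos_squared: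
  "Re ((cos z)\<^sup>2) = (1 + cos (2 * Re z) * cosh (2 * Im z)) / 2"
  "Im ((cos z)\<^sup>2) = - sin (2 * Re z) * sinh (2 * Im z) / 2"
proof -
  have "(cos z)\<^sup>2 = (1 + cos (2 * z)) / 2" by (simp add: cos_double_cos)
  then have "Re ((cos z)\<^sup>2) = (1 + Re (cos (2 * z))) / 2" "Im ((cos z)\<^sup>2) = Im (cos (2 * z)) / 2"
    by (simp_all only: Re_divide_numeral Im_divide_numeral plus_complex.sel one_complex.sel add_0)
  moreover have "Re (cos (2 * z)) = cos (2 * Re z) * cosh (2 * Im z)"
    "Im (cos (2 * z)) = - (sin (2 * Re z) * sinh (2 * Im z))"
    by (simp_all add: Re_cos Im_cos cosh_field_def sinh_field_def field_simps)
  ultimately show "Re ((cos z)\<^sup>2) = (1 + cos (2 * Re z) * cosh (2 * Im z)) / 2"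
   "Im ((cos z)\<^sup>2) = - sin (2 * Re z) * sinh (2 * Im z) / 2" by simp_all
qed

lemma norm_cos_sin_le_cosh: "cmod (cos z) \<le> cosh (Im z)" "cmod (sin z) \<le> cosh (Im z)"
proof -
  have "cmod (exp (\<i> * z) + exp (- (\<i> * z))) \<le> exp (- Im z) + exp (Im z)"
    by (rule norm_triangle_le) simp
  then show "cmod (cos z) \<le> cosh (Im z)"
    by (simp add: cos_exp_eq norm_divide cosh_field_def)
  have "cmod (exp (\<i> * z) - exp (- (\<i> * z))) \<le> exp (- Im z) + exp (Im z)"
    by (rule norm_triangle_le_diff) simp
  then show "cmod (sin z) \<le> cosh (Im z)"
    by (simp add: sin_exp_eq norm_divide cosh_field_def norm_mult)
qed

text \<open>
  The setting of the contour argument for one monomial \<open>\<xi>^i S^j T^l\<close>. The number \<open>a\<close> is the height of the branch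
  points, \<open>w\<close> the distance by which the contour is moved; \<open>w \<le> a / 2\<close> keeps the saddle segment well inside the strip
  and \<open>w \<le> \<pi> / 8\<close> keeps all sines in question monotone. Of the two square roots, \<open>inner_root\<close> is holomorphic
  in the strip below the branch points and \<open>outer_root\<close> in the region \<open>U\<close> beside the upper tail; both agree with
  \<open>SS \<xi> K\<close> on the parts of the contour in their regions. Accordingly, \<open>inner\<close> and \<open>outer\<close> are the transformed
  integrand with either root.
\<close>
locale layers =
  fixes k K R0 :: real and i j l :: nat
  assumes k: "0 < k" and kK: "k < K" and R0: "0 \<le> R0"
begin

definition a :: real where "a = arcosh (K / k)"
definition w :: real where "w = min (a / 2) (pi / 8)"

definition ampl :: "real \<Rightarrow> complex \<Rightarrow> complex \<Rightarrow> complex" where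
  "ampl Y s z = (of_real k * cos z) ^ i * (- \<i> * of_real k * sin z) ^ j * s ^ l * exp (s * of_real Y)"
definition inner_root :: "complex \<Rightarrow> complex" where
  "inner_root z = - \<i> * csqrt ((of_real K)\<^sup>2 - (of_real k * cos z)\<^sup>2)"
definition outer_root :: "complex \<Rightarrow> complex" where
  "outer_root z = csqrt ((of_real k * cos z)\<^sup>2 - (of_real K)\<^sup>2)"
definition wave :: "real \<Rightarrow> real \<Rightarrow> complex \<Rightarrow> complex" where
  "wave \<rho> \<theta> z = exp (\<i> * of_real \<rho> * cos (z - of_real \<theta>))"
definition inner where "inner \<rho> \<theta> Y z = wave \<rho> \<theta> z * ampl Y (inner_root z) z"
definition outer where "outer \<rho> \<theta> Y z = wave \<rho> \<theta> z * ampl Y (outer_root z) z"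

lemma K: "0 < K" using k kK by simp
lemma cosh_a: "k * cosh a = K" and a_pos: "0 < a"
proof -
  have "1 < K / k" using k kK by simp
  then show "k * cosh a = K" "0 < a" using k by (simp_all add: a_def cosh_arcosh_real arcosh_real_gt_1_iff)
qed
lemma w: "0 < w" "w \<le> 1/2" "2 * w \<le> a" "w \<le> pi / 8"
proof -
  have m: "w \<le> a / 2" "w \<le> pi / 8" by (auto simp: w_def)
  show "0 < w" using a_pos by (simp add: w_def)
  show "w \<le> 1/2" using m(2) pi_less_4 by linarith
  show "2 * w \<le> a" "w \<le> pi / 8" using m by linarith+
qed

lemma K2: "K\<^sup>2 = k\<^sup>2 * ((1 + cosh (2 * a)) / 2)"
proof -
  have "K\<^sup>2 = (k * cosh a)\<^sup>2" by (simp only: cosh_a)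
  then show ?thesis by (simp add: power_mult_distrib cosh_double_cosh)
qed

text \<open>
  The real and the imaginary part of the radicand decide where the principal square root is holomorphic.
\<close>
lemma radicand:
  "Re ((of_real K)\<^sup>2 - (of_real k * cos z)\<^sup>2) = k\<^sup>2 / 2 * (cosh (2 * a) - cos (2 * Re z) * cosh (2 * Im z))"
  "Im ((of_real K)\<^sup>2 - (of_real k * cos z)\<^sup>2) = k\<^sup>2 / 2 * (sin (2 * Re z) * sinh (2 * Im z))"
proof -
  have e: "(of_real K)\<^sup>2 - (of_real k * cos z)\<^sup>2 = of_real (K\<^sup>2) - of_real (k\<^sup>2) * (cos z)\<^sup>2"
    by (simp add: power_mult_distrib)
  show "Re ((of_real K)\<^sup>2 - (of_real k * cos z)\<^sup>2) = k\<^sup>2 / 2 * (cosh (2 * a) - cos (2 * Re z) * cosh (2 * Im z))"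
  proof -
    have "Re ((of_real K)\<^sup>2 - (of_real k * cos z)\<^sup>2) = K\<^sup>2 - k\<^sup>2 * Re ((cos z)\<^sup>2)"
      unfolding e by (simp del: of_real_power)
    then show ?thesis unfolding Re_Im_cos_squared K2 by (simp add: algebra_simps add_divide_distrib)
  qed
  show "Im ((of_real K)\<^sup>2 - (of_real k * cos z)\<^sup>2) = k\<^sup>2 / 2 * (sin (2 * Re z) * sinh (2 * Im z))"
  proof -
    have "Im ((of_real K)\<^sup>2 - (of_real k * cos z)\<^sup>2) = - (k\<^sup>2 * Im ((cos z)\<^sup>2))"
      unfolding e by (simp del: of_real_power)
    then show ?thesis unfolding Re_Im_cos_squared by simp
  qed
qed

text \<open>
  In the open strip \<open>cosh (2 Im z) < cosh (2 a)\<close> forces a positive real part; on its boundary only the branch points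
  give the value zero.
\<close>
lemma inner_radicand_nonpos:
  assumes "\<bar>Im z\<bar> \<le> a" 
  shows "(of_real K)\<^sup>2 - (of_real k * cos z)\<^sup>2 = 0 \<or> (of_real K)\<^sup>2 - (of_real k * cos z)\<^sup>2 \<notin> \<real>\<^sub>\<le>\<^sub>0"
    "\<bar>Im z\<bar> < a \<Longrightarrow> (of_real K)\<^sup>2 - (of_real k * cos z)\<^sup>2 \<notin> \<real>\<^sub>\<le>\<^sub>0"
proof -
  have le: "cos (2 * Re z) * cosh (2 * Im z) \<le> cosh (2 * Im z)" 
    using mult_right_mono[of "cos (2 * Re z)" 1 "cosh (2 * Im z)"] by simp
  have ch: "cosh (2 * Im z) \<le> cosh (2 * a)" "\<bar>Im z\<bar> < a \<Longrightarrow> cosh (2 * Im z) < cosh (2 * a)"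
    using assms a_pos cosh_real_nonneg_le_iff[of "2 * \<bar>Im z\<bar>" "2 * a"] cosh_real_nonneg_less_iff[of "2 * \<bar>Im z\<bar>" "2 * a"]
    by (auto simp: abs_if split: if_splits)
  let ?z = "(of_real K)\<^sup>2 - (of_real k * cos z)\<^sup>2"
  have "0 \<le> cosh (2 * a) - cos (2 * Re z) * cosh (2 * Im z)" using le ch(1) by linarith
  then have "0 \<le> Re ?z" unfolding radicand by (intro mult_nonneg_nonneg) auto
  then show "?z = 0 \<or> ?z \<notin> \<real>\<^sub>\<le>\<^sub>0" by (auto simp: complex_nonpos_Reals_iff complex_eq_iff)
  show "?z \<notin> \<real>\<^sub>\<le>\<^sub>0" if "\<bar>Im z\<bar> < a"
  proof -
    have "0 < cosh (2 * a) - cos (2 * Re z) * cosh (2 * Im z)" using le ch(2)[OF that] by linarith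
    then have "0 < Re ?z" unfolding radicand using k by (intro mult_pos_pos) auto
    then show ?thesis by (auto simp: complex_nonpos_Reals_iff)
  qed
qed

lemma continuous_inner_root: "continuous_on {z. \<bar>Im z\<bar> \<le> a} inner_root"
proof -
  have "continuous_on {z. \<bar>Im z\<bar> \<le> a} (\<lambda>z. csqrt ((of_real K)\<^sup>2 - (of_real k * cos z)\<^sup>2))"
    by (intro continuous_on_compose2[OF continuous_on_csqrt'] continuous_intros)
      (use inner_radicand_nonpos(1) in blast)
  then show ?thesis unfolding inner_root_def by (intro continuous_intros)
qed

lemma holomorphic_inner_root: "inner_root holomorphic_on {z. \<bar>Im z\<bar> < a}"
  unfolding inner_root_def using inner_radicand_nonpos(2)
  by (intro holomorphic_intros) auto

text \<open>
  Strictly to the left of the imaginary axis the imaginary part of the radicand has no zero, and on the axis above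
  the branch point the radicand is real and non-negative.
\<close>
lemma outer_radicand_nonpos:
  assumes "- w \<le> Re z" "Re z \<le> 0" "a \<le> Im z"
  shows "(of_real k * cos z)\<^sup>2 - (of_real K)\<^sup>2 = 0 \<or> (of_real k * cos z)\<^sup>2 - (of_real K)\<^sup>2 \<notin> \<real>\<^sub>\<le>\<^sub>0" (is ?A)
    "Re z < 0 \<Longrightarrow> (of_real k * cos z)\<^sup>2 - (of_real K)\<^sup>2 \<notin> \<real>\<^sub>\<le>\<^sub>0"
proof -
  let ?z = "(of_real k * cos z)\<^sup>2 - (of_real K)\<^sup>2"
  have z: "?z = - ((of_real K)\<^sup>2 - (of_real k * cos z)\<^sup>2)" by simp
  have Re: "Re ?z = k\<^sup>2 / 2 * (cos (2 * Re z) * cosh (2 * Im z) - cosh (2 * a))"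
    unfolding z uminus_complex.sel radicand by (simp add: algebra_simps)
  have Im: "Im ?z = - (k\<^sup>2 / 2 * (sin (2 * Re z) * sinh (2 * Im z)))"
    unfolding z uminus_complex.sel radicand ..
  show neg: "?z \<notin> \<real>\<^sub>\<le>\<^sub>0" if "Re z < 0"
  proof -
    have "0 < sin (- (2 * Re z))" using that assms w pi_gt3 by (intro sin_gt_zero) linarith+
    moreover have "0 < sinh (2 * Im z)" using assms a_pos by simp
    ultimately have "Im ?z \<noteq> 0" unfolding Im using k by simp
    then show ?thesis by (simp add: complex_nonpos_Reals_iff)
  qed
  \<comment> \<open>on the imaginary axis the radicand is real, and non-negative above the branch point\<close>
  show ?A
  proof (cases "Re z < 0")
    case False
    then have "Re z = 0" using assms by simp
    then have "Re ?z \<ge> 0" unfolding Re using assms a_pos cosh_real_nonneg_le_iff[of "2 * a" "2 * Im z"] by (intro mult_nonneg_nonneg) auto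
    then show ?thesis by (auto simp: complex_nonpos_Reals_iff complex_eq_iff)
  qed (use neg in auto)
qed

text \<open>
  The region swept when the upper tail is moved to the left by \<open>w\<close>; its corner \<open>\<i> a\<close> is the branch point.
\<close>
definition U where "U = {z. - w \<le> Re z \<and> Re z \<le> 0 \<and> a \<le> Im z}"

lemma convex_U: "convex U" and convex_strip: "convex {z. \<bar>Im z\<bar> \<le> a}"
proof -
  have "U = {z. Re z \<ge> - w} \<inter> {z. Re z \<le> 0} \<inter> {z. Im z \<ge> a}" by (auto simp: U_def)
  then show "convex U" by (metis convex_Int convex_halfspace_Im_ge convex_halfspace_Re_le convex_halfspace_Re_ge)
  have "{z. \<bar>Im z\<bar> \<le> a} = {z. Im z \<le> a} \<inter> {z. Im z \<ge> - a}" by auto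
  then show "convex {z. \<bar>Im z\<bar> \<le> a}" by (metis convex_Int convex_halfspace_Im_ge convex_halfspace_Im_le)
qed

lemma continuous_outer_root: "continuous_on U outer_root"
  unfolding outer_root_def
    by (intro continuous_on_compose2[OF continuous_on_csqrt'] continuous_intros)
      (use outer_radicand_nonpos(1) U_def in blast)

text \<open>
  Primitives stand in for Cauchy's theorem: all contour pieces in the closed strip are expressed by the increments of
  one function. The integrand needs to be holomorphic in the interior only, so the branch points on the boundary do
  no harm.
\<close>
lemma inner_primitive:
  obtains P where "\<And>z. \<bar>Im z\<bar> \<le> a \<Longrightarrow> (P has_field_derivative inner \<rho> \<theta> Y z) (at z within {z. \<bar>Im z\<bar> \<le> a})"
proof (rule holomorphic_convex_primitive[OF convex_strip finite.emptyI])
  show "continuous_on {z. \<bar>Im z\<bar> \<le> a} (inner \<rho> \<theta> Y)"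
    unfolding inner_def wave_def ampl_def
    by (intro continuous_intros continuous_inner_root)
  have "inner \<rho> \<theta> Y holomorphic_on {z. \<bar>Im z\<bar> < a}"
    unfolding inner_def wave_def ampl_def
    by (intro holomorphic_intros holomorphic_inner_root)
  moreover have "{z. \<bar>Im z\<bar> < a} = {z. Im z < a} \<inter> {z. Im z > - a}" by auto
  then have "open {z. \<bar>Im z\<bar> < a}" by (metis open_Int open_halfspace_Im_gt open_halfspace_Im_lt)
  moreover have "interior {z. \<bar>Im z\<bar> \<le> a} \<subseteq> {z. \<bar>Im z\<bar> < a}"
  proof
    fix z assume "z \<in> interior {z. \<bar>Im z\<bar> \<le> a}"
    then obtain e where e: "e > 0" "cball z e \<subseteq> {z. \<bar>Im z\<bar> \<le> a}" by (auto simp: mem_interior_cball)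
    have "z + \<i> * of_real e \<in> cball z e" "z - \<i> * of_real e \<in> cball z e"
      using e(1) by (auto simp: dist_norm norm_mult)
    then have "z + \<i> * of_real e \<in> {z. \<bar>Im z\<bar> \<le> a}" "z - \<i> * of_real e \<in> {z. \<bar>Im z\<bar> \<le> a}"
      using e(2) by blast+
    then show "z \<in> {z. \<bar>Im z\<bar> < a}" using e(1) by (auto simp: abs_if split: if_splits)
  qed
  ultimately show "inner \<rho> \<theta> Y field_differentiable at x" if "x \<in> interior {z. \<bar>Im z\<bar> \<le> a} - {}" for x
    using that by (intro holomorphic_on_imp_differentiable_at) auto
qed (use that in auto)

lemma outer_primitive:
  obtains P where "\<And>z. z \<in> U \<Longrightarrow> (P has_field_derivative outer \<rho> \<theta> Y z) (at z within U)"
proof (rule holomorphic_convex_primitive[OF convex_U finite.emptyI])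
  show "continuous_on U (outer \<rho> \<theta> Y)"
    unfolding outer_def wave_def ampl_def
    by (intro continuous_intros continuous_outer_root)
  let ?V = "{z. - w < Re z} \<inter> {z. Re z < 0} \<inter> {z. a < Im z}"
  have "outer \<rho> \<theta> Y holomorphic_on ?V"
    unfolding outer_def wave_def ampl_def outer_root_def
    by (intro holomorphic_intros outer_radicand_nonpos) auto
  moreover have "open ?V" by (intro open_Int open_halfspace_Im_gt open_halfspace_Re_lt open_halfspace_Re_gt)
  moreover have "interior U \<subseteq> ?V"
  proof
    fix z assume "z \<in> interior U"
    then obtain e where e: "e > 0" "cball z e \<subseteq> U" by (auto simp: mem_interior_cball)
    have "z + of_real e \<in> cball z e" "z - of_real e \<in> cball z e" "z - \<i> * of_real e \<in> cball z e"
      using e(1) by (auto simp: dist_norm norm_mult)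
    then have "z + of_real e \<in> U" "z - of_real e \<in> U" "z - \<i> * of_real e \<in> U"
      using e(2) by blast+
    then show "z \<in> ?V" using e(1) by (auto simp: U_def)
  qed
  ultimately show "outer \<rho> \<theta> Y field_differentiable at x" if "x \<in> interior U - {}" for x
    using that by (intro holomorphic_on_imp_differentiable_at) auto
qed (use that in auto)

lemma norm_wave: "cmod (wave \<rho> \<theta> z) = exp (\<rho> * sin (Re z - \<theta>) * sinh (Im z))"
  unfolding wave_def norm_exp_i_cos by simp

lemma norm_ampl_le:
  assumes "cmod s \<le> 2 * c" "k * cosh (Im z) \<le> c" and e: "cmod (exp (s * of_real Y)) \<le> E"
  shows "cmod (ampl Y s z) \<le> (2 * c) ^ (i + j + l) * E"
proof -
  have c0: "0 \<le> c" using assms(2) k cosh_real_pos[of "Im z"] by (meson less_imp_le mult_nonneg_nonneg order_trans)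
  have b: "cmod (of_real k * cos z) \<le> 2 * c" "cmod (- \<i> * of_real k * sin z) \<le> 2 * c"
  proof -
    have "k * cmod (cos z) \<le> k * cosh (Im z)" "k * cmod (sin z) \<le> k * cosh (Im z)"
      using k by (auto intro!: mult_left_mono norm_cos_sin_le_cosh)
    then have "k * cmod (cos z) \<le> 2 * c" "k * cmod (sin z) \<le> 2 * c"
      using assms(2) c0 by linarith+
    then show "cmod (of_real k * cos z) \<le> 2 * c" "cmod (- \<i> * of_real k * sin z) \<le> 2 * c"
      using k by (simp_all add: norm_mult)
  qed
  have "cmod (ampl Y s z) = cmod (of_real k * cos z) ^ i * cmod (- \<i> * of_real k * sin z) ^ j * cmod s ^ l * cmod (exp (s * of_real Y))"
    by (simp only: ampl_def norm_mult norm_power)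
  also have "\<dots> \<le> (2 * c) ^ i * (2 * c) ^ j * (2 * c) ^ l * E"
  proof (rule mult_mono[OF _ e])
    show "cmod (of_real k * cos z) ^ i * cmod (- \<i> * of_real k * sin z) ^ j * cmod s ^ l \<le> (2 * c) ^ i * (2 * c) ^ j * (2 * c) ^ l"
      by (rule mult_mono[OF mult_mono[OF power_mono[OF b(1)] power_mono[OF b(2)]] power_mono[OF assms(1)]])
        (simp_all add: c0)
  qed (simp_all add: c0)
  finally show ?thesis unfolding power_add .
qed

text \<open>
  A bound of the amplitude on the whole strip; it absorbs the factor \<open>exp (T Y)\<close> for \<open>\<bar>Y\<bar> \<le> R0\<close>.
\<close>
definition B where "B = (2 * K) ^ (i + j + l) * exp (2 * K * R0)"

lemma norm_sum_squares_sqrt: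
  fixes x y :: complex
  assumes "cmod x \<le> c" "cmod y \<le> c" "s\<^sup>2 = x\<^sup>2 - y\<^sup>2 \<or> s\<^sup>2 = y\<^sup>2 - x\<^sup>2"
  shows "cmod s \<le> 2 * c"
proof -
  have c: "0 \<le> c" using assms(1) norm_ge_zero order_trans by blast
  have "cmod (s\<^sup>2) \<le> cmod (x\<^sup>2) + cmod (y\<^sup>2)"
    using assms(3) norm_triangle_ineq4[of "x\<^sup>2" "y\<^sup>2"] norm_triangle_ineq4[of "y\<^sup>2" "x\<^sup>2"]
    by (elim disjE) (simp_all only: add.commute)
  then have "(cmod s)\<^sup>2 \<le> (cmod x)\<^sup>2 + (cmod y)\<^sup>2" unfolding norm_power .
  also have "\<dots> \<le> c\<^sup>2 + c\<^sup>2" using assms c by (intro add_mono power_mono) auto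
  also have "\<dots> \<le> (2 * c)\<^sup>2" by (simp add: power_mult_distrib)
  finally show ?thesis by (rule power2_le_imp_le) (simp add: c)
qed

lemma root_squared: "(inner_root z)\<^sup>2 = (of_real k * cos z)\<^sup>2 - (of_real K)\<^sup>2" "(outer_root z)\<^sup>2 = (of_real k * cos z)\<^sup>2 - (of_real K)\<^sup>2"
  by (simp_all add: inner_root_def outer_root_def power_mult_distrib)

lemma k_cos_le: "cmod (of_real k * cos z) \<le> k * cosh (Im z)"
  using mult_left_mono[OF norm_cos_sin_le_cosh(1)[of z], of k] k by (simp add: norm_mult)

lemma cosh_strip: "\<bar>Im z\<bar> \<le> a \<Longrightarrow> k * cosh (Im z) \<le> K"
  using cosh_real_nonneg_le_iff[of "\<bar>Im z\<bar>" a] a_pos k mult_left_mono[of "cosh (Im z)" "cosh a" k] cosh_a by simp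

lemma cosh_outer: "a \<le> \<bar>Im z\<bar> \<Longrightarrow> K \<le> k * cosh (Im z)"
  using cosh_real_nonneg_le_iff[of a "\<bar>Im z\<bar>"] a_pos k mult_left_mono[of "cosh a" "cosh (Im z)" k] cosh_a by simp

lemma norm_inner_root_le: "\<bar>Im z\<bar> \<le> a \<Longrightarrow> cmod (inner_root z) \<le> 2 * K"
  by (rule norm_sum_squares_sqrt[where x = "of_real k * cos z" and y = "of_real K"])
    (use order_trans[OF k_cos_le cosh_strip] K root_squared in auto)

lemma norm_outer_root_le: "a \<le> \<bar>Im z\<bar> \<Longrightarrow> cmod (outer_root z) \<le> 2 * (k * cosh (Im z))"
  by (rule norm_sum_squares_sqrt[where x = "of_real k * cos z" and y = "of_real K"])
    (use k_cos_le cosh_outer K root_squared in auto)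

lemma norm_ampl_strip:
  assumes "\<bar>Im z\<bar> \<le> a" "cmod s \<le> 2 * K" "\<bar>Y\<bar> \<le> R0"
  shows "cmod (ampl Y s z) \<le> B"
  unfolding B_def
proof (rule norm_ampl_le[OF assms(2) cosh_strip[OF assms(1)]])
  have "Re s * Y \<le> \<bar>Re s\<bar> * \<bar>Y\<bar>" by (metis abs_ge_self abs_mult)
  also have "\<dots> \<le> (2 * K) * R0"
    using assms abs_Re_le_cmod[of s] by (intro mult_mono) auto
  finally show "cmod (exp (s * of_real Y)) \<le> exp (2 * K * R0)" by simp
qed

text \<open>
  Beyond the branch points \<open>Re T \<ge> 0\<close> and \<open>Y \<le> 0\<close>, so the exponential is harmless and only polynomial growth in
  \<open>cosh (Im z)\<close> remains.
\<close>
lemma norm_ampl_outer: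
  assumes "a \<le> \<bar>Im z\<bar>" "Y \<le> 0"
  shows "cmod (ampl Y (outer_root z) z) \<le> (2 * (k * cosh (Im z))) ^ (i + j + l)"
proof -
  have "0 \<le> Re (outer_root z)"
    using csqrt_principal[of "(of_real k * cos z)\<^sup>2 - (of_real K)\<^sup>2"] by (auto simp: outer_root_def)
  then have "cmod (exp (outer_root z * of_real Y)) \<le> 1" using assms by (simp add: mult_nonneg_nonpos)
  from norm_ampl_le[OF norm_outer_root_le[OF assms(1)] order_refl this] show ?thesis by simp
qed

end

section \<open>The jump between the branches near the branch points\<close>

lemma sin_ge_sin:
  fixes x e :: real
  assumes "0 \<le> e" "e \<le> pi / 2" "e \<le> x" "x \<le> pi - e"
  shows "sin e \<le> sin x"
proof (cases "x \<le> pi / 2")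
  case True
  then show ?thesis using assms by (intro sin_monotone_2pi_le) auto
next
  case False
  have "sin e \<le> sin (pi - x)" using False assms by (intro sin_monotone_2pi_le) auto
  then show ?thesis by simp
qed

lemma exp_decay_powr:
  fixes b :: real assumes b: "0 < b"
  shows "\<exists>C\<ge>0. \<forall>\<rho>\<ge>1. exp (- (b * \<rho>)) \<le> C * \<rho> powr (-3/2)"
proof (intro exI[of _ "2 / b\<^sup>2"] conjI allI impI)
  fix \<rho> :: real assume \<rho>: "1 \<le> \<rho>"
  have "(b * \<rho>)\<^sup>2 / 2 \<le> exp (b * \<rho>)"
    using exp_lower_Taylor_quadratic[of "b * \<rho>"] b \<rho> by (smt (verit) mult_nonneg_nonneg)
  then have "exp (- (b * \<rho>)) \<le> 2 / (b * \<rho>)\<^sup>2"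
    using b \<rho> by (simp add: exp_minus field_simps)
  also have "\<dots> = 2 / b\<^sup>2 * \<rho> powr (-2)"
    using \<rho> by (simp add: powr_minus_divide power_mult_distrib)
  also have "\<dots> \<le> 2 / b\<^sup>2 * \<rho> powr (-3/2)"
    using \<rho> by (intro mult_left_mono powr_mono) auto
  finally show "exp (- (b * \<rho>)) \<le> 2 / b\<^sup>2 * \<rho> powr (-3/2)" .
qed (use b in auto)

lemma powr_three_halves:
  fixes \<rho> :: real assumes "0 < \<rho>" shows "\<rho> powr (-3/2) = 1 / (\<rho> * sqrt \<rho>)"
proof -
  have "\<rho> powr (3/2) = \<rho> powr (1 + 1/2)" by simp
  also have "\<dots> = \<rho> * sqrt \<rho>" using assms by (subst powr_add) (simp add: powr_half_sqrt)
  finally show ?thesis using assms by (simp add: powr_minus_divide)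
qed

text \<open>
  The elementary integral behind the exponent \<open>- 3/2\<close>: \<open>sqrt s\<close> integrated against \<open>exp (- \<rho> c s)\<close> has order
  \<open>\<rho> powr (-3/2)\<close>. By \<open>2 sqrt (\<rho> s) \<le> 1 + \<rho> s\<close> the square root is traded for \<open>1 / sqrt \<rho>\<close> and half of the decay, which
  leaves an exponential with an explicit primitive.
\<close>
lemma sqrt_exp_increment:
  fixes g :: "real \<Rightarrow> complex"
  assumes w: "0 < w" and cont: "continuous_on {0..w} g" and \<rho>: "0 < \<rho>" and c: "0 < c" and D: "0 \<le> D"
    and der: "\<And>s. 0 < s \<Longrightarrow> s < w \<Longrightarrow> (g has_vector_derivative g' s) (at s)"
    and bd: "\<And>s. 0 < s \<Longrightarrow> s < w \<Longrightarrow> cmod (g' s) \<le> D * sqrt s * exp (- (\<rho> * c * s))"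
  shows "cmod (g w - g 0) \<le> D * (1 + 2 / c) / c * \<rho> powr (-3/2)"
proof -
  \<comment> \<open>half of the decay remains in the primitive \<open>\<phi>\<close>; the other half absorbs \<open>1 + \<rho> s\<close>\<close>
  define E where "E = D * (1 + 2 / c) / (2 * sqrt \<rho>)"
  define \<phi> where "\<phi> s = - (E * (2 / (\<rho> * c))) * exp (- (\<rho> * c * s / 2))" for s
  have E: "0 \<le> E" using D c \<rho> by (simp add: E_def)
  have "cmod (g w - g 0) \<le> \<phi> w - \<phi> 0"
  proof (rule differentiable_bound_general[OF w cont])
    show "continuous_on {0..w} \<phi>" unfolding \<phi>_def by (intro continuous_intros) auto
    show "(\<phi> has_vector_derivative E * exp (- (\<rho> * c * s / 2))) (at s)" for s
      unfolding \<phi>_def has_real_derivative_iff_has_vector_derivative[symmetric]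
      using \<rho> c by (auto intro!: derivative_eq_intros)
    show "cmod (g' s) \<le> E * exp (- (\<rho> * c * s / 2))" if s: "0 < s" "s < w" for s
    proof -
      define x where "x = \<rho> * c * s / 2"
      have x: "0 \<le> x" using \<rho> c s by (simp add: x_def)
      have "0 \<le> (sqrt (\<rho> * s) - 1)\<^sup>2" by simp
      then have "2 * sqrt (\<rho> * s) \<le> 1 + \<rho> * s" using \<rho> s by (simp add: power2_diff)
      then have "sqrt s \<le> (1 + \<rho> * s) / (2 * sqrt \<rho>)" using \<rho> by (simp add: real_sqrt_mult field_simps)
      also have "1 + \<rho> * s \<le> (1 + 2 / c) * exp x"
      proof -
        have "\<rho> * s = 2 / c * x" using c by (simp add: x_def)
        also have "x \<le> exp x" using exp_ge_add_one_self[of x] by linarith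
        then have "2 / c * x \<le> 2 / c * exp x" using c by (intro mult_left_mono) simp_all
        finally show ?thesis using x by (simp add: distrib_right add_mono)
      qed
      finally have sq: "sqrt s \<le> (1 + 2 / c) * exp x / (2 * sqrt \<rho>)" using \<rho> by (simp add: divide_right_mono)
      then have "D * sqrt s * exp (- (\<rho> * c * s)) \<le> D * ((1 + 2 / c) * exp x / (2 * sqrt \<rho>)) * exp (- (2 * x))"
      proof -
        have e: "\<rho> * c * s = 2 * x" by (simp add: x_def)
        show ?thesis unfolding e using D sq by (intro mult_right_mono mult_left_mono) auto
      qed
      also have "\<dots> = E * exp (- x)" by (simp add: E_def mult_exp_exp)
      finally show ?thesis using bd[OF s] by (simp add: x_def)
    qed
  qed (use der in auto)
  also have "\<dots> \<le> E * (2 / (\<rho> * c))" using E \<rho> c by (simp add: \<phi>_def)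
  also have "\<dots> = D * (1 + 2 / c) / c * \<rho> powr (-3/2)"
    unfolding powr_three_halves[OF \<rho>] using \<rho> c by (simp add: E_def)
  finally show ?thesis .
qed

context layers begin

text \<open>
  A Lipschitz constant of the amplitude as a function of the root, doubled because the roots \<open>s\<close> and \<open>- s\<close> are
  compared.
\<close>
definition B1 where "B1 = K ^ (i + j) * ((real l * (2 * K) ^ (l - 1) + R0 * (2 * K) ^ l) * exp (2 * K * R0)) * 2"

lemma B1_nonneg: "0 \<le> B1" and B_nonneg: "0 \<le> B" using K R0 by (auto simp: B1_def B_def)

lemma ampl_diff:
  assumes z: "\<bar>Im z\<bar> \<le> a" and s: "cmod s \<le> 2 * K" and Y: "\<bar>Y\<bar> \<le> R0"
  shows "cmod (ampl Y s z - ampl Y (- s) z) \<le> B1 * cmod s"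
proof -
  define g where "g s = s ^ l * exp (s * of_real Y)" for s :: complex
  define L where "L = (real l * (2 * K) ^ (l - 1) + R0 * (2 * K) ^ l) * exp (2 * K * R0)"
  have L: "0 \<le> L" using K R0 by (simp add: L_def)
  have "cmod (g s - g (- s)) \<le> L * cmod (s - - s)"
  proof (rule field_differentiable_bound[where S = "cball 0 (2 * K)"])
    show "(g has_field_derivative (of_nat l * z ^ (l - 1) + of_real Y * z ^ l) * exp (z * of_real Y)) (at z within cball 0 (2 * K))" for z
      unfolding g_def by (auto intro!: derivative_eq_intros simp: algebra_simps)
    show "cmod ((of_nat l * z ^ (l - 1) + of_real Y * z ^ l) * exp (z * of_real Y)) \<le> L" if "z \<in> cball 0 (2 * K)" for z
    proof -
      have z: "cmod z \<le> 2 * K" using that by (simp add: dist_norm)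
      have "cmod (of_nat l * z ^ (l - 1) + of_real Y * z ^ l) \<le> real l * (2 * K) ^ (l - 1) + R0 * (2 * K) ^ l"
      proof (rule norm_triangle_mono)
        have p: "cmod z ^ n \<le> (2 * K) ^ n" for n by (rule power_mono[OF z norm_ge_zero])
        show "cmod (of_nat l * z ^ (l - 1)) \<le> real l * (2 * K) ^ (l - 1)"
          unfolding norm_mult norm_power norm_of_nat by (rule mult_left_mono[OF p]) simp
        show "cmod (of_real Y * z ^ l) \<le> R0 * (2 * K) ^ l"
          unfolding norm_mult norm_power norm_of_real using Y R0 by (intro mult_mono p) auto
      qed
      moreover have "cmod (exp (z * of_real Y)) \<le> exp (2 * K * R0)"
      proof -
        have "Re z * Y \<le> \<bar>Re z\<bar> * \<bar>Y\<bar>" by (metis abs_ge_self abs_mult)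
        also have "\<dots> \<le> (2 * K) * R0"
          using z Y abs_Re_le_cmod[of z] by (intro mult_mono) auto
        finally show ?thesis by simp
      qed
      ultimately show ?thesis unfolding norm_mult L_def using K R0 by (intro mult_mono) auto
    qed
  qed (use s in \<open>auto simp: dist_norm\<close>)
  then have g: "cmod (g s - g (- s)) \<le> L * (2 * cmod s)" by (simp add: norm_mult flip: mult_2)
  have "ampl Y s z - ampl Y (- s) z = (of_real k * cos z) ^ i * (- \<i> * of_real k * sin z) ^ j * (g s - g (- s))"
    by (simp add: ampl_def g_def algebra_simps)
  also have "cmod \<dots> = (k * cmod (cos z)) ^ i * (k * cmod (sin z)) ^ j * cmod (g s - g (- s))"
    using k by (simp add: norm_mult norm_power power_mult_distrib)
  also have "\<dots> \<le> K ^ i * K ^ j * (L * (2 * cmod s))"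
  proof -
    have "k * cmod (cos z) \<le> K" "k * cmod (sin z) \<le> K"
      using mult_left_mono[OF norm_cos_sin_le_cosh(1)[of z], of k] mult_left_mono[OF norm_cos_sin_le_cosh(2)[of z], of k] cosh_strip[OF z] k
      by linarith+
    then show ?thesis using k K g by (intro mult_mono power_mono) auto
  qed
  finally show ?thesis by (simp add: B1_def L_def power_add mult_ac)
qed

lemma inner_root_eq_or: "inner_root z = outer_root z \<or> inner_root z = - outer_root z"
  using root_squared[of z] by (simp add: power2_eq_iff flip: power2_eq_iff)

definition D where "D = B1 * sqrt (2 * k\<^sup>2 * cosh (2 * a))"
definition c2 where "c2 = sinh a / 2"

text \<open>
  At distance \<open>s\<close> from a branch point the two roots differ at most by a sign and have size \<open>O(sqrt s)\<close>. The wave is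
  bounded there by \<open>exp (- \<rho> s sinh a / 2)\<close>, because \<open>sin (\<theta> + s) \<ge> sin s \<ge> s / 2\<close> for all \<open>\<theta> \<in> [0, \<pi> / 2]\<close>; this is
  what makes the estimate uniform down to \<open>\<theta> = 0\<close>.
\<close>
lemma branch_difference:
  assumes z: "(z = Complex (- s) a) \<or> z = Complex (pi - s) (- a)" and s: "0 \<le> s" "s \<le> w"
    and \<theta>: "0 \<le> \<theta>" "\<theta> \<le> pi / 2" and \<rho>: "0 \<le> \<rho>" and Y: "\<bar>Y\<bar> \<le> R0"
  shows "cmod (inner \<rho> \<theta> Y z - outer \<rho> \<theta> Y z) \<le> D * sqrt s * exp (- (\<rho> * c2 * s))"
proof -
  have im: "\<bar>Im z\<bar> \<le> a" using z a_pos by auto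
  define q where "q = (of_real k * cos z)\<^sup>2 - (of_real K :: complex)\<^sup>2"
  have q: "q = - ((of_real K)\<^sup>2 - (of_real k * cos z)\<^sup>2)" by (simp add: q_def)
  have cs: "cos (2 * Re z) * cosh (2 * Im z) = cos (2 * s) * cosh (2 * a)"
    "\<bar>sin (2 * Re z) * sinh (2 * Im z)\<bar> = \<bar>sin (2 * s)\<bar> * sinh (2 * a)"
    using z a_pos by (auto simp: abs_mult right_diff_distrib cos_diff sin_diff)
  have c1: "1 - cos (2 * s) \<le> 2 * s"
  proof -
    have "1 - cos (2 * s) = 2 * (sin s)\<^sup>2" by (simp add: cos_double_sin)
    also have "(sin s)\<^sup>2 \<le> \<bar>sin s\<bar>" using abs_sin_le_one[of s] 
      by (metis abs_ge_zero mult_left_le power2_abs power2_eq_square)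
    also have "\<dots> \<le> s" using abs_sin_x_le_abs_x[of s] s by simp
    finally show ?thesis by simp
  qed
  have "\<bar>Re q\<bar> \<le> k\<^sup>2 * cosh (2 * a) * s"
  proof -
    have "\<bar>Re q\<bar> = k\<^sup>2 / 2 * \<bar>cosh (2 * a) * (1 - cos (2 * s))\<bar>"
    proof -
      have e: "cosh (2 * a) - cos (2 * s) * cosh (2 * a) = cosh (2 * a) * (1 - cos (2 * s))" by (simp add: algebra_simps)
      show ?thesis unfolding q uminus_complex.sel radicand cs e by (simp add: abs_mult)
    qed
    also have "\<dots> = k\<^sup>2 / 2 * (cosh (2 * a) * (1 - cos (2 * s)))" by (simp add: abs_mult)
    also have "\<dots> \<le> k\<^sup>2 / 2 * (cosh (2 * a) * (2 * s))" by (intro mult_left_mono c1) auto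
    finally show ?thesis by simp
  qed
  moreover have "\<bar>Im q\<bar> \<le> k\<^sup>2 * cosh (2 * a) * s"
  proof -
    have "\<bar>Im q\<bar> = k\<^sup>2 / 2 * (\<bar>sin (2 * s)\<bar> * sinh (2 * a))"
      unfolding q uminus_complex.sel radicand by (simp only: abs_minus_cancel abs_mult cs(2)[symmetric]) simp
    also have "\<dots> \<le> k\<^sup>2 / 2 * ((2 * s) * cosh (2 * a))"
      using abs_sin_x_le_abs_x[of "2 * s"] s a_pos by (intro mult_left_mono mult_mono sinh_le_cosh_real) auto
    finally show ?thesis by (simp add: mult_ac)
  qed
  ultimately have "cmod q \<le> 2 * k\<^sup>2 * cosh (2 * a) * s" using cmod_le[of q] by simp
  then have "sqrt (cmod q) \<le> sqrt (2 * k\<^sup>2 * cosh (2 * a)) * sqrt s"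
    unfolding real_sqrt_mult[symmetric] by simp
  then have r: "cmod (outer_root z) \<le> sqrt (2 * k\<^sup>2 * cosh (2 * a)) * sqrt s" by (simp add: outer_root_def q_def)
  have r2: "cmod (outer_root z) \<le> 2 * K" using norm_inner_root_le[OF im] inner_root_eq_or[of z] by auto
  have A: "cmod (ampl Y (inner_root z) z - ampl Y (outer_root z) z) \<le> D * sqrt s"
  proof -
    have "cmod (ampl Y (inner_root z) z - ampl Y (outer_root z) z) \<le> B1 * cmod (outer_root z)"
      using inner_root_eq_or[of z] ampl_diff[OF im r2 Y] B1_nonneg by (auto simp: norm_minus_commute)
    also have "\<dots> \<le> B1 * (sqrt (2 * k\<^sup>2 * cosh (2 * a)) * sqrt s)" by (intro mult_left_mono r B1_nonneg)
    finally show ?thesis by (simp add: D_def)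
  qed
  have "sin (Re z - \<theta>) * sinh (Im z) = - (sin (\<theta> + s) * sinh a)"
    using z
  proof
    assume "z = Complex (- s) a"
    then have "Re z - \<theta> = - (\<theta> + s)" "Im z = a" by simp_all
    then show ?thesis by (simp only: sin_minus)
  next
    assume "z = Complex (pi - s) (- a)"
    then have "Re z - \<theta> = pi - (\<theta> + s)" "Im z = - a" by simp_all
    then show ?thesis by (simp only: sin_pi_minus sinh_minus mult_minus_right)
  qed
  moreover have "s / 2 * sinh a \<le> sin (\<theta> + s) * sinh a"
  proof (rule mult_right_mono)
    have "s / 2 \<le> sin s" using s w by (intro sin_ge_half) linarith+
    also have "\<dots> \<le> sin (\<theta> + s)" using s w \<theta> pi_gt3 by (intro sin_ge_sin) linarith+
    finally show "s / 2 \<le> sin (\<theta> + s)" .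
  qed (use a_pos in simp)
  ultimately have "cmod (wave \<rho> \<theta> z) \<le> exp (- (\<rho> * c2 * s))"
    unfolding norm_wave using mult_left_mono[OF _ \<rho>, of "s / 2 * sinh a" "sin (\<theta> + s) * sinh a"]
    by (simp add: c2_def mult.assoc) (simp add: mult_ac)
  then have "cmod (wave \<rho> \<theta> z) * cmod (ampl Y (inner_root z) z - ampl Y (outer_root z) z) \<le> exp (- (\<rho> * c2 * s)) * (D * sqrt s)"
    using A by (intro mult_mono) auto
  then show ?thesis by (simp add: inner_def outer_def norm_mult mult_ac flip: right_diff_distrib)
qed

end

section \<open>Increments along the deformed contour\<close>

lemma has_vector_derivative_continuous_on:
  "(\<And>x. x \<in> S \<Longrightarrow> (f has_vector_derivative f' x) (at x within S)) \<Longrightarrow> continuous_on S f"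
  unfolding continuous_on_eq_continuous_within by (blast intro: has_vector_derivative_continuous)

context layers begin

text \<open>
  In the two boxes that connect the saddle segment with the points near the branch points, the product of
  \<open>sin (Re z - \<theta>)\<close> and \<open>sinh (Im z)\<close> is at most \<open>- sin w sinh w\<close>.
\<close>
lemma box_decay:
  assumes P: "\<And>z. \<bar>Im z\<bar> \<le> a \<Longrightarrow> (P has_field_derivative inner \<rho> \<theta> Y z) (at z within {z. \<bar>Im z\<bar> \<le> a})"
    and \<rho>: "0 \<le> \<rho>" and Y: "\<bar>Y\<bar> \<le> R0"
    and side: "(w \<le> u1 - \<theta> \<and> u2 - \<theta> \<le> pi - w \<and> - a \<le> v1 \<and> v2 \<le> - w) \<or> (w - pi \<le> u1 - \<theta> \<and> u2 - \<theta> \<le> - w \<and> w \<le> v1 \<and> v2 \<le> a)"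
    and z: "z1 \<in> {z. u1 \<le> Re z \<and> Re z \<le> u2 \<and> v1 \<le> Im z \<and> Im z \<le> v2}" "z2 \<in> {z. u1 \<le> Re z \<and> Re z \<le> u2 \<and> v1 \<le> Im z \<and> Im z \<le> v2}"
  shows "cmod (P z1 - P z2) \<le> B * exp (- (sin w * sinh w * \<rho>)) * cmod (z1 - z2)"
proof -
  let ?S = "{z. u1 \<le> Re z \<and> Re z \<le> u2 \<and> v1 \<le> Im z \<and> Im z \<le> v2}"
  have "?S = {z. Re z \<ge> u1} \<inter> {z. Re z \<le> u2} \<inter> {z. Im z \<ge> v1} \<inter> {z. Im z \<le> v2}" by auto
  then have cv: "convex ?S"
    by (metis convex_Int convex_halfspace_Im_ge convex_halfspace_Im_le convex_halfspace_Re_le convex_halfspace_Re_ge)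
  have sub: "?S \<subseteq> {z. \<bar>Im z\<bar> \<le> a}" using side w a_pos by auto
  show ?thesis
  proof (rule field_differentiable_bound[OF cv _ _ z])
    show "(P has_field_derivative inner \<rho> \<theta> Y z) (at z within ?S)" if "z \<in> ?S" for z
      using P[of z] sub that by (blast intro: has_field_derivative_subset)
    fix z assume z: "z \<in> ?S"
    then have im: "\<bar>Im z\<bar> \<le> a" using sub by auto
    have w2: "w \<le> pi / 2" "0 \<le> sinh w" "0 \<le> sin w" using w pi_gt3 by (auto intro!: sin_ge_zero)
    have "sin w * sinh w \<le> - (sin (Re z - \<theta>) * sinh (Im z))"
      using side
    proof
      assume s: "w \<le> u1 - \<theta> \<and> u2 - \<theta> \<le> pi - w \<and> - a \<le> v1 \<and> v2 \<le> - w"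
      have "sin w \<le> sin (Re z - \<theta>)" using s z w w2 by (intro sin_ge_sin) auto
      moreover have "w \<le> - Im z" using s z by auto
      then have "sinh w \<le> sinh (- Im z)" by (simp only: sinh_real_le_iff)
      ultimately have "sin w * sinh w \<le> sin (Re z - \<theta>) * sinh (- Im z)" using w2 by (intro mult_mono) auto
      then show ?thesis by simp
    next
      assume s: "w - pi \<le> u1 - \<theta> \<and> u2 - \<theta> \<le> - w \<and> w \<le> v1 \<and> v2 \<le> a"
      have "sin w \<le> sin (- (Re z - \<theta>))" using s z w w2 by (intro sin_ge_sin) auto
      moreover have "sinh w \<le> sinh (Im z)" using s z by auto
      ultimately have "sin w * sinh w \<le> sin (- (Re z - \<theta>)) * sinh (Im z)" using w2 by (intro mult_mono) auto
      then show ?thesis by (simp only: sin_minus)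
    qed
    from mult_left_mono[OF this \<rho>] have "cmod (wave \<rho> \<theta> z) \<le> exp (- (sin w * sinh w * \<rho>))"
      unfolding norm_wave exp_le_cancel_iff by (simp add: mult_ac)
    moreover have "cmod (ampl Y (inner_root z) z) \<le> B" by (rule norm_ampl_strip[OF im norm_inner_root_le[OF im] Y])
    ultimately show "cmod (inner \<rho> \<theta> Y z) \<le> B * exp (- (sin w * sinh w * \<rho>))"
      unfolding inner_def norm_mult by (subst mult.commute, intro mult_mono) (auto simp: B_nonneg)
  qed
qed

text \<open>
  The straight segment through the saddle \<open>z = \<theta>\<close> in the direction of steepest descent.
\<close>
lemma saddle_increment:
  assumes P: "\<And>z. \<bar>Im z\<bar> \<le> a \<Longrightarrow> (P has_field_derivative inner \<rho> \<theta> Y z) (at z within {z. \<bar>Im z\<bar> \<le> a})"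
  shows "P (Complex (\<theta> - w) w) - P (Complex (\<theta> + w) (- w))
    = - (1 - \<i>) * integral {-w..w} (\<lambda>t. exp (\<i> * of_real \<rho> * cos (saddle_path t)) * ampl Y (inner_root (of_real \<theta> - saddle_path t)) (of_real \<theta> - saddle_path t))"
proof -
  let ?g = "\<lambda>t. of_real \<theta> - saddle_path t"
  let ?f = "\<lambda>t. - (1 - \<i>) * (exp (\<i> * of_real \<rho> * cos (saddle_path t)) * ampl Y (inner_root (?g t)) (?g t))"
  have *: "(?f has_integral P (?g w) - P (?g (- w))) {-w..w}"
  proof (rule fundamental_theorem_of_calculus)
    show "((\<lambda>t. P (?g t)) has_vector_derivative ?f t) (at t within {-w..w})" if "t \<in> {-w..w}" for t
    proof -
      have "(?g has_vector_derivative - (1 - \<i>)) (at t within {-w..w})"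
        unfolding saddle_path_def by (auto intro!: derivative_eq_intros)
      moreover have "?g ` {-w..w} \<subseteq> {z. \<bar>Im z\<bar> \<le> a}" using w by (auto simp: saddle_path_def)
      then have "(P has_field_derivative inner \<rho> \<theta> Y (?g t)) (at (?g t) within ?g ` {-w..w})"
        using P that by (blast intro: has_field_derivative_subset)
      ultimately have "((P \<circ> ?g) has_vector_derivative - (1 - \<i>) * inner \<rho> \<theta> Y (?g t)) (at t within {-w..w})"
        by (rule field_vector_diff_chain_within)
      then show ?thesis by (simp add: o_def inner_def wave_def algebra_simps)
    qed
  qed (use w in simp)
  have "?g w = Complex (\<theta> - w) w" "?g (- w) = Complex (\<theta> + w) (- w)"
    by (simp_all add: saddle_path_def complex_eq_iff)
  then show ?thesis using integral_unique[OF *] by (simp only: integral_mult_right)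
qed

text \<open>
  The contour with the inner root and the one with the outer root have to be joined at the branch points; the mismatch
  is the integral of the difference of the two integrands along a horizontal segment of length \<open>w\<close>. The second estimate
  is for the branch point \<open>\<pi> - \<i> a\<close>: the map \<open>z \<mapsto> \<pi> + cnj z\<close> carries the upper tail to the lower one and the integrand
  to \<open>(- 1) ^ i\<close> times its conjugate, so the same function \<open>Q\<close> describes both tails.
\<close>
lemma branch_increment:
  assumes P: "\<And>z. \<bar>Im z\<bar> \<le> a \<Longrightarrow> (P has_field_derivative inner \<rho> \<theta> Y z) (at z within {z. \<bar>Im z\<bar> \<le> a})"
    and Q: "\<And>z. z \<in> U \<Longrightarrow> (Q has_field_derivative outer \<rho> \<theta> Y z) (at z within U)"
    and \<theta>: "0 \<le> \<theta>" "\<theta> \<le> pi / 2" and \<rho>: "0 < \<rho>" and Y: "\<bar>Y\<bar> \<le> R0"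
  defines "C \<equiv> D * (1 + 2 / c2) / c2"
  shows "cmod ((P (Complex (- w) a) - P (Complex 0 a)) - (Q (Complex (- w) a) - Q (Complex 0 a))) \<le> C * \<rho> powr (-3/2)"
    "cmod ((P (Complex (pi - w) (- a)) - P (Complex pi (- a))) - (- 1) ^ i * cnj (Q (Complex (- w) a) - Q (Complex 0 a))) \<le> C * \<rho> powr (-3/2)"
proof -
  have c2: "0 < c2" "0 \<le> D" using a_pos B1_nonneg by (auto simp: c2_def D_def)
  have dP: "((\<lambda>s. P (Complex (p - s) q)) has_vector_derivative - inner \<rho> \<theta> Y (Complex (p - s) q)) (at s within {0..w})"
    if "q = a \<or> q = - a" "s \<in> {0..w}" for p q s
  proof -
    have "((\<lambda>s. Complex (p - s) q) has_vector_derivative - 1) (at s within {0..w})"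
      unfolding Complex_eq by (auto intro!: derivative_eq_intros)
    moreover have "(\<lambda>s. Complex (p - s) q) ` {0..w} \<subseteq> {z. \<bar>Im z\<bar> \<le> a}" using that a_pos by auto
    then have "(P has_field_derivative inner \<rho> \<theta> Y (Complex (p - s) q)) (at (Complex (p - s) q) within (\<lambda>s. Complex (p - s) q) ` {0..w})"
      using P that by (blast intro: has_field_derivative_subset)
    ultimately show ?thesis
      using field_vector_diff_chain_within[of "\<lambda>s. Complex (p - s) q" "-1" s "{0..w}" P] by (simp add: o_def)
  qed
  have dQ: "((\<lambda>s. Q (Complex (- s) a)) has_vector_derivative - outer \<rho> \<theta> Y (Complex (- s) a)) (at s within {0..w})"
    if "s \<in> {0..w}" for s
  proof -
    have "((\<lambda>s. Complex (- s) a) has_vector_derivative - 1) (at s within {0..w})"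
      unfolding Complex_eq by (auto intro!: derivative_eq_intros)
    moreover have "(\<lambda>s. Complex (- s) a) ` {0..w} \<subseteq> U" by (auto simp: U_def)
    then have "(Q has_field_derivative outer \<rho> \<theta> Y (Complex (- s) a)) (at (Complex (- s) a) within (\<lambda>s. Complex (- s) a) ` {0..w})"
      using Q that by (blast intro: has_field_derivative_subset)
    ultimately show ?thesis
      using field_vector_diff_chain_within[of "\<lambda>s. Complex (- s) a" "-1" s "{0..w}" Q] by (simp add: o_def)
  qed
  have refl: "(- 1) ^ i * cnj (outer \<rho> \<theta> Y (Complex (- s) a)) = outer \<rho> \<theta> Y (Complex (pi - s) (- a))" if s: "0 < s" "s < w" for s
  proof -
    define z where "z = Complex (- s) a"
    have z': "Complex (pi - s) (- a) = of_real pi + cnj z" by (simp add: z_def complex_eq_iff)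
    have c: "cos (of_real pi + cnj z) = - cnj (cos z)" "sin (of_real pi + cnj z) = - cnj (sin z)"
      by (simp_all add: cos_add sin_add cos_of_real sin_of_real cnj_cos cnj_sin)
    have "(of_real k * cos z)\<^sup>2 - (of_real K)\<^sup>2 \<notin> \<real>\<^sub>\<le>\<^sub>0"
      using s by (intro outer_radicand_nonpos(2)) (simp_all add: z_def)
    from cnj_csqrt[OF this] have r: "outer_root (of_real pi + cnj z) = cnj (outer_root z)"
      by (simp add: outer_root_def c)
    have "cos (of_real pi + cnj z - of_real \<theta>) = cos (of_real pi + cnj (z - of_real \<theta>))" by (simp add: add_diff_eq)
    also have "\<dots> = - cnj (cos (z - of_real \<theta>))"
      by (simp only: cos_add cos_of_real sin_of_real) (simp add: cnj_cos)
    finally have "wave \<rho> \<theta> (of_real pi + cnj z) = cnj (wave \<rho> \<theta> z)"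
      by (simp add: wave_def exp_cnj)
    moreover have "ampl Y (cnj (outer_root z)) (of_real pi + cnj z) = (- 1) ^ i * cnj (ampl Y (outer_root z) z)"
      by (simp add: ampl_def c exp_cnj power_minus[of "of_real k * cnj (cos z)"])
    ultimately show ?thesis unfolding z' outer_def r z_def[symmetric] by simp
  qed
  show "cmod ((P (Complex (- w) a) - P (Complex 0 a)) - (Q (Complex (- w) a) - Q (Complex 0 a))) \<le> C * \<rho> powr (-3/2)"
  proof -
    let ?g = "\<lambda>s. P (Complex (0 - s) a) - Q (Complex (- s) a)"
    let ?g' = "\<lambda>s. - inner \<rho> \<theta> Y (Complex (0 - s) a) - - outer \<rho> \<theta> Y (Complex (- s) a)"
    have d: "(?g has_vector_derivative ?g' s) (at s within {0..w})" if "s \<in> {0..w}" for s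
      by (intro has_vector_derivative_diff dP dQ) (use that in auto)
    have "cmod (?g w - ?g 0) \<le> C * \<rho> powr (-3/2)"
      unfolding C_def
    proof (rule sqrt_exp_increment[OF w(1) _ \<rho> c2])
      show "continuous_on {0..w} ?g"
        using d by (rule has_vector_derivative_continuous_on)
      fix s assume s: "0 < s" "s < w"
      show "(?g has_vector_derivative ?g' s) (at s)"
        using d[of s] s by (simp add: at_within_Icc_at)
      show "cmod (?g' s) \<le> D * sqrt s * exp (- (\<rho> * c2 * s))"
        using branch_difference[of "Complex (- s) a" s \<theta> \<rho> Y] s \<theta> \<rho> Y by (simp add: norm_minus_commute)
    qed
    then show ?thesis by (simp add: algebra_simps)
  qed
  show "cmod ((P (Complex (pi - w) (- a)) - P (Complex pi (- a))) - (- 1) ^ i * cnj (Q (Complex (- w) a) - Q (Complex 0 a))) \<le> C * \<rho> powr (-3/2)"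
  proof -
    let ?g = "\<lambda>s. P (Complex (pi - s) (- a)) - (- 1) ^ i * cnj (Q (Complex (- s) a))"
    let ?g' = "\<lambda>s. - inner \<rho> \<theta> Y (Complex (pi - s) (- a)) - (- 1) ^ i * cnj (- outer \<rho> \<theta> Y (Complex (- s) a))"
    have d: "(?g has_vector_derivative ?g' s) (at s within {0..w})" if "s \<in> {0..w}" for s
      by (intro has_vector_derivative_diff has_vector_derivative_mult_right has_vector_derivative_cnj dP dQ) (use that in auto)
    have "cmod (?g w - ?g 0) \<le> C * \<rho> powr (-3/2)"
      unfolding C_def
    proof (rule sqrt_exp_increment[OF w(1) _ \<rho> c2])
      show "continuous_on {0..w} ?g"
        using d by (rule has_vector_derivative_continuous_on)
      fix s assume s: "0 < s" "s < w"
      show "(?g has_vector_derivative ?g' s) (at s)"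
        using d[of s] s by (simp add: at_within_Icc_at)
      show "cmod (?g' s) \<le> D * sqrt s * exp (- (\<rho> * c2 * s))"
        using branch_difference[of "Complex (pi - s) (-a)" s \<theta> \<rho> Y] s \<theta> \<rho> Y refl[OF s] by (simp add: norm_minus_commute)
    qed
    then show ?thesis by (simp add: algebra_simps)
  qed
qed

text \<open>
  On the vertical line \<open>Re z = - w\<close> one has \<open>sin (\<theta> - Re z) \<ge> sin w\<close>, and half of the resulting exponential decay in
  \<open>Im z\<close> absorbs the polynomial growth of the amplitude once \<open>\<rho>\<close> is large. As the line starts at height \<open>a > 0\<close>, its
  contribution is even exponentially small.
\<close>
lemma ray_increment:
  "\<exists>C \<rho>0. \<forall>\<rho> \<theta> Y Q \<eta>. \<rho>0 \<le> \<rho> \<longrightarrow> 0 \<le> \<theta> \<longrightarrow> \<theta> \<le> pi / 2 \<longrightarrow> Y \<le> 0 \<longrightarrow> a < \<eta> \<longrightarrow>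
    (\<forall>z\<in>U. (Q has_field_derivative outer \<rho> \<theta> Y z) (at z within U)) \<longrightarrow>
    cmod (Q (Complex (- w) \<eta>) - Q (Complex (- w) a)) \<le> C * \<rho> powr (-3/2)"
proof -
  define m where "m = i + j + l"
  define c where "c = sin w"
  have c: "0 < c" unfolding c_def using w pi_gt3 by (intro sin_gt_zero) linarith+
  obtain C where C: "0 \<le> C" "\<And>\<rho>. 1 \<le> \<rho> \<Longrightarrow> exp (- (c * a / 2 * \<rho>)) \<le> C * \<rho> powr (-3/2)"
    using exp_decay_powr[of "c * a / 2"] c a_pos by auto
  define M where "M = (2 * k) ^ m"
  have M: "0 \<le> M" using k by (simp add: M_def)
  show ?thesis
  proof (rule exI[of _ "M * (2 / c) * C"], rule exI[of _ "max 1 (2 * real m / c)"], intro allI impI)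
    fix \<rho> \<theta> Y Q \<eta>
    assume \<rho>: "max 1 (2 * real m / c) \<le> \<rho>" and \<theta>: "0 \<le> \<theta>" "\<theta> \<le> pi / 2" and Y: "Y \<le> 0" and \<eta>: "a < \<eta>"
      and Q: "\<forall>z\<in>U. (Q has_field_derivative outer \<rho> \<theta> Y z) (at z within U)"
    \<comment> \<open>the amplitude grows like \<open>exp (m t)\<close>, at most half the rate of decay of the wave\<close>
    have \<rho>1: "1 \<le> \<rho>" "real m \<le> \<rho> * c / 2" using \<rho> c by (auto simp: field_simps)
    define \<phi> where "\<phi> t = - (M * (2 / (\<rho> * c))) * exp (- (\<rho> * c / 2 * t))" for t
    have dQ: "((\<lambda>t. Q (Complex (- w) t)) has_vector_derivative \<i> * outer \<rho> \<theta> Y (Complex (- w) t)) (at t within {a..\<eta>})"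
      if "t \<in> {a..\<eta>}" for t
    proof -
      have "((\<lambda>t. Complex (- w) t) has_vector_derivative \<i>) (at t within {a..\<eta>})"
        unfolding Complex_eq by (auto intro!: derivative_eq_intros)
      moreover have "(\<lambda>t. Complex (- w) t) ` {a..\<eta>} \<subseteq> U" using w by (auto simp: U_def)
      then have "(Q has_field_derivative outer \<rho> \<theta> Y (Complex (- w) t)) (at (Complex (- w) t) within (\<lambda>t. Complex (- w) t) ` {a..\<eta>})"
        using Q that by (blast intro: has_field_derivative_subset)
      ultimately show ?thesis
        using field_vector_diff_chain_within[of "\<lambda>t. Complex (- w) t" "\<i>" t "{a..\<eta>}" Q] by (simp add: o_def)
    qed
    have "cmod (Q (Complex (- w) \<eta>) - Q (Complex (- w) a)) \<le> \<phi> \<eta> - \<phi> a"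
    proof (rule differentiable_bound_general[OF \<eta>])
      show "continuous_on {a..\<eta>} (\<lambda>t. Q (Complex (- w) t))"
        using dQ by (rule has_vector_derivative_continuous_on)
      show "continuous_on {a..\<eta>} \<phi>" unfolding \<phi>_def by (intro continuous_intros) auto
      fix t assume t: "a < t" "t < \<eta>"
      show "((\<lambda>t. Q (Complex (- w) t)) has_vector_derivative \<i> * outer \<rho> \<theta> Y (Complex (- w) t)) (at t)"
        using dQ[of t] t by (simp add: at_within_Icc_at)
      show "(\<phi> has_vector_derivative M * exp (- (\<rho> * c / 2 * t))) (at t)"
        unfolding \<phi>_def has_real_derivative_iff_has_vector_derivative[symmetric]
        using \<rho>1 c by (auto intro!: derivative_eq_intros)
      have t0: "0 \<le> t" using t a_pos by simp
      have "cmod (ampl Y (outer_root (Complex (- w) t)) (Complex (- w) t)) \<le> (2 * (k * cosh t)) ^ m"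
        using norm_ampl_outer[of "Complex (- w) t" Y] t Y by (simp add: m_def)
      also have "\<dots> \<le> (2 * k * exp t) ^ m"
      proof (rule power_mono)
        have "cosh t \<le> exp t" using t0 by (simp add: cosh_field_def)
        then show "2 * (k * cosh t) \<le> 2 * k * exp t" using k by simp
      qed (use k in simp)
      also have "\<dots> = M * exp (real m * t)" by (simp add: M_def power_mult_distrib exp_of_nat_mult)
      also have "\<dots> \<le> M * exp (\<rho> * c / 2 * t)" using M mult_right_mono[OF \<rho>1(2) t0] by (intro mult_left_mono) simp_all
      finally have A: "cmod (ampl Y (outer_root (Complex (- w) t)) (Complex (- w) t)) \<le> M * exp (\<rho> * c / 2 * t)" .
      have "c * t \<le> sin (\<theta> + w) * sinh t"
        unfolding c_def using \<theta> w pi_gt3 t0 by (intro mult_mono sin_ge_sin sinh_ge_self sin_ge_zero) auto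
      moreover have "sin (- w - \<theta>) = - sin (\<theta> + w)" by (metis add_uminus_conv_diff minus_add_distrib add.commute sin_minus)
      ultimately have W: "cmod (wave \<rho> \<theta> (Complex (- w) t)) \<le> exp (- (\<rho> * c * t))"
        unfolding norm_wave using mult_left_mono[of "c * t" "sin (\<theta> + w) * sinh t" \<rho>] \<rho>1 by (simp add: mult.assoc)
      have "cmod (outer \<rho> \<theta> Y (Complex (- w) t)) \<le> exp (- (\<rho> * c * t)) * (M * exp (\<rho> * c / 2 * t))"
        unfolding outer_def norm_mult using A W by (intro mult_mono) auto
      also have "\<dots> = M * exp (- (\<rho> * c / 2 * t))" by (simp add: mult_exp_exp)
      finally show "cmod (\<i> * outer \<rho> \<theta> Y (Complex (- w) t)) \<le> M * exp (- (\<rho> * c / 2 * t))" by (simp add: norm_mult)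
    qed
    also have "\<dots> \<le> M * (2 / (\<rho> * c)) * exp (- (\<rho> * c / 2 * a))" using M \<rho>1 c by (simp add: \<phi>_def)
    also have "\<dots> \<le> M * (2 / c) * exp (- (\<rho> * c / 2 * a))"
      using M \<rho>1 c by (intro mult_right_mono mult_left_mono) (auto simp: field_simps)
    also have "\<dots> \<le> M * (2 / c) * (C * \<rho> powr (-3/2))"
      using C(2)[OF \<rho>1(1)] M c by (intro mult_left_mono) (auto simp: mult_ac)
    finally show "cmod (Q (Complex (- w) \<eta>) - Q (Complex (- w) a)) \<le> M * (2 / c) * C * \<rho> powr (-3/2)" by simp
  qed
qed

text \<open>
  The tail and its translate by \<open>w\<close> are joined at infinity. The decay at height \<open>\<eta>\<close> is like
  \<open>exp (- \<rho> sin e cosh \<eta>)\<close> with some \<open>e > 0\<close> depending on \<open>\<theta> > 0\<close>; uniformity is irrelevant since only the limit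
  \<open>\<eta> \<rightarrow> \<infinity>\<close> matters.
\<close>
lemma arc_vanishes:
  assumes \<rho>: "0 < \<rho>" and \<theta>: "0 < \<theta>" "\<theta> \<le> pi / 2" and Y: "Y \<le> 0"
    and Q: "\<And>z. z \<in> U \<Longrightarrow> (Q has_field_derivative outer \<rho> \<theta> Y z) (at z within U)"
  shows "((\<lambda>\<eta>. Q (Complex 0 \<eta>) - Q (Complex (- w) \<eta>)) \<longlongrightarrow> 0) at_top"
proof -
  define m where "m = i + j + l"
  define e where "e = min \<theta> (pi / 4)"
  define c where "c = \<rho> * sin e"
  have e: "0 < e" "e \<le> pi / 2" using \<theta> by (auto simp: e_def min_def)
  have c: "0 < c" unfolding c_def using e \<rho> by (intro mult_pos_pos sin_gt_zero) auto
  have "cmod (Q (Complex 0 \<eta>) - Q (Complex (- w) \<eta>)) \<le> exp c * (2 * k) ^ m * w * (cosh \<eta> ^ m / exp (c * cosh \<eta>))"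
    if \<eta>: "a \<le> \<eta>" for \<eta>
  proof -
    have \<eta>0: "0 \<le> \<eta>" using \<eta> a_pos by simp
    let ?S = "{z. - w \<le> Re z \<and> Re z \<le> 0 \<and> Im z = \<eta>}"
    have SE: "?S = {z. Re z \<ge> - w} \<inter> {z. Re z \<le> 0} \<inter> {z. Im z \<ge> \<eta>} \<inter> {z. Im z \<le> \<eta>}" by auto
    have "convex ?S" unfolding SE
      by (intro convex_Int convex_halfspace_Im_ge convex_halfspace_Im_le convex_halfspace_Re_le convex_halfspace_Re_ge)
    then have "cmod (Q (Complex 0 \<eta>) - Q (Complex (- w) \<eta>)) \<le> (exp (c - c * cosh \<eta>) * (2 * (k * cosh \<eta>)) ^ m) * cmod (Complex 0 \<eta> - Complex (- w) \<eta>)"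
    proof (rule field_differentiable_bound)
      show "(Q has_field_derivative outer \<rho> \<theta> Y z) (at z within ?S)" if "z \<in> ?S" for z
        using Q[of z] that \<eta> by (auto simp: U_def intro: has_field_derivative_subset)
      fix z assume z: "z \<in> ?S"
      have A: "cmod (ampl Y (outer_root z) z) \<le> (2 * (k * cosh \<eta>)) ^ m"
        using norm_ampl_outer[of z Y] z \<eta> Y by (auto simp: m_def)
      have "cosh \<eta> - 1 \<le> sinh \<eta>" using cosh_minus_sinh[of \<eta>] \<eta>0 by (simp add: algebra_simps)
      moreover have "sin e \<le> sin (\<theta> - Re z)"
        using z \<theta> w e by (intro sin_ge_sin) (auto simp: e_def min_def)
      moreover have "0 \<le> sin e" using e by (intro sin_ge_zero) auto
      ultimately have "sin e * (cosh \<eta> - 1) \<le> sin (\<theta> - Re z) * sinh \<eta>"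
        using \<eta>0 cosh_real_ge_1[of \<eta>] by (intro mult_mono) auto
      then have "c * (cosh \<eta> - 1) \<le> \<rho> * (sin (\<theta> - Re z) * sinh \<eta>)"
        unfolding c_def using \<rho> by (simp add: mult.assoc)
      moreover have "sin (Re z - \<theta>) = - sin (\<theta> - Re z)" by (metis minus_diff_eq sin_minus)
      ultimately have W: "cmod (wave \<rho> \<theta> z) \<le> exp (c - c * cosh \<eta>)"
        unfolding norm_wave using z by (simp add: algebra_simps)
      show "cmod (outer \<rho> \<theta> Y z) \<le> exp (c - c * cosh \<eta>) * (2 * (k * cosh \<eta>)) ^ m"
        unfolding outer_def norm_mult using A W by (intro mult_mono) auto
    qed (use w in auto)
    also have "cmod (Complex 0 \<eta> - Complex (- w) \<eta>) = w" using w by (simp add: complex_diff cmod_def)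
    also have "exp (c - c * cosh \<eta>) * (2 * (k * cosh \<eta>)) ^ m * w = exp c * (2 * k) ^ m * w * (cosh \<eta> ^ m / exp (c * cosh \<eta>))"
      by (simp add: exp_diff power_mult_distrib)
    finally show ?thesis .
  qed
  then have ev: "\<forall>\<^sub>F \<eta> in at_top. cmod (Q (Complex 0 \<eta>) - Q (Complex (- w) \<eta>)) \<le> exp c * (2 * k) ^ m * w * (cosh \<eta> ^ m / exp (c * cosh \<eta>))"
    by (auto simp: eventually_at_top_linorder)
  have lim: "((\<lambda>x::real. x ^ m / exp (c * x)) \<longlongrightarrow> 0) at_top"
  proof -
    have "((\<lambda>x::real. (c * x) ^ m / exp (c * x)) \<longlongrightarrow> 0) at_top"
      by (rule filterlim_compose[OF tendsto_power_div_exp_0])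
        (intro filterlim_tendsto_pos_mult_at_top[OF tendsto_const c filterlim_ident])
    from tendsto_mult_right_zero[OF this, of "1 / c ^ m"] show ?thesis
      using c by (simp add: power_mult_distrib)
  qed
  have "((\<lambda>\<eta>. cosh \<eta> ^ m / exp (c * cosh \<eta>)) \<longlongrightarrow> 0) at_top"
    by (rule filterlim_compose[OF lim cosh_real_at_top])
  then have "((\<lambda>\<eta>. exp c * (2 * k) ^ m * w * (cosh \<eta> ^ m / exp (c * cosh \<eta>))) \<longlongrightarrow> 0) at_top"
    by (rule tendsto_mult_right_zero)
  then show ?thesis by (rule Lim_null_comparison[OF ev])
qed

lemma norm_conj_alternating: "cmod ((- 1) ^ i * cnj x) = cmod x"
  by (simp add: norm_mult norm_power)

text \<open>
  Here \<open>T\<close> is the integral over the whole original contour, written with primitives: upper tail, middle part, and the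
  reflected lower tail. It is decomposed into the ends \<open>s\<close> at infinity, the rays \<open>r\<close>, the mismatches \<open>E1\<close>, \<open>E2\<close>
  at the branch points, the connecting pieces \<open>X1\<close>, \<open>X2\<close> and the saddle segment \<open>S\<close>; all but the last are errors.
\<close>
lemma contour_estimate:
  "\<exists>C \<rho>0. 0 < \<rho>0 \<and> (\<forall>\<rho> \<theta> Y P Q T. \<rho>0 \<le> \<rho> \<longrightarrow> 0 < \<theta> \<longrightarrow> \<theta> \<le> pi / 2 \<longrightarrow> - R0 \<le> Y \<longrightarrow> Y \<le> 0 \<longrightarrow>
    (\<forall>z. \<bar>Im z\<bar> \<le> a \<longrightarrow> (P has_field_derivative inner \<rho> \<theta> Y z) (at z within {z. \<bar>Im z\<bar> \<le> a})) \<longrightarrow>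
    (\<forall>z\<in>U. (Q has_field_derivative outer \<rho> \<theta> Y z) (at z within U)) \<longrightarrow>
    ((\<lambda>\<eta>. (Q (Complex 0 \<eta>) - Q (Complex 0 a)) + (P (Complex 0 a) - P (Complex pi (- a)))
        - (- 1) ^ i * cnj (Q (Complex 0 \<eta>) - Q (Complex 0 a))) \<longlongrightarrow> T) at_top \<longrightarrow>
    cmod (T + (1 - \<i>) * (exp (\<i> * of_real \<rho>) * of_real (sqrt (pi / \<rho>)) * ampl Y (inner_root (of_real \<theta>)) (of_real \<theta>)))
      \<le> C * \<rho> powr (-3/2))"
proof -
  obtain Cs where Cs: "\<And>\<rho> \<theta> A. 1 \<le> \<rho> \<Longrightarrow> A holomorphic_on {z. \<bar>Im z\<bar> < 2 * w} \<Longrightarrow> (\<And>z. \<bar>Im z\<bar> < 2 * w \<Longrightarrow> cmod (A z) \<le> B) \<Longrightarrow>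
    cmod (integral {-w..w} (\<lambda>t. exp (\<i> * of_real \<rho> * cos (saddle_path t)) * A (of_real \<theta> - saddle_path t))
       - exp (\<i> * of_real \<rho>) * of_real (sqrt (pi / \<rho>)) * A (of_real \<theta>)) \<le> Cs * \<rho> powr (-3/2)"
    using saddle_contribution[of w B] w B_nonneg by fastforce
  obtain Cr \<rho>r where Cr: "\<And>\<rho> \<theta> Y Q \<eta>. \<rho>r \<le> \<rho> \<Longrightarrow> 0 \<le> \<theta> \<Longrightarrow> \<theta> \<le> pi / 2 \<Longrightarrow> Y \<le> 0 \<Longrightarrow> a < \<eta> \<Longrightarrow>
    (\<And>z. z \<in> U \<Longrightarrow> (Q has_field_derivative outer \<rho> \<theta> Y z) (at z within U)) \<Longrightarrow>
    cmod (Q (Complex (- w) \<eta>) - Q (Complex (- w) a)) \<le> Cr * \<rho> powr (-3/2)"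
    using ray_increment by blast
  have "0 < sin w * sinh w" using w pi_gt3 by (intro mult_pos_pos sin_gt_zero) auto
  from exp_decay_powr[OF this] obtain Ce where Ce: "0 \<le> Ce" "\<And>\<rho>. 1 \<le> \<rho> \<Longrightarrow> exp (- (sin w * sinh w * \<rho>)) \<le> Ce * \<rho> powr (-3/2)"
    by blast
  define Cb where "Cb = D * (1 + 2 / c2) / c2"
  \<comment> \<open>\<open>4 + a\<close> bounds the length of the two connecting pieces\<close>
  define Cx where "Cx = B * Ce * (4 + a)"
  show ?thesis
  proof (rule exI[of _ "2 * Cr + 2 * Cb + 2 * Cx + 2 * Cs"], rule exI[of _ "max 1 \<rho>r"], intro conjI allI impI)
    fix \<rho> \<theta> Y P Q T
    assume \<rho>: "max 1 \<rho>r \<le> \<rho>" and \<theta>: "0 < \<theta>" "\<theta> \<le> pi / 2" and Y: "- R0 \<le> Y" "Y \<le> 0"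
      and P: "\<forall>z. \<bar>Im z\<bar> \<le> a \<longrightarrow> (P has_field_derivative inner \<rho> \<theta> Y z) (at z within {z. \<bar>Im z\<bar> \<le> a})"
      and Q: "\<forall>z\<in>U. (Q has_field_derivative outer \<rho> \<theta> Y z) (at z within U)"
      and T: "((\<lambda>\<eta>. (Q (Complex 0 \<eta>) - Q (Complex 0 a)) + (P (Complex 0 a) - P (Complex pi (- a)))
        - (- 1) ^ i * cnj (Q (Complex 0 \<eta>) - Q (Complex 0 a))) \<longlongrightarrow> T) at_top"
    have \<rho>1: "1 \<le> \<rho>" "\<rho>r \<le> \<rho>" "0 < \<rho>" using \<rho> by auto
    have Y': "\<bar>Y\<bar> \<le> R0" using Y by auto
    let ?e = "\<rho> powr (-3/2)"
    let ?main = "(1 - \<i>) * (exp (\<i> * of_real \<rho>) * of_real (sqrt (pi / \<rho>)) * ampl Y (inner_root (of_real \<theta>)) (of_real \<theta>))"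
    have P': "\<And>z. \<bar>Im z\<bar> \<le> a \<Longrightarrow> (P has_field_derivative inner \<rho> \<theta> Y z) (at z within {z. \<bar>Im z\<bar> \<le> a})"
      and Q': "\<And>z. z \<in> U \<Longrightarrow> (Q has_field_derivative outer \<rho> \<theta> Y z) (at z within U)" using P Q by auto
    define b where "b = Q (Complex (- w) a) - Q (Complex 0 a)"
    define s where "s \<eta> = Q (Complex 0 \<eta>) - Q (Complex (- w) \<eta>)" for \<eta>
    define r where "r \<eta> = Q (Complex (- w) \<eta>) - Q (Complex (- w) a)" for \<eta>
    \<comment> \<open>the horizontal segment at each branch point, traversed with both roots\<close>
    define E1 where "E1 = (P (Complex (- w) a) - P (Complex 0 a)) - b"
    define E2 where "E2 = (P (Complex (pi - w) (- a)) - P (Complex pi (- a))) - (- 1) ^ i * cnj b"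
    define X1 where "X1 = P (Complex (- w) a) - P (Complex (\<theta> - w) w)"
    define X2 where "X2 = P (Complex (\<theta> + w) (- w)) - P (Complex (pi - w) (- a))"
    define S where "S = P (Complex (\<theta> - w) w) - P (Complex (\<theta> + w) (- w))"
    have E: "cmod E1 \<le> Cb * ?e" "cmod E2 \<le> Cb * ?e"
      unfolding E1_def E2_def b_def Cb_def
      by (rule branch_increment[OF P' Q' less_imp_le[OF \<theta>(1)] \<theta>(2) \<rho>1(3) Y']; assumption)+
    have len: "cmod (Complex (- w) a - Complex (\<theta> - w) w) \<le> 4 + a" "cmod (Complex (\<theta> + w) (- w) - Complex (pi - w) (- a)) \<le> 4 + a"
      using cmod_le[of "Complex (- w) a - Complex (\<theta> - w) w"] cmod_le[of "Complex (\<theta> + w) (- w) - Complex (pi - w) (- a)"]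
        \<theta> w pi_less_4 by auto
    have ex: "B * exp (- (sin w * sinh w * \<rho>)) * y \<le> Cx * ?e" if "0 \<le> y" "y \<le> 4 + a" for y
    proof -
      have "B * exp (- (sin w * sinh w * \<rho>)) * y \<le> B * (Ce * ?e) * (4 + a)"
        using Ce(2)[OF \<rho>1(1)] Ce(1) that B_nonneg by (intro mult_mono mult_left_mono) auto
      then show ?thesis by (simp add: Cx_def mult_ac)
    qed
    have X1: "cmod X1 \<le> Cx * ?e" unfolding X1_def
      by (rule order_trans[OF box_decay[OF P', of "\<theta> - pi + w" "\<theta> - w" w a] ex[OF norm_ge_zero len(1)]])
        (use \<rho>1 Y' w \<theta> in auto)
    have X2: "cmod X2 \<le> Cx * ?e" unfolding X2_def
      by (rule order_trans[OF box_decay[OF P', of "\<theta> + w" "\<theta> + pi - w" "- a" "- w"] ex[OF norm_ge_zero len(2)]])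
        (use \<rho>1 Y' w \<theta> in auto)
    have hol: "(\<lambda>z. ampl Y (inner_root z) z) holomorphic_on {z. \<bar>Im z\<bar> < 2 * w}"
      unfolding ampl_def using w
      by (intro holomorphic_intros holomorphic_on_subset[OF holomorphic_inner_root]) auto
    have bd: "cmod (ampl Y (inner_root z) z) \<le> B" if "\<bar>Im z\<bar> < 2 * w" for z
      using that w by (intro norm_ampl_strip norm_inner_root_le Y') auto
    have "S + ?main = - (1 - \<i>) * (integral {-w..w} (\<lambda>t. exp (\<i> * of_real \<rho> * cos (saddle_path t)) * ampl Y (inner_root (of_real \<theta> - saddle_path t)) (of_real \<theta> - saddle_path t))
      - exp (\<i> * of_real \<rho>) * of_real (sqrt (pi / \<rho>)) * ampl Y (inner_root (of_real \<theta>)) (of_real \<theta>))"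
    proof -
      have "S = - (1 - \<i>) * integral {-w..w} (\<lambda>t. exp (\<i> * of_real \<rho> * cos (saddle_path t)) * ampl Y (inner_root (of_real \<theta> - saddle_path t)) (of_real \<theta> - saddle_path t))"
        unfolding S_def by (rule saddle_increment, rule P')
      then show ?thesis by (simp add: algebra_simps)
    qed
    also have "cmod \<dots> \<le> 2 * (Cs * ?e)"
    proof -
      have "cmod (- (1 - \<i>)) \<le> 2" using cmod_le[of "- (1 - \<i>)"] by simp
      then show ?thesis unfolding norm_mult by (intro mult_mono Cs[OF \<rho>1(1) hol bd]) auto
    qed
    finally have S: "cmod (S + ?main) \<le> 2 * (Cs * ?e)" .
    have "((\<lambda>\<eta>. 2 * cmod (s \<eta>) + (2 * Cr + 2 * Cb + 2 * Cx + 2 * Cs) * ?e) \<longlongrightarrow> 2 * cmod 0 + (2 * Cr + 2 * Cb + 2 * Cx + 2 * Cs) * ?e) at_top"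
      unfolding s_def by (intro tendsto_intros arc_vanishes[OF \<rho>1(3) \<theta> Y(2) Q'])
    moreover have "((\<lambda>\<eta>. cmod (((Q (Complex 0 \<eta>) - Q (Complex 0 a)) + (P (Complex 0 a) - P (Complex pi (- a)))
        - (- 1) ^ i * cnj (Q (Complex 0 \<eta>) - Q (Complex 0 a))) + ?main)) \<longlongrightarrow> cmod (T + ?main)) at_top"
      by (intro tendsto_intros T)
    moreover have "\<forall>\<^sub>F \<eta> in at_top. cmod (((Q (Complex 0 \<eta>) - Q (Complex 0 a)) + (P (Complex 0 a) - P (Complex pi (- a)))
        - (- 1) ^ i * cnj (Q (Complex 0 \<eta>) - Q (Complex 0 a))) + ?main) \<le> 2 * cmod (s \<eta>) + (2 * Cr + 2 * Cb + 2 * Cx + 2 * Cs) * ?e"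
      using eventually_gt_at_top[of a]
    proof eventually_elim
      case (elim \<eta>)
      have r: "cmod (r \<eta>) \<le> Cr * ?e" unfolding r_def by (rule Cr[OF \<rho>1(2) _ \<theta>(2) Y(2) elim Q']) (use \<theta> in auto)
      have srb: "Q (Complex 0 \<eta>) - Q (Complex 0 a) = s \<eta> + r \<eta> + b" by (simp add: s_def r_def b_def)
      have "((Q (Complex 0 \<eta>) - Q (Complex 0 a)) + (P (Complex 0 a) - P (Complex pi (- a)))
        - (- 1) ^ i * cnj (Q (Complex 0 \<eta>) - Q (Complex 0 a))) + ?main
        = s \<eta> + r \<eta> + - ((- 1) ^ i * cnj (s \<eta>)) + - ((- 1) ^ i * cnj (r \<eta>)) + - E1 + E2 + X1 + X2 + (S + ?main)"
        unfolding srb E1_def E2_def X1_def X2_def S_def by (simp add: algebra_simps)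
      also have "cmod \<dots> \<le> cmod (s \<eta>) + Cr * ?e + cmod (s \<eta>) + Cr * ?e + Cb * ?e + Cb * ?e + Cx * ?e + Cx * ?e + 2 * (Cs * ?e)"
        by (intro norm_triangle_mono S X1 X2) (use r E norm_conj_alternating in auto)
      finally show ?case by (simp add: algebra_simps)
    qed
    ultimately have "cmod (T + ?main) \<le> 2 * cmod 0 + (2 * Cr + 2 * Cb + 2 * Cx + 2 * Cs) * ?e"
      by (intro tendsto_le[OF trivial_limit_at_top_linorder])
    then show "cmod (T + ?main) \<le> (2 * Cr + 2 * Cb + 2 * Cx + 2 * Cs) * ?e" by simp
  qed simp
qed

end

section \<open>The Fourier integrals\<close>

lemma has_bochner_integral_gamma:
  fixes p c :: real assumes p: "p > -1" and c: "c > 0"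
  shows "has_bochner_integral lborel (\<lambda>t. indicator {0..} t * (t powr p * exp (- c * t))) (Gamma (p + 1) / c powr (p + 1))"
proof -
  let ?f = "\<lambda>t. t powr p / exp t"
  have hi: "(?f has_integral Gamma (p + 1)) {0..}" using Gamma_integral_real[of "p + 1"] p by simp
  then have "has_bochner_integral lborel (\<lambda>x. indicator {0..} x * ?f x) (Gamma (p + 1))"
  proof -
    have "nn_integral lborel (\<lambda>x. ennreal (indicator {0..} x * ?f x)) = ennreal (Gamma (p + 1))"
      using nn_integral_has_integral_lebesgue[OF _ hi] by simp
    then show ?thesis
      using p by (intro has_bochner_integral_nn_integral) (auto intro!: Gamma_real_nonneg)
  qed
  then have "has_bochner_integral lborel (\<lambda>x. indicator {0..} (0 + c * x) * ?f (0 + c * x)) (Gamma (p + 1) /\<^sub>R \<bar>c\<bar>)"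
    using lborel_has_bochner_integral_real_affine_iff[of c "\<lambda>x. indicator {0..} x * ?f x" _ 0] c by simp
  from has_bochner_integral_mult_right[OF this, of "1 / c powr p"]
  have "has_bochner_integral lborel (\<lambda>x. 1 / c powr p * (indicator {0..} (0 + c * x) * ?f (0 + c * x))) (1 / c powr p * (Gamma (p + 1) /\<^sub>R \<bar>c\<bar>))" by simp
  moreover have "(\<lambda>x. 1 / c powr p * (indicator {0..} (0 + c * x) * ?f (0 + c * x))) = (\<lambda>t. indicator {0..} t * (t powr p * exp (- c * t)))"
    using c by (auto simp: fun_eq_iff indicator_def powr_mult exp_minus zero_le_mult_iff divide_inverse)
  moreover have "1 / c powr p * (Gamma (p + 1) /\<^sub>R \<bar>c\<bar>) = Gamma (p + 1) / c powr (p + 1)"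
    using c by (simp add: powr_add divide_inverse)
  ultimately show ?thesis by simp
qed

text \<open>
  Shifting the singularity changes the exponential by a bounded factor only.
\<close>
lemma integrable_exp_abs_over_sqrt:
  fixes c b :: real assumes c: "c > 0"
  shows "integrable lborel (\<lambda>u. exp (- c * \<bar>u\<bar>) / sqrt \<bar>u - b\<bar>)"
proof -
  have "has_bochner_integral lborel (\<lambda>t. indicator {0..} t *\<^sub>R (exp (- c * \<bar>t\<bar>) / sqrt \<bar>t\<bar>)) (Gamma (- 1 / 2 + 1) / c powr (- 1 / 2 + 1))"
  proof -
    have "(\<lambda>t. indicator {0..} t *\<^sub>R (exp (- c * \<bar>t\<bar>) / sqrt \<bar>t\<bar>)) = (\<lambda>t. indicator {0..} t * (t powr (- 1 / 2) * exp (- c * t)))"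
      by (auto simp: fun_eq_iff indicator_def powr_minus_divide powr_half_sqrt)
    then show ?thesis using has_bochner_integral_gamma[of "- 1 / 2" c] c by simp
  qed
  from has_bochner_integral_even_function[OF this] have "integrable lborel (\<lambda>t. exp (- c * \<bar>t\<bar>) / sqrt \<bar>t\<bar>)"
    by (auto intro: integrable.intros)
  then have "integrable lborel (\<lambda>u. exp (- c * \<bar>- b + 1 * u\<bar>) / sqrt \<bar>- b + 1 * u\<bar>)"
    by (rule lborel_integrable_real_affine) simp
  then have "integrable lborel (\<lambda>u. exp (- c * \<bar>u - b\<bar>) / sqrt \<bar>u - b\<bar>)" by simp
  then have "integrable lborel (\<lambda>u. exp (c * \<bar>b\<bar>) * (exp (- c * \<bar>u - b\<bar>) / sqrt \<bar>u - b\<bar>))"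
    by (rule integrable_mult_right)
  then show ?thesis
  proof (rule Bochner_Integration.integrable_bound)
    show "AE u in lborel. norm (exp (- c * \<bar>u\<bar>) / sqrt \<bar>u - b\<bar>) \<le> norm (exp (c * \<bar>b\<bar>) * (exp (- c * \<bar>u - b\<bar>) / sqrt \<bar>u - b\<bar>))"
    proof (rule AE_I2)
      fix u :: real
      have "c * \<bar>u - b\<bar> \<le> c * (\<bar>u\<bar> + \<bar>b\<bar>)" using c by (intro mult_left_mono) auto
      then have "exp (- c * \<bar>u\<bar>) \<le> exp (c * \<bar>b\<bar>) * exp (- c * \<bar>u - b\<bar>)"
        by (simp add: mult_exp_exp algebra_simps)
      then show "norm (exp (- c * \<bar>u\<bar>) / sqrt \<bar>u - b\<bar>) \<le> norm (exp (c * \<bar>b\<bar>) * (exp (- c * \<bar>u - b\<bar>) / sqrt \<bar>u - b\<bar>))"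
        by (simp add: abs_mult divide_right_mono)
    qed
  qed measurable
qed

lemma SS_measurable [measurable]: "a > 0 \<Longrightarrow> (\<lambda>\<xi>. SS (of_real \<xi>) a) \<in> borel_measurable borel"
  unfolding SS_of_real by measurable

lemma SS_real_bounds:
  assumes a: "0 < a"
  shows "cmod (SS (of_real \<xi>) a) \<le> \<bar>\<xi>\<bar> + a" "\<bar>\<xi>\<bar> - a \<le> Re (SS (of_real \<xi>) a)" "0 \<le> Re (SS (of_real \<xi>) a)"
    "cmod (SS (of_real \<xi>) a) = sqrt \<bar>\<xi> - a\<bar> * sqrt \<bar>\<xi> + a\<bar>"
proof -
  have f: "\<xi>\<^sup>2 - a\<^sup>2 = (\<xi> - a) * (\<xi> + a)" by (simp add: power2_eq_square algebra_simps)
  have "cmod (SS (of_real \<xi>) a) = sqrt \<bar>\<xi>\<^sup>2 - a\<^sup>2\<bar>"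
    using a abs_le_square_iff[of a \<xi>] by (auto simp: SS_of_real norm_mult abs_if)
  then show "cmod (SS (of_real \<xi>) a) = sqrt \<bar>\<xi> - a\<bar> * sqrt \<bar>\<xi> + a\<bar>"
    by (simp add: f abs_mult real_sqrt_mult)
  have "\<bar>\<xi>\<^sup>2 - a\<^sup>2\<bar> \<le> (\<bar>\<xi>\<bar> + a)\<^sup>2" using a by (simp add: power2_sum abs_le_iff)
  then have "sqrt \<bar>\<xi>\<^sup>2 - a\<^sup>2\<bar> \<le> \<bar>\<xi>\<bar> + a" using a by (intro real_le_lsqrt) auto
  then show "cmod (SS (of_real \<xi>) a) \<le> \<bar>\<xi>\<bar> + a" using \<open>cmod _ = sqrt \<bar>\<xi>\<^sup>2 - a\<^sup>2\<bar>\<close> by simp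
  show "\<bar>\<xi>\<bar> - a \<le> Re (SS (of_real \<xi>) a)"
  proof (cases "a \<le> \<bar>\<xi>\<bar>")
    case True
    have "(\<bar>\<xi>\<bar> - a)\<^sup>2 \<le> \<xi>\<^sup>2 - a\<^sup>2" using True a mult_left_mono[OF True, of a] by (simp add: power2_eq_square algebra_simps)
    then show ?thesis using True a by (simp add: SS_of_real real_le_rsqrt)
  qed (use a in \<open>auto simp: SS_of_real\<close>)
  show "0 \<le> Re (SS (of_real \<xi>) a)"
  proof (cases "a \<le> \<bar>\<xi>\<bar>")
    case True
    then have "a\<^sup>2 \<le> \<xi>\<^sup>2" using a abs_le_square_iff[of a \<xi>] by simp
    then show ?thesis using True a by (simp add: SS_of_real)
  qed (use a in \<open>auto simp: SS_of_real\<close>)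
qed

text \<open>
  The monomials \<open>\<xi>^i S^j T^l\<close> cover the reflected and the transmitted wave as well as their gradients. The exponents of
  \<open>T Y\<close> and \<open>- S X2\<close> both have non-positive real part for \<open>Y \<le> 0\<close> and \<open>X2 \<ge> 0\<close>.
\<close>
definition fourier_term :: "real \<Rightarrow> real \<Rightarrow> nat \<Rightarrow> nat \<Rightarrow> nat \<Rightarrow> real \<Rightarrow> real \<Rightarrow> real \<Rightarrow> real \<Rightarrow> complex" where
  "fourier_term k K i j l X1 X2 Y \<xi> =
     of_real \<xi> ^ i * SS (of_real \<xi>) k ^ j * SS (of_real \<xi>) K ^ l *
     exp (SS (of_real \<xi>) K * of_real Y - SS (of_real \<xi>) k * of_real X2 + \<i> * of_real (\<xi> * X1)) / SS (of_real \<xi>) k"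

lemma fourier_term_measurable [measurable]:
  assumes "0 < k" "0 < K" shows "fourier_term k K i j l X1 X2 Y \<in> borel_measurable borel"
  unfolding fourier_term_def[abs_def] using assms by measurable

text \<open>
  An integrable majorant with the singularities of \<open>1 / S\<close> at \<open>\<xi> = \<plusminus> k\<close>.
\<close>
definition weight :: "real \<Rightarrow> real \<Rightarrow> real \<Rightarrow> real" where
  "weight k c \<xi> = exp (- c * \<bar>\<xi>\<bar>) / sqrt \<bar>\<xi> - k\<bar> + exp (- c * \<bar>\<xi>\<bar>) / sqrt \<bar>\<xi> + k\<bar>"

lemma integrable_weight: "0 < c \<Longrightarrow> integrable lborel (weight k c)"
  unfolding weight_def[abs_def]
  using integrable_exp_abs_over_sqrt[of c k] integrable_exp_abs_over_sqrt[of c "- k"] by simp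

lemma inverse_SS_le:
  assumes k: "0 < k"
  shows "1 / cmod (SS (of_real \<xi>) k) \<le> (1 / sqrt k) * (1 / sqrt \<bar>\<xi> - k\<bar> + 1 / sqrt \<bar>\<xi> + k\<bar>)"
proof (cases "\<xi> = k \<or> \<xi> = - k")
  case True
  then show ?thesis using SS_real_bounds(4)[OF k, of \<xi>] k by auto
next
  case False
  then have p: "0 < \<bar>\<xi> - k\<bar>" "0 < \<bar>\<xi> + k\<bar>" by auto
  consider "k \<le> \<bar>\<xi> - k\<bar>" | "k \<le> \<bar>\<xi> + k\<bar>" using k by linarith
  then show ?thesis
  proof cases
    case 1
    then have "1 / sqrt \<bar>\<xi> - k\<bar> \<le> 1 / sqrt k" using k by (simp add: frac_le)
    then have "1 / sqrt \<bar>\<xi> - k\<bar> * (1 / sqrt \<bar>\<xi> + k\<bar>) \<le> 1 / sqrt k * (1 / sqrt \<bar>\<xi> + k\<bar>)" by (intro mult_right_mono) auto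
    also have "\<dots> \<le> (1 / sqrt k) * (1 / sqrt \<bar>\<xi> - k\<bar> + 1 / sqrt \<bar>\<xi> + k\<bar>)" using k by (intro mult_left_mono) auto
    finally show ?thesis using SS_real_bounds(4)[OF k, of \<xi>] by simp
  next
    case 2
    then have "1 / sqrt \<bar>\<xi> + k\<bar> \<le> 1 / sqrt k" using k by (simp add: frac_le)
    then have "1 / sqrt \<bar>\<xi> + k\<bar> * (1 / sqrt \<bar>\<xi> - k\<bar>) \<le> 1 / sqrt k * (1 / sqrt \<bar>\<xi> - k\<bar>)" by (intro mult_right_mono) auto
    also have "\<dots> \<le> (1 / sqrt k) * (1 / sqrt \<bar>\<xi> - k\<bar> + 1 / sqrt \<bar>\<xi> + k\<bar>)" using k by (intro mult_left_mono) auto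
    finally show ?thesis using SS_real_bounds(4)[OF k, of \<xi>] by (simp add: mult.commute)
  qed
qed

lemma power_le_fact_exp:
  fixes y :: real assumes "0 \<le> y" shows "y ^ n \<le> fact n * exp y"
proof -
  have "(\<Sum>m\<in>{n}. y ^ m /\<^sub>R fact m) \<le> (\<Sum>m. y ^ m /\<^sub>R fact m)"
    using assms by (intro sum_le_suminf summable_exp_generic) auto
  then show ?thesis by (simp add: exp_def field_simps)
qed

lemma power_exp_bound:
  fixes b c :: real assumes c: "0 < c" and b: "0 \<le> b"
  shows "\<exists>C\<ge>0. \<forall>x\<ge>0. (x + b) ^ n * exp (- c * x) \<le> C"
proof (intro exI[of _ "fact n * exp (c * b) / c ^ n"] conjI allI impI)
  fix x :: real assume x: "0 \<le> x"
  have "(c * (x + b)) ^ n \<le> fact n * exp (c * (x + b))" using x b c by (intro power_le_fact_exp) simp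
  then have "(x + b) ^ n \<le> fact n * exp (c * b) / c ^ n * exp (c * x)"
  proof -
    have "c ^ n * (x + b) ^ n \<le> fact n * (exp (c * x) * exp (c * b))"
    proof -
      have "exp (c * (x + b)) = exp (c * x) * exp (c * b)" by (simp add: distrib_left exp_add)
      then show ?thesis using \<open>(c * (x + b)) ^ n \<le> _\<close> by (simp only: power_mult_distrib)
    qed
    then have "(x + b) ^ n \<le> fact n * (exp (c * x) * exp (c * b)) / c ^ n"
      using c by (simp add: pos_le_divide_eq mult.commute)
    then show ?thesis by (simp add: mult_ac)
  qed
  from mult_right_mono[OF this, of "exp (- c * x)"]
  show "(x + b) ^ n * exp (- c * x) \<le> fact n * exp (c * b) / c ^ n"
    by (simp add: mult.assoc mult_exp_exp)
qed (use c in auto)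

text \<open>
  Half of the decay \<open>exp (- X2 \<bar>\<xi>\<bar>)\<close> is spent on the polynomial factors.
\<close>
lemma fourier_term_bound:
  assumes k: "0 < k" "k < K" and X2: "0 < X2"
  shows "\<exists>C\<ge>0. \<forall>X1 Y \<xi>. Y \<le> 0 \<longrightarrow> cmod (fourier_term k K i j l X1 X2 Y \<xi>) \<le> C * weight k (X2 / 2) \<xi>"
proof -
  obtain C where C: "0 \<le> C" "\<And>x. 0 \<le> x \<Longrightarrow> (x + K) ^ (i + j + l) * exp (- (X2 / 2) * x) \<le> C"
    using power_exp_bound[of "X2 / 2" K "i + j + l"] X2 k by auto
  show ?thesis
  proof (rule exI[of _ "C * exp (k * X2) / sqrt k"], intro conjI allI impI)
    show "0 \<le> C * exp (k * X2) / sqrt k" using C(1) k by simp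
    fix X1 Y \<xi> :: real assume Y: "Y \<le> 0"
    let ?s = "SS (of_real \<xi>) k" let ?t = "SS (of_real \<xi>) K" let ?x = "\<bar>\<xi>\<bar>"
    have K: "0 < K" using k by simp
    have m: "cmod (of_real \<xi> ^ i * ?s ^ j * ?t ^ l) \<le> (?x + K) ^ (i + j + l)"
    proof -
      have "cmod ?s \<le> ?x + K" "cmod ?t \<le> ?x + K" using SS_real_bounds(1)[OF k(1), of \<xi>] SS_real_bounds(1)[OF K, of \<xi>] k by auto
      then have "?x ^ i * cmod ?s ^ j * cmod ?t ^ l \<le> (?x + K) ^ i * (?x + K) ^ j * (?x + K) ^ l"
        using K by (intro mult_mono power_mono) auto
      then show ?thesis by (simp add: norm_mult norm_power power_add)
    qed
    have "Re ?t * Y \<le> 0" using SS_real_bounds(3)[OF K, of \<xi>] Y by (simp add: mult_nonneg_nonpos)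
    moreover have "(?x - k) * X2 \<le> Re ?s * X2" using SS_real_bounds(2)[OF k(1), of \<xi>] X2 by simp
    ultimately have "cmod (exp (?t * of_real Y - ?s * of_real X2 + \<i> * of_real (\<xi> * X1))) \<le> exp (k * X2 - X2 * ?x)"
      by (simp add: algebra_simps)
    moreover have "exp (k * X2 - X2 * ?x) = exp (k * X2) * (exp (- (X2 / 2) * ?x) * exp (- (X2 / 2) * ?x))"
      by (simp add: mult_exp_exp)
    ultimately have e: "cmod (exp (?t * of_real Y - ?s * of_real X2 + \<i> * of_real (\<xi> * X1))) \<le> exp (k * X2) * (exp (- (X2 / 2) * ?x) * exp (- (X2 / 2) * ?x))"
      by (simp only:)
    have "cmod (fourier_term k K i j l X1 X2 Y \<xi>) = cmod (of_real \<xi> ^ i * ?s ^ j * ?t ^ l) * cmod (exp (?t * of_real Y - ?s * of_real X2 + \<i> * of_real (\<xi> * X1))) * (1 / cmod ?s)"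
      by (simp add: fourier_term_def norm_mult norm_divide)
    also have "\<dots> \<le> (?x + K) ^ (i + j + l) * (exp (k * X2) * (exp (- (X2 / 2) * ?x) * exp (- (X2 / 2) * ?x))) * ((1 / sqrt k) * (1 / sqrt \<bar>\<xi> - k\<bar> + 1 / sqrt \<bar>\<xi> + k\<bar>))"
      using K by (intro mult_mono m e inverse_SS_le k mult_nonneg_nonneg) auto
    also have "\<dots> = ((?x + K) ^ (i + j + l) * exp (- (X2 / 2) * ?x)) * (exp (k * X2) / sqrt k * weight k (X2 / 2) \<xi>)"
      by (simp add: weight_def field_simps)
    also have "\<dots> \<le> C * (exp (k * X2) / sqrt k * weight k (X2 / 2) \<xi>)"
      using C(2)[of ?x] k by (intro mult_right_mono) (auto simp: weight_def)
    finally show "cmod (fourier_term k K i j l X1 X2 Y \<xi>) \<le> C * exp (k * X2) / sqrt k * weight k (X2 / 2) \<xi>" by simp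
  qed
qed

lemma integrable_fourier_term:
  assumes k: "0 < k" "k < K" and X2: "0 < X2" and Y: "Y \<le> 0"
  shows "integrable lborel (fourier_term k K i j l X1 X2 Y)"
proof -
  obtain C where C: "0 \<le> C" "\<And>X1 Y \<xi>. Y \<le> 0 \<Longrightarrow> cmod (fourier_term k K i j l X1 X2 Y \<xi>) \<le> C * weight k (X2 / 2) \<xi>"
    using fourier_term_bound[OF assms(1-3)] by blast
  have "integrable lborel (\<lambda>\<xi>. C * weight k (X2 / 2) \<xi>)" using integrable_weight[of "X2 / 2" k] X2 by simp
  then show ?thesis
    by (rule Bochner_Integration.integrable_bound)
      (use C(2)[OF Y] k in \<open>auto intro!: AE_I2 order_trans[OF C(2)[OF Y]]\<close>)
qed

definition fourier :: "real \<Rightarrow> real \<Rightarrow> nat \<Rightarrow> nat \<Rightarrow> nat \<Rightarrow> real \<Rightarrow> real \<Rightarrow> real \<Rightarrow> complex" where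
  "fourier k K i j l X1 X2 Y = (LBINT \<xi>. fourier_term k K i j l X1 X2 Y \<xi>)"

lemma tendsto_integral_symmetric_interval:
  fixes f :: "real \<Rightarrow> complex"
  assumes f: "integrable lborel f"
  shows "((\<lambda>N. integral {-N..N} f) \<longlongrightarrow> integral\<^sup>L lborel f) at_top"
proof -
  have [measurable]: "f \<in> borel_measurable lborel" using f by auto
  have "((\<lambda>N. integral\<^sup>L lborel (\<lambda>x. indicator {-N..N} x *\<^sub>R f x)) \<longlongrightarrow> integral\<^sup>L lborel f) at_top"
  proof (rule integral_dominated_convergence_at_top[where w = "\<lambda>x. norm (f x)"])
    show "AE x in lborel. ((\<lambda>N. indicator {-N..N} x *\<^sub>R f x) \<longlongrightarrow> f x) at_top"
    proof (rule AE_I2, rule tendsto_eventually)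
      fix x :: real
      show "\<forall>\<^sub>F N in at_top. indicator {-N..N} x *\<^sub>R f x = f x"
        using eventually_ge_at_top[of "\<bar>x\<bar>"] by eventually_elim (auto simp: indicator_def abs_le_iff)
    qed
    show "\<forall>\<^sub>F N in at_top. AE x in lborel. norm (indicator {-N..N} x *\<^sub>R f x) \<le> norm (f x)"
      by (intro always_eventually allI AE_I2) (auto simp: indicator_def)
  qed (use f in auto)
  moreover have "integral\<^sup>L lborel (\<lambda>x. indicator {-N..N} x *\<^sub>R f x) = integral {-N..N} f" for N
  proof -
    have "set_integrable lborel {-N..N} f" unfolding set_integrable_def
      by (rule integrable_mult_indicator[OF _ f]) simp
    from set_borel_integral_eq_integral(2)[OF this] show ?thesis by (simp add: set_lebesgue_integral_def)
  qed
  ultimately show ?thesis by simp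
qed

section \<open>The Fourier integrals as contour integrals in the angle\<close>

text \<open>
  Integration by substitution along a path \<open>\<tau>\<close> with \<open>\<tau>' = \<i> / s\<close>. Only continuity is required at the end points, where
  the derivative of the path is singular; this is the situation at \<open>\<xi> = \<plusminus> k\<close>.
\<close>
lemma path_primitive_integral:
  fixes \<tau> s h :: "real \<Rightarrow> complex"
  assumes le: "\<alpha> \<le> \<beta>" and c\<tau>: "continuous_on {\<alpha>..\<beta>} \<tau>" and sub: "\<tau> ` {\<alpha>..\<beta>} \<subseteq> S"
    and F: "\<And>z. z \<in> S \<Longrightarrow> (F has_field_derivative f z) (at z within S)"
    and d\<tau>: "\<And>\<xi>. \<alpha> < \<xi> \<Longrightarrow> \<xi> < \<beta> \<Longrightarrow> (\<tau> has_vector_derivative (\<i> / s \<xi>)) (at \<xi>)"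
    and h: "\<And>\<xi>. \<alpha> < \<xi> \<Longrightarrow> \<xi> < \<beta> \<Longrightarrow> h \<xi> = f (\<tau> \<xi>) / s \<xi>"
  shows "(h has_integral - \<i> * (F (\<tau> \<beta>) - F (\<tau> \<alpha>))) {\<alpha>..\<beta>}"
proof -
  have cF: "continuous_on S F"
    using F by (auto simp: continuous_on_eq_continuous_within intro: DERIV_continuous)
  have "(h has_integral - \<i> * F (\<tau> \<beta>) - (- \<i> * F (\<tau> \<alpha>))) {\<alpha>..\<beta>}"
  proof (rule fundamental_theorem_of_calculus_interior[OF le])
    show "continuous_on {\<alpha>..\<beta>} (\<lambda>\<xi>. - \<i> * F (\<tau> \<xi>))"
      by (intro continuous_intros continuous_on_compose2[OF cF c\<tau>] sub)
    fix \<xi> assume \<xi>: "\<xi> \<in> {\<alpha><..<\<beta>}"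
    then have "(\<tau> has_vector_derivative (\<i> / s \<xi>)) (at \<xi> within {\<alpha>..\<beta>})"
      using d\<tau>[of \<xi>] by (auto intro: has_vector_derivative_at_within)
    moreover have "(F has_field_derivative f (\<tau> \<xi>)) (at (\<tau> \<xi>) within \<tau> ` {\<alpha>..\<beta>})"
      using F[of "\<tau> \<xi>"] sub \<xi> by (intro has_field_derivative_subset[OF F sub]) auto
    ultimately have "((F \<circ> \<tau>) has_vector_derivative \<i> / s \<xi> * f (\<tau> \<xi>)) (at \<xi> within {\<alpha>..\<beta>})"
      by (rule field_vector_diff_chain_within)
    then have "((F \<circ> \<tau>) has_vector_derivative \<i> / s \<xi> * f (\<tau> \<xi>)) (at \<xi>)"
      using \<xi> by (simp add: at_within_Icc_at)
    from has_vector_derivative_mult_right[OF this, of "- \<i>"]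
    show "((\<lambda>\<xi>. - \<i> * F (\<tau> \<xi>)) has_vector_derivative h \<xi>) (at \<xi>)"
      using h[of \<xi>] \<xi> by (simp add: o_def)
  qed
  then show ?thesis by (simp add: algebra_simps)
qed

context layers begin

text \<open>
  The addition theorem \<open>cos (z - \<theta>) = cos z cos \<theta> + sin z sin \<theta>\<close> merges the two exponents into one cosine.
\<close>
lemma wave_eq:
  "wave (k * r) \<theta> z = exp (\<i> * (of_real k * cos z) * of_real (r * cos \<theta>) - (- \<i> * of_real k * sin z) * of_real (r * sin \<theta>))"
  by (simp add: wave_def cos_diff cos_of_real sin_of_real algebra_simps)

lemma term_eq:
  assumes c: "of_real k * cos z = of_real \<xi>" and s: "- \<i> * of_real k * sin z = SS (of_real \<xi>) k" and t: "t = SS (of_real \<xi>) K"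
  shows "fourier_term k K i j l (r * cos \<theta>) (r * sin \<theta>) Y \<xi> = (wave (k * r) \<theta> z * ampl Y t z) / SS (of_real \<xi>) k"
  unfolding wave_eq ampl_def c s t fourier_term_def
  by (simp add: exp_add exp_diff mult_ac)

lemma SS_above: "\<xi> \<ge> b \<Longrightarrow> b > 0 \<Longrightarrow> SS (of_real \<xi>) b = of_real (sqrt (\<xi>\<^sup>2 - b\<^sup>2))"
  by (simp add: SS_of_real)
lemma SS_between: "\<bar>\<xi>\<bar> < b \<Longrightarrow> SS (of_real \<xi>) b = - \<i> * of_real (sqrt (b\<^sup>2 - \<xi>\<^sup>2))"
  by (simp add: SS_of_real)

lemma SS_uminus: "b > 0 \<Longrightarrow> SS (of_real (- \<xi>)) b = SS (of_real \<xi>) b"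
  using SS_of_real[of b "- \<xi>"] SS_of_real[of b \<xi>] by simp

lemma inner_root_real:
  assumes "of_real k * cos z = (of_real \<xi> :: complex)" "\<bar>\<xi>\<bar> \<le> K"
  shows "inner_root z = SS (of_real \<xi>) K"
proof -
  have e: "(of_real K)\<^sup>2 - (of_real \<xi>)\<^sup>2 = (of_real (K\<^sup>2 - \<xi>\<^sup>2) :: complex)" by simp
  have "0 \<le> K\<^sup>2 - \<xi>\<^sup>2" using assms(2) K abs_le_square_iff[of \<xi> K] by simp
  then have "csqrt (of_real (K\<^sup>2 - \<xi>\<^sup>2)) = of_real (sqrt (K\<^sup>2 - \<xi>\<^sup>2))" by simp
  then have "inner_root z = - \<i> * of_real (sqrt (K\<^sup>2 - \<xi>\<^sup>2))"
    unfolding inner_root_def assms(1) e by simp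
  moreover have "SS (of_real \<xi>) K = - \<i> * of_real (sqrt (K\<^sup>2 - \<xi>\<^sup>2))"
    using K assms(2) by (cases "\<bar>\<xi>\<bar> = K") (auto simp: SS_of_real abs_if split: if_splits)
  ultimately show ?thesis by simp
qed

lemma outer_root_real:
  assumes "of_real k * cos z = (of_real \<xi> :: complex)" "K \<le> \<bar>\<xi>\<bar>"
  shows "outer_root z = SS (of_real \<xi>) K"
proof -
  have e: "(of_real \<xi>)\<^sup>2 - (of_real K)\<^sup>2 = (of_real (\<xi>\<^sup>2 - K\<^sup>2) :: complex)" by simp
  have "0 \<le> \<xi>\<^sup>2 - K\<^sup>2" using assms(2) K abs_le_square_iff[of K \<xi>] by simp
  then have "csqrt (of_real (\<xi>\<^sup>2 - K\<^sup>2)) = of_real (sqrt (\<xi>\<^sup>2 - K\<^sup>2))" by simp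
  then show ?thesis using K assms(2) unfolding outer_root_def assms(1) e by (simp add: SS_of_real)
qed

text \<open>
  The inverse of \<open>\<xi> = k cos z\<close> on the real line is described by three paths: \<open>\<tau>p\<close> for \<open>\<xi> \<ge> k\<close> runs up the imaginary
  axis, \<open>\<tau>0\<close> for \<open>\<bar>\<xi>\<bar> \<le> k\<close> along the real segment from \<open>\<pi>\<close> to \<open>0\<close>, and \<open>\<tau>m\<close> for \<open>\<xi> \<le> - k\<close> below the point \<open>\<pi>\<close>.
  On each of them \<open>- \<i> k sin z\<close> is the required branch \<open>SS \<xi> k\<close>.
\<close>
definition \<tau>p where "\<tau>p \<xi> = Complex 0 (arcosh (\<xi> / k))"

lemma \<tau>p:
  assumes \<xi>: "k \<le> \<xi>"
  shows "of_real k * cos (\<tau>p \<xi>) = of_real \<xi>" "- \<i> * of_real k * sin (\<tau>p \<xi>) = SS (of_real \<xi>) k" "0 \<le> Im (\<tau>p \<xi>)"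
    "\<xi> \<le> K \<Longrightarrow> Im (\<tau>p \<xi>) \<le> a" "K \<le> \<xi> \<Longrightarrow> a \<le> Im (\<tau>p \<xi>)"
proof -
  let ?\<eta> = "arcosh (\<xi> / k)"
  have x: "1 \<le> \<xi> / k" using \<xi> k by simp
  have e: "\<tau>p \<xi> = \<i> * of_real ?\<eta>" by (simp add: \<tau>p_def Complex_eq)
  have c: "cos (\<tau>p \<xi>) = of_real (cosh ?\<eta>)" "sin (\<tau>p \<xi>) = \<i> * of_real (sinh ?\<eta>)"
    unfolding e by (simp_all add: complex_eq_iff Re_cos Im_cos Re_sin Im_sin cosh_field_def sinh_field_def)
  show "of_real k * cos (\<tau>p \<xi>) = of_real \<xi>" unfolding c using x k by (simp add: cosh_arcosh_real)
  have "sinh ?\<eta> = sqrt ((\<xi> / k)\<^sup>2 - 1)" using x by (simp add: sinh_arcosh_real)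
  also have "\<dots> = sqrt (\<xi>\<^sup>2 - k\<^sup>2) / k"
  proof -
    have "(\<xi> / k)\<^sup>2 - 1 = (\<xi>\<^sup>2 - k\<^sup>2) / k\<^sup>2" using k by (simp add: power_divide diff_divide_distrib)
    then show ?thesis using k by (simp add: real_sqrt_divide)
  qed
  finally show "- \<i> * of_real k * sin (\<tau>p \<xi>) = SS (of_real \<xi>) k"
    unfolding c using k \<xi> by (simp add: SS_above)
  show "0 \<le> Im (\<tau>p \<xi>)" using x by (simp add: \<tau>p_def arcosh_nonneg_real)
  show "\<xi> \<le> K \<Longrightarrow> Im (\<tau>p \<xi>) \<le> a" "K \<le> \<xi> \<Longrightarrow> a \<le> Im (\<tau>p \<xi>)"
  proof -
    have *: "Im (\<tau>p \<xi>) \<le> a \<longleftrightarrow> \<xi> \<le> K" "a \<le> Im (\<tau>p \<xi>) \<longleftrightarrow> K \<le> \<xi>"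
    proof -
      have ch: "cosh a = K / k" using cosh_a k by (simp add: field_simps)
      have n: "0 \<le> arcosh (\<xi> / k)" using x by simp
      show "Im (\<tau>p \<xi>) \<le> a \<longleftrightarrow> \<xi> \<le> K" "a \<le> Im (\<tau>p \<xi>) \<longleftrightarrow> K \<le> \<xi>"
        using cosh_real_nonneg_le_iff[OF n less_imp_le[OF a_pos]] cosh_real_nonneg_le_iff[OF less_imp_le[OF a_pos] n] x k
        unfolding ch by (simp_all add: \<tau>p_def cosh_arcosh_real divide_le_cancel)
    qed
    show "\<xi> \<le> K \<Longrightarrow> Im (\<tau>p \<xi>) \<le> a" "K \<le> \<xi> \<Longrightarrow> a \<le> Im (\<tau>p \<xi>)" using * by auto
  qed
qed

lemma sqrt_over_k: "sqrt ((\<xi> / k)\<^sup>2 - 1) = sqrt (\<xi>\<^sup>2 - k\<^sup>2) / k" "sqrt (1 - (\<xi> / k)\<^sup>2) = sqrt (k\<^sup>2 - \<xi>\<^sup>2) / k"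
proof -
  have "(\<xi> / k)\<^sup>2 - 1 = (\<xi>\<^sup>2 - k\<^sup>2) / k\<^sup>2" "1 - (\<xi> / k)\<^sup>2 = (k\<^sup>2 - \<xi>\<^sup>2) / k\<^sup>2"
    using k by (simp_all add: power_divide diff_divide_distrib)
  then show "sqrt ((\<xi> / k)\<^sup>2 - 1) = sqrt (\<xi>\<^sup>2 - k\<^sup>2) / k" "sqrt (1 - (\<xi> / k)\<^sup>2) = sqrt (k\<^sup>2 - \<xi>\<^sup>2) / k"
    using k by (simp_all add: real_sqrt_divide)
qed

lemma \<tau>p_deriv:
  assumes "k < \<xi>" shows "(\<tau>p has_vector_derivative (\<i> / SS (of_real \<xi>) k)) (at \<xi>)"
proof -
  have x: "1 < \<xi> / k" using assms k by simp
  have "((\<lambda>\<xi>. arcosh (\<xi> / k)) has_real_derivative (1 / sqrt ((\<xi> / k)\<^sup>2 - 1)) * (1 / k)) (at \<xi>)"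
    by (rule DERIV_chain2[where f = arcosh and g = "\<lambda>\<xi>. \<xi> / k", OF arcosh_real_has_field_derivative[OF x]]) (use k in \<open>auto intro!: derivative_eq_intros\<close>)
  also have "(1 / sqrt ((\<xi> / k)\<^sup>2 - 1)) * (1 / k) = 1 / sqrt (\<xi>\<^sup>2 - k\<^sup>2)"
    unfolding sqrt_over_k using k by simp
  finally have "((\<lambda>\<xi>. arcosh (\<xi> / k)) has_real_derivative (1 / sqrt (\<xi>\<^sup>2 - k\<^sup>2))) (at \<xi>)" .
  from has_vector_derivative_mult_right[OF has_vector_derivative_of_real[OF this], of "\<i> :: complex"]
  show ?thesis unfolding \<tau>p_def[abs_def] Complex_eq using assms k by (simp add: SS_above)
qed

lemma \<tau>p_cont: "continuous_on {k..} \<tau>p"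
  unfolding \<tau>p_def[abs_def] Complex_eq using k by (intro continuous_intros continuous_on_arcosh') auto

lemma \<tau>p_values: "\<tau>p k = 0" "\<tau>p K = Complex 0 a" "0 \<le> \<eta> \<Longrightarrow> \<tau>p (k * cosh \<eta>) = Complex 0 \<eta>"
  using k by (simp_all add: \<tau>p_def a_def arcosh_cosh_real complex_eq_iff)

definition \<tau>m where "\<tau>m \<xi> = of_real pi - \<tau>p (- \<xi>)"

lemma \<tau>m:
  assumes \<xi>: "\<xi> \<le> - k"
  shows "of_real k * cos (\<tau>m \<xi>) = of_real \<xi>" "- \<i> * of_real k * sin (\<tau>m \<xi>) = SS (of_real \<xi>) k" "Im (\<tau>m \<xi>) \<le> 0"
    "- K \<le> \<xi> \<Longrightarrow> - a \<le> Im (\<tau>m \<xi>)"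
proof -
  have c: "cos (\<tau>m \<xi>) = - cos (\<tau>p (- \<xi>))" "sin (\<tau>m \<xi>) = sin (\<tau>p (- \<xi>))"
    by (simp_all add: \<tau>m_def cos_diff sin_diff cos_of_real sin_of_real)
  have "k \<le> - \<xi>" using \<xi> by simp
  note p = \<tau>p[OF this]
  show "of_real k * cos (\<tau>m \<xi>) = of_real \<xi>" using p(1) by (simp add: c)
  show "- \<i> * of_real k * sin (\<tau>m \<xi>) = SS (of_real \<xi>) k" using p(2) SS_uminus[OF k, of \<xi>] unfolding c by simp
  show "Im (\<tau>m \<xi>) \<le> 0" "- K \<le> \<xi> \<Longrightarrow> - a \<le> Im (\<tau>m \<xi>)" using p(3,4) by (auto simp: \<tau>m_def)
qed

lemma \<tau>m_deriv:
  assumes "\<xi> < - k" shows "(\<tau>m has_vector_derivative (\<i> / SS (of_real \<xi>) k)) (at \<xi>)"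
proof -
  have "(\<tau>p has_vector_derivative (\<i> / SS (of_real (- \<xi>)) k)) (at (- \<xi>))" using assms by (intro \<tau>p_deriv) simp
  moreover have "(uminus has_vector_derivative (- 1)) (at \<xi>)" by (auto intro!: derivative_eq_intros)
  ultimately have "((\<tau>p \<circ> uminus) has_vector_derivative (- 1) *\<^sub>R (\<i> / SS (of_real (- \<xi>)) k)) (at \<xi>)"
    by (intro vector_diff_chain_at) auto
  from has_vector_derivative_diff[OF has_vector_derivative_const this, of "of_real pi"]
  show ?thesis using SS_uminus[OF k, of \<xi>] unfolding \<tau>m_def[abs_def] by (simp add: o_def)
qed

lemma \<tau>m_cont: "continuous_on {..-k} \<tau>m"
  unfolding \<tau>m_def[abs_def] by (intro continuous_intros continuous_on_compose2[OF \<tau>p_cont]) auto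

lemma \<tau>m_values: "\<tau>m (- k) = of_real pi" "\<tau>m (- K) = Complex pi (- a)"
  using \<tau>p_values by (simp_all add: \<tau>m_def complex_eq_iff)

definition \<tau>0 where "\<tau>0 \<xi> = complex_of_real (arccos (\<xi> / k))"

lemma \<tau>0:
  assumes \<xi>: "\<bar>\<xi>\<bar> < k"
  shows "of_real k * cos (\<tau>0 \<xi>) = of_real \<xi>" "- \<i> * of_real k * sin (\<tau>0 \<xi>) = SS (of_real \<xi>) k"
    "(\<tau>0 has_vector_derivative (\<i> / SS (of_real \<xi>) k)) (at \<xi>)"
proof -
  have x: "- 1 < \<xi> / k" "\<xi> / k < 1" using \<xi> k by (auto simp: field_simps abs_less_iff)
  show "of_real k * cos (\<tau>0 \<xi>) = of_real \<xi>" using x k by (simp add: \<tau>0_def cos_of_real)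
  have "sin (arccos (\<xi> / k)) = sqrt (k\<^sup>2 - \<xi>\<^sup>2) / k" using x by (simp add: sin_arccos sqrt_over_k)
  then show "- \<i> * of_real k * sin (\<tau>0 \<xi>) = SS (of_real \<xi>) k"
    using k \<xi> by (simp add: \<tau>0_def sin_of_real SS_between)
  have "((\<lambda>\<xi>. arccos (\<xi> / k)) has_real_derivative inverse (- sqrt (1 - (\<xi> / k)\<^sup>2)) * (1 / k)) (at \<xi>)"
    using x k by (auto intro!: derivative_eq_intros)
  also have "inverse (- sqrt (1 - (\<xi> / k)\<^sup>2)) * (1 / k) = - (1 / sqrt (k\<^sup>2 - \<xi>\<^sup>2))"
    unfolding sqrt_over_k using k by (simp add: divide_inverse)
  finally have "((\<lambda>\<xi>. arccos (\<xi> / k)) has_real_derivative - (1 / sqrt (k\<^sup>2 - \<xi>\<^sup>2))) (at \<xi>)" .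
  from has_vector_derivative_of_real[OF this, where ?'a = complex]
  show "(\<tau>0 has_vector_derivative (\<i> / SS (of_real \<xi>) k)) (at \<xi>)"
    unfolding \<tau>0_def[abs_def] using k \<xi> by (simp add: SS_between)
qed

lemma \<tau>0_cont: "continuous_on {-k..k} \<tau>0"
  unfolding \<tau>0_def[abs_def] using k by (intro continuous_intros) (auto simp: field_simps)

lemma \<tau>0_values: "\<tau>0 k = 0" "\<tau>0 (- k) = of_real pi" using k by (simp_all add: \<tau>0_def)

text \<open>
  Both vertical wave numbers are real beyond the branch points, so the negative tail is a conjugate of the positive
  one.
\<close>
lemma fourier_term_reflect:
  assumes "K \<le> \<xi>"
  shows "fourier_term k K i j l X1 X2 Y (- \<xi>) = (- 1) ^ i * cnj (fourier_term k K i j l X1 X2 Y \<xi>)"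
proof -
  have "k \<le> \<xi>" using assms kK by simp
  then have "cnj (SS (of_real \<xi>) k) = SS (of_real \<xi>) k" "cnj (SS (of_real \<xi>) K) = SS (of_real \<xi>) K"
    using assms k K by (simp_all add: SS_above)
  then show ?thesis
    unfolding fourier_term_def SS_uminus[OF k] SS_uminus[OF K]
    by (simp add: exp_cnj power_minus[of "of_real \<xi>"])
qed

text \<open>
  The interval \<open>[-k cosh \<eta>, k cosh \<eta>]\<close> is cut at \<open>\<plusminus> k\<close> and \<open>\<plusminus> K\<close>. The three middle pieces telescope in the primitive \<open>P\<close>
  of the inner integrand, the positive tail uses \<open>Q\<close>, and the negative tail is obtained by conjugation.
\<close>
lemma fourier_as_contour:
  assumes r: "0 < r" and \<theta>: "0 < \<theta>" "\<theta> < pi" and Y: "Y \<le> 0"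
    and P: "\<And>z. \<bar>Im z\<bar> \<le> a \<Longrightarrow> (P has_field_derivative inner (k * r) \<theta> Y z) (at z within {z. \<bar>Im z\<bar> \<le> a})"
    and Q: "\<And>z. z \<in> U \<Longrightarrow> (Q has_field_derivative outer (k * r) \<theta> Y z) (at z within U)"
  shows "((\<lambda>\<eta>. (Q (Complex 0 \<eta>) - Q (Complex 0 a)) + (P (Complex 0 a) - P (Complex pi (- a)))
        - (- 1) ^ i * cnj (Q (Complex 0 \<eta>) - Q (Complex 0 a))) \<longlongrightarrow> \<i> * fourier k K i j l (r * cos \<theta>) (r * sin \<theta>) Y) at_top"
proof -
  let ?h = "fourier_term k K i j l (r * cos \<theta>) (r * sin \<theta>) Y"
  have X2: "0 < r * sin \<theta>" using r \<theta> by (simp add: sin_gt_zero)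
  have int: "integral {- (k * cosh \<eta>)..k * cosh \<eta>} ?h = - \<i> * ((Q (Complex 0 \<eta>) - Q (Complex 0 a)) + (P (Complex 0 a) - P (Complex pi (- a)))
        - (- 1) ^ i * cnj (Q (Complex 0 \<eta>) - Q (Complex 0 a)))" if \<eta>: "a < \<eta>" for \<eta>
  proof -
    define N where "N = k * cosh \<eta>"
    have N: "K < N" unfolding N_def using \<eta> a_pos k cosh_real_nonneg_less_iff[of a \<eta>] cosh_a
      by (metis less_imp_le less_trans mult_less_cancel_left_pos)
    have I5: "(?h has_integral - \<i> * (Q (\<tau>p N) - Q (\<tau>p K))) {K..N}"
    proof (rule path_primitive_integral[where F = Q and \<tau> = \<tau>p and \<alpha> = "K" and \<beta> = "N" and S = U and f = "outer (k * r) \<theta> Y" and s = "\<lambda>\<xi>. SS (of_real \<xi>) k"])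
      show "continuous_on {K..N} \<tau>p" using kK by (intro continuous_on_subset[OF \<tau>p_cont]) auto
      show "\<tau>p ` {K..N} \<subseteq> U" using \<tau>p(5) kK w by (auto simp: U_def) (auto simp: \<tau>p_def)
      fix \<xi> assume \<xi>: "K < \<xi>" "\<xi> < N"
      then have k\<xi>: "k < \<xi>" using kK by simp
      show "(\<tau>p has_vector_derivative (\<i> / SS (of_real \<xi>) k)) (at \<xi>)" by (rule \<tau>p_deriv[OF k\<xi>])
      note t = \<tau>p(1,2)[OF less_imp_le[OF k\<xi>]]
      show "?h \<xi> = outer (k * r) \<theta> Y (\<tau>p \<xi>) / SS (of_real \<xi>) k"
        unfolding outer_def by (rule term_eq[OF t outer_root_real[OF t(1)]]) (use \<xi> K in auto)
    qed (use N Q in auto)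
    have I4: "(?h has_integral - \<i> * (P (\<tau>p K) - P (\<tau>p k))) {k..K}"
    proof (rule path_primitive_integral[where F = P and \<tau> = \<tau>p and \<alpha> = "k" and \<beta> = "K" and S = "{z. \<bar>Im z\<bar> \<le> a}" and f = "inner (k * r) \<theta> Y" and s = "\<lambda>\<xi>. SS (of_real \<xi>) k"])
      show "continuous_on {k..K} \<tau>p" by (intro continuous_on_subset[OF \<tau>p_cont]) auto
      show "\<tau>p ` {k..K} \<subseteq> {z. \<bar>Im z\<bar> \<le> a}" using \<tau>p(3,4) by auto
      fix \<xi> assume \<xi>: "k < \<xi>" "\<xi> < K"
      show "(\<tau>p has_vector_derivative (\<i> / SS (of_real \<xi>) k)) (at \<xi>)" by (rule \<tau>p_deriv[OF \<xi>(1)])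
      note t = \<tau>p(1,2)[OF less_imp_le[OF \<xi>(1)]]
      show "?h \<xi> = inner (k * r) \<theta> Y (\<tau>p \<xi>) / SS (of_real \<xi>) k"
        unfolding inner_def by (rule term_eq[OF t inner_root_real[OF t(1)]]) (use \<xi> k in auto)
    qed (use kK P in auto)
    have I3: "(?h has_integral - \<i> * (P (\<tau>0 k) - P (\<tau>0 (- k)))) {-k..k}"
    proof (rule path_primitive_integral[where F = P and \<tau> = \<tau>0 and \<alpha> = "-k" and \<beta> = "k" and S = "{z. \<bar>Im z\<bar> \<le> a}" and f = "inner (k * r) \<theta> Y" and s = "\<lambda>\<xi>. SS (of_real \<xi>) k"])
      show "continuous_on {-k..k} \<tau>0" by (rule \<tau>0_cont)
      show "\<tau>0 ` {-k..k} \<subseteq> {z. \<bar>Im z\<bar> \<le> a}" using a_pos by (auto simp: \<tau>0_def)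
      fix \<xi> assume "- k < \<xi>" "\<xi> < k"
      then have \<xi>: "\<bar>\<xi>\<bar> < k" by auto
      show "(\<tau>0 has_vector_derivative (\<i> / SS (of_real \<xi>) k)) (at \<xi>)" by (rule \<tau>0(3)[OF \<xi>])
      note t = \<tau>0(1,2)[OF \<xi>]
      show "?h \<xi> = inner (k * r) \<theta> Y (\<tau>0 \<xi>) / SS (of_real \<xi>) k"
        unfolding inner_def by (rule term_eq[OF t inner_root_real[OF t(1)]]) (use \<xi> kK in auto)
    qed (use k P in auto)
    have I2: "(?h has_integral - \<i> * (P (\<tau>m (- k)) - P (\<tau>m (- K)))) {-K..-k}"
    proof (rule path_primitive_integral[where F = P and \<tau> = \<tau>m and \<alpha> = "-K" and \<beta> = "-k" and S = "{z. \<bar>Im z\<bar> \<le> a}" and f = "inner (k * r) \<theta> Y" and s = "\<lambda>\<xi>. SS (of_real \<xi>) k"])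
      show "continuous_on {-K..-k} \<tau>m" by (intro continuous_on_subset[OF \<tau>m_cont]) auto
      show "\<tau>m ` {-K..-k} \<subseteq> {z. \<bar>Im z\<bar> \<le> a}" using \<tau>m(3,4) a_pos by fastforce
      fix \<xi> assume \<xi>: "- K < \<xi>" "\<xi> < - k"
      show "(\<tau>m has_vector_derivative (\<i> / SS (of_real \<xi>) k)) (at \<xi>)" by (rule \<tau>m_deriv[OF \<xi>(2)])
      note t = \<tau>m(1,2)[OF less_imp_le[OF \<xi>(2)]]
      show "?h \<xi> = inner (k * r) \<theta> Y (\<tau>m \<xi>) / SS (of_real \<xi>) k"
        unfolding inner_def by (rule term_eq[OF t inner_root_real[OF t(1)]]) (use \<xi> k in auto)
    qed (use kK P in auto)
    have I1: "(?h has_integral (- 1) ^ i * cnj (- \<i> * (Q (\<tau>p N) - Q (\<tau>p K)))) {-N..-K}"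
    proof -
      have "((\<lambda>\<xi>. (- 1) ^ i * cnj (?h \<xi>)) has_integral (- 1) ^ i * cnj (- \<i> * (Q (\<tau>p N) - Q (\<tau>p K)))) {K..N}"
        using has_integral_mult_right[OF has_integral_linear[OF I5 bounded_linear_cnj], of "(- 1) ^ i"] by (simp only: o_def)
      then have "((\<lambda>\<xi>. ?h (- \<xi>)) has_integral (- 1) ^ i * cnj (- \<i> * (Q (\<tau>p N) - Q (\<tau>p K)))) {K..N}"
        by (rule has_integral_eq[rotated]) (simp add: fourier_term_reflect)
      from has_integral_reflect_lemma_real[OF this] show ?thesis by simp
    qed
    have "(?h has_integral (((- 1) ^ i * cnj (- \<i> * (Q (\<tau>p N) - Q (\<tau>p K))) + - \<i> * (P (\<tau>m (- k)) - P (\<tau>m (- K)))) + - \<i> * (P (\<tau>0 k) - P (\<tau>0 (- k))))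
        + (- \<i> * (P (\<tau>p K) - P (\<tau>p k)) + - \<i> * (Q (\<tau>p N) - Q (\<tau>p K)))) {-N..N}"
      by (rule has_integral_combine[OF _ _ has_integral_combine[OF _ _ has_integral_combine[OF _ _ I1 I2] I3] has_integral_combine[OF _ _ I4 I5]])
        (use N kK k in auto)
    from integral_unique[OF this] show ?thesis
      unfolding N_def using \<tau>p_values(3)[of \<eta>] \<eta> a_pos
      by (simp add: \<tau>p_values \<tau>m_values \<tau>0_values algebra_simps)
  qed
  have "filterlim (\<lambda>\<eta>. k * cosh \<eta>) at_top at_top"
    by (intro filterlim_tendsto_pos_mult_at_top[OF tendsto_const k cosh_real_at_top])
  from filterlim_compose[OF tendsto_integral_symmetric_interval[OF integrable_fourier_term[OF k kK X2 Y]] this]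
  have "((\<lambda>\<eta>. \<i> * integral {- (k * cosh \<eta>)..k * cosh \<eta>} ?h) \<longlongrightarrow> \<i> * fourier k K i j l (r * cos \<theta>) (r * sin \<theta>) Y) at_top"
    unfolding fourier_def by (rule tendsto_mult_left)
  moreover have "\<forall>\<^sub>F \<eta> in at_top. \<i> * integral {- (k * cosh \<eta>)..k * cosh \<eta>} ?h = (Q (Complex 0 \<eta>) - Q (Complex 0 a)) + (P (Complex 0 a) - P (Complex pi (- a)))
        - (- 1) ^ i * cnj (Q (Complex 0 \<eta>) - Q (Complex 0 a))"
    using eventually_gt_at_top[of a] by eventually_elim (subst int, auto simp: mult.assoc[symmetric])
  ultimately show ?thesis by (rule Lim_transform_eventually)
qed

lemma fourier_estimate_right:
  "\<exists>C r0. 0 < r0 \<and> (\<forall>r \<theta> Y. r0 \<le> r \<longrightarrow> 0 < \<theta> \<longrightarrow> \<theta> \<le> pi / 2 \<longrightarrow> - R0 \<le> Y \<longrightarrow> Y \<le> 0 \<longrightarrow>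
    cmod (fourier k K i j l (r * cos \<theta>) (r * sin \<theta>) Y
      - (1 + \<i>) * (exp (\<i> * of_real (k * r)) * of_real (sqrt (pi / (k * r))) * ampl Y (inner_root (of_real \<theta>)) (of_real \<theta>)))
      \<le> C * r powr (-3/2))"
proof -
  obtain C \<rho>0 where \<rho>0: "0 < \<rho>0" and C: "\<And>\<rho> \<theta> Y P Q T. \<rho>0 \<le> \<rho> \<Longrightarrow> 0 < \<theta> \<Longrightarrow> \<theta> \<le> pi / 2 \<Longrightarrow> - R0 \<le> Y \<Longrightarrow> Y \<le> 0 \<Longrightarrow>
    (\<forall>z. \<bar>Im z\<bar> \<le> a \<longrightarrow> (P has_field_derivative inner \<rho> \<theta> Y z) (at z within {z. \<bar>Im z\<bar> \<le> a})) \<Longrightarrow>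
    (\<forall>z\<in>U. (Q has_field_derivative outer \<rho> \<theta> Y z) (at z within U)) \<Longrightarrow>
    ((\<lambda>\<eta>. (Q (Complex 0 \<eta>) - Q (Complex 0 a)) + (P (Complex 0 a) - P (Complex pi (- a)))
        - (- 1) ^ i * cnj (Q (Complex 0 \<eta>) - Q (Complex 0 a))) \<longlongrightarrow> T) at_top \<Longrightarrow>
    cmod (T + (1 - \<i>) * (exp (\<i> * of_real \<rho>) * of_real (sqrt (pi / \<rho>)) * ampl Y (inner_root (of_real \<theta>)) (of_real \<theta>)))
      \<le> C * \<rho> powr (-3/2)"
    using contour_estimate by blast
  show ?thesis
  proof (rule exI[of _ "C * k powr (-3/2)"], rule exI[of _ "\<rho>0 / k"], intro conjI allI impI)
    fix r \<theta> Y assume r: "\<rho>0 / k \<le> r" and \<theta>: "0 < \<theta>" "\<theta> \<le> pi / 2" and Y: "- R0 \<le> Y" "Y \<le> 0"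
    have kr: "\<rho>0 \<le> k * r" and r0: "0 < r"
      using r k \<rho>0 by (auto simp: field_simps intro: less_le_trans[of 0 "\<rho>0 / k"])
    obtain P where P: "\<And>z. \<bar>Im z\<bar> \<le> a \<Longrightarrow> (P has_field_derivative inner (k * r) \<theta> Y z) (at z within {z. \<bar>Im z\<bar> \<le> a})"
      using inner_primitive by blast
    obtain Q where Q: "\<And>z. z \<in> U \<Longrightarrow> (Q has_field_derivative outer (k * r) \<theta> Y z) (at z within U)"
      using outer_primitive by blast
    let ?m = "exp (\<i> * of_real (k * r)) * of_real (sqrt (pi / (k * r))) * ampl Y (inner_root (of_real \<theta>)) (of_real \<theta>)"
    let ?L = "fourier k K i j l (r * cos \<theta>) (r * sin \<theta>) Y"
    have "cmod (\<i> * ?L + (1 - \<i>) * ?m) \<le> C * (k * r) powr (-3/2)"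
      by (rule C[OF kr \<theta> Y]) (use P Q fourier_as_contour[OF r0 \<theta>(1) _ Y(2) P Q] \<theta> pi_gt_zero in auto)
    moreover have "\<i> * ?L + (1 - \<i>) * ?m = \<i> * (?L - (1 + \<i>) * ?m)" by (simp add: algebra_simps)
    moreover have "(k * r) powr (-3/2) = k powr (-3/2) * r powr (-3/2)" using k r0 by (simp add: powr_mult)
    ultimately show "cmod (?L - (1 + \<i>) * ?m) \<le> C * k powr (-3/2) * r powr (-3/2)"
      by (simp add: norm_mult mult.assoc)
  qed (use \<rho>0 k in auto)
qed

end

section \<open>Far-field asymptotics and bounded shifts\<close>

text \<open>
  The amplitude of the Fourier integral at the stationary point \<open>\<xi> = k c\<close>, where \<open>S = - \<i> k s\<close> and
  \<open>T = - \<i> sqrt (K\<^sup>2 - k\<^sup>2 c\<^sup>2)\<close>.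
\<close>
definition symbol :: "real \<Rightarrow> real \<Rightarrow> nat \<Rightarrow> nat \<Rightarrow> nat \<Rightarrow> real \<Rightarrow> real \<Rightarrow> real \<Rightarrow> complex" where
  "symbol k K i j l Y c s = of_real (k * c) ^ i * (- \<i> * of_real (k * s)) ^ j * (- \<i> * of_real (sqrt (K\<^sup>2 - k\<^sup>2 * c\<^sup>2))) ^ l
     * exp (- \<i> * of_real (sqrt (K\<^sup>2 - k\<^sup>2 * c\<^sup>2) * Y))"

text \<open>
  The outgoing cylindrical wave in the normalisation of stationary phase. It is \<open>4 \<pi>\<close> times
  \<open>exp (\<i> k r) / sqrt r \<cdot> exp (\<i> \<pi> / 4) / sqrt (8 \<pi> k)\<close>, the far field of \<open>\<i> / 4\<close> times the Hankel function.
\<close>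
definition far :: "real \<Rightarrow> real \<Rightarrow> complex" where
  "far k r = (1 + \<i>) * (exp (\<i> * of_real (k * r)) * of_real (sqrt (pi / (k * r))))"

lemma fourier_flip:
  assumes "0 < k" "0 < K"
  shows "fourier k K i j l (- X1) X2 Y = (- 1) ^ i * fourier k K i j l X1 X2 Y"
proof -
  have "fourier_term k K i j l (- X1) X2 Y (0 + (- 1) * \<xi>) = (- 1) ^ i * fourier_term k K i j l X1 X2 Y \<xi>" for \<xi>
  proof -
    have "SS (of_real (- \<xi>)) k = SS (of_real \<xi>) k" "SS (of_real (- \<xi>)) K = SS (of_real \<xi>) K"
      using assms SS_of_real[of k "- \<xi>"] SS_of_real[of k \<xi>] SS_of_real[of K "- \<xi>"] SS_of_real[of K \<xi>] by simp_all
    then show ?thesis unfolding fourier_term_def by (simp add: power_minus[of "of_real \<xi>"])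
  qed
  then show ?thesis
    unfolding fourier_def using lborel_integral_real_affine[of "- 1" "fourier_term k K i j l (- X1) X2 Y" 0] by simp
qed

lemma (in layers) ampl_inner_real:
  "ampl Y (inner_root (of_real \<theta>)) (of_real \<theta>) = symbol k K i j l Y (cos \<theta>) (sin \<theta>)"
proof -
  have e: "(of_real K)\<^sup>2 - (of_real k * cos (of_real \<theta>))\<^sup>2 = (of_real (K\<^sup>2 - k\<^sup>2 * (cos \<theta>)\<^sup>2) :: complex)"
    by (simp add: power_mult_distrib cos_of_real)
  have "(k * cos \<theta>)\<^sup>2 \<le> K\<^sup>2"
    using k kK mult_mono[of k K "\<bar>cos \<theta>\<bar>" 1] by (intro abs_le_square_iff[THEN iffD1]) (auto simp: abs_mult)
  then have "csqrt (of_real (K\<^sup>2 - k\<^sup>2 * (cos \<theta>)\<^sup>2)) = of_real (sqrt (K\<^sup>2 - k\<^sup>2 * (cos \<theta>)\<^sup>2))"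
    by (simp add: power_mult_distrib)
  then have "inner_root (of_real \<theta>) = - \<i> * of_real (sqrt (K\<^sup>2 - k\<^sup>2 * (cos \<theta>)\<^sup>2))"
    unfolding inner_root_def e by simp
  then show ?thesis unfolding ampl_def symbol_def by (simp add: cos_of_real sin_of_real mult.assoc)
qed

text \<open>
  The contour argument covers \<open>0 < \<theta> \<le> \<pi> / 2\<close>; the remaining directions follow from the substitution \<open>\<xi> \<mapsto> - \<xi>\<close>, which
  multiplies both sides by \<open>(- 1) ^ i\<close>.
\<close>
theorem fourier_asymptotics:
  assumes k: "0 < k" "k < K" and R0: "0 \<le> R0"
  shows "\<exists>C\<ge>0. \<exists>r0>0. \<forall>r c s Y. r0 \<le> r \<longrightarrow> 0 < s \<longrightarrow> c\<^sup>2 + s\<^sup>2 = 1 \<longrightarrow> - R0 \<le> Y \<longrightarrow> Y \<le> 0 \<longrightarrow>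
    cmod (fourier k K i j l (r * c) (r * s) Y - far k r * symbol k K i j l Y c s) \<le> C * r powr (-3/2)"
proof -
  interpret layers k K R0 i j l using assms by unfold_locales
  obtain C r0 where r0: "0 < r0" and C: "\<And>r \<theta> Y. r0 \<le> r \<Longrightarrow> 0 < \<theta> \<Longrightarrow> \<theta> \<le> pi / 2 \<Longrightarrow> - R0 \<le> Y \<Longrightarrow> Y \<le> 0 \<Longrightarrow>
    cmod (fourier k K i j l (r * cos \<theta>) (r * sin \<theta>) Y - far k r * symbol k K i j l Y (cos \<theta>) (sin \<theta>)) \<le> C * r powr (-3/2)"
    using fourier_estimate_right unfolding ampl_inner_real far_def mult.assoc by blast
  have main: "cmod (fourier k K i j l (r * c) (r * s) Y - far k r * symbol k K i j l Y c s) \<le> C * r powr (-3/2)"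
    if r: "r0 \<le> r" and s: "0 < s" and cs: "c\<^sup>2 + s\<^sup>2 = 1" and Y: "- R0 \<le> Y" "Y \<le> 0" and c: "0 \<le> c" for r c s Y
  proof -
    have "0 < s\<^sup>2" using s by simp
    then have "c\<^sup>2 < 1" using cs by linarith
    then have "c\<^sup>2 < 1\<^sup>2" by simp
    then have c1: "c < 1" by (rule power2_less_imp_less) simp
    define \<theta> where "\<theta> = arccos c"
    have "s\<^sup>2 = 1 - c\<^sup>2" using cs by simp
    then have "cos \<theta> = c" "sin \<theta> = s" using c c1 s by (simp_all add: \<theta>_def sin_arccos real_sqrt_unique flip: \<open>s\<^sup>2 = 1 - c\<^sup>2\<close>)
    moreover have "0 < \<theta>" using arccos_less_mono[of 1 c] c c1 by (simp add: \<theta>_def)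
    moreover have "\<theta> \<le> pi / 2" using arccos_le_arccos[of 0 c] c c1 by (simp add: \<theta>_def)
    ultimately show ?thesis using C[of r \<theta> Y] r Y by simp
  qed
  show ?thesis
  proof (rule exI[of _ "max C 0"], intro conjI, simp, rule exI[of _ r0], intro conjI allI impI r0)
    fix r c s Y :: real
    assume a: "r0 \<le> r" "0 < s" "c\<^sup>2 + s\<^sup>2 = 1" "- R0 \<le> Y" "Y \<le> 0"
    have "cmod (fourier k K i j l (r * c) (r * s) Y - far k r * symbol k K i j l Y c s) \<le> C * r powr (-3/2)"
    proof (cases "0 \<le> c")
      case False
      have "fourier k K i j l (r * c) (r * s) Y = (- 1) ^ i * fourier k K i j l (r * - c) (r * s) Y"
        using fourier_flip[of k K i j l "r * - c" "r * s" Y] k K by simp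
      moreover have "symbol k K i j l Y c s = (- 1) ^ i * symbol k K i j l Y (- c) s"
        by (simp add: symbol_def power_minus[of "of_real k * of_real c"])
      ultimately have "fourier k K i j l (r * c) (r * s) Y - far k r * symbol k K i j l Y c s
         = (- 1) ^ i * (fourier k K i j l (r * - c) (r * s) Y - far k r * symbol k K i j l Y (- c) s)"
        by (simp add: algebra_simps)
      then show ?thesis using main[of r s "- c" Y] a False by (simp add: norm_mult norm_power)
    qed (use main a in auto)
    also have "\<dots> \<le> max C 0 * r powr (-3/2)" by (intro mult_right_mono) auto
    finally show "cmod (fourier k K i j l (r * c) (r * s) Y - far k r * symbol k K i j l Y c s) \<le> max C 0 * r powr (-3/2)" .
  qed
qed

text \<open>
  Amplitudes that tolerate a change of direction of order \<open>1 / r\<close>.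
\<close>
definition bounded_lipschitz :: "real \<Rightarrow> (real \<Rightarrow> real \<Rightarrow> real \<Rightarrow> complex) \<Rightarrow> bool" where
  "bounded_lipschitz R f \<longleftrightarrow> (\<exists>M\<ge>0. \<exists>L\<ge>0. \<forall>Y\<in>{-R..0}. \<forall>c\<in>{-1..1}. \<forall>s\<in>{-1..1}. \<forall>c'\<in>{-1..1}. \<forall>s'\<in>{-1..1}.
     cmod (f Y c s) \<le> M \<and> cmod (f Y c s - f Y c' s') \<le> L * (\<bar>c - c'\<bar> + \<bar>s - s'\<bar>))"

lemma bounded_lipschitzI:
  assumes "0 \<le> M" "0 \<le> L"
    "\<And>Y c s c' s'. Y \<in> {-R..0} \<Longrightarrow> c \<in> {-1..1} \<Longrightarrow> s \<in> {-1..1} \<Longrightarrow> cmod (f Y c s) \<le> M"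
    "\<And>Y c s c' s'. Y \<in> {-R..0} \<Longrightarrow> c \<in> {-1..1} \<Longrightarrow> s \<in> {-1..1} \<Longrightarrow> c' \<in> {-1..1} \<Longrightarrow> s' \<in> {-1..1} \<Longrightarrow>
      cmod (f Y c s - f Y c' s') \<le> L * (\<bar>c - c'\<bar> + \<bar>s - s'\<bar>)"
  shows "bounded_lipschitz R f"
  unfolding bounded_lipschitz_def using assms by blast

lemma bounded_lipschitz_const: "bounded_lipschitz R (\<lambda>Y c s. z)"
  by (rule bounded_lipschitzI[of "cmod z" 0]) auto

lemma bounded_lipschitz_mult:
  assumes "bounded_lipschitz R f" "bounded_lipschitz R g"
  shows "bounded_lipschitz R (\<lambda>Y c s. f Y c s * g Y c s)"
proof -
  obtain M L where f: "0 \<le> M" "0 \<le> L" "\<And>Y c s c' s'. Y \<in> {-R..0} \<Longrightarrow> c \<in> {-1..1} \<Longrightarrow> s \<in> {-1..1} \<Longrightarrow> c' \<in> {-1..1} \<Longrightarrow> s' \<in> {-1..1} \<Longrightarrow>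
      cmod (f Y c s) \<le> M \<and> cmod (f Y c s - f Y c' s') \<le> L * (\<bar>c - c'\<bar> + \<bar>s - s'\<bar>)"
    using assms(1) unfolding bounded_lipschitz_def by meson
  obtain M' L' where g: "0 \<le> M'" "0 \<le> L'" "\<And>Y c s c' s'. Y \<in> {-R..0} \<Longrightarrow> c \<in> {-1..1} \<Longrightarrow> s \<in> {-1..1} \<Longrightarrow> c' \<in> {-1..1} \<Longrightarrow> s' \<in> {-1..1} \<Longrightarrow>
      cmod (g Y c s) \<le> M' \<and> cmod (g Y c s - g Y c' s') \<le> L' * (\<bar>c - c'\<bar> + \<bar>s - s'\<bar>)"
    using assms(2) unfolding bounded_lipschitz_def by meson
  show ?thesis
  proof (rule bounded_lipschitzI[of "M * M'" "L * M' + M * L'"])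
    fix Y c s c' s' :: real assume Y: "Y \<in> {-R..0}" and a: "c \<in> {-1..1}" "s \<in> {-1..1}"
    show "cmod (f Y c s * g Y c s) \<le> M * M'"
      unfolding norm_mult using f(3)[of Y c s c s] g(3)[of Y c s c s] Y a f(1) by (intro mult_mono) auto
    assume b: "c' \<in> {-1..1}" "s' \<in> {-1..1}"
    let ?d = "\<bar>c - c'\<bar> + \<bar>s - s'\<bar>"
    have "f Y c s * g Y c s - f Y c' s' * g Y c' s' = (f Y c s - f Y c' s') * g Y c s + f Y c' s' * (g Y c s - g Y c' s')"
      by (simp add: algebra_simps)
    also have "cmod \<dots> \<le> (L * ?d) * M' + M * (L' * ?d)"
      unfolding norm_mult[symmetric]
      using f(3)[OF Y a b] g(3)[OF Y a b] f(3)[OF Y b a] f(1,2) g(1,2)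
      by (intro norm_triangle_mono) (auto simp: norm_mult intro!: mult_mono)
    finally show "cmod (f Y c s * g Y c s - f Y c' s' * g Y c' s') \<le> (L * M' + M * L') * ?d"
      by (simp add: algebra_simps)
  qed (use f(1,2) g(1,2) in auto)
qed

lemma bounded_lipschitz_power:
  "bounded_lipschitz R f \<Longrightarrow> bounded_lipschitz R (\<lambda>Y c s. f Y c s ^ n)"
  by (induction n) (auto intro: bounded_lipschitz_const bounded_lipschitz_mult)

text \<open>
  Here \<open>k < K\<close> enters: the radicand is at least \<open>K\<^sup>2 - k\<^sup>2 > 0\<close> for all directions, so the square root is Lipschitz.
\<close>
lemma sqrt_vertical_lipschitz:
  assumes k: "0 < k" "k < K" and c: "\<bar>c\<bar> \<le> 1" "\<bar>c'\<bar> \<le> 1"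
  shows "\<bar>sqrt (K\<^sup>2 - k\<^sup>2 * c\<^sup>2)\<bar> \<le> K" "\<bar>sqrt (K\<^sup>2 - k\<^sup>2 * c\<^sup>2) - sqrt (K\<^sup>2 - k\<^sup>2 * c'\<^sup>2)\<bar> \<le> k\<^sup>2 / sqrt (K\<^sup>2 - k\<^sup>2) * \<bar>c - c'\<bar>"
proof -
  have kK: "0 < K\<^sup>2 - k\<^sup>2" using k by (simp add: power_strict_mono)
  have g: "K\<^sup>2 - k\<^sup>2 \<le> K\<^sup>2 - k\<^sup>2 * u\<^sup>2" if "\<bar>u\<bar> \<le> 1" for u :: real
    using that mult_left_mono[of "u\<^sup>2" 1 "k\<^sup>2"] by (simp add: abs_square_le_1)
  let ?p = "sqrt (K\<^sup>2 - k\<^sup>2 * c\<^sup>2)" let ?q = "sqrt (K\<^sup>2 - k\<^sup>2 * c'\<^sup>2)" let ?m = "sqrt (K\<^sup>2 - k\<^sup>2)"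
  have "?p \<le> sqrt (K\<^sup>2)" by (intro real_sqrt_le_mono) simp
  moreover have "0 \<le> ?p" using g[OF c(1)] kK by simp
  ultimately show "\<bar>?p\<bar> \<le> K" using k by simp
  have m: "?m \<le> ?p" "?m \<le> ?q" "0 < ?m" using g c kK by auto
  have sq: "?p\<^sup>2 = K\<^sup>2 - k\<^sup>2 * c\<^sup>2" "?q\<^sup>2 = K\<^sup>2 - k\<^sup>2 * c'\<^sup>2"
    using g[OF c(1)] g[OF c(2)] kK by (simp_all only: real_sqrt_pow2)
  have "(?p - ?q) * (?p + ?q) = ?p\<^sup>2 - ?q\<^sup>2" by (simp only: power2_eq_square square_diff_square_factored mult.commute)
  also have "\<dots> = k\<^sup>2 * ((c' - c) * (c' + c))" unfolding sq by (simp add: power2_eq_square algebra_simps)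
  finally have "\<bar>(?p - ?q) * (?p + ?q)\<bar> = k\<^sup>2 * (\<bar>c - c'\<bar> * \<bar>c' + c\<bar>)" by (simp only: abs_mult abs_power2 abs_minus_commute)
  moreover have "\<bar>?p + ?q\<bar> = ?p + ?q" using m by linarith
  ultimately have "\<bar>?p - ?q\<bar> * (?p + ?q) = k\<^sup>2 * (\<bar>c - c'\<bar> * \<bar>c' + c\<bar>)" by (simp only: abs_mult)
  moreover have "\<bar>?p - ?q\<bar> * (2 * ?m) \<le> \<bar>?p - ?q\<bar> * (?p + ?q)"
    using add_mono[OF m(1,2)] by (intro mult_left_mono) (simp_all only: mult_2 abs_ge_zero)
  moreover have "k\<^sup>2 * (\<bar>c - c'\<bar> * \<bar>c' + c\<bar>) \<le> k\<^sup>2 * (\<bar>c - c'\<bar> * 2)" using c by (intro mult_left_mono) auto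
  ultimately have "\<bar>?p - ?q\<bar> * ?m \<le> k\<^sup>2 * \<bar>c - c'\<bar>" by linarith
  then show "\<bar>?p - ?q\<bar> \<le> k\<^sup>2 / ?m * \<bar>c - c'\<bar>" using m by (simp add: pos_le_divide_eq)
qed

lemma bounded_lipschitz_of_real:
  fixes g :: "real \<Rightarrow> real"
  assumes M: "\<And>u. \<bar>u\<bar> \<le> 1 \<Longrightarrow> \<bar>g u\<bar> \<le> M" and L: "0 \<le> L" "\<And>u v. \<bar>u\<bar> \<le> 1 \<Longrightarrow> \<bar>v\<bar> \<le> 1 \<Longrightarrow> \<bar>g u - g v\<bar> \<le> L * \<bar>u - v\<bar>"
  shows "bounded_lipschitz R (\<lambda>Y c s. of_real (g c))" "bounded_lipschitz R (\<lambda>Y c s. of_real (g s))"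
proof -
  have M0: "0 \<le> M" using M[of 0] by simp
  have d: "L * \<bar>c - c'\<bar> \<le> L * (\<bar>c - c'\<bar> + \<bar>s - s'\<bar>)" "L * \<bar>s - s'\<bar> \<le> L * (\<bar>c - c'\<bar> + \<bar>s - s'\<bar>)" for c c' s s' :: real
    using L(1) by (auto intro!: mult_left_mono)
  have *: "\<bar>u\<bar> \<le> 1" if "u \<in> {-1..1}" for u :: real using that by auto
  show "bounded_lipschitz R (\<lambda>Y c s. of_real (g c))"
  proof (rule bounded_lipschitzI[OF M0 L(1)])
    fix Y c s c' s' :: real assume "c \<in> {-1..1}"
    then show "cmod (of_real (g c)) \<le> M" using M[OF *] by simp
    assume "c' \<in> {-1..1}"
    then show "cmod (of_real (g c) - of_real (g c')) \<le> L * (\<bar>c - c'\<bar> + \<bar>s - s'\<bar>)"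
      using order_trans[OF L(2)[OF * *] d(1)] \<open>c \<in> {-1..1}\<close> by (simp only: norm_of_real flip: of_real_diff)
  qed
  show "bounded_lipschitz R (\<lambda>Y c s. of_real (g s))"
  proof (rule bounded_lipschitzI[OF M0 L(1)])
    fix Y c s c' s' :: real assume "s \<in> {-1..1}"
    then show "cmod (of_real (g s)) \<le> M" using M[OF *] by simp
    assume "s' \<in> {-1..1}"
    then show "cmod (of_real (g s) - of_real (g s')) \<le> L * (\<bar>c - c'\<bar> + \<bar>s - s'\<bar>)"
      using order_trans[OF L(2)[OF * *] d(2)] \<open>s \<in> {-1..1}\<close> by (simp only: norm_of_real flip: of_real_diff)
  qed
qed

lemma norm_exp_imaginary_diff_le: "cmod (exp (\<i> * of_real x) - exp (\<i> * of_real y)) \<le> \<bar>x - y\<bar>"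
proof -
  have "cmod (exp (\<i> * of_real x) - exp (\<i> * of_real y)) \<le> exp 0 * cmod (\<i> * of_real x - \<i> * of_real y)"
    by (rule norm_exp_diff_le) auto
  also have "\<i> * of_real x - \<i> * of_real y = \<i> * of_real (x - y)" by (simp add: algebra_simps)
  finally show ?thesis by (simp only: norm_mult norm_of_real) simp
qed

lemma bounded_lipschitz_symbol:
  assumes k: "0 < k" "k < K" and R: "0 \<le> R"
  shows "bounded_lipschitz R (symbol k K i j l)"
proof -
  let ?q = "\<lambda>c. sqrt (K\<^sup>2 - k\<^sup>2 * c\<^sup>2)"
  define L where "L = k\<^sup>2 / sqrt (K\<^sup>2 - k\<^sup>2)"
  have L: "0 \<le> L" using k by (simp add: L_def power_mono)
  have g: "\<bar>k * u\<bar> \<le> k" "\<bar>k * u - k * v\<bar> \<le> k * \<bar>u - v\<bar>" if "\<bar>u\<bar> \<le> 1" for u v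
    using that k mult_left_mono[of "\<bar>u\<bar>" 1 k] by (simp_all add: abs_mult flip: right_diff_distrib)
  have 1: "bounded_lipschitz R (\<lambda>Y c s. of_real (k * c))" "bounded_lipschitz R (\<lambda>Y c s. of_real (k * s))"
    by (rule bounded_lipschitz_of_real[of "\<lambda>u. k * u" k k]; use g k in simp)+
  note q = sqrt_vertical_lipschitz[OF k, folded L_def]
  have 3: "bounded_lipschitz R (\<lambda>Y c s. of_real (?q c))"
    by (rule bounded_lipschitz_of_real(1)[of ?q K L]) (use q(1)[of _ 0] q(2) L in auto)
  have 4: "bounded_lipschitz R (\<lambda>Y c s. exp (- \<i> * of_real (?q c * Y)))"
  proof (rule bounded_lipschitzI[of 1 "L * R"])
    fix Y c s c' s' :: real assume a: "Y \<in> {-R..0}" "c \<in> {-1..1}" "c' \<in> {-1..1}"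
    have "cmod (exp (- \<i> * of_real (?q c * Y)) - exp (- \<i> * of_real (?q c' * Y)))
        = cmod (exp (\<i> * of_real (- (?q c * Y))) - exp (\<i> * of_real (- (?q c' * Y))))" by simp
    also have "\<dots> \<le> \<bar>- (?q c * Y) - - (?q c' * Y)\<bar>" by (rule norm_exp_imaginary_diff_le)
    also have "\<dots> = \<bar>?q c - ?q c'\<bar> * \<bar>Y\<bar>" by (simp add: abs_mult[symmetric] left_diff_distrib abs_minus_commute)
    also have "\<dots> \<le> (L * \<bar>c - c'\<bar>) * R" using q(2)[of c c'] a L by (intro mult_mono) auto
    also have "\<dots> \<le> L * R * (\<bar>c - c'\<bar> + \<bar>s - s'\<bar>)" using L R by (simp add: distrib_left mult_ac)
    finally show "cmod (exp (- \<i> * of_real (?q c * Y)) - exp (- \<i> * of_real (?q c' * Y))) \<le> L * R * (\<bar>c - c'\<bar> + \<bar>s - s'\<bar>)" .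
  qed (use L R in auto)
  show ?thesis
    unfolding symbol_def[abs_def]
    by (intro bounded_lipschitz_mult bounded_lipschitz_power bounded_lipschitz_const 1 3 4)
qed

text \<open>
  With \<open>\<beta> = c b1 + s b2\<close> the distance to the shifted origin satisfies \<open>r' = r - \<beta> + O(1 / r)\<close>, and the direction changes
  by \<open>O(1 / r)\<close>. Since the wave itself has order \<open>r powr (-1/2)\<close>, each of these replacements, in the phase, in the factor
  \<open>1 / sqrt r'\<close> and in the amplitude, costs \<open>O(r powr (-3/2))\<close>.
\<close>
lemma far_field_shift:
  assumes k: "0 < k" and R: "0 \<le> R" and f: "bounded_lipschitz R f"
  shows "\<exists>C\<ge>0. \<forall>r c s b1 b2 Y r'. 2 * R + 1 \<le> r \<longrightarrow> c\<^sup>2 + s\<^sup>2 = 1 \<longrightarrow> b1\<^sup>2 + b2\<^sup>2 \<le> R\<^sup>2 \<longrightarrow> Y \<in> {-R..0} \<longrightarrow>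
    r' = sqrt ((r * c - b1)\<^sup>2 + (r * s - b2)\<^sup>2) \<longrightarrow>
    cmod (far k r' * f Y ((r * c - b1) / r') ((r * s - b2) / r')
       - far k r * exp (- \<i> * of_real (k * (c * b1 + s * b2))) * f Y c s) \<le> C * r powr (-3/2)"
proof -
  obtain M L where bnd: "0 \<le> M" "0 \<le> L" "\<And>Y c s c' s'. Y \<in> {-R..0} \<Longrightarrow> c \<in> {-1..1} \<Longrightarrow> s \<in> {-1..1} \<Longrightarrow> c' \<in> {-1..1} \<Longrightarrow> s' \<in> {-1..1} \<Longrightarrow>
      cmod (f Y c s) \<le> M \<and> cmod (f Y c s - f Y c' s') \<le> L * (\<bar>c - c'\<bar> + \<bar>s - s'\<bar>)"
    using f unfolding bounded_lipschitz_def by meson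
  define A where "A = 2 * (k * R\<^sup>2 + R)"
  define N where "N = cmod ((1 + \<i>) * of_real (sqrt (pi / k)))"
  have A: "0 \<le> A" and N: "0 \<le> N" using k R by (auto simp: A_def N_def)
  show ?thesis
  proof (rule exI[of _ "N * (A * M + 8 * L * R)"], intro conjI allI impI)
    fix r c s b1 b2 Y r'
    assume r: "2 * R + 1 \<le> r" and cs: "c\<^sup>2 + s\<^sup>2 = 1" and b: "b1\<^sup>2 + b2\<^sup>2 \<le> R\<^sup>2" and Y: "Y \<in> {-R..0}"
      and r': "r' = sqrt ((r * c - b1)\<^sup>2 + (r * s - b2)\<^sup>2)"
    let ?\<beta> = "c * b1 + s * b2"
    have r0: "0 < r" "R \<le> r / 2" "1 \<le> r" using r R by auto
    \<comment> \<open>Lagrange's identity, for \<open>\<bar>\<beta>\<bar> \<le> R\<close>\<close>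
    have lag: "?\<beta>\<^sup>2 + (c * b2 - s * b1)\<^sup>2 = (c\<^sup>2 + s\<^sup>2) * (b1\<^sup>2 + b2\<^sup>2)" by (simp add: power2_eq_square algebra_simps)
    have "0 \<le> (c * b2 - s * b1)\<^sup>2" by simp
    then have b2: "?\<beta>\<^sup>2 \<le> b1\<^sup>2 + b2\<^sup>2" using lag unfolding cs mult_1 by linarith
    then have "?\<beta>\<^sup>2 \<le> R\<^sup>2" using b by linarith
    then have "\<bar>?\<beta>\<bar> \<le> \<bar>R\<bar>" by (simp only: abs_le_square_iff)
    then have \<beta>: "\<bar>?\<beta>\<bar> \<le> R" "0 \<le> b1\<^sup>2 + b2\<^sup>2 - ?\<beta>\<^sup>2" using b2 R by simp_all
    have r'c: "r' = cmod (Complex (r * c) (r * s) - Complex b1 b2)" by (simp add: r' cmod_def)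
    have cx: "cmod (Complex (r * c) (r * s)) = r"
    proof -
      have "(r * c)\<^sup>2 + (r * s)\<^sup>2 = r\<^sup>2 * (c\<^sup>2 + s\<^sup>2)" by (simp only: power_mult_distrib distrib_left)
      then show ?thesis using cs r0 by (simp add: cmod_def)
    qed
    have cb: "cmod (Complex b1 b2) \<le> R" using b R by (simp add: cmod_def real_le_lsqrt)
    have d: "\<bar>r' - r\<bar> \<le> R"
      using norm_triangle_ineq3[of "Complex (r * c) (r * s) - Complex b1 b2" "Complex (r * c) (r * s)"] cb cx r'c by simp
    then have r'2: "r / 2 \<le> r'" "0 < r'" using r0 by linarith+
    have b12: "\<bar>b1\<bar> \<le> R" "\<bar>b2\<bar> \<le> R" using abs_Re_le_cmod[of "Complex b1 b2"] abs_Im_le_cmod[of "Complex b1 b2"] cb by auto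
    have cs1: "\<bar>c\<bar> \<le> 1" "\<bar>s\<bar> \<le> 1"
      using cs by (simp_all add: abs_square_le_1[symmetric]) (metis add.commute le_add_same_cancel1 zero_le_power2)+
    have sq: "r'\<^sup>2 = r\<^sup>2 - 2 * r * ?\<beta> + (b1\<^sup>2 + b2\<^sup>2)"
    proof -
      have "r'\<^sup>2 = (r * c - b1)\<^sup>2 + (r * s - b2)\<^sup>2" by (simp add: r')
      also have "\<dots> = r\<^sup>2 * (c\<^sup>2 + s\<^sup>2) - 2 * r * ?\<beta> + (b1\<^sup>2 + b2\<^sup>2)" by (simp add: power2_eq_square algebra_simps)
      finally show ?thesis using cs by simp
    qed
    \<comment> \<open>the squares of \<open>r'\<close> and \<open>r - \<beta>\<close> differ by at most \<open>R\<^sup>2\<close>, so the numbers themselves differ by \<open>O(1 / r)\<close>\<close>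
    have "\<bar>r' - (r - ?\<beta>)\<bar> * r \<le> \<bar>r' - (r - ?\<beta>)\<bar> * (r' + (r - ?\<beta>))"
      using r'2 r0 \<beta>(1) by (intro mult_left_mono) auto
    also have "\<dots> = \<bar>(r' - (r - ?\<beta>)) * (r' + (r - ?\<beta>))\<bar>" using r'2 r0 \<beta>(1) by (simp add: abs_mult)
    also have "(r' - (r - ?\<beta>)) * (r' + (r - ?\<beta>)) = b1\<^sup>2 + b2\<^sup>2 - ?\<beta>\<^sup>2"
      using sq by (simp add: power2_eq_square algebra_simps)
    also have "\<bar>b1\<^sup>2 + b2\<^sup>2 - ?\<beta>\<^sup>2\<bar> \<le> R\<^sup>2"
      using \<beta>(2) b zero_le_power2[of ?\<beta>] by linarith
    finally have ph: "\<bar>r' - (r - ?\<beta>)\<bar> \<le> R\<^sup>2 / r" using r0 by (simp add: pos_le_divide_eq)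
    define E' where "E' = exp (\<i> * of_real (k * r')) / of_real (sqrt r')"
    define E where "E = exp (\<i> * of_real (k * (r - ?\<beta>))) / of_real (sqrt r)"
    have sr: "1 / sqrt r' \<le> 2 / sqrt r"
    proof -
      have "sqrt r / 2 \<le> sqrt (r / 2)" using r0 by (intro real_le_rsqrt) (simp add: power_divide)
      also have "\<dots> \<le> sqrt r'" using r'2 by simp
      finally show ?thesis using r0 r'2 by (simp add: field_simps)
    qed
    have dE: "cmod (E' - E) \<le> A / (r * sqrt r)"
    proof -
      have "E' - E = (exp (\<i> * of_real (k * r')) - exp (\<i> * of_real (k * (r - ?\<beta>)))) * of_real (1 / sqrt r')
          + exp (\<i> * of_real (k * (r - ?\<beta>))) * of_real (1 / sqrt r' - 1 / sqrt r)"
        by (simp add: E'_def E_def divide_inverse algebra_simps)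
      also have "cmod \<dots> \<le> (k * (R\<^sup>2 / r)) * (2 / sqrt r) + 1 * (R * (2 / sqrt r) / r)"
      proof (rule norm_triangle_mono)
        have "cmod (exp (\<i> * of_real (k * r')) - exp (\<i> * of_real (k * (r - ?\<beta>)))) \<le> k * (R\<^sup>2 / r)"
          using norm_exp_imaginary_diff_le[of "k * r'" "k * (r - ?\<beta>)"] mult_left_mono[OF ph, of k] k
          by (simp add: abs_mult flip: right_diff_distrib)
        then show "cmod ((exp (\<i> * of_real (k * r')) - exp (\<i> * of_real (k * (r - ?\<beta>)))) * of_real (1 / sqrt r')) \<le> (k * (R\<^sup>2 / r)) * (2 / sqrt r)"
          unfolding norm_mult norm_of_real using sr r'2 k r0 by (intro mult_mono) auto
        have "(1 / sqrt r' - 1 / sqrt r) * (sqrt r + sqrt r') = (r - r') / (sqrt r * sqrt r')"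
          using r0 r'2 by (simp add: field_simps)
        then have "\<bar>1 / sqrt r' - 1 / sqrt r\<bar> * (sqrt r + sqrt r') = \<bar>r - r'\<bar> * (1 / sqrt r') / sqrt r"
        proof -
          have "\<bar>sqrt r + sqrt r'\<bar> = sqrt r + sqrt r'" "\<bar>sqrt r * sqrt r'\<bar> = sqrt r * sqrt r'" using r0 r'2 by auto
          then have "\<bar>1 / sqrt r' - 1 / sqrt r\<bar> * (sqrt r + sqrt r') = \<bar>r - r'\<bar> / (sqrt r * sqrt r')"
            using \<open>(1 / sqrt r' - 1 / sqrt r) * (sqrt r + sqrt r') = _\<close> by (metis abs_divide abs_mult)
          then show ?thesis by (simp add: field_simps)
        qed
        also have "\<dots> \<le> R * (2 / sqrt r) / sqrt r" using d sr r'2 r0 R by (intro divide_right_mono mult_mono) auto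
        finally have "\<bar>1 / sqrt r' - 1 / sqrt r\<bar> * (sqrt r + sqrt r') \<le> R * (2 / sqrt r) / sqrt r" .
        moreover have "\<bar>1 / sqrt r' - 1 / sqrt r\<bar> * sqrt r \<le> \<bar>1 / sqrt r' - 1 / sqrt r\<bar> * (sqrt r + sqrt r')"
          using r'2 by (intro mult_left_mono) auto
        ultimately have "\<bar>1 / sqrt r' - 1 / sqrt r\<bar> * sqrt r \<le> R * (2 / sqrt r) / sqrt r" by linarith
        then have "\<bar>1 / sqrt r' - 1 / sqrt r\<bar> \<le> R * (2 / sqrt r) / sqrt r / sqrt r" using r0 by (simp only: pos_le_divide_eq real_sqrt_gt_zero)
        also have "\<dots> = R * (2 / sqrt r) / r" using r0 by simp
        finally show "cmod (exp (\<i> * of_real (k * (r - ?\<beta>))) * of_real (1 / sqrt r' - 1 / sqrt r)) \<le> 1 * (R * (2 / sqrt r) / r)"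
          unfolding norm_mult norm_of_real by simp
      qed
      also have "\<dots> = A / (r * sqrt r)" using r0 by (simp add: A_def field_simps)
      finally show ?thesis .
    qed
    have dir: "\<bar>(r * c - b1) / r' - c\<bar> \<le> 4 * R / r" "\<bar>(r * s - b2) / r' - s\<bar> \<le> 4 * R / r"
    proof -
      have *: "\<bar>(r * u - v) / r' - u\<bar> \<le> 4 * R / r" if "\<bar>u\<bar> \<le> 1" "\<bar>v\<bar> \<le> R" for u v
      proof -
        have "(r * u - v) / r' - u = (u * (r - r') - v) / r'" using r'2 by (simp add: field_simps)
        also have "\<bar>\<dots>\<bar> = \<bar>u * (r - r') - v\<bar> / r'" using r'2 by simp
        also have "\<bar>u * (r - r') - v\<bar> \<le> 1 * R + R"
          using that d R by (intro order_trans[OF abs_triangle_ineq4] add_mono) (auto simp: abs_mult intro!: mult_mono[of "\<bar>u\<bar>" 1, simplified])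
        then have "\<bar>u * (r - r') - v\<bar> / r' \<le> (1 * R + R) / (r / 2)" using r'2 r0 R by (intro frac_le) auto
        finally show ?thesis by simp
      qed
      show "\<bar>(r * c - b1) / r' - c\<bar> \<le> 4 * R / r" "\<bar>(r * s - b2) / r' - s\<bar> \<le> 4 * R / r" by (rule *; use cs1 b12 in simp)+
    qed
    have in1: "(r * c - b1) / r' \<in> {-1..1}" "(r * s - b2) / r' \<in> {-1..1}"
    proof -
      have "\<bar>r * c - b1\<bar> \<le> r'" "\<bar>r * s - b2\<bar> \<le> r'" unfolding r' by (auto intro!: real_le_rsqrt)
      then show "(r * c - b1) / r' \<in> {-1..1}" "(r * s - b2) / r' \<in> {-1..1}" using r'2 by (auto simp: field_simps abs_le_iff)
    qed
    have csI: "c \<in> {-1..1}" "s \<in> {-1..1}" using cs1 by auto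
    let ?f' = "f Y ((r * c - b1) / r') ((r * s - b2) / r')"
    have ff: "cmod (?f' - f Y c s) \<le> L * (8 * R / r)"
    proof -
      have "cmod (?f' - f Y c s) \<le> L * (\<bar>(r * c - b1) / r' - c\<bar> + \<bar>(r * s - b2) / r' - s\<bar>)"
        using bnd(3)[OF Y in1 csI] by simp
      also have "\<dots> \<le> L * (8 * R / r)" using dir bnd(2) by (intro mult_left_mono) auto
      finally show ?thesis .
    qed
    have nE: "cmod E = 1 / sqrt r" using r0 by (simp add: E_def norm_divide)
    have "far k r' = ((1 + \<i>) * of_real (sqrt (pi / k))) * E'" "far k r * exp (- \<i> * of_real (k * ?\<beta>)) = ((1 + \<i>) * of_real (sqrt (pi / k))) * E"
    proof -
      have e: "exp (\<i> * of_real (k * (r - ?\<beta>))) = exp (\<i> * of_real (k * r)) * exp (- \<i> * of_real (k * ?\<beta>))"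
        by (simp add: algebra_simps flip: exp_add)
      have q: "sqrt (pi / (k * t)) = sqrt (pi / k) / sqrt t" if "0 < t" for t
        using k that by (simp add: real_sqrt_mult real_sqrt_divide)
      show "far k r' = ((1 + \<i>) * of_real (sqrt (pi / k))) * E'"
        unfolding far_def E'_def q[OF r'2(2)] by simp
      show "far k r * exp (- \<i> * of_real (k * ?\<beta>)) = ((1 + \<i>) * of_real (sqrt (pi / k))) * E"
        unfolding far_def E_def q[OF r0(1)] e by simp
    qed
    then have "far k r' * ?f' - far k r * exp (- \<i> * of_real (k * ?\<beta>)) * f Y c s
       = ((1 + \<i>) * of_real (sqrt (pi / k))) * ((E' - E) * ?f' + E * (?f' - f Y c s))"
      by (simp add: algebra_simps)
    also have "cmod \<dots> = N * cmod ((E' - E) * ?f' + E * (?f' - f Y c s))" by (simp add: N_def norm_mult)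
    also have "\<dots> \<le> N * (A / (r * sqrt r) * M + 1 / sqrt r * (L * (8 * R / r)))"
    proof (intro mult_left_mono norm_triangle_mono N)
      show "cmod ((E' - E) * ?f') \<le> A / (r * sqrt r) * M"
        unfolding norm_mult using dE bnd(3)[OF Y in1 csI] bnd(1) by (intro mult_mono) (auto intro: order_trans[OF norm_ge_zero dE])
      show "cmod (E * (?f' - f Y c s)) \<le> 1 / sqrt r * (L * (8 * R / r))"
        unfolding norm_mult nE using ff r0 by (intro mult_left_mono) auto
    qed
    also have "\<dots> = N * (A * M + 8 * L * R) * r powr (-3/2)"
      unfolding powr_three_halves[OF r0(1)] using r0 by (simp add: field_simps)
    finally show "cmod (far k r' * ?f' - far k r * exp (- \<i> * of_real (k * ?\<beta>)) * f Y c s) \<le> N * (A * M + 8 * L * R) * r powr (-3/2)" .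
  qed (use N A bnd R in auto)
qed

section \<open>Differentiation of exponential integrals\<close>

lemma norm_exp_taylor1: "cmod (exp z - 1 - z) \<le> (cmod z)\<^sup>2 * exp (cmod z)"
  using Taylor_exp_field[of z 1] by (simp add: power2_eq_square mult.commute diff_diff_eq)

text \<open>
  The exponential margin \<open>\<epsilon>\<close> in the integrability assumption makes the second-order remainder of the exponential
  integrable for small increments. The same lemma serves for the gradient of the Fourier integrals, for the derivative of Laplace integrals, and for the
  derivative of the Gamma integral.
\<close>
lemma has_derivative_exp_integral:
  fixes G p q :: "real \<Rightarrow> complex" and la lb :: "'a::real_normed_vector \<Rightarrow> real"
  assumes l: "bounded_linear la" "bounded_linear lb" "\<And>h. \<bar>la h\<bar> \<le> norm h" "\<And>h. \<bar>lb h\<bar> \<le> norm h"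
    and [measurable]: "G \<in> borel_measurable borel" "p \<in> borel_measurable borel" "q \<in> borel_measurable borel"
    and \<epsilon>: "0 < \<epsilon>"
    and int: "integrable lborel (\<lambda>\<xi>. cmod (G \<xi>) * exp (\<epsilon> * (cmod (p \<xi>) + cmod (q \<xi>))))"
  shows "((\<lambda>y. LBINT \<xi>. G \<xi> * exp (p \<xi> * of_real (la (y - y0)) + q \<xi> * of_real (lb (y - y0)))) has_derivative
     (\<lambda>h. of_real (la h) * (LBINT \<xi>. G \<xi> * p \<xi>) + of_real (lb h) * (LBINT \<xi>. G \<xi> * q \<xi>))) (at y0)"
proof -
  define m where "m \<xi> = cmod (p \<xi>) + cmod (q \<xi>)" for \<xi>
  have m0: "0 \<le> m \<xi>" for \<xi> by (simp add: m_def)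
  define W where "W \<xi> = cmod (G \<xi>) * exp (\<epsilon> * m \<xi>)" for \<xi>
  have W: "integrable lborel W" using int by (simp add: W_def[abs_def] m_def)
  interpret la: bounded_linear la by (rule l)
  interpret lb: bounded_linear lb by (rule l)
  let ?z = "\<lambda>h \<xi>. p \<xi> * of_real (la h) + q \<xi> * of_real (lb h)"
  have z: "cmod (?z h \<xi>) \<le> norm h * m \<xi>" for h \<xi>
  proof -
    have "cmod (?z h \<xi>) \<le> cmod (p \<xi>) * norm h + cmod (q \<xi>) * norm h"
      by (intro norm_triangle_mono) (auto simp: norm_mult intro!: mult_left_mono l)
    then show ?thesis by (simp add: m_def algebra_simps)
  qed
  have me: "m \<xi> \<le> 1 / \<epsilon> * exp (\<epsilon> * m \<xi>)" for \<xi>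
  proof -
    have "\<epsilon> * m \<xi> \<le> exp (\<epsilon> * m \<xi>)" using exp_ge_add_one_self[of "\<epsilon> * m \<xi>"] by linarith
    then show ?thesis using \<epsilon> by (simp add: field_simps)
  qed
  have iGpq: "integrable lborel (\<lambda>\<xi>. G \<xi> * p \<xi>)" "integrable lborel (\<lambda>\<xi>. G \<xi> * q \<xi>)"
  proof -
    have *: "cmod (G \<xi>) * c \<le> 1 / \<epsilon> * W \<xi>" if "c \<le> m \<xi>" for c \<xi>
      using mult_left_mono[OF order_trans[OF that me], of "cmod (G \<xi>)"] by (simp add: W_def mult_ac)
    show "integrable lborel (\<lambda>\<xi>. G \<xi> * p \<xi>)" "integrable lborel (\<lambda>\<xi>. G \<xi> * q \<xi>)"
      by (rule Bochner_Integration.integrable_bound[OF integrable_mult_right[OF W, of "1 / \<epsilon>"]];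
          use * \<epsilon> in \<open>auto intro!: AE_I2 simp: norm_mult m_def abs_mult W_def\<close>)+
  qed
  have iE: "integrable lborel (\<lambda>\<xi>. G \<xi> * exp (?z h \<xi>))" if h: "norm h \<le> \<epsilon>" for h
  proof (rule Bochner_Integration.integrable_bound[OF W])
    show "AE \<xi> in lborel. norm (G \<xi> * exp (?z h \<xi>)) \<le> norm (W \<xi>)"
    proof (rule AE_I2)
      fix \<xi>
      have "cmod (exp (?z h \<xi>)) \<le> exp (cmod (?z h \<xi>))" by (rule norm_exp)
      also have "\<dots> \<le> exp (\<epsilon> * m \<xi>)" using z[of \<xi> h] mult_right_mono[OF h m0[of \<xi>]] by simp
      finally show "norm (G \<xi> * exp (?z h \<xi>)) \<le> norm (W \<xi>)" by (simp add: norm_mult W_def mult_left_mono del: norm_exp_eq_Re)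
    qed
  qed simp
  define C where "C = 8 / \<epsilon>\<^sup>2 * integral\<^sup>L lborel W"
  define F where "F h = (LBINT \<xi>. G \<xi> * exp (?z h \<xi>))" for h
  define F' where "F' h = of_real (la h) * (LBINT \<xi>. G \<xi> * p \<xi>) + of_real (lb h) * (LBINT \<xi>. G \<xi> * q \<xi>)" for h
  have est: "cmod (F h - F 0 - F' h) \<le> C * (norm h)\<^sup>2" if h: "norm h \<le> \<epsilon> / 2" for h
  proof -
    have i1: "integrable lborel (\<lambda>\<xi>. G \<xi> * exp (?z h \<xi>))" "integrable lborel (\<lambda>\<xi>. G \<xi>)"
      using iE[of h] iE[of 0] h \<epsilon> by (simp_all add: la.zero lb.zero)
    have "F h - F 0 - F' h = (LBINT \<xi>. G \<xi> * (exp (?z h \<xi>) - 1 - ?z h \<xi>))"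
    proof -
      have "(LBINT \<xi>. G \<xi> * (exp (?z h \<xi>) - 1 - ?z h \<xi>))
          = (LBINT \<xi>. G \<xi> * exp (?z h \<xi>) - G \<xi> - (of_real (la h) * (G \<xi> * p \<xi>) + of_real (lb h) * (G \<xi> * q \<xi>)))"
        by (simp add: algebra_simps)
      also have "\<dots> = F h - (LBINT \<xi>. G \<xi>) - F' h"
        unfolding F_def F'_def using i1 iGpq by simp
      finally show ?thesis by (simp add: F_def la.zero lb.zero)
    qed
    also have "cmod \<dots> \<le> (LBINT \<xi>. 8 / \<epsilon>\<^sup>2 * (norm h)\<^sup>2 * W \<xi>)"
    proof (rule Bochner_Integration.integral_norm_bound_integral)
      show "integrable lborel (\<lambda>\<xi>. 8 / \<epsilon>\<^sup>2 * (norm h)\<^sup>2 * W \<xi>)" using W by (rule integrable_mult_right)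
      have "integrable lborel (\<lambda>\<xi>. G \<xi> * exp (?z h \<xi>) - G \<xi> - (of_real (la h) * (G \<xi> * p \<xi>) + of_real (lb h) * (G \<xi> * q \<xi>)))"
        using i1 iGpq by simp
      then show "integrable lborel (\<lambda>\<xi>. G \<xi> * (exp (?z h \<xi>) - 1 - ?z h \<xi>))" by (simp add: algebra_simps)
      fix \<xi>
      have "(cmod (?z h \<xi>))\<^sup>2 * exp (cmod (?z h \<xi>)) \<le> (norm h * m \<xi>)\<^sup>2 * exp (\<epsilon> / 2 * m \<xi>)"
        using z[of \<xi> h] mult_right_mono[OF h m0[of \<xi>]] by (intro mult_mono power_mono) auto
      also have "\<dots> = (norm h)\<^sup>2 * ((m \<xi>)\<^sup>2 * exp (\<epsilon> / 2 * m \<xi>))" by (simp add: power_mult_distrib)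
      also have "(m \<xi>)\<^sup>2 * exp (\<epsilon> / 2 * m \<xi>) \<le> 8 / \<epsilon>\<^sup>2 * exp (\<epsilon> * m \<xi>)"
      proof -
        have "(\<epsilon> / 2 * m \<xi>)\<^sup>2 \<le> fact 2 * exp (\<epsilon> / 2 * m \<xi>)" using \<epsilon> m0 by (intro power_le_fact_exp) simp
        then have "(m \<xi>)\<^sup>2 \<le> 8 / \<epsilon>\<^sup>2 * exp (\<epsilon> / 2 * m \<xi>)" using \<epsilon> by (simp add: field_simps power_mult_distrib)
        from mult_right_mono[OF this, of "exp (\<epsilon> / 2 * m \<xi>)"] show ?thesis by (simp add: mult.assoc mult_exp_exp)
      qed
      finally have "cmod (exp (?z h \<xi>) - 1 - ?z h \<xi>) \<le> (norm h)\<^sup>2 * (8 / \<epsilon>\<^sup>2 * exp (\<epsilon> * m \<xi>))"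
        using norm_exp_taylor1[of "?z h \<xi>"] by (simp add: mult_left_mono)
      from mult_left_mono[OF this, of "cmod (G \<xi>)"]
      show "norm (G \<xi> * (exp (?z h \<xi>) - 1 - ?z h \<xi>)) \<le> 8 / \<epsilon>\<^sup>2 * (norm h)\<^sup>2 * W \<xi>"
        by (simp add: norm_mult W_def mult_ac)
    qed
    also have "\<dots> = C * (norm h)\<^sup>2" using W by (simp add: C_def mult_ac)
    finally show ?thesis .
  qed
  have bl: "bounded_linear F'" unfolding F'_def
    by (intro bounded_linear_add bounded_linear_mult_const[THEN bounded_linear_compose[of _ "\<lambda>h. of_real (la h)"]]
      bounded_linear_mult_const[THEN bounded_linear_compose[of _ "\<lambda>h. of_real (lb h)"]]
      bounded_linear_compose[OF bounded_linear_of_real] l bounded_linear_ident)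
  have "(F has_derivative F') (at 0)"
    unfolding has_derivative_at
  proof (intro conjI bl)
    have lim: "((\<lambda>h::'a. C * norm h) \<longlongrightarrow> 0) (at 0)"
      by (rule tendsto_mult_right_zero, rule tendsto_norm_zero, rule tendsto_ident_at)
    have "\<forall>\<^sub>F h in at 0. norm (norm (F (0 + h) - F 0 - F' h) / norm h) \<le> C * norm h"
      unfolding eventually_at
    proof (intro exI[of _ "\<epsilon> / 2"] conjI ballI impI)
      fix h :: 'a assume "h \<noteq> 0 \<and> dist h 0 < \<epsilon> / 2"
      then have h: "h \<noteq> 0" "norm h \<le> \<epsilon> / 2" by auto
      then show "norm (norm (F (0 + h) - F 0 - F' h) / norm h) \<le> C * norm h"
        using est[OF h(2)] by (simp add: divide_le_eq power2_eq_square mult_ac)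
    qed (use \<epsilon> in auto)
    then show "(\<lambda>h. norm (F (0 + h) - F 0 - F' h) / norm h) \<midarrow>0\<rightarrow> 0"
      by (rule Lim_null_comparison[OF _ lim])
  qed
  then have "((F \<circ> (\<lambda>y. y - y0)) has_derivative (F' \<circ> (\<lambda>h. h))) (at y0)"
    by (intro diff_chain_at) (auto intro!: derivative_eq_intros)
  then show ?thesis by (simp add: o_def F_def[abs_def] F'_def[abs_def])
qed

text \<open>
  This is \<open>\<Gamma>'(1) = - \<gamma>\<close>, by differentiating the Gamma integral under the integral sign.
\<close>
lemma integral_exp_ln:
  "has_bochner_integral lborel (\<lambda>u::real. indicator {0..} u * (exp (- u) * ln u)) (- euler_mascheroni)"
proof -
  define G where "G u = complex_of_real (indicator {0..} u * exp (- u))" for u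
  have pw: "exp (\<bar>ln u\<bar> / 2) \<le> u powr (1/2) + u powr (-1/2)" if "0 < u" for u :: real
    using that by (auto simp: powr_def abs_if)
  have W: "integrable lborel (\<lambda>u::real. indicator {0..} u * (u powr (1/2) * exp (- u)) + indicator {0..} u * (u powr (-1/2) * exp (- u)))"
    using has_bochner_integral_gamma[of "1/2" 1] has_bochner_integral_gamma[of "-1/2" 1]
    by (intro Bochner_Integration.integrable_add) (auto intro: integrable.intros)
  have Wb: "\<bar>ln u\<bar> * exp (- u) \<le> 2 * (u powr (1/2) * exp (- u) + u powr (-1/2) * exp (- u))" if "0 < u" for u :: real
  proof -
    have "\<bar>ln u\<bar> / 2 \<le> exp (\<bar>ln u\<bar> / 2)" using exp_ge_add_one_self[of "\<bar>ln u\<bar> / 2"] by linarith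
    from order_trans[OF this pw[OF that]] have "\<bar>ln u\<bar> \<le> 2 * (u powr (1/2) + u powr (-1/2))"
      by (simp add: divide_le_eq mult.commute)
    from mult_right_mono[OF this, of "exp (- u)"] show ?thesis by (simp add: algebra_simps)
  qed
  have D: "((\<lambda>x::real. LBINT u. G u * exp (of_real (ln u) * of_real (x - 0) + 0 * of_real 0)) has_derivative
     (\<lambda>h. of_real h * (LBINT u. G u * of_real (ln u)) + of_real 0 * (LBINT u. G u * 0))) (at 0)"
  proof (rule has_derivative_exp_integral[where la = "\<lambda>h. h" and lb = "\<lambda>h. 0" and q = "\<lambda>_. 0" and p = "\<lambda>u. of_real (ln u)" and \<epsilon> = "1/2"])
    show "integrable lborel (\<lambda>u. cmod (G u) * exp (1/2 * (cmod (of_real (ln u)) + cmod 0)))"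
    proof (rule Bochner_Integration.integrable_bound[OF W])
      show "AE u in lborel. norm (cmod (G u) * exp (1/2 * (cmod (of_real (ln u)) + cmod 0)))
        \<le> norm (indicator {0..} u * (u powr (1/2) * exp (- u)) + indicator {0..} u * (u powr (-1/2) * exp (- u)))"
        using AE_lborel_singleton[of 0]
      proof eventually_elim
        case (elim u)
        show ?case
        proof (cases "0 < u")
          case True
          then show ?thesis using mult_left_mono[OF pw[OF True], of "exp (- u)"]
            by (simp add: G_def norm_mult algebra_simps)
        qed (use elim in \<open>auto simp: G_def\<close>)
      qed
    qed (simp add: G_def)
  qed (auto simp: G_def)
  have eq: "(LBINT u. G u * exp (of_real (ln u) * of_real (x - 0) + 0 * of_real 0)) = of_real (Gamma (x + 1))" if "x > -1" for x :: real
  proof -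
    have "AE u in lborel. G u * exp (of_real (ln u) * of_real (x - 0) + 0 * of_real 0) = of_real (indicator {0..} u * (u powr x * exp (- 1 * u)))"
      using AE_lborel_singleton[of 0]
    proof eventually_elim
      case (elim u)
      then show ?case by (cases "0 < u") (auto simp: G_def powr_def mult.commute simp flip: exp_of_real)
    qed
    then have "(LBINT u. G u * exp (of_real (ln u) * of_real (x - 0) + 0 * of_real 0)) = (LBINT u. complex_of_real (indicator {0..} u * (u powr x * exp (- 1 * u))))"
      by (intro integral_cong_AE) (auto simp: G_def)
    also have "\<dots> = of_real (LBINT u. indicator {0..} u * (u powr x * exp (- 1 * u)))"
      by (rule integral_complex_of_real)
    also have "\<dots> = of_real (Gamma (x + 1))"
      using has_bochner_integral_integral_eq[OF has_bochner_integral_gamma[of x 1]] that by simp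
    finally show ?thesis .
  qed
  have iln: "integrable lborel (\<lambda>u::real. indicator {0..} u * (exp (- u) * ln u))"
  proof (rule Bochner_Integration.integrable_bound[OF integrable_mult_right[OF W, of 2]])
    show "AE u::real in lborel. norm (indicator {0..} u * (exp (- u) * ln u)) \<le> norm (2 * (indicator {0..} u * (u powr (1/2) * exp (- u)) + indicator {0..} u * (u powr (-1/2) * exp (- u))))"
      using AE_lborel_singleton[of 0]
    proof eventually_elim
      case (elim u)
      then show ?case using Wb[of u] by (cases "0 < u") (auto simp: abs_mult mult.commute)
    qed
  qed simp
  have val: "(LBINT u. G u * of_real (ln u)) = of_real (LBINT u::real. indicator {0..} u * (exp (- u) * ln u))"
    by (simp add: G_def mult.assoc flip: of_real_mult integral_of_real)
  let ?I = "LBINT u::real. indicator {0..} u * (exp (- u) * ln u)"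
  have "((\<lambda>x. complex_of_real (Gamma (x + 1))) has_derivative (\<lambda>h. of_real h * of_real ?I)) (at 0)"
  proof (rule has_derivative_transform_within_open[where s = "{-1<..}" and f = "\<lambda>x::real. LBINT u. G u * exp (of_real (ln u) * of_real (x - 0) + 0 * of_real 0)"])
    show "((\<lambda>x::real. LBINT u. G u * exp (of_real (ln u) * of_real (x - 0) + 0 * of_real 0)) has_derivative (\<lambda>h. of_real h * of_real ?I)) (at 0)"
      using D unfolding val by simp
  qed (use eq in auto)
  from bounded_linear.has_derivative[OF bounded_linear_Re this]
  have "((\<lambda>x. Gamma (x + 1)) has_real_derivative ?I) (at 0)" by (simp add: has_field_derivative_def mult_commute_abs)
  moreover have "((\<lambda>x. Gamma (x + 1)) has_real_derivative (- euler_mascheroni)) (at (0::real))"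
    by (auto intro!: derivative_eq_intros)
  ultimately have "?I = - euler_mascheroni" by (rule DERIV_unique)
  then show ?thesis using iln by (simp add: has_bochner_integral_iff)
qed

section \<open>The Bessel equation\<close>

definition pser :: "(nat \<Rightarrow> real) \<Rightarrow> real \<Rightarrow> real" where
  "pser c x = (\<Sum>n. c n * x ^ n)"

lemma pser_deriv:
  assumes "\<And>y. summable (\<lambda>n. c n * y ^ n)"
  shows "(pser c has_real_derivative pser (diffs c) x) (at x)"
  unfolding pser_def[abs_def] by (rule termdiffs_strong_converges_everywhere[OF assms])

text \<open>
  The operator \<open>d/dx (x d/dx)\<close> multiplies the coefficients by \<open>n\<^sup>2\<close> and shifts them; this matches the recursion of the
  Bessel coefficients.
\<close>
lemma pser_mult_deriv:
  assumes s: "\<And>y. summable (\<lambda>n. c n * y ^ n)"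
  shows "((\<lambda>x. x * pser (diffs c) x) has_real_derivative pser (\<lambda>n. real (Suc n) ^ 2 * c (Suc n)) x) (at x)"
proof -
  have sd: "summable (\<lambda>n. diffs c n * y ^ n)" for y
    by (rule termdiff_converges_all[OF s])
  have sn: "summable (\<lambda>n. (real n * c n) * y ^ n)" for y
  proof -
    have "summable (\<lambda>n. (real (Suc n) * c (Suc n)) * y ^ Suc n)"
      using summable_mult[OF sd[of y], of y] by (simp add: diffs_def mult_ac)
    then show ?thesis using summable_Suc_iff[of "\<lambda>n. (real n * c n) * y ^ n"] by simp
  qed
  have "pser (\<lambda>n. real n * c n) y = y * pser (diffs c) y" for y
  proof -
    have "pser (\<lambda>n. real n * c n) y = (\<Sum>n. (real (Suc n) * c (Suc n)) * y ^ Suc n)"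
      unfolding pser_def using suminf_split_head[OF sn[of y]] by simp
    also have "\<dots> = (\<Sum>n. y * (diffs c n * y ^ n))" by (simp add: diffs_def mult_ac)
    also have "\<dots> = y * pser (diffs c) y" unfolding pser_def by (rule suminf_mult[OF sd])
    finally show ?thesis .
  qed
  then have "(\<lambda>x. x * pser (diffs c) x) = pser (\<lambda>n. real n * c n)" by auto
  moreover have "diffs (\<lambda>n. real n * c n) = (\<lambda>n. real (Suc n) ^ 2 * c (Suc n))"
    by (auto simp: diffs_def power2_eq_square)
  ultimately show ?thesis using pser_deriv[OF sn, of x] by simp
qed

text \<open>
  The coefficients of the two series in the variable \<open>x = t\<^sup>2 / 4\<close>.
\<close>
definition jc :: "nat \<Rightarrow> real" where "jc m = (- 1) ^ m / (fact m)\<^sup>2"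
definition yc :: "nat \<Rightarrow> real" where "yc m = (- 1) ^ m * harm m / (fact m)\<^sup>2"

lemma harm_le: "harm m \<le> (fact m :: real)"
proof (induction m)
  case (Suc m)
  have "harm (Suc m) = harm m + inverse (real (Suc m))" by (simp add: harm_Suc)
  also have "\<dots> \<le> fact m + real m * fact m"
  proof (cases "m = 0")
    case False
    have "inverse (real (Suc m)) \<le> 1" by (simp add: inverse_eq_divide)
    also have "1 \<le> real m * fact m" using False by (intro mult_ge1_I) auto
    finally show ?thesis using Suc by simp
  qed (simp add: harm_def)
  also have "\<dots> = fact (Suc m)" by (simp add: algebra_simps)
  finally show ?case .
qed (simp add: harm_def)

lemma summable_jc: "summable (\<lambda>n. jc n * y ^ n)"
  and summable_yc: "summable (\<lambda>n. yc n * y ^ n)"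
proof -
  have S: "summable (\<lambda>n. \<bar>y\<bar> ^ n /\<^sub>R fact n)" by (rule summable_exp_generic)
  have f: "1 \<le> (fact n :: real)" for n by (rule fact_ge_1)
  show "summable (\<lambda>n. jc n * y ^ n)"
  proof (rule summable_comparison_test'[OF S])
    show "norm (jc n * y ^ n) \<le> \<bar>y\<bar> ^ n /\<^sub>R fact n" for n
    proof -
      have "\<bar>jc n\<bar> = 1 / (fact n * fact n)" by (simp add: jc_def power2_eq_square abs_mult power_abs)
      also have "\<dots> \<le> 1 / fact n" using f[of n] mult_left_mono[OF f[of n], of "fact n"] by (intro divide_left_mono) auto
      finally show ?thesis using mult_right_mono[of "\<bar>jc n\<bar>" "1 / fact n" "\<bar>y\<bar> ^ n"] by (simp add: abs_mult power_abs divide_inverse)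
    qed
  qed
  show "summable (\<lambda>n. yc n * y ^ n)"
  proof (rule summable_comparison_test'[OF S])
    show "norm (yc n * y ^ n) \<le> \<bar>y\<bar> ^ n /\<^sub>R fact n" for n
    proof -
      have "\<bar>yc n\<bar> = harm n / (fact n * fact n)" by (simp add: yc_def power2_eq_square abs_mult power_abs harm_nonneg)
      also have "\<dots> \<le> fact n / (fact n * fact n)" using harm_le[of n] by (intro divide_right_mono) auto
      also have "\<dots> = 1 / fact n" by simp
      finally show ?thesis using mult_right_mono[of "\<bar>yc n\<bar>" "1 / fact n" "\<bar>y\<bar> ^ n"] by (simp add: abs_mult power_abs divide_inverse)
    qed
  qed
qed

lemma jc_Suc: "real (Suc n) ^ 2 * jc (Suc n) = - jc n"
  by (simp add: jc_def power2_eq_square divide_simps)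

lemma yc_Suc: "real (Suc n) ^ 2 * yc (Suc n) = diffs jc n - yc n"
  by (simp add: yc_def jc_def diffs_def harm_Suc power2_eq_square divide_simps) (simp add: algebra_simps)

lemma pser_derivs:
  "(pser jc has_real_derivative pser (diffs jc) x) (at x)"
  "((\<lambda>x. x * pser (diffs jc) x) has_real_derivative - pser jc x) (at x)"
  "(pser yc has_real_derivative pser (diffs yc) x) (at x)"
  "((\<lambda>x. x * pser (diffs yc) x) has_real_derivative pser (diffs jc) x - pser yc x) (at x)"
proof -
  show "(pser jc has_real_derivative pser (diffs jc) x) (at x)" "(pser yc has_real_derivative pser (diffs yc) x) (at x)"
    by (rule pser_deriv[OF summable_jc] pser_deriv[OF summable_yc])+
  have "pser (\<lambda>n. real (Suc n) ^ 2 * jc (Suc n)) x = - pser jc x"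
    unfolding jc_Suc pser_def using suminf_minus[OF summable_jc[of x]] by simp
  then show "((\<lambda>x. x * pser (diffs jc) x) has_real_derivative - pser jc x) (at x)"
    using pser_mult_deriv[OF summable_jc, of x] by simp
  have "pser (\<lambda>n. real (Suc n) ^ 2 * yc (Suc n)) x = pser (diffs jc) x - pser yc x"
    unfolding yc_Suc pser_def using suminf_diff[OF termdiff_converges_all[OF summable_jc] summable_yc, of x x]
    by (simp add: left_diff_distrib)
  then show "((\<lambda>x. x * pser (diffs yc) x) has_real_derivative pser (diffs jc) x - pser yc x) (at x)"
    using pser_mult_deriv[OF summable_yc, of x] by simp
qed

lemma bessel_J0_pser: "bessel_J0 t = pser jc (t\<^sup>2 / 4)"
  unfolding bessel_J0_def pser_def jc_def by (simp add: field_simps)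
lemma bessel_Y0_pser: "bessel_Y0 t = 2 / pi * ((ln (t / 2) + euler_mascheroni) * pser jc (t\<^sup>2 / 4) - pser yc (t\<^sup>2 / 4))"
  unfolding bessel_Y0_def bessel_J0_pser pser_def yc_def by (simp add: field_simps)

text \<open>
  Bessel's equation \<open>t u'' + u' + t u = 0\<close> as a first-order system, with \<open>v = t u'\<close>.
\<close>
definition bessel_pair :: "(real \<Rightarrow> real) \<Rightarrow> (real \<Rightarrow> real) \<Rightarrow> bool" where
  "bessel_pair u v \<longleftrightarrow> (\<forall>t>0. (u has_real_derivative v t / t) (at t) \<and> (v has_real_derivative - (t * u t)) (at t))"

definition J0v :: "real \<Rightarrow> real" where "J0v t = 2 * (t\<^sup>2 / 4 * pser (diffs jc) (t\<^sup>2 / 4))"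
definition Y0v :: "real \<Rightarrow> real" where
  "Y0v t = 2 / pi * (pser jc (t\<^sup>2 / 4) + 2 * (ln (t / 2) + euler_mascheroni) * (t\<^sup>2 / 4 * pser (diffs jc) (t\<^sup>2 / 4))
     - 2 * (t\<^sup>2 / 4 * pser (diffs yc) (t\<^sup>2 / 4)))"

lemma quarter_square_deriv: "((\<lambda>t. t\<^sup>2 / 4) has_real_derivative t / 2) (at t)"
  by (auto intro!: derivative_eq_intros)

lemma bessel_pair_JY: "bessel_pair bessel_J0 J0v" "bessel_pair bessel_Y0 Y0v"
proof -
  note d = DERIV_chain2[OF pser_derivs(1) quarter_square_deriv] DERIV_chain2[OF pser_derivs(2) quarter_square_deriv]
    DERIV_chain2[OF pser_derivs(3) quarter_square_deriv] DERIV_chain2[OF pser_derivs(4) quarter_square_deriv]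
  show "bessel_pair bessel_J0 J0v"
    unfolding bessel_pair_def
  proof (intro allI impI conjI)
    fix t :: real assume t: "0 < t"
    show "(bessel_J0 has_real_derivative J0v t / t) (at t)"
      unfolding bessel_J0_pser[abs_def] by (rule DERIV_cong[OF d(1)]) (use t in \<open>simp add: J0v_def power2_eq_square\<close>)
    show "(J0v has_real_derivative - (t * bessel_J0 t)) (at t)"
      unfolding J0v_def[abs_def] bessel_J0_pser by (rule DERIV_cong[OF DERIV_cmult[OF d(2)]]) simp
  qed
  show "bessel_pair bessel_Y0 Y0v"
    unfolding bessel_pair_def
  proof (intro allI impI conjI)
    fix t :: real assume t: "0 < t"
    have dl: "((\<lambda>t. ln (t / 2) + euler_mascheroni) has_real_derivative 1 / t) (at t)"
      using t by (auto intro!: derivative_eq_intros)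
    let ?x = "t\<^sup>2 / 4"
    show "(bessel_Y0 has_real_derivative Y0v t / t) (at t)"
      unfolding bessel_Y0_pser[abs_def]
      by (rule DERIV_cong[OF DERIV_cmult[OF DERIV_diff[OF DERIV_mult[OF dl d(1)] d(3)]]])
        (use t in \<open>simp add: Y0v_def power2_eq_square field_simps\<close>)
    have e: "2 * (ln (s / 2) + euler_mascheroni) * (s\<^sup>2 / 4 * pser (diffs jc) (s\<^sup>2 / 4)) = 2 * ((ln (s / 2) + euler_mascheroni) * (s\<^sup>2 / 4 * pser (diffs jc) (s\<^sup>2 / 4)))" for s
      by simp
    show "(Y0v has_real_derivative - (t * bessel_Y0 t)) (at t)"
      unfolding Y0v_def[abs_def] bessel_Y0_pser e
      by (rule DERIV_cong[OF DERIV_cmult[OF DERIV_diff[OF DERIV_add[OF d(1) DERIV_cmult[OF DERIV_mult[OF dl d(2)]]] DERIV_cmult[OF d(4)]]]])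
        (use t in \<open>simp add: power2_eq_square field_simps\<close>)
  qed
qed

text \<open>
  The energy \<open>u\<^sup>2 + u'\<^sup>2\<close> is non-increasing along solutions, so it vanishes identically if it tends to \<open>0\<close> at the
  origin. That \<open>u' = v / t\<close> tends to \<open>0\<close> follows from \<open>v' = - t u\<close> with bounded \<open>u\<close>.
\<close>
lemma bessel_unique:
  assumes B: "bessel_pair u v" and u0: "(u \<longlongrightarrow> 0) (at_right 0)" and v0: "(v \<longlongrightarrow> 0) (at_right 0)" and t: "0 < t"
  shows "u t = 0"
proof -
  have du: "(u has_real_derivative v t / t) (at t)" and dv: "(v has_real_derivative - (t * u t)) (at t)" if "0 < t" for t
    using B that by (auto simp: bessel_pair_def)
  have "\<forall>\<^sub>F t in at_right 0. \<bar>u t\<bar> < 1" using u0 by (auto dest: tendstoD[where e = 1] simp: dist_norm)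
  then obtain \<delta> where \<delta>: "0 < \<delta>" "\<And>t. 0 < t \<Longrightarrow> t < \<delta> \<Longrightarrow> \<bar>u t\<bar> \<le> 1"
    unfolding eventually_at_right_field by force
  have vt: "\<bar>v t\<bar> \<le> t * t" if t: "0 < t" "t < \<delta>" for t
  proof -
    have "\<bar>v t - v s\<bar> \<le> t * t" if s: "0 < s" "s < t" for s
    proof -
      have "norm (v t - v s) \<le> t * norm (t - s)"
      proof (rule field_differentiable_bound[where S = "{s..t}"])
        show "(v has_field_derivative - (z * u z)) (at z within {s..t})" if "z \<in> {s..t}" for z
          using dv[of z] that s by (auto intro: has_field_derivative_at_within)
        show "norm (- (z * u z)) \<le> t" if "z \<in> {s..t}" for z
          using \<delta>(2)[of z] that s t mult_mono[of z t "\<bar>u z\<bar>" 1] by (auto simp: abs_mult)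
      qed (use s in auto)
      also have "\<dots> \<le> t * t" using s t by (intro mult_left_mono) auto
      finally show ?thesis by simp
    qed
    then have ev: "\<forall>\<^sub>F s in at_right 0. \<bar>v t - v s\<bar> \<le> t * t"
      using t by (auto simp: eventually_at_right_field)
    have "((\<lambda>s. \<bar>v t - v s\<bar>) \<longlongrightarrow> \<bar>v t - 0\<bar>) (at_right 0)" by (intro tendsto_intros v0)
    from tendsto_upperbound[OF this ev] show ?thesis by simp
  qed
  define E where "E t = (u t)\<^sup>2 + (v t / t)\<^sup>2" for t
  have "((\<lambda>t. v t / t) \<longlongrightarrow> 0) (at_right 0)"
  proof (rule Lim_null_comparison)
    show "\<forall>\<^sub>F t in at_right 0. norm (v t / t) \<le> t"
      unfolding eventually_at_right_field using \<delta>(1) vt by (intro exI[of _ \<delta>]) (auto simp: divide_le_eq)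
  qed (rule tendsto_ident_at)
  then have E0: "(E \<longlongrightarrow> 0\<^sup>2 + 0\<^sup>2) (at_right 0)" unfolding E_def[abs_def] by (intro tendsto_intros u0)
  have mono: "E t \<le> E s" if s: "0 < s" "s \<le> t" for s t
  proof (rule DERIV_nonpos_imp_nonincreasing[OF s(2)])
    fix x assume "s \<le> x" "x \<le> t"
    then have x: "0 < x" using s by simp
    have "(E has_real_derivative (2 * u x * (v x / x) + 2 * (v x / x) * ((- (x * u x) * x - v x * 1) / (x * x)))) (at x)"
      unfolding E_def[abs_def] using du[OF x] dv[OF x] x by (auto intro!: derivative_eq_intros simp: mult_ac)
    moreover have "2 * u x * (v x / x) + 2 * (v x / x) * ((- (x * u x) * x - v x * 1) / (x * x)) = - 2 * (v x)\<^sup>2 / x ^ 3"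
      using x by (simp add: field_simps power2_eq_square power3_eq_cube)
    moreover have "- 2 * (v x)\<^sup>2 / x ^ 3 \<le> 0" using x by (simp add: divide_nonpos_nonneg)
    ultimately show "\<exists>y. (E has_real_derivative y) (at x) \<and> y \<le> 0" by metis
  qed
  have "E t \<le> 0\<^sup>2 + 0\<^sup>2"
    by (rule tendsto_lowerbound[OF E0]) (use mono[of _ t] t in \<open>auto simp: eventually_at_right_field intro!: exI[of _ t]\<close>)
  then have "(u t)\<^sup>2 + (v t / t)\<^sup>2 \<le> 0" by (simp add: E_def)
  then show ?thesis using sum_power2_le_zero_iff by blast
qed

section \<open>A Laplace integral solving the Bessel equation\<close>

text \<open>
  The root in the Laplace integral after scaling the variable by \<open>t\<close>; \<open>hroot 1\<close> is the unscaled version.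
\<close>
definition hroot :: "real \<Rightarrow> real \<Rightarrow> complex" where
  "hroot t u = csqrt (of_real u * (of_real u - 2 * \<i> * of_real t))"

lemma hroot_facts:
  assumes u: "0 < u" and t: "0 < t"
  shows "(hroot t u)\<^sup>2 = of_real u * (of_real u - 2 * \<i> * of_real t)" "0 < Re (hroot t u)" "hroot t u \<noteq> 0"
    "cmod (hroot t u) = sqrt u * sqrt (cmod (of_real u - 2 * \<i> * of_real t))"
    "of_real u * (of_real u - 2 * \<i> * of_real t) \<notin> \<real>\<^sub>\<le>\<^sub>0"
    "Im (hroot t u) < 0"
    "(hroot t has_vector_derivative (of_real u - \<i> * of_real t) / hroot t u) (at u)"
    "isCont (hroot t) u"
    "u \<le> cmod (hroot t u)" "sqrt (2 * t) * sqrt u \<le> cmod (hroot t u)"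
proof -
  let ?z = "\<lambda>u. of_real u * (of_real u - 2 * \<i> * of_real t) :: complex"
  have Re: "Re (?z u) = u\<^sup>2" and Im: "Im (?z u) = - 2 * t * u" by (simp_all add: power2_eq_square)
  show nz: "?z u \<notin> \<real>\<^sub>\<le>\<^sub>0" using u t Im by (simp add: complex_nonpos_Reals_iff)
  show sq: "(hroot t u)\<^sup>2 = ?z u" by (simp add: hroot_def)
  have "csqrt (?z u) \<notin> \<real>\<^sub>\<le>\<^sub>0" using nz by auto
  show Rp: "0 < Re (hroot t u)"
  proof -
    have "Im ((hroot t u)\<^sup>2) = 2 * Re (hroot t u) * Im (hroot t u)" by (simp add: power2_eq_square)
    then have "Re (hroot t u) * Im (hroot t u) \<noteq> 0" using sq Im u t by auto
    then have "Re (hroot t u) \<noteq> 0" by auto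
    then show ?thesis using csqrt_principal[of "?z u"] by (auto simp: hroot_def)
  qed
  then show nz2: "hroot t u \<noteq> 0" by auto
  show "Im (hroot t u) < 0"
  proof -
    have "2 * Re (hroot t u) * Im (hroot t u) = - 2 * t * u"
      using sq Im by (metis Im_power2)
    moreover have "0 < t * u" using u t by simp
    ultimately have "Re (hroot t u) * Im (hroot t u) < 0" by linarith
    then show ?thesis using Rp by (simp add: mult_less_0_iff)
  qed
  show nm: "cmod (hroot t u) = sqrt u * sqrt (cmod (of_real u - 2 * \<i> * of_real t))"
    using u by (simp add: hroot_def norm_mult real_sqrt_mult)
  have "((\<lambda>z::complex. z * (z - 2 * \<i> * of_real t)) has_field_derivative 2 * (of_real u - \<i> * of_real t)) (at (of_real u))"
    by (rule derivative_eq_intros refl)+ (simp add: algebra_simps)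
  then have "((\<lambda>z. csqrt (z * (z - 2 * \<i> * of_real t))) has_field_derivative (2 * (of_real u - \<i> * of_real t)) / (2 * csqrt (?z u))) (at (of_real u))"
    by (rule has_field_derivative_csqrt') (rule nz)
  then have "((\<lambda>u. csqrt (?z u)) has_vector_derivative (2 * (of_real u - \<i> * of_real t)) / (2 * csqrt (?z u))) (at u)"
    by (rule has_vector_derivative_real_field)
  moreover have "(2 * (of_real u - \<i> * of_real t)) / (2 * csqrt (?z u)) = (of_real u - \<i> * of_real t) / hroot t u"
    unfolding hroot_def by (rule mult_divide_mult_cancel_left) simp
  ultimately show "(hroot t has_vector_derivative (of_real u - \<i> * of_real t) / hroot t u) (at u)"
    by (simp only: hroot_def[abs_def])
  then show "isCont (hroot t) u" by (rule has_vector_derivative_continuous)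
  have "u \<le> cmod (of_real u - 2 * \<i> * of_real t)" "2 * t \<le> cmod (of_real u - 2 * \<i> * of_real t)"
    using abs_Re_le_cmod[of "of_real u - 2 * \<i> * of_real t"] abs_Im_le_cmod[of "of_real u - 2 * \<i> * of_real t"] u t by auto
  then have "sqrt u \<le> sqrt (cmod (of_real u - 2 * \<i> * of_real t))" "sqrt (2 * t) \<le> sqrt (cmod (of_real u - 2 * \<i> * of_real t))" by simp_all
  from mult_left_mono[OF this(1), of "sqrt u"] mult_left_mono[OF this(2), of "sqrt u"]
  show "u \<le> cmod (hroot t u)" "sqrt (2 * t) * sqrt u \<le> cmod (hroot t u)"
    unfolding nm using u by (simp_all add: mult.commute)
qed

text \<open>
  The fundamental theorem on the open half-line in terms of the Lebesgue integral over all of \<open>\<real>\<close>.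
\<close>
lemma halfline_FTC:
  fixes f F :: "real \<Rightarrow> complex"
  assumes "\<And>u. 0 < u \<Longrightarrow> (F has_vector_derivative f u) (at u)" "\<And>u. 0 < u \<Longrightarrow> isCont f u"
    "integrable lborel (\<lambda>u. indicator {0<..} u *\<^sub>R f u)" "(F \<longlongrightarrow> A) (at_right 0)" "(F \<longlongrightarrow> B) at_top"
  shows "(LBINT u. indicator {0<..} u *\<^sub>R f u) = B - A"
proof -
  have e: "einterval 0 \<infinity> = {0<..}" by (auto simp: einterval_def zero_ereal_def)
  have "(LBINT u=0..\<infinity>. f u) = B - A"
    by (rule interval_integral_FTC_integrable[where F = F])
      (use assms in \<open>auto simp: ereal_tendsto_simps zero_ereal_def set_integrable_def e[unfolded zero_ereal_def]\<close>)
  then show ?thesis by (simp add: interval_lebesgue_integral_def set_lebesgue_integral_def e)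
qed

lemma integrable_halfline_powr:
  fixes p c :: real assumes "p > -1" "c > 0"
  shows "has_bochner_integral lborel (\<lambda>u. indicator {0<..} u *\<^sub>R (u powr p * exp (- (c * u)))) (Gamma (p + 1) / c powr (p + 1))"
proof -
  have "(\<lambda>u. indicator {0<..} u *\<^sub>R (u powr p * exp (- (c * u)))) = (\<lambda>t. indicator {0..} t * (t powr p * exp (- c * t)))"
    by (auto simp: fun_eq_iff indicator_def)
  then show ?thesis using has_bochner_integral_gamma[OF assms] by simp
qed

text \<open>
  Continuity on the open half-line yields measurability, so a pointwise bound suffices.
\<close>
lemma integrable_halfline:
  fixes f :: "real \<Rightarrow> complex"
  assumes c: "continuous_on {0<..} f" and g: "integrable lborel (\<lambda>u. indicator {0<..} u *\<^sub>R g u)" and le: "\<And>u. 0 < u \<Longrightarrow> cmod (f u) \<le> (g u :: real)"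
  shows "integrable lborel (\<lambda>u. indicator {0<..} u *\<^sub>R f u)"
proof (rule Bochner_Integration.integrable_bound[OF g])
  show "(\<lambda>u. indicator {0<..} u *\<^sub>R f u) \<in> borel_measurable lborel"
    using borel_measurable_continuous_on_indicator[OF _ c] by simp
  show "AE u in lborel. norm (indicator {0<..} u *\<^sub>R f u) \<le> norm (indicator {0<..} u *\<^sub>R g u)"
  proof (rule AE_I2)
    fix u :: real
    show "norm (indicator {0<..} u *\<^sub>R f u) \<le> norm (indicator {0<..} u *\<^sub>R g u)"
    proof (cases "0 < u")
      case True
      from order_trans[OF le[OF this] abs_ge_self] show ?thesis using True by simp
    qed simp
  qed
qed

lemma hroot_cont: "0 < t \<Longrightarrow> continuous_on {0<..} (hroot t)"
  by (intro continuous_at_imp_continuous_on ballI hroot_facts(8)) simp_all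

definition lap :: "nat \<Rightarrow> real \<Rightarrow> complex" where
  "lap n t = (LBINT w. indicator {0<..} w *\<^sub>R (of_real (w ^ n * exp (- (t * w))) / hroot 1 w))"

lemma lap_term_bound:
  assumes w: "0 < w"
  shows "cmod (of_real (w ^ n * exp (- (t * w))) / hroot 1 w) \<le> w powr (real n - 1/2) * exp (- (t * w))"
proof -
  have "sqrt w \<le> sqrt 2 * sqrt w" using w by (simp add: mult_le_cancel_right1)
  also have "\<dots> \<le> cmod (hroot 1 w)" using hroot_facts(10)[OF w, of 1] by simp
  finally have "w ^ n * exp (- (t * w)) / cmod (hroot 1 w) \<le> w ^ n * exp (- (t * w)) / sqrt w"
    using w hroot_facts(3)[OF w, of 1] by (intro divide_left_mono) auto
  also have "\<dots> = w powr (real n - 1/2) * exp (- (t * w))"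
    using w by (simp add: powr_diff powr_realpow powr_half_sqrt)
  finally show ?thesis using w by (simp add: norm_divide norm_mult norm_power)
qed

lemma integrable_lap:
  assumes "0 < t" shows "integrable lborel (\<lambda>w. indicator {0<..} w *\<^sub>R (of_real (w ^ n * exp (- (t * w))) / hroot 1 w))"
proof (rule integrable_halfline[OF _ integrable.intros[OF integrable_halfline_powr[of "real n - 1/2" t]] lap_term_bound])
  show "continuous_on {0<..} (\<lambda>w. of_real (w ^ n * exp (- (t * w))) / hroot 1 w)"
    using hroot_facts(3)[of _ 1] by (intro continuous_intros hroot_cont) auto
qed (use assms in auto)

lemma lap_deriv:
  assumes t: "0 < t" shows "(lap n has_vector_derivative - lap (Suc n) t) (at t)"
proof -
  define G where "G w = indicator {0<..} w *\<^sub>R (of_real (w ^ n * exp (- (t * w))) / hroot 1 w)" for w :: real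
  have mG: "G \<in> borel_measurable borel" using integrable_lap[OF t, of n] unfolding G_def[abs_def] by auto
  have "((\<lambda>y::real. LBINT w. G w * exp (of_real (- w) * of_real (y - t) + 0 * of_real 0)) has_derivative
     (\<lambda>h. of_real h * (LBINT w. G w * of_real (- w)) + of_real 0 * (LBINT w. G w * 0))) (at t)"
  proof (rule has_derivative_exp_integral[where la = "\<lambda>h. h" and lb = "\<lambda>h. 0" and q = "\<lambda>_. 0" and p = "\<lambda>w. of_real (- w)" and \<epsilon> = "t/2"])
    have "integrable lborel (\<lambda>w. norm (indicator {0<..} w *\<^sub>R (of_real (w ^ n * exp (- (t / 2 * w))) / hroot 1 w)))"
      using integrable_lap[of "t/2" n] t by (intro integrable_norm) auto
    moreover have "cmod (G w) * exp (t / 2 * (cmod (of_real (- w)) + cmod 0)) = norm (indicator {0<..} w *\<^sub>R (of_real (w ^ n * exp (- (t / 2 * w))) / hroot 1 w))" for w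
    proof (cases "0 < w")
      case True
      have "exp (- (t * w)) * exp (t / 2 * w) = exp (- (t / 2 * w))" by (simp add: mult_exp_exp)
      then show ?thesis using True by (simp add: G_def norm_divide norm_mult norm_power mult_ac)
    qed (simp add: G_def)
    ultimately show "integrable lborel (\<lambda>w. cmod (G w) * exp (t / 2 * (cmod (of_real (- w)) + cmod 0)))" by simp
  qed (use mG t in auto)
  moreover have "(LBINT w. G w * exp (of_real (- w) * of_real (y - t) + 0 * of_real 0)) = lap n y" for y
    unfolding lap_def
  proof (rule Bochner_Integration.integral_cong[OF refl])
    fix w :: real
    have "complex_of_real (exp (- (t * w))) * exp (of_real (- w) * of_real (y - t)) = of_real (exp (- (y * w)))"
      by (simp add: exp_of_real[symmetric] mult_exp_exp algebra_simps flip: exp_of_real)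
    then show "G w * exp (of_real (- w) * of_real (y - t) + 0 * of_real 0) = indicator {0<..} w *\<^sub>R (of_real (w ^ n * exp (- (y * w))) / hroot 1 w)"
      by (simp add: G_def mult.assoc)
  qed
  moreover have "(LBINT w. G w * of_real (- w)) = - lap (Suc n) t"
  proof -
    have "(LBINT w. G w * of_real (- w)) = (LBINT w. - (indicator {0<..} w *\<^sub>R (of_real (w ^ Suc n * exp (- (t * w))) / hroot 1 w)))"
      by (rule Bochner_Integration.integral_cong[OF refl]) (simp add: G_def mult_ac)
    then show ?thesis by (simp add: lap_def)
  qed
  ultimately show ?thesis
    by (simp add: has_vector_derivative_def scaleR_conv_of_real)
qed

text \<open>
  Integrate the derivative of \<open>exp (- t w) sqrt (w (w - 2 \<i>))\<close>, which vanishes at both ends. Together with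
  \<open>lap n' = - lap (n + 1)\<close> this is Bessel's equation for \<open>exp (\<i> t) lap 0 t\<close>.
\<close>
lemma lap_ode:
  assumes t: "0 < t"
  shows "of_real t * (lap 2 t - 2 * \<i> * lap 1 t) = lap 1 t - \<i> * lap 0 t"
proof -
  let ?e = "\<lambda>w. complex_of_real (exp (- (t * w)))"
  define f where "f w = of_real t * ?e w * hroot 1 w - ?e w * (of_real w - \<i>) / hroot 1 w" for w
  note h = hroot_facts[where t = 1, simplified]
  have fw: "f w = of_real t * (of_real (w ^ 2 * exp (- (t * w))) / hroot 1 w - 2 * \<i> * (of_real (w ^ 1 * exp (- (t * w))) / hroot 1 w))
     - (of_real (w ^ 1 * exp (- (t * w))) / hroot 1 w - \<i> * (of_real (w ^ 0 * exp (- (t * w))) / hroot 1 w))" if w: "0 < w" for w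
  proof -
    have "hroot 1 w = of_real w * (of_real w - 2 * \<i>) / hroot 1 w"
      using h(1)[OF w] h(3)[OF w] by (simp add: power2_eq_square eq_divide_eq)
    then have "f w = of_real t * ?e w * (of_real w * (of_real w - 2 * \<i>) / hroot 1 w) - ?e w * (of_real w - \<i>) / hroot 1 w"
      unfolding f_def by simp
    also have "\<dots> = of_real t * (of_real (w ^ 2 * exp (- (t * w))) / hroot 1 w - 2 * \<i> * (of_real (w ^ 1 * exp (- (t * w))) / hroot 1 w))
     - (of_real (w ^ 1 * exp (- (t * w))) / hroot 1 w - \<i> * (of_real (w ^ 0 * exp (- (t * w))) / hroot 1 w))"
      using h(3)[OF w] by (simp add: field_simps power2_eq_square)
    finally show ?thesis .
  qed
  define g where "g n w = indicator {0<..} w *\<^sub>R (complex_of_real (w ^ n * exp (- (t * w))) / hroot 1 w)" for n w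
  have fi: "indicator {0<..} w *\<^sub>R f w = of_real t * (g 2 w - 2 * \<i> * g 1 w) - (g 1 w - \<i> * g 0 w)" for w
    using fw[of w] unfolding g_def by (cases "0 < w") auto
  have il: "integrable lborel (g n)" for n unfolding g_def[abs_def] by (rule integrable_lap[OF t])
  have gl: "integral\<^sup>L lborel (g n) = lap n t" for n by (simp add: g_def[abs_def] lap_def)
  have int: "(LBINT w. indicator {0<..} w *\<^sub>R f w) = of_real t * (lap 2 t - 2 * \<i> * lap 1 t) - (lap 1 t - \<i> * lap 0 t)"
    unfolding fi gl[symmetric] using il by simp
  have "(LBINT w. indicator {0<..} w *\<^sub>R f w) = 0 - 0"
  proof (rule halfline_FTC[where F = "\<lambda>w. - ?e w * hroot 1 w"])
    fix w :: real assume w: "0 < w"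
    have "(?e has_vector_derivative of_real (- t * exp (- (t * w)))) (at w)"
      by (rule has_vector_derivative_of_real) (auto intro!: derivative_eq_intros)
    then have "((\<lambda>w. - ?e w * hroot 1 w) has_vector_derivative (- ?e w * ((of_real w - \<i>) / hroot 1 w) + - of_real (- t * exp (- (t * w))) * hroot 1 w)) (at w)"
      by (intro has_vector_derivative_mult has_vector_derivative_minus h(7)[OF w])
    moreover have "- ?e w * ((of_real w - \<i>) / hroot 1 w) + - of_real (- t * exp (- (t * w))) * hroot 1 w = f w"
      by (simp add: f_def)
    ultimately show "((\<lambda>w. - ?e w * hroot 1 w) has_vector_derivative f w) (at w)" by (simp only:)
    show "isCont f w" unfolding f_def[abs_def] using h(3,8)[OF w] by (intro continuous_intros) auto
  next
    show "integrable lborel (\<lambda>w. indicator {0<..} w *\<^sub>R f w)" unfolding fi using il by simp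
    have nb: "norm (- ?e w * hroot 1 w) \<le> exp (- (t * w)) * (sqrt w * sqrt (w + 2))" if "0 < w" for w
    proof -
      have "cmod (of_real w - 2 * \<i>) \<le> w + 2" using that norm_triangle_ineq4[of "of_real w" "2 * \<i>"] by (simp add: norm_mult)
      then show ?thesis using h(4)[OF that] that by (simp add: norm_mult mult_left_mono)
    qed
    have "((\<lambda>w. exp (- (t * w)) * (sqrt w * sqrt (w + 2))) \<longlongrightarrow> 0) (at_right 0)" using t by real_asymp
    then show "((\<lambda>w. - ?e w * hroot 1 w) \<longlongrightarrow> 0) (at_right 0)"
      by (rule Lim_null_comparison[rotated]) (use nb in \<open>auto simp: eventually_at_right_field intro!: exI[of _ 1]\<close>)
    have "((\<lambda>w. exp (- (t * w)) * (sqrt w * sqrt (w + 2))) \<longlongrightarrow> 0) at_top" using t by real_asymp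
    then show "((\<lambda>w. - ?e w * hroot 1 w) \<longlongrightarrow> 0) at_top"
      by (rule Lim_null_comparison[rotated]) (use nb in \<open>auto simp: eventually_at_top_dense intro!: exI[of _ 0]\<close>)
  qed
  then show ?thesis using int by simp
qed

section \<open>The Laplace integral for small arguments\<close>

lemma hroot_scale: 
  assumes "0 < t" "0 < u" shows "hroot 1 (u / t) = hroot t u / of_real t"
proof -
  have "of_real (u / t) * (of_real (u / t) - 2 * \<i> * of_real 1) = (hroot t u / of_real t)\<^sup>2"
    using assms hroot_facts(1)[OF assms(2,1)] by (simp add: power_divide field_simps power2_eq_square)
  moreover have "0 < Re (hroot t u / of_real t)" using hroot_facts(2)[OF assms(2,1)] assms by simp
  then have "csqrt ((hroot t u / of_real t)\<^sup>2) = hroot t u / of_real t" by (intro csqrt_square disjI1)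
  ultimately show ?thesis unfolding hroot_def[of 1] by simp
qed

lemma lap_scaled:
  assumes t: "0 < t"
  shows "of_real (t ^ n) * lap n t = (LBINT u. indicator {0<..} u *\<^sub>R (of_real (u ^ n * exp (- u)) / hroot t u))"
proof -
  define g where "g u = indicator {0<..} u *\<^sub>R (complex_of_real (u ^ n * exp (- u)) / hroot t u)" for u
  have "lap n t = \<bar>1 / t\<bar> *\<^sub>R (LBINT u. indicator {0<..} (0 + (1 / t) * u) *\<^sub>R (of_real ((0 + (1 / t) * u) ^ n * exp (- (t * (0 + (1 / t) * u)))) / hroot 1 (0 + (1 / t) * u)))"
    unfolding lap_def using t by (intro lborel_integral_real_affine) simp
  also have "(\<lambda>u. indicator {0<..} (0 + (1 / t) * u) *\<^sub>R (of_real ((0 + (1 / t) * u) ^ n * exp (- (t * (0 + (1 / t) * u)))) / hroot 1 (0 + (1 / t) * u)))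
      = (\<lambda>u. of_real (t / t ^ n) * g u)"
  proof
    fix u :: real
    show "indicator {0<..} (0 + (1 / t) * u) *\<^sub>R (of_real ((0 + (1 / t) * u) ^ n * exp (- (t * (0 + (1 / t) * u)))) / hroot 1 (0 + (1 / t) * u))
      = of_real (t / t ^ n) * g u"
    proof (cases "0 < u")
      case True
      then show ?thesis using t hroot_scale[OF t True] by (simp add: g_def power_divide)
    next
      case False
      then have "\<not> 0 < u / t" using t by (simp add: zero_less_divide_iff)
      then show ?thesis using False by (simp add: g_def)
    qed
  qed
  also have "(LBINT u. of_real (t / t ^ n) * g u) = of_real (t / t ^ n) * integral\<^sup>L lborel g"
    by (rule integral_mult_right_zero)
  finally show ?thesis using t unfolding g_def[symmetric] by (simp add: scaleR_conv_of_real)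
qed

text \<open>
  The logarithm of this function of \<open>u\<close> is a primitive of \<open>1 / hroot t u\<close>.
\<close>
definition lroot :: "real \<Rightarrow> real \<Rightarrow> complex" where
  "lroot t u = of_real u - \<i> * of_real t + hroot t u"

lemma lroot_facts:
  assumes u: "0 < u" and t: "0 < t"
  shows "u \<le> Re (lroot t u)" "lroot t u \<notin> \<real>\<^sub>\<le>\<^sub>0" "t \<le> 1 \<Longrightarrow> cmod (lroot t u) \<le> 2 * u + 2"
    "t \<le> 1 \<Longrightarrow> cmod (Ln (lroot t u)) \<le> \<bar>ln u\<bar> + 2 * u + 6"
    "((\<lambda>u. Ln (lroot t u)) has_vector_derivative 1 / hroot t u) (at u)"
proof -
  note h = hroot_facts[OF u t]
  show re: "u \<le> Re (lroot t u)" using h(2) by (simp add: lroot_def)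
  then show nz: "lroot t u \<notin> \<real>\<^sub>\<le>\<^sub>0" using u by (auto simp: complex_nonpos_Reals_iff)
  show cm: "cmod (lroot t u) \<le> 2 * u + 2" if t1: "t \<le> 1"
  proof -
    have "cmod (of_real u - 2 * \<i> * of_real t) \<le> u + 2"
      using norm_triangle_ineq4[of "of_real u" "2 * \<i> * of_real t"] u t t1 by (simp add: norm_mult)
    then have "cmod (hroot t u) \<le> sqrt u * sqrt (u + 2)" unfolding h(4) using u by (intro mult_left_mono) auto
    also have "\<dots> = sqrt (u * (u + 2))" by (simp add: real_sqrt_mult)
    also have "\<dots> \<le> u + 1" using u by (intro real_le_lsqrt) (auto simp: power2_eq_square algebra_simps)
    finally have "cmod (hroot t u) \<le> u + 1" .
    moreover have "cmod (of_real u - \<i> * of_real t) \<le> u + 1"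
      using norm_triangle_ineq4[of "of_real u" "\<i> * of_real t"] u t t1 by (simp add: norm_mult)
    ultimately show ?thesis unfolding lroot_def by (intro norm_triangle_le) linarith
  qed
  show "cmod (Ln (lroot t u)) \<le> \<bar>ln u\<bar> + 2 * u + 6" if t1: "t \<le> 1"
  proof -
    have n0: "lroot t u \<noteq> 0" using nz by auto
    have "u \<le> cmod (lroot t u)" using re abs_Re_le_cmod[of "lroot t u"] u by linarith
    then have "ln u \<le> ln (cmod (lroot t u))" by (subst ln_le_cancel_iff) (use u n0 in auto)
    moreover have "ln (cmod (lroot t u)) \<le> 2 * u + 2"
      using ln_bound[of "cmod (lroot t u)"] cm[OF t1] n0 by simp
    ultimately have "\<bar>ln (cmod (lroot t u))\<bar> \<le> \<bar>ln u\<bar> + 2 * u + 2" using u by linarith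
    then have "\<bar>Re (Ln (lroot t u))\<bar> \<le> \<bar>ln u\<bar> + 2 * u + 2" using n0 by simp
    moreover have "\<bar>Im (Ln (lroot t u))\<bar> \<le> 4" using Im_Ln_le_pi[OF n0] mpi_less_Im_Ln[OF n0] pi_less_4 by linarith
    ultimately show ?thesis using cmod_le[of "Ln (lroot t u)"] by linarith
  qed
  have "(lroot t has_vector_derivative 1 + (of_real u - \<i> * of_real t) / hroot t u) (at u)"
    unfolding lroot_def[abs_def] by (rule derivative_eq_intros h(7) refl)+ simp
  moreover have "1 + (of_real u - \<i> * of_real t) / hroot t u = lroot t u / hroot t u"
    using h(3) by (simp add: lroot_def field_simps)
  ultimately have "(lroot t has_vector_derivative lroot t u / hroot t u) (at u)" by simp
  from field_vector_diff_chain_at[OF this has_field_derivative_Ln[OF nz]]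
  have "((Ln \<circ> lroot t) has_vector_derivative lroot t u / hroot t u * inverse (lroot t u)) (at u)" .
  moreover have "lroot t u / hroot t u * inverse (lroot t u) = 1 / hroot t u" using nz h(3) by (auto simp: field_simps)
  ultimately show "((\<lambda>u. Ln (lroot t u)) has_vector_derivative 1 / hroot t u) (at u)" by (simp only: o_def)
qed

text \<open>
  A majorant for \<open>exp (- u) Ln (lroot t u)\<close> that works for all \<open>t \<in> (0, 1]\<close> at once.
\<close>
definition logdom :: "real \<Rightarrow> real" where "logdom u = exp (- u) * (\<bar>ln u\<bar> + 2 * u + 6)"

lemma integrable_logdom: "integrable lborel (\<lambda>u. indicator {0<..} u *\<^sub>R logdom u)"
proof -
  have 1: "integrable lborel (\<lambda>u::real. \<bar>indicator {0..} u * (exp (- u) * ln u)\<bar>)"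
    using integrable.intros[OF integral_exp_ln] by (rule integrable_abs)
  have 2: "integrable lborel (\<lambda>u::real. 2 * (indicator {0<..} u *\<^sub>R (u powr 1 * exp (- (1 * u)))))"
    "integrable lborel (\<lambda>u::real. 6 * (indicator {0<..} u *\<^sub>R (u powr 0 * exp (- (1 * u)))))"
    by (rule integrable_mult_right[OF integrable.intros[OF integrable_halfline_powr]]; simp)+
  have "(\<lambda>u. indicator {0<..} u *\<^sub>R logdom u) = (\<lambda>u. \<bar>indicator {0..} u * (exp (- u) * ln u)\<bar> + 2 * (indicator {0<..} u *\<^sub>R (u powr 1 * exp (- (1 * u)))) + 6 * (indicator {0<..} u *\<^sub>R (u powr 0 * exp (- (1 * u)))))"
    by (auto simp: fun_eq_iff logdom_def indicator_def abs_mult algebra_simps)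
  then show ?thesis using 1 2 by simp
qed

lemma cont_Ln_lroot: "0 < t \<Longrightarrow> continuous_on {0<..} (\<lambda>u. Ln (lroot t u))"
  by (intro continuous_at_imp_continuous_on ballI has_vector_derivative_continuous[OF lroot_facts(5)]) simp_all

text \<open>
  Integration by parts makes the logarithmic singularity at \<open>t = 0\<close> explicit: the remaining integral has a limit. The
  constant of integration \<open>Ln (- \<i> t)\<close> is the value of the primitive at \<open>u = 0\<close>.
\<close>
lemma lap0_log:
  assumes t: "0 < t" "t \<le> 1"
  shows "lap 0 t = (LBINT u. indicator {0<..} u *\<^sub>R (of_real (exp (- u)) * Ln (lroot t u))) - Ln (- \<i> * of_real t)"
proof -
  let ?c = "Ln (- \<i> * of_real t)"
  let ?e = "\<lambda>u. complex_of_real (exp (- u))"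
  define f where "f u = ?e u * (Ln (lroot t u) - ?c) - ?e u / hroot t u" for u
  have i1: "integrable lborel (\<lambda>u. indicator {0<..} u *\<^sub>R (?e u * Ln (lroot t u)))"
  proof (rule integrable_halfline[OF _ integrable_logdom])
    show "continuous_on {0<..} (\<lambda>u. ?e u * Ln (lroot t u))" by (intro continuous_intros cont_Ln_lroot t)
    show "cmod (?e u * Ln (lroot t u)) \<le> logdom u" if "0 < u" for u
      using lroot_facts(4)[OF that t] by (simp add: norm_mult logdom_def mult_left_mono)
  qed
  have i2: "has_bochner_integral lborel (\<lambda>u. indicator {0<..} u *\<^sub>R ?e u) 1"
  proof -
    have "has_bochner_integral lborel (\<lambda>u. complex_of_real (indicator {0<..} u *\<^sub>R (u powr 0 * exp (- (1 * u))))) (of_real (Gamma (0 + 1) / 1 powr (0 + 1)))"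
      by (intro has_bochner_integral_of_real integrable_halfline_powr) auto
    moreover have "(\<lambda>u. complex_of_real (indicator {0<..} u *\<^sub>R (u powr 0 * exp (- (1 * u))))) = (\<lambda>u. indicator {0<..} u *\<^sub>R ?e u)"
      by (auto simp: fun_eq_iff indicator_def)
    ultimately show ?thesis by simp
  qed
  have i3: "integrable lborel (\<lambda>u. indicator {0<..} u *\<^sub>R (?e u / hroot t u))"
  proof (rule integrable_halfline[OF _ integrable.intros[OF has_bochner_integral_mult_right[OF integrable_halfline_powr[of "- 1/2" 1], of "1 / sqrt (2 * t)"], unfolded mult_scaleR_right]])
    show "continuous_on {0<..} (\<lambda>u. ?e u / hroot t u)" using hroot_facts(3) t by (intro continuous_intros hroot_cont) auto
    show "cmod (?e u / hroot t u) \<le> 1 / sqrt (2 * t) * (u powr (- 1 / 2) * exp (- (1 * u)))" if u: "0 < u" for u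
    proof -
      have "exp (- u) / cmod (hroot t u) \<le> exp (- u) / (sqrt (2 * t) * sqrt u)"
        using hroot_facts(3,10)[OF u t(1)] u t by (intro divide_left_mono) auto
      then show ?thesis using u by (simp add: norm_divide powr_minus_divide powr_half_sqrt)
    qed
  qed auto
  define g1 where "g1 u = indicator {0<..} u *\<^sub>R (?e u * Ln (lroot t u))" for u
  define g2 where "g2 u = indicator {0<..} u *\<^sub>R ?e u" for u
  define g3 where "g3 u = indicator {0<..} u *\<^sub>R (?e u / hroot t u)" for u
  have fi: "indicator {0<..} u *\<^sub>R f u = (g1 u - g2 u * ?c) - g3 u" for u
    by (cases "0 < u") (auto simp: f_def g1_def g2_def g3_def algebra_simps)
  note gi = i1[folded g1_def] integrable.intros[OF i2[folded g2_def]] i3[folded g3_def]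
  have bnd: "cmod (- ?e u * (Ln (lroot t u) - ?c)) \<le> logdom u + exp (- u) * cmod ?c" if "0 < u" for u
  proof -
    have "cmod (Ln (lroot t u) - ?c) \<le> (\<bar>ln u\<bar> + 2 * u + 6) + cmod ?c"
      using lroot_facts(4)[OF that t] by (intro order_trans[OF norm_triangle_ineq4]) simp
    from mult_left_mono[OF this, of "exp (- u)"]
    have "exp (- u) * cmod (Ln (lroot t u) - ?c) \<le> logdom u + exp (- u) * cmod ?c" by (simp add: logdom_def algebra_simps)
    then show ?thesis by (simp only: norm_mult norm_minus_cancel norm_of_real abs_exp_cancel)
  qed
  have hr0: "(hroot t \<longlongrightarrow> 0) (at_right 0)"
  proof -
    have "((\<lambda>u. csqrt (of_real u * (of_real u - 2 * \<i> * of_real t))) \<longlongrightarrow> 0) (at_right 0)"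
    proof (rule tendsto_norm_zero_cancel)
      have "((\<lambda>u. sqrt (cmod (of_real u * (of_real u - 2 * \<i> * of_real t)))) \<longlongrightarrow> sqrt (cmod (of_real 0 * (of_real 0 - 2 * \<i> * of_real t)))) (at_right (0::real))"
        by (intro tendsto_intros)
      then show "((\<lambda>u. cmod (csqrt (of_real u * (of_real u - 2 * \<i> * of_real t)))) \<longlongrightarrow> 0) (at_right (0::real))" by simp
    qed
    then show ?thesis by (simp add: hroot_def[abs_def])
  qed
  have "(LBINT u. indicator {0<..} u *\<^sub>R f u) = 0 - 0"
  proof (rule halfline_FTC[where F = "\<lambda>u. - ?e u * (Ln (lroot t u) - ?c)"])
    fix u :: real assume u: "0 < u"
    have "(?e has_vector_derivative of_real (- exp (- u))) (at u)"
      by (rule has_vector_derivative_of_real) (auto intro!: derivative_eq_intros)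
    then have "((\<lambda>u. - ?e u * (Ln (lroot t u) - ?c)) has_vector_derivative (- ?e u * (1 / hroot t u - 0) + - of_real (- exp (- u)) * (Ln (lroot t u) - ?c))) (at u)"
      by (intro has_vector_derivative_mult has_vector_derivative_minus has_vector_derivative_diff has_vector_derivative_const lroot_facts(5)[OF u t(1)])
    moreover have "- ?e u * (1 / hroot t u - 0) + - of_real (- exp (- u)) * (Ln (lroot t u) - ?c) = f u" by (simp add: f_def)
    ultimately show "((\<lambda>u. - ?e u * (Ln (lroot t u) - ?c)) has_vector_derivative f u) (at u)" by (simp only:)
    have ce: "isCont ?e u" by (intro continuous_intros)
    show "isCont f u" unfolding f_def[abs_def]
      by (intro continuous_diff continuous_mult isCont_divide continuous_const ce hroot_facts(3,8)[OF u t(1)]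
          has_vector_derivative_continuous[OF lroot_facts(5)[OF u t(1)]])
  next
    show "integrable lborel (\<lambda>u. indicator {0<..} u *\<^sub>R f u)"
      unfolding fi using gi by simp
    have "- \<i> * of_real t \<notin> \<real>\<^sub>\<le>\<^sub>0" using t by (simp add: complex_nonpos_Reals_iff)
    moreover have "(lroot t \<longlongrightarrow> of_real 0 - \<i> * of_real t + 0) (at_right 0)"
      unfolding lroot_def[abs_def] by (intro tendsto_intros hr0)
    then have "(lroot t \<longlongrightarrow> - \<i> * of_real t) (at_right 0)" by simp
    ultimately have lnl: "((\<lambda>u. Ln (lroot t u)) \<longlongrightarrow> ?c) (at_right 0)" by (rule tendsto_Ln[rotated])
    have "((\<lambda>u. - ?e u * (Ln (lroot t u) - ?c)) \<longlongrightarrow> - of_real (exp (- 0)) * (?c - ?c)) (at_right 0)"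
      by (intro tendsto_mult tendsto_minus tendsto_of_real tendsto_exp tendsto_diff tendsto_const tendsto_ident_at lnl)
    then show "((\<lambda>u. - ?e u * (Ln (lroot t u) - ?c)) \<longlongrightarrow> 0) (at_right 0)" by simp
    have "((\<lambda>u. logdom u + exp (- u) * cmod ?c) \<longlongrightarrow> 0) at_top" unfolding logdom_def by real_asymp
    then show "((\<lambda>u. - ?e u * (Ln (lroot t u) - ?c)) \<longlongrightarrow> 0) at_top"
      by (rule Lim_null_comparison[rotated]) (use bnd in \<open>auto simp: eventually_at_top_dense intro!: exI[of _ 0]\<close>)
  qed
  moreover have "(LBINT u. indicator {0<..} u *\<^sub>R f u) = ((LBINT u. indicator {0<..} u *\<^sub>R (?e u * Ln (lroot t u))) - 1 * ?c) - lap 0 t"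
    unfolding fi using gi has_bochner_integral_integral_eq[OF i2[folded g2_def]] lap_scaled[OF t(1), of 0]
    by (simp add: g1_def[abs_def] g3_def[abs_def])
  ultimately show ?thesis by simp
qed

text \<open>
  Dominated convergence for \<open>t \<rightarrow> 0\<close> from the right, reduced to the version for \<open>t \<rightarrow> \<infinity>\<close> by inversion. The maximum with
  \<open>1\<close> confines the parameter to \<open>(0, 1]\<close>, where the majorant is assumed.
\<close>
lemma tendsto_halfline_integral:
  fixes f :: "real \<Rightarrow> real \<Rightarrow> complex"
  assumes "\<And>t. 0 < t \<Longrightarrow> t \<le> 1 \<Longrightarrow> continuous_on {0<..} (f t)" "continuous_on {0<..} l"
    and lim: "\<And>u. 0 < u \<Longrightarrow> ((\<lambda>t. f t u) \<longlongrightarrow> l u) (at_right 0)"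
    and g: "integrable lborel (\<lambda>u. indicator {0<..} u *\<^sub>R g u)" "\<And>t u. 0 < t \<Longrightarrow> t \<le> 1 \<Longrightarrow> 0 < u \<Longrightarrow> cmod (f t u) \<le> g u"
  shows "((\<lambda>t. LBINT u. indicator {0<..} u *\<^sub>R f t u) \<longlongrightarrow> (LBINT u. indicator {0<..} u *\<^sub>R l u)) (at_right 0)"
proof -
  have m: "0 < inverse (max 1 t)" "inverse (max 1 t) \<le> 1" for t :: real by (auto simp: field_simps max_def)
  have "((\<lambda>t. LBINT u. indicator {0<..} u *\<^sub>R f (inverse (max 1 t)) u) \<longlongrightarrow> (LBINT u. indicator {0<..} u *\<^sub>R l u)) at_top"
  proof (rule integral_dominated_convergence_at_top[where w = "\<lambda>u. indicator {0<..} u *\<^sub>R g u"])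
    show "(\<lambda>u. indicator {0<..} u *\<^sub>R l u) \<in> borel_measurable lborel"
      using borel_measurable_continuous_on_indicator[OF _ assms(2)] by simp
    show "(\<lambda>u. indicator {0<..} u *\<^sub>R f (inverse (max 1 t)) u) \<in> borel_measurable lborel" for t
      using borel_measurable_continuous_on_indicator[OF _ assms(1)[OF m]] by simp
    show "\<forall>\<^sub>F t in at_top. AE u in lborel. norm (indicator {0<..} u *\<^sub>R f (inverse (max 1 t)) u) \<le> indicator {0<..} u *\<^sub>R g u"
      using g(2)[OF m] by (intro always_eventually allI AE_I2) (simp add: indicator_def)
    show "AE u in lborel. ((\<lambda>t. indicator {0<..} u *\<^sub>R f (inverse (max 1 t)) u) \<longlongrightarrow> indicator {0<..} u *\<^sub>R l u) at_top"
    proof (rule AE_I2)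
      fix u :: real
      show "((\<lambda>t. indicator {0<..} u *\<^sub>R f (inverse (max 1 t)) u) \<longlongrightarrow> indicator {0<..} u *\<^sub>R l u) at_top"
      proof (cases "0 < u")
        case True
        have "((\<lambda>t. f (inverse (max 1 t)) u) \<longlongrightarrow> l u) at_top"
          by (rule Lim_transform_eventually[OF lim[OF True, unfolded filterlim_at_right_to_top]])
            (use eventually_ge_at_top[of "1::real"] in eventually_elim, simp add: max_def)
        then show ?thesis using True by simp
      qed simp
    qed
  qed (rule g)
  then show ?thesis
    unfolding filterlim_at_right_to_top
    by (rule Lim_transform_eventually) (use eventually_ge_at_top[of "1::real"] in eventually_elim, simp add: max_def)
qed

lemma hroot_at_0: "0 < u \<Longrightarrow> ((\<lambda>t. hroot t u) \<longlongrightarrow> of_real u) (at_right 0)"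
proof -
  assume u: "0 < u"
  have "((\<lambda>t. of_real u * (of_real u - 2 * \<i> * of_real t)) \<longlongrightarrow> (of_real u * (of_real u - 2 * \<i> * of_real 0) :: complex)) (at_right (0::real))"
    by (intro tendsto_intros)
  then have "((\<lambda>t. of_real u * (of_real u - 2 * \<i> * of_real t)) \<longlongrightarrow> (of_real (u\<^sup>2) :: complex)) (at_right (0::real))"
    by (simp add: power2_eq_square)
  moreover have "isCont csqrt (of_real (u\<^sup>2))" using u by (intro continuous_at_csqrt) (simp add: complex_nonpos_Reals_iff del: of_real_power)
  ultimately have "((\<lambda>t. hroot t u) \<longlongrightarrow> csqrt (of_real (u\<^sup>2))) (at_right 0)"
    unfolding hroot_def by (rule isCont_tendsto_compose[rotated])
  moreover have "csqrt (of_real (u\<^sup>2)) = of_real u" using u by (simp add: csqrt_of_real del: of_real_power)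
  ultimately show ?thesis by simp
qed

lemma lap1_limit: "((\<lambda>t. of_real t * lap 1 t) \<longlongrightarrow> 1) (at_right 0)"
proof -
  have e1: "has_bochner_integral lborel (\<lambda>u. indicator {0<..} u *\<^sub>R exp (- u)) (1::real)"
  proof -
    have "(\<lambda>u. indicator {0<..} u *\<^sub>R (u powr 0 * exp (- (1 * u)))) = (\<lambda>u. indicator {0<..} u *\<^sub>R exp (- u) :: real)"
      by (auto simp: fun_eq_iff indicator_def)
    then show ?thesis using integrable_halfline_powr[of 0 1] by simp
  qed
  have "((\<lambda>t. LBINT u. indicator {0<..} u *\<^sub>R (complex_of_real (u ^ 1 * exp (- u)) / hroot t u)) \<longlongrightarrow> (LBINT u. indicator {0<..} u *\<^sub>R complex_of_real (exp (- u)))) (at_right 0)"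
  proof (rule tendsto_halfline_integral[where g = "\<lambda>u. exp (- u)"])
    show "continuous_on {0<..} (\<lambda>u. complex_of_real (u ^ 1 * exp (- u)) / hroot t u)" if "0 < t" for t
      using hroot_facts(3)[OF _ that] that by (intro continuous_intros hroot_cont) auto
    show "((\<lambda>t. complex_of_real (u ^ 1 * exp (- u)) / hroot t u) \<longlongrightarrow> complex_of_real (exp (- u))) (at_right 0)" if "0 < u" for u
    proof -
      have "((\<lambda>t. complex_of_real (u ^ 1 * exp (- u)) / hroot t u) \<longlongrightarrow> complex_of_real (u ^ 1 * exp (- u)) / of_real u) (at_right 0)"
        using that by (intro tendsto_intros hroot_at_0) auto
      then show ?thesis using that by simp
    qed
    show "cmod (complex_of_real (u ^ 1 * exp (- u)) / hroot t u) \<le> exp (- u)" if "0 < t" "0 < u" for t u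
      using hroot_facts(9)[OF that(2,1)] that by (simp add: norm_divide norm_mult divide_le_eq mult.commute)
  qed (use integrable.intros[OF e1] in \<open>auto intro!: continuous_intros\<close>)
  moreover have "(LBINT u. indicator {0<..} u *\<^sub>R complex_of_real (exp (- u))) = 1"
  proof -
    have "has_bochner_integral lborel (\<lambda>u. complex_of_real (indicator {0<..} u *\<^sub>R exp (- u))) (complex_of_real 1)"
      by (rule has_bochner_integral_of_real[OF e1])
    from has_bochner_integral_integral_eq[OF this] show ?thesis by (simp add: scaleR_conv_of_real)
  qed
  ultimately have "((\<lambda>t. LBINT u. indicator {0<..} u *\<^sub>R (complex_of_real (u ^ 1 * exp (- u)) / hroot t u)) \<longlongrightarrow> 1) (at_right 0)" by simp
  then show ?thesis
    by (rule Lim_transform_eventually)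
      (use lap_scaled[of _ 1] in \<open>auto simp: eventually_at_right_field intro!: exI[of _ 1]\<close>)
qed

text \<open>
  In the limit \<open>lroot t u \<rightarrow> 2 u\<close> the integral becomes \<open>\<integral> exp (- u) ln (2 u) du = ln 2 - \<gamma>\<close>, while
  \<open>- Ln (- \<i> t) = - ln t + \<i> \<pi> / 2\<close>. This is the logarithmic behaviour of the Hankel function at \<open>0\<close>.
\<close>
lemma lap0_limit: "((\<lambda>t. lap 0 t + of_real (ln (t / 2) + euler_mascheroni)) \<longlongrightarrow> \<i> * of_real (pi / 2)) (at_right 0)"
proof -
  let ?l = "\<lambda>u. complex_of_real (exp (- u)) * of_real (ln (2 * u))"
  have I: "((\<lambda>t. LBINT u. indicator {0<..} u *\<^sub>R (of_real (exp (- u)) * Ln (lroot t u))) \<longlongrightarrow> (LBINT u. indicator {0<..} u *\<^sub>R ?l u)) (at_right 0)"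
  proof (rule tendsto_halfline_integral[OF _ _ _ integrable_logdom])
    show "continuous_on {0<..} (\<lambda>u. of_real (exp (- u)) * Ln (lroot t u))" if "0 < t" for t
      using that by (intro continuous_intros cont_Ln_lroot)
    show "continuous_on {0<..} ?l" by (intro continuous_intros) auto
    show "((\<lambda>t. of_real (exp (- u)) * Ln (lroot t u)) \<longlongrightarrow> ?l u) (at_right 0)" if u: "0 < u" for u
    proof -
      have "((\<lambda>t. lroot t u) \<longlongrightarrow> of_real u - \<i> * of_real 0 + of_real u) (at_right 0)"
        unfolding lroot_def by (intro tendsto_intros hroot_at_0 u)
      then have "((\<lambda>t. lroot t u) \<longlongrightarrow> of_real (2 * u)) (at_right 0)" by simp
      moreover have "complex_of_real (2 * u) \<notin> \<real>\<^sub>\<le>\<^sub>0" using u by (simp add: complex_nonpos_Reals_iff)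
      ultimately have "((\<lambda>t. Ln (lroot t u)) \<longlongrightarrow> Ln (of_real (2 * u))) (at_right 0)" by (rule tendsto_Ln)
      also have "Ln (of_real (2 * u)) = of_real (ln (2 * u))" by (rule Ln_of_real) (use u in simp)
      finally show ?thesis by (intro tendsto_intros)
    qed
    show "cmod (of_real (exp (- u)) * Ln (lroot t u)) \<le> logdom u" if "0 < t" "t \<le> 1" "0 < u" for t u
      using lroot_facts(4)[OF that(3,1,2)] by (simp add: norm_mult logdom_def mult_left_mono)
  qed
  have L: "has_bochner_integral lborel (\<lambda>u. indicator {0<..} u *\<^sub>R ?l u) (of_real (ln 2 - euler_mascheroni))"
  proof -
    have "has_bochner_integral lborel (\<lambda>u::real. ln 2 * (indicator {0<..} u *\<^sub>R (u powr 0 * exp (- (1 * u)))) + indicator {0..} u * (exp (- u) * ln u)) (ln 2 * (Gamma (0 + 1) / 1 powr (0 + 1)) + - euler_mascheroni)"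
      by (intro has_bochner_integral_add has_bochner_integral_mult_right integrable_halfline_powr integral_exp_ln) auto
    then have "has_bochner_integral lborel (\<lambda>u. complex_of_real (ln 2 * (indicator {0<..} u *\<^sub>R (u powr 0 * exp (- (1 * u)))) + indicator {0..} u * (exp (- u) * ln u))) (complex_of_real (ln 2 * (Gamma (0 + 1) / 1 powr (0 + 1)) + - euler_mascheroni))"
      by (rule has_bochner_integral_of_real)
    then have "has_bochner_integral lborel (\<lambda>u. complex_of_real (ln 2 * (indicator {0<..} u *\<^sub>R (u powr 0 * exp (- (1 * u)))) + indicator {0..} u * (exp (- u) * ln u))) (of_real (ln 2 - euler_mascheroni))"
      by simp
    moreover have "(\<lambda>u. complex_of_real (ln 2 * (indicator {0<..} u *\<^sub>R (u powr 0 * exp (- (1 * u)))) + indicator {0..} u * (exp (- u) * ln u))) = (\<lambda>u. indicator {0<..} u *\<^sub>R ?l u)"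
    proof
      fix u :: real
      show "complex_of_real (ln 2 * (indicator {0<..} u *\<^sub>R (u powr 0 * exp (- (1 * u)))) + indicator {0..} u * (exp (- u) * ln u)) = indicator {0<..} u *\<^sub>R ?l u"
        by (cases u "0::real" rule: linorder_cases) (simp_all add: ln_mult algebra_simps)
    qed
    ultimately show ?thesis by simp
  qed
  have "((\<lambda>t. (LBINT u. indicator {0<..} u *\<^sub>R (of_real (exp (- u)) * Ln (lroot t u))) + (\<i> * of_real (pi / 2) - of_real (ln 2 - euler_mascheroni))) \<longlongrightarrow> of_real (ln 2 - euler_mascheroni) + (\<i> * of_real (pi / 2) - of_real (ln 2 - euler_mascheroni))) (at_right 0)"
    using I unfolding has_bochner_integral_integral_eq[OF L] by (intro tendsto_intros)
  then have "((\<lambda>t. (LBINT u. indicator {0<..} u *\<^sub>R (of_real (exp (- u)) * Ln (lroot t u))) + (\<i> * of_real (pi / 2) - of_real (ln 2 - euler_mascheroni))) \<longlongrightarrow> \<i> * of_real (pi / 2)) (at_right 0)"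
    by simp
  then show ?thesis
  proof (rule Lim_transform_eventually)
    have "(LBINT u. indicator {0<..} u *\<^sub>R (of_real (exp (- u)) * Ln (lroot t u))) + (\<i> * of_real (pi / 2) - of_real (ln 2 - euler_mascheroni)) = lap 0 t + of_real (ln (t / 2) + euler_mascheroni)"
      if t: "0 < t" "t < 1" for t
    proof -
      have "exp (\<i> * of_real (pi / 2)) = \<i>" by (simp only: cis_conv_exp[symmetric] cis_pi_half)
      then have "exp (of_real (ln t) - \<i> * of_real (pi / 2)) = - \<i> * of_real t"
        using t by (simp add: exp_diff exp_of_real del: of_real_divide)
      then have "Ln (- \<i> * of_real t) = of_real (ln t) - \<i> * of_real (pi / 2)" by (rule Ln_unique) (use pi_gt_zero in \<open>auto intro: order_trans[of _ 0]\<close>)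
      then show ?thesis using lap0_log[OF t(1) less_imp_le[OF t(2)]] t by (simp add: ln_div)
    qed
    then show "\<forall>\<^sub>F t in at_right 0. (LBINT u. indicator {0<..} u *\<^sub>R (of_real (exp (- u)) * Ln (lroot t u))) + (\<i> * of_real (pi / 2) - of_real (ln 2 - euler_mascheroni)) = lap 0 t + of_real (ln (t / 2) + euler_mascheroni)"
      unfolding eventually_at_right_field by (intro exI[of _ 1]) auto
  qed
qed

text \<open>
  The factor that makes the limit at \<open>0\<close> of the real part equal to \<open>1\<close>, the value of the Bessel function of the
  first kind.
\<close>
definition hankel_const :: complex where "hankel_const = - (2 * \<i> / of_real pi)"
definition hankel_lap :: "real \<Rightarrow> complex" where
  "hankel_lap t = hankel_const * (exp (\<i> * of_real t) * lap 0 t)"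
definition hankel_lap_v :: "real \<Rightarrow> complex" where
  "hankel_lap_v t = hankel_const * (of_real t * (exp (\<i> * of_real t) * (\<i> * lap 0 t - lap 1 t)))"

lemma hankel_lap_ode:
  assumes t: "0 < t"
  shows "(hankel_lap has_vector_derivative hankel_lap_v t / of_real t) (at t)"
    "(hankel_lap_v has_vector_derivative - (of_real t * hankel_lap t)) (at t)"
proof -
  let ?E = "\<lambda>t. exp (\<i> * complex_of_real t)"
  have "(exp \<circ> (\<lambda>t. \<i> * complex_of_real t) has_vector_derivative \<i> * exp (\<i> * of_real t)) (at t)"
    by (rule field_vector_diff_chain_at) (auto intro!: derivative_eq_intros has_vector_derivative_real_field[of "\<lambda>z. \<i> * z"])
  then have dE: "(?E has_vector_derivative \<i> * ?E t) (at t)" by (simp add: o_def)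
  have dt: "(complex_of_real has_vector_derivative 1) (at t)" by (rule has_vector_derivative_real_field[of "\<lambda>z. z"]) (rule DERIV_ident)
  have d0: "(lap 0 has_vector_derivative - lap 1 t) (at t)" and d1: "(lap 1 has_vector_derivative - lap 2 t) (at t)"
    using lap_deriv[OF t, of 0] lap_deriv[OF t, of 1] by (simp_all add: numeral_2_eq_2)
  have "(hankel_lap has_vector_derivative hankel_const * (?E t * - lap 1 t + \<i> * ?E t * lap 0 t)) (at t)"
    unfolding hankel_lap_def[abs_def]
    by (intro has_vector_derivative_mult_right has_vector_derivative_mult dE d0)
  moreover have "hankel_const * (?E t * - lap 1 t + \<i> * ?E t * lap 0 t) = hankel_lap_v t / of_real t"
  proof -
    have "hankel_lap_v t / of_real t = hankel_const * (?E t * (\<i> * lap 0 t - lap 1 t))" using t by (simp add: hankel_lap_v_def)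
    then show ?thesis by (simp only:) (simp add: algebra_simps)
  qed
  ultimately show "(hankel_lap has_vector_derivative hankel_lap_v t / of_real t) (at t)" by (simp only:)
  let ?X = "\<i> * lap 0 t - lap 1 t"
  have "(hankel_lap_v has_vector_derivative hankel_const * (of_real t * (?E t * (\<i> * - lap 1 t - - lap 2 t) + \<i> * ?E t * ?X) + 1 * (?E t * ?X))) (at t)"
    unfolding hankel_lap_v_def[abs_def]
    by (intro has_vector_derivative_mult_right has_vector_derivative_mult has_vector_derivative_diff dE d0 d1 dt)
  moreover have "hankel_const * (of_real t * (?E t * (\<i> * - lap 1 t - - lap 2 t) + \<i> * ?E t * ?X) + 1 * (?E t * ?X)) = - (of_real t * hankel_lap t)"
  proof -
    have "of_real t * (?E t * (\<i> * - lap 1 t - - lap 2 t) + \<i> * ?E t * ?X) + 1 * (?E t * ?X)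
      = ?E t * (of_real t * (lap 2 t - 2 * \<i> * lap 1 t) - of_real t * lap 0 t + ?X)" by (simp add: algebra_simps)
    also have "\<dots> = - (?E t * (of_real t * lap 0 t))" unfolding lap_ode[OF t] by (simp add: algebra_simps)
    finally show ?thesis by (simp add: hankel_lap_def mult_ac)
  qed
  ultimately show "(hankel_lap_v has_vector_derivative - (of_real t * hankel_lap t)) (at t)" by (simp only:)
qed

lemma pser_at_0: "pser c 0 = c 0" unfolding pser_def by (rule powser_zero)

text \<open>
  Both functions contain the same logarithm, multiplied by \<open>exp (\<i> t)\<close> in one case and by the power series of the
  Bessel function in the other. Both factors are \<open>1 + O(t)\<close> and \<open>t ln t \<rightarrow> 0\<close>, so the logarithms cancel in the limit.
\<close>
lemma hankel_limits:
  "((\<lambda>t. hankel_lap t - (of_real (bessel_J0 t) + \<i> * of_real (bessel_Y0 t))) \<longlongrightarrow> 0) (at_right 0)"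
  "((\<lambda>t. hankel_lap_v t - (of_real (J0v t) + \<i> * of_real (Y0v t))) \<longlongrightarrow> 0) (at_right 0)"
proof -
  let ?g = "euler_mascheroni :: real"
  define \<l> where "\<l> t = ln (t / 2) + ?g" for t :: real
  define X where "X t = t\<^sup>2 / 4" for t :: real
  define L where "L t = lap 0 t + of_real (\<l> t)" for t
  define E where "E t = exp (\<i> * complex_of_real t)" for t
  have L: "(L \<longlongrightarrow> \<i> * of_real (pi / 2)) (at_right 0)" using lap0_limit by (simp add: L_def[abs_def] \<l>_def)
  have X0: "(X \<longlongrightarrow> 0) (at_right 0)" unfolding X_def by real_asymp
  have Xat: "filterlim X (at 0) (at_right 0)" unfolding X_def by real_asymp
  have Xl: "((\<lambda>t. X t * \<l> t) \<longlongrightarrow> 0) (at_right 0)" unfolding X_def \<l>_def by real_asymp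
  have tl: "((\<lambda>t. t * \<l> t) \<longlongrightarrow> 0) (at_right 0)" unfolding \<l>_def by real_asymp
  have E1: "(E \<longlongrightarrow> 1) (at_right 0)"
  proof -
    have "(E \<longlongrightarrow> exp (\<i> * complex_of_real 0)) (at_right 0)" unfolding E_def by (intro tendsto_intros)
    then show ?thesis by simp
  qed
  have El: "((\<lambda>t. (E t - 1) * of_real (\<l> t)) \<longlongrightarrow> 0) (at_right 0)"
  proof (rule Lim_null_comparison)
    have "cmod ((E t - 1) * of_real (\<l> t)) \<le> \<bar>t * \<l> t\<bar>" for t
      using norm_exp_imaginary_diff_le[of t 0] by (simp add: norm_mult E_def abs_mult mult_right_mono)
    then show "\<forall>\<^sub>F t in at_right 0. cmod ((E t - 1) * of_real (\<l> t)) \<le> \<bar>t * \<l> t\<bar>" by (intro always_eventually allI)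
    show "((\<lambda>t. \<bar>t * \<l> t\<bar>) \<longlongrightarrow> 0) (at_right 0)" using tendsto_rabs[OF tl] by simp
  qed
  have c: "isCont (pser jc) 0" "isCont (pser yc) 0" "isCont (\<lambda>x. x * pser (diffs jc) x) 0" "isCont (\<lambda>x. x * pser (diffs yc) x) 0" "isCont (pser (diffs jc)) 0"
    by (rule DERIV_isCont, rule pser_derivs)+ (rule DERIV_isCont, rule pser_deriv, rule termdiff_converges_all, rule summable_jc)
  have p: "((\<lambda>t. pser jc (X t)) \<longlongrightarrow> 1) (at_right 0)" using isCont_tendsto_compose[OF c(1) X0] by (simp add: pser_at_0 jc_def)
  have q: "((\<lambda>t. pser yc (X t)) \<longlongrightarrow> 0) (at_right 0)" using isCont_tendsto_compose[OF c(2) X0] by (simp add: pser_at_0 yc_def harm_def)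
  have xp: "((\<lambda>t. X t * pser (diffs jc) (X t)) \<longlongrightarrow> 0) (at_right 0)" using isCont_tendsto_compose[OF c(3) X0] by simp
  have xq: "((\<lambda>t. X t * pser (diffs yc) (X t)) \<longlongrightarrow> 0) (at_right 0)" using isCont_tendsto_compose[OF c(4) X0] by simp
  have p1: "((\<lambda>t. pser (diffs jc) (X t)) \<longlongrightarrow> pser (diffs jc) 0) (at_right 0)" by (rule isCont_tendsto_compose[OF c(5) X0])
  have lp: "((\<lambda>t. \<l> t * (1 - pser jc (X t))) \<longlongrightarrow> 0) (at_right 0)"
  proof -
    have "((\<lambda>h. (pser jc (0 + h) - pser jc 0) / h) \<longlongrightarrow> pser (diffs jc) 0) (at 0)" using pser_derivs(1)[of 0] by (simp add: DERIV_def)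
    then have "((\<lambda>h. (pser jc h - 1) / h) \<longlongrightarrow> pser (diffs jc) 0) (at 0)" by (simp add: pser_at_0 jc_def)
    from filterlim_compose[OF this Xat]
    have "((\<lambda>t. - ((X t * \<l> t) * ((pser jc (X t) - 1) / X t))) \<longlongrightarrow> - (0 * pser (diffs jc) 0)) (at_right 0)"
      by (intro tendsto_intros Xl)
    then have "((\<lambda>t. - ((X t * \<l> t) * ((pser jc (X t) - 1) / X t))) \<longlongrightarrow> 0) (at_right 0)" by simp
    then show ?thesis
      by (rule Lim_transform_eventually) (auto simp: eventually_at_right_field X_def field_simps intro!: exI[of _ 1])
  qed
  have xpl: "((\<lambda>t. \<l> t * (X t * pser (diffs jc) (X t))) \<longlongrightarrow> 0) (at_right 0)"
    using tendsto_mult[OF Xl p1] by (simp add: mult_ac)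
  have hc: "hankel_const * (\<i> * of_real (pi / 2)) = 1" by (simp add: hankel_const_def)
  have hc2: "\<i> * of_real (2 / pi) = - hankel_const" by (simp add: hankel_const_def)
  have "((\<lambda>t. hankel_const * (E t * L t) - hankel_const * ((E t - 1) * of_real (\<l> t)) - of_real (pser jc (X t)) - hankel_const * of_real (\<l> t * (1 - pser jc (X t)) + pser yc (X t)))
     \<longlongrightarrow> hankel_const * (1 * (\<i> * of_real (pi / 2))) - hankel_const * 0 - of_real 1 - hankel_const * of_real (0 + 0)) (at_right 0)"
    by (intro tendsto_intros E1 L El p lp q)
  moreover have "hankel_const * (E t * L t) - hankel_const * ((E t - 1) * of_real (\<l> t)) - of_real (pser jc (X t)) - hankel_const * of_real (\<l> t * (1 - pser jc (X t)) + pser yc (X t))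
     = hankel_lap t - (of_real (bessel_J0 t) + \<i> * of_real (bessel_Y0 t))" for t
  proof -
    have "\<i> * of_real (bessel_Y0 t) = - hankel_const * of_real (\<l> t * pser jc (X t) - pser yc (X t))"
      unfolding bessel_Y0_pser of_real_mult[of "2/pi"] mult.assoc[symmetric] hc2 by (simp add: \<l>_def X_def)
    then show ?thesis
      unfolding hankel_lap_def L_def E_def bessel_J0_pser X_def[symmetric] by (simp add: algebra_simps)
  qed
  ultimately show "((\<lambda>t. hankel_lap t - (of_real (bessel_J0 t) + \<i> * of_real (bessel_Y0 t))) \<longlongrightarrow> 0) (at_right 0)"
    using hc by simp
  have tL: "((\<lambda>t. of_real t * lap 0 t) \<longlongrightarrow> 0) (at_right 0)"
  proof -
    have "((\<lambda>t. of_real t * L t - of_real (t * \<l> t)) \<longlongrightarrow> of_real 0 * (\<i> * of_real (pi / 2)) - of_real 0) (at_right 0)"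
      by (intro tendsto_intros L tl)
    then show ?thesis by (simp add: L_def algebra_simps)
  qed
  have "((\<lambda>t. hankel_const * (E t * (\<i> * (of_real t * lap 0 t) - of_real t * lap 1 t)) - of_real (2 * (X t * pser (diffs jc) (X t)))
     + hankel_const * of_real (pser jc (X t) + 2 * (\<l> t * (X t * pser (diffs jc) (X t))) - 2 * (X t * pser (diffs yc) (X t))))
     \<longlongrightarrow> hankel_const * (1 * (\<i> * 0 - 1)) - of_real (2 * 0) + hankel_const * of_real (1 + 2 * 0 - 2 * 0)) (at_right 0)"
    by (intro tendsto_intros E1 tL lap1_limit xp p xpl xq)
  moreover have "hankel_const * (E t * (\<i> * (of_real t * lap 0 t) - of_real t * lap 1 t)) - of_real (2 * (X t * pser (diffs jc) (X t)))
     + hankel_const * of_real (pser jc (X t) + 2 * (\<l> t * (X t * pser (diffs jc) (X t))) - 2 * (X t * pser (diffs yc) (X t)))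
     = hankel_lap_v t - (of_real (J0v t) + \<i> * of_real (Y0v t))" for t
  proof -
    have "\<i> * of_real (Y0v t) = - hankel_const * of_real (pser jc (X t) + 2 * (\<l> t * (X t * pser (diffs jc) (X t))) - 2 * (X t * pser (diffs yc) (X t)))"
      unfolding Y0v_def of_real_mult[of "2/pi"] mult.assoc[symmetric] hc2 by (simp add: \<l>_def X_def)
    then show ?thesis unfolding hankel_lap_v_def E_def J0v_def X_def[symmetric] by (simp add: algebra_simps)
  qed
  ultimately show "((\<lambda>t. hankel_lap_v t - (of_real (J0v t) + \<i> * of_real (Y0v t))) \<longlongrightarrow> 0) (at_right 0)"
    by simp
qed

text \<open>
  Real and imaginary part of the difference solve the Bessel system and tend to \<open>0\<close> at the origin together with
  \<open>t\<close> times their derivatives.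
\<close>
lemma hankel_eq_lap:
  assumes t: "0 < t" shows "hankel1_0 t = hankel_lap t"
proof -
  have d: "((\<lambda>t. Re (hankel_lap t)) has_real_derivative Re (hankel_lap_v t) / t) (at t)" "((\<lambda>t. Re (hankel_lap_v t)) has_real_derivative - (t * Re (hankel_lap t))) (at t)"
    "((\<lambda>t. Im (hankel_lap t)) has_real_derivative Im (hankel_lap_v t) / t) (at t)" "((\<lambda>t. Im (hankel_lap_v t)) has_real_derivative - (t * Im (hankel_lap t))) (at t)" if "0 < t" for t
    using bounded_linear.has_vector_derivative[OF bounded_linear_Re hankel_lap_ode(1)[OF that]] bounded_linear.has_vector_derivative[OF bounded_linear_Re hankel_lap_ode(2)[OF that]]
      bounded_linear.has_vector_derivative[OF bounded_linear_Im hankel_lap_ode(1)[OF that]] bounded_linear.has_vector_derivative[OF bounded_linear_Im hankel_lap_ode(2)[OF that]]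
    by (simp_all add: has_real_derivative_iff_has_vector_derivative Re_divide_of_real Im_divide_of_real)
  have "bessel_pair (\<lambda>t. Re (hankel_lap t) - bessel_J0 t) (\<lambda>t. Re (hankel_lap_v t) - J0v t)"
    "bessel_pair (\<lambda>t. Im (hankel_lap t) - bessel_Y0 t) (\<lambda>t. Im (hankel_lap_v t) - Y0v t)"
    using bessel_pair_JY d unfolding bessel_pair_def
    by (auto intro!: DERIV_cong[OF DERIV_diff] simp: diff_divide_distrib right_diff_distrib)
  moreover have "((\<lambda>t. Re (hankel_lap t) - bessel_J0 t) \<longlongrightarrow> 0) (at_right 0)" "((\<lambda>t. Re (hankel_lap_v t) - J0v t) \<longlongrightarrow> 0) (at_right 0)"
    "((\<lambda>t. Im (hankel_lap t) - bessel_Y0 t) \<longlongrightarrow> 0) (at_right 0)" "((\<lambda>t. Im (hankel_lap_v t) - Y0v t) \<longlongrightarrow> 0) (at_right 0)"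
    using tendsto_Re[OF hankel_limits(1)] tendsto_Re[OF hankel_limits(2)] tendsto_Im[OF hankel_limits(1)] tendsto_Im[OF hankel_limits(2)] by simp_all
  ultimately have "Re (hankel_lap t) - bessel_J0 t = 0" "Im (hankel_lap t) - bessel_Y0 t = 0"
    using bessel_unique[OF _ _ _ t] by blast+
  then show ?thesis by (simp add: hankel1_0_def complex_eq_iff)
qed

section \<open>The Hankel function for large arguments\<close>

definition hankel1_deriv :: "real \<Rightarrow> complex" where
  "hankel1_deriv t = hankel_const * (exp (\<i> * of_real t) * (\<i> * lap 0 t - lap 1 t))"

lemma hankel1_has_deriv:
  assumes t: "0 < t" shows "(hankel1_0 has_vector_derivative hankel1_deriv t) (at t)"
proof -
  have "hankel_lap_v t / of_real t = hankel1_deriv t" using t by (simp add: hankel_lap_v_def hankel1_deriv_def)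
  then have "(hankel_lap has_vector_derivative hankel1_deriv t) (at t)" using hankel_lap_ode(1)[OF t] by simp
  then show ?thesis
    by (rule has_vector_derivative_transform_within_open[where S = "{0<..}"]) (use t hankel_eq_lap in auto)
qed

lemma lap1_bound: assumes t: "0 < t" shows "cmod (lap 1 t) \<le> Gamma (3/2) * t powr (-3/2)"
proof -
  have g: "has_bochner_integral lborel (\<lambda>u. indicator {0<..} u *\<^sub>R (u powr (1/2) * exp (- (t * u)))) (Gamma (1/2 + 1) / t powr (1/2 + 1))"
    by (rule integrable_halfline_powr) (use t in auto)
  have "cmod (lap 1 t) \<le> (LBINT u. indicator {0<..} u *\<^sub>R (u powr (1/2) * exp (- (t * u))))"
    unfolding lap_def
  proof (rule Bochner_Integration.integral_norm_bound_integral[OF integrable_lap[OF t] integrable.intros[OF g]])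
    fix w :: real
    show "norm (indicator {0<..} w *\<^sub>R (complex_of_real (w ^ 1 * exp (- (t * w))) / hroot 1 w)) \<le> indicator {0<..} w *\<^sub>R (w powr (1/2) * exp (- (t * w)))"
      using lap_term_bound[of w 1 t] by (cases "0 < w") auto
  qed
  also have "\<dots> = Gamma (1/2 + 1) / t powr (1/2 + 1)" by (rule has_bochner_integral_integral_eq[OF g])
  also have "\<dots> = Gamma (3/2) * t powr (-3/2)" using powr_minus_divide[of t "3/2"] by simp
  finally show ?thesis .
qed

text \<open>
  For small \<open>u\<close> the root \<open>sqrt (u (u - 2 \<i>))\<close> is close to \<open>(1 - \<i>) sqrt u\<close>; the difference of the inverses is at most
  \<open>sqrt u\<close> for all \<open>u > 0\<close>, which contributes \<open>\<Gamma>(3/2) t powr (-3/2)\<close>.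
\<close>
lemma lap0_bound:
  assumes t: "0 < t"
  shows "cmod (lap 0 t - of_real (sqrt (pi / t)) / (1 - \<i>)) \<le> Gamma (3/2) * t powr (-3/2)"
proof -
  have g: "has_bochner_integral lborel (\<lambda>u. indicator {0<..} u *\<^sub>R (u powr (1/2) * exp (- (t * u)))) (Gamma (1/2 + 1) / t powr (1/2 + 1))"
    by (rule integrable_halfline_powr) (use t in auto)
  have g2: "has_bochner_integral lborel (\<lambda>u. indicator {0<..} u *\<^sub>R (u powr (-1/2) * exp (- (t * u)))) (Gamma (-1/2 + 1) / t powr (-1/2 + 1))"
    by (rule integrable_halfline_powr) (use t in auto)
  have "Gamma (-1/2 + 1) / t powr (-1/2 + 1) = sqrt (pi / t)"
    using t by (simp add: Gamma_one_half_real powr_half_sqrt real_sqrt_divide)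
  then have g3: "has_bochner_integral lborel (\<lambda>u. complex_of_real (indicator {0<..} u *\<^sub>R (u powr (-1/2) * exp (- (t * u)))) / (1 - \<i>)) (of_real (sqrt (pi / t)) / (1 - \<i>))"
    by (intro has_bochner_integral_divide_zero has_bochner_integral_of_real) (use g2 in simp)
  have split: "lap 0 t - of_real (sqrt (pi / t)) / (1 - \<i>) = (LBINT u. indicator {0<..} u *\<^sub>R (of_real (u ^ 0 * exp (- (t * u))) / hroot 1 u) - complex_of_real (indicator {0<..} u *\<^sub>R (u powr (-1/2) * exp (- (t * u)))) / (1 - \<i>))"
    unfolding has_bochner_integral_integral_eq[OF g3, symmetric] lap_def
    by (rule Bochner_Integration.integral_diff[symmetric, OF integrable_lap[OF t] integrable.intros[OF g3]])
  have "cmod (lap 0 t - of_real (sqrt (pi / t)) / (1 - \<i>)) \<le> (LBINT u. indicator {0<..} u *\<^sub>R (u powr (1/2) * exp (- (t * u))))"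
  unfolding split
  proof (rule Bochner_Integration.integral_norm_bound_integral[OF Bochner_Integration.integrable_diff[OF integrable_lap[OF t] integrable.intros[OF g3]] integrable.intros[OF g]])
    fix u :: real
    show "norm (indicator {0<..} u *\<^sub>R (of_real (u ^ 0 * exp (- (t * u))) / hroot 1 u) - complex_of_real (indicator {0<..} u *\<^sub>R (u powr (-1/2) * exp (- (t * u)))) / (1 - \<i>))
       \<le> indicator {0<..} u *\<^sub>R (u powr (1/2) * exp (- (t * u)))"
    proof (cases "0 < u")
      case True
      define h where "h = hroot 1 u"
      define m where "m = (1 - \<i>) * complex_of_real (sqrt u)"
      note hf = hroot_facts[OF True, of 1, simplified, folded h_def]
      have su: "0 < sqrt u" "sqrt u * sqrt u = u" using True by auto
      have m0: "m \<noteq> 0" "cmod m = sqrt 2 * sqrt u" using True by (auto simp: m_def norm_mult cmod_def complex_eq_iff real_sqrt_mult)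
      have m2: "m * m = - 2 * \<i> * of_real u"
      proof -
        have "m * m = ((1 - \<i>) * (1 - \<i>)) * of_real (sqrt u * sqrt u)" unfolding m_def of_real_mult by (simp only: mult_ac)
        then show ?thesis unfolding su(2) by (simp add: algebra_simps)
      qed
      have d: "(h - m) * (h + m) = of_real (u\<^sup>2)"
      proof -
        have "(h - m) * (h + m) = h\<^sup>2 - m * m" by (simp add: power2_eq_square algebra_simps)
        then show ?thesis unfolding hf(1) m2 by (simp add: power2_eq_square algebra_simps)
      qed
      have "sqrt u \<le> Re (h + m)" using hf(2) by (simp add: m_def)
      then have hm: "sqrt u \<le> cmod (h + m)" using abs_Re_le_cmod[of "h + m"] by linarith
      have "cmod (h - m) * sqrt u \<le> cmod (h - m) * cmod (h + m)" using hm by (intro mult_left_mono) auto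
      also have "\<dots> = u\<^sup>2" using d by (metis norm_mult norm_of_real abs_power2)
      finally have a1: "cmod (h - m) \<le> u\<^sup>2 / sqrt u" using su by (simp add: pos_le_divide_eq)
      have "sqrt u \<le> cmod h" "sqrt u \<le> cmod m" using hf(9) hf(10) m0 su by (auto intro: order_trans[of "sqrt u" "sqrt 2 * sqrt u"])
      then have a2: "sqrt u * sqrt u \<le> cmod h * cmod m" by (intro mult_mono) (use su in auto)
      have "1 / h - 1 / m = (m - h) / (h * m)" using hf(3) m0 by (simp add: field_simps)
      then have "cmod (1 / h - 1 / m) = cmod (h - m) / (cmod h * cmod m)" by (simp add: norm_divide norm_mult norm_minus_commute)
      also have "\<dots> \<le> (u\<^sup>2 / sqrt u) / (sqrt u * sqrt u)" using a1 a2 True by (intro frac_le) auto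
      also have "\<dots> = sqrt u" using su True by (simp add: field_simps power2_eq_square)
      finally have A: "cmod (1 / h - 1 / m) \<le> sqrt u" .
      have "indicator {0<..} u *\<^sub>R (of_real (u ^ 0 * exp (- (t * u))) / hroot 1 u) - complex_of_real (indicator {0<..} u *\<^sub>R (u powr (-1/2) * exp (- (t * u)))) / (1 - \<i>)
        = of_real (exp (- (t * u))) * (1 / h - 1 / m)"
      proof -
        have e: "u powr (-1/2) = 1 / sqrt u" using powr_minus_divide[of u "1/2"] powr_half_sqrt[of u] True by simp
        have f: "complex_of_real (1 / sqrt u * X) / (1 - \<i>) = of_real X * (1 / m)" for X by (simp add: m_def divide_simps)
        have i: "indicator {0<..} u = (1::real)" using True by simp
        show ?thesis unfolding e i scaleR_one f h_def right_diff_distrib by simp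
      qed
      then show ?thesis using mult_left_mono[OF A, of "exp (- (t * u))"] True by (simp only: norm_mult norm_of_real abs_exp_cancel powr_half_sqrt less_imp_le) (simp add: mult.commute)
    qed simp
  qed
  also have "\<dots> = Gamma (1/2 + 1) / t powr (1/2 + 1)" by (rule has_bochner_integral_integral_eq[OF g])
  also have "\<dots> = Gamma (3/2) * t powr (-3/2)" using powr_minus_divide[of t "3/2"] by simp
  finally show ?thesis .
qed

text \<open>
  Derivative and function have the same leading term up to the factor \<open>\<i> k\<close>, since \<open>lap 1\<close> is of lower order than
  \<open>lap 0\<close>.
\<close>
lemma hankel_asymptotics:
  assumes k: "0 < k"
  shows "\<exists>C\<ge>0. \<forall>r>0. cmod (\<i> / 4 * hankel1_0 (k * r) - far k r / (4 * of_real pi)) \<le> C * r powr (-3/2)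
     \<and> cmod (\<i> / 4 * of_real k * hankel1_deriv (k * r) - \<i> * of_real k * (far k r / (4 * of_real pi))) \<le> C * r powr (-3/2)"
proof -
  define G where "G = Gamma (3/2) * k powr (-3/2)"
  have G: "0 \<le> G" by (simp add: G_def Gamma_real_nonneg)
  define C where "C = (1 + 2 * k) * G"
  show ?thesis
  proof (rule exI[of _ C], intro conjI allI impI)
    show "0 \<le> C" using G k by (simp add: C_def)
    fix r :: real assume r: "0 < r"
    have kr: "0 < k * r" using k r by simp
    have pw: "Gamma (3/2) * (k * r) powr (-3/2) = G * r powr (-3/2)" using k r by (simp add: G_def powr_mult)
    let ?e = "exp (\<i> * complex_of_real (k * r))"
    let ?L = "of_real (sqrt (pi / (k * r))) / (1 - \<i>) :: complex"
    have e0: "cmod (lap 0 (k * r) - ?L) \<le> G * r powr (-3/2)" using lap0_bound[OF kr] pw by simp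
    have e1: "cmod (lap 1 (k * r)) \<le> G * r powr (-3/2)" using lap1_bound[OF kr] pw by simp
    have c: "\<i> / 4 * hankel_const = 1 / (2 * of_real pi)" by (simp add: hankel_const_def)
    have "1 / (1 - \<i>) = (1 + \<i>) / 2"
    proof -
      have "1 - \<i> \<noteq> 0" by (simp add: complex_eq_iff)
      then show ?thesis by (simp add: field_simps)
    qed
    then have L: "?L = of_real (sqrt (pi / (k * r))) * ((1 + \<i>) / 2)" by (metis times_divide_eq_right mult.right_neutral)
    have f: "far k r / (4 * of_real pi) = 1 / (2 * of_real pi) * (?e * ?L)" unfolding L far_def by (simp add: field_simps)
    have n: "cmod (1 / (2 * of_real pi)) \<le> 1" using pi_gt3 by (simp add: norm_divide norm_mult)
    have ne: "cmod ?e = 1" by simp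
    have "\<i> / 4 * hankel1_0 (k * r) - far k r / (4 * of_real pi) = 1 / (2 * of_real pi) * (?e * (lap 0 (k * r) - ?L))"
      unfolding f hankel_eq_lap[OF kr] hankel_lap_def mult.assoc[symmetric] c by (simp add: algebra_simps)
    then have "cmod (\<i> / 4 * hankel1_0 (k * r) - far k r / (4 * of_real pi)) = cmod (1 / (2 * of_real pi)) * cmod (lap 0 (k * r) - ?L)"
      by (simp only: norm_mult ne mult_1)
    also have "\<dots> \<le> 1 * (G * r powr (-3/2))" by (intro mult_mono n e0) auto
    also have "\<dots> \<le> C * r powr (-3/2)" unfolding mult_1 C_def using G k by (intro mult_right_mono) (auto simp: distrib_right)
    finally show "cmod (\<i> / 4 * hankel1_0 (k * r) - far k r / (4 * of_real pi)) \<le> C * r powr (-3/2)" .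
    have "\<i> / 4 * of_real k * hankel1_deriv (k * r) - \<i> * of_real k * (far k r / (4 * of_real pi))
       = of_real k * (1 / (2 * of_real pi) * (?e * (\<i> * (lap 0 (k * r) - ?L) - lap 1 (k * r))))"
    proof -
      have "\<i> / 4 * of_real k * hankel1_deriv (k * r) = of_real k * (1 / (2 * of_real pi) * (?e * (\<i> * lap 0 (k * r) - lap 1 (k * r))))"
        unfolding hankel1_deriv_def c[symmetric] by (simp add: mult_ac)
      then show ?thesis unfolding f by (simp only:) (simp add: algebra_simps)
    qed
    then have "cmod (\<i> / 4 * of_real k * hankel1_deriv (k * r) - \<i> * of_real k * (far k r / (4 * of_real pi)))
       = k * (cmod (1 / (2 * of_real pi)) * cmod (\<i> * (lap 0 (k * r) - ?L) - lap 1 (k * r)))"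
      using k by (simp only: norm_mult ne mult_1 norm_of_real abs_of_pos)
    also have "\<dots> \<le> k * (1 * (G * r powr (-3/2) + G * r powr (-3/2)))"
      using k e0 e1 by (intro mult_left_mono mult_mono n order_trans[OF norm_triangle_ineq4] add_mono) (auto simp: norm_mult)
    finally have le2: "cmod (\<i> / 4 * of_real k * hankel1_deriv (k * r) - \<i> * of_real k * (far k r / (4 * of_real pi))) \<le> k * (2 * (G * r powr (-3/2)))" by simp
    show "cmod (\<i> / 4 * of_real k * hankel1_deriv (k * r) - \<i> * of_real k * (far k r / (4 * of_real pi))) \<le> C * r powr (-3/2)"
      using le2 G by (simp add: C_def algebra_simps) (use mult_nonneg_nonneg[OF G, of "r powr (-3/2)"] in \<open>linarith | simp add: add_increasing\<close>)
  qed
qed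

text \<open>
  The decay \<open>exp (- X2 \<bar>\<xi>\<bar> / 2)\<close> of the majorant leaves room for the factor with exponent \<open>X2 / 8 (2 \<bar>\<xi>\<bar> + K)\<close>, which is
  the margin needed for differentiation under the integral.
\<close>
lemma fourier_shift_integrable:
  assumes k: "0 < k" "k < K" and X2: "0 < X2" and Y: "Y \<le> 0"
    and [measurable]: "p \<in> borel_measurable borel" "q \<in> borel_measurable borel"
    and pq: "\<And>\<xi>. cmod (p \<xi>) + cmod (q \<xi>) \<le> 2 * \<bar>\<xi>\<bar> + K"
  shows "integrable lborel (\<lambda>\<xi>. cmod (fourier_term k K i j l X1 X2 Y \<xi>) * exp (X2 / 8 * (cmod (p \<xi>) + cmod (q \<xi>))))"
proof -
  obtain C where C: "0 \<le> C" "\<And>X1 Y \<xi>. Y \<le> 0 \<Longrightarrow> cmod (fourier_term k K i j l X1 X2 Y \<xi>) \<le> C * weight k (X2 / 2) \<xi>"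
    using fourier_term_bound[OF k X2] by blast
  have K: "0 < K" using k by simp
  have [measurable]: "fourier_term k K i j l X1 X2 Y \<in> borel_measurable borel" using k(1) K by measurable
  have W: "integrable lborel (\<lambda>\<xi>. C * exp (X2 / 8 * K) * weight k (X2 / 4) \<xi>)"
    using integrable_weight[of "X2 / 4" k] X2 by (intro integrable_mult_right) auto
  show ?thesis
  proof (rule Bochner_Integration.integrable_bound[OF W])
    show "AE \<xi> in lborel. norm (cmod (fourier_term k K i j l X1 X2 Y \<xi>) * exp (X2 / 8 * (cmod (p \<xi>) + cmod (q \<xi>)))) \<le> norm (C * exp (X2 / 8 * K) * weight k (X2 / 4) \<xi>)"
    proof (rule AE_I2)
      fix \<xi> :: real
      have "X2 / 8 * (cmod (p \<xi>) + cmod (q \<xi>)) \<le> X2 / 8 * (2 * \<bar>\<xi>\<bar> + K)" using pq[of \<xi>] X2 by (intro mult_left_mono) auto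
      also have "\<dots> = X2 / 4 * \<bar>\<xi>\<bar> + X2 / 8 * K" by (simp add: algebra_simps)
      finally have "exp (X2 / 8 * (cmod (p \<xi>) + cmod (q \<xi>))) \<le> exp (X2 / 4 * \<bar>\<xi>\<bar>) * exp (X2 / 8 * K)" by (simp add: mult_exp_exp)
      then have "cmod (fourier_term k K i j l X1 X2 Y \<xi>) * exp (X2 / 8 * (cmod (p \<xi>) + cmod (q \<xi>))) \<le> (C * weight k (X2 / 2) \<xi>) * (exp (X2 / 4 * \<bar>\<xi>\<bar>) * exp (X2 / 8 * K))"
        using C(2)[OF Y] by (intro mult_mono) (auto intro: order_trans[OF norm_ge_zero C(2)[OF Y]])
      also have "\<dots> = C * exp (X2 / 8 * K) * (weight k (X2 / 2) \<xi> * exp (X2 / 4 * \<bar>\<xi>\<bar>))" by (simp add: mult_ac)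
      also have "weight k (X2 / 2) \<xi> * exp (X2 / 4 * \<bar>\<xi>\<bar>) = weight k (X2 / 4) \<xi>"
      proof -
        have "exp (- (X2 / 2) * \<bar>\<xi>\<bar>) * exp (X2 / 4 * \<bar>\<xi>\<bar>) = exp (- (X2 / 4) * \<bar>\<xi>\<bar>)" by (simp add: mult_exp_exp)
        then show ?thesis unfolding weight_def distrib_right times_divide_eq_left by simp
      qed
      finally show "norm (cmod (fourier_term k K i j l X1 X2 Y \<xi>) * exp (X2 / 8 * (cmod (p \<xi>) + cmod (q \<xi>)))) \<le> norm (C * exp (X2 / 8 * K) * weight k (X2 / 4) \<xi>)"
        by (simp add: order_trans[OF _ abs_ge_self])
    qed
  qed simp
qed

lemma has_derivative_fourier_upper:
  assumes k: "0 < k" "k < K" and X2: "0 < x2 + y $ 2"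
  shows "((\<lambda>y::real^2. fourier k K i j l (x1 - y $ 1) (x2 + y $ 2) 0) has_derivative
     (\<lambda>h. of_real (h $ 1) * (- \<i> * fourier k K (Suc i) j l (x1 - y $ 1) (x2 + y $ 2) 0) + of_real (h $ 2) * (- fourier k K i (Suc j) l (x1 - y $ 1) (x2 + y $ 2) 0))) (at y)"
proof -
  let ?G = "fourier_term k K i j l (x1 - y $ 1) (x2 + y $ 2) 0"
  have K: "0 < K" using k by simp
  have m: "?G \<in> borel_measurable borel" "(\<lambda>\<xi>. - \<i> * complex_of_real \<xi>) \<in> borel_measurable borel" "(\<lambda>\<xi>. - SS (complex_of_real \<xi>) k) \<in> borel_measurable borel"
    using k K by measurable
  have "((\<lambda>z::real^2. LBINT \<xi>. ?G \<xi> * exp ((- \<i> * of_real \<xi>) * of_real ((z - y) $ 1) + (- SS (of_real \<xi>) k) * of_real ((z - y) $ 2))) has_derivative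
     (\<lambda>h. of_real (h $ 1) * (LBINT \<xi>. ?G \<xi> * (- \<i> * of_real \<xi>)) + of_real (h $ 2) * (LBINT \<xi>. ?G \<xi> * (- SS (of_real \<xi>) k)))) (at y)"
  proof (rule has_derivative_exp_integral[where la = "\<lambda>h. h $ 1" and lb = "\<lambda>h. h $ 2" and \<epsilon> = "(x2 + y $ 2) / 8"])
    show "integrable lborel (\<lambda>\<xi>. cmod (?G \<xi>) * exp ((x2 + y $ 2) / 8 * (cmod (- \<i> * of_real \<xi>) + cmod (- SS (of_real \<xi>) k))))"
      by (rule fourier_shift_integrable[OF k X2 order_refl m(2,3)])
        (use order_trans[OF SS_real_bounds(1)[OF k(1)] add_left_mono[OF less_imp_le[OF k(2)]]] in \<open>auto simp: norm_mult\<close>)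
  qed (use m X2 in \<open>auto intro: bounded_linear_vec_nth component_le_norm_cart\<close>)
  moreover have "(LBINT \<xi>. ?G \<xi> * exp ((- \<i> * of_real \<xi>) * of_real ((z - y) $ 1) + (- SS (of_real \<xi>) k) * of_real ((z - y) $ 2))) = fourier k K i j l (x1 - z $ 1) (x2 + z $ 2) 0" for z :: "real^2"
    unfolding fourier_def
  proof (rule Bochner_Integration.integral_cong[OF refl])
    fix \<xi> :: real
    show "?G \<xi> * exp ((- \<i> * of_real \<xi>) * of_real ((z - y) $ 1) + (- SS (of_real \<xi>) k) * of_real ((z - y) $ 2)) = fourier_term k K i j l (x1 - z $ 1) (x2 + z $ 2) 0 \<xi>"
      by (simp add: fourier_term_def mult.assoc flip: exp_add) (simp add: algebra_simps)
  qed
  moreover have "(LBINT \<xi>. ?G \<xi> * (- \<i> * of_real \<xi>)) = - \<i> * fourier k K (Suc i) j l (x1 - y $ 1) (x2 + y $ 2) 0"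
  proof -
    have "(\<lambda>\<xi>. ?G \<xi> * (- \<i> * of_real \<xi>)) = (\<lambda>\<xi>. - \<i> * fourier_term k K (Suc i) j l (x1 - y $ 1) (x2 + y $ 2) 0 \<xi>)"
      by (simp add: fourier_term_def fun_eq_iff)
    then show ?thesis by (simp only: fourier_def integral_mult_right_zero)
  qed
  moreover have "(LBINT \<xi>. ?G \<xi> * (- SS (of_real \<xi>) k)) = - fourier k K i (Suc j) l (x1 - y $ 1) (x2 + y $ 2) 0"
  proof -
    have "(\<lambda>\<xi>. ?G \<xi> * (- SS (of_real \<xi>) k)) = (\<lambda>\<xi>. - fourier_term k K i (Suc j) l (x1 - y $ 1) (x2 + y $ 2) 0 \<xi>)"
      by (simp add: fourier_term_def fun_eq_iff)
    then show ?thesis by (simp add: fourier_def)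
  qed
  ultimately show ?thesis by (simp only:)
qed

lemma has_derivative_fourier_lower:
  assumes k: "0 < k" "k < K" and x2: "0 < x2" and y: "y $ 2 < 0"
  shows "((\<lambda>y::real^2. fourier k K i j l (x1 - y $ 1) x2 (y $ 2)) has_derivative
     (\<lambda>h. of_real (h $ 1) * (- \<i> * fourier k K (Suc i) j l (x1 - y $ 1) x2 (y $ 2)) + of_real (h $ 2) * fourier k K i j (Suc l) (x1 - y $ 1) x2 (y $ 2))) (at y)"
proof -
  let ?G = "fourier_term k K i j l (x1 - y $ 1) x2 (y $ 2)"
  have K: "0 < K" using k by simp
  have m: "?G \<in> borel_measurable borel" "(\<lambda>\<xi>. - \<i> * complex_of_real \<xi>) \<in> borel_measurable borel" "(\<lambda>\<xi>. SS (complex_of_real \<xi>) K) \<in> borel_measurable borel"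
    using k K by measurable
  have "((\<lambda>z::real^2. LBINT \<xi>. ?G \<xi> * exp ((- \<i> * of_real \<xi>) * of_real ((z - y) $ 1) + SS (of_real \<xi>) K * of_real ((z - y) $ 2))) has_derivative
     (\<lambda>h. of_real (h $ 1) * (LBINT \<xi>. ?G \<xi> * (- \<i> * of_real \<xi>)) + of_real (h $ 2) * (LBINT \<xi>. ?G \<xi> * SS (of_real \<xi>) K))) (at y)"
  proof (rule has_derivative_exp_integral[where la = "\<lambda>h. h $ 1" and lb = "\<lambda>h. h $ 2" and \<epsilon> = "x2 / 8"])
    show "integrable lborel (\<lambda>\<xi>. cmod (?G \<xi>) * exp (x2 / 8 * (cmod (- \<i> * of_real \<xi>) + cmod (SS (of_real \<xi>) K))))"
      by (rule fourier_shift_integrable[OF k x2 less_imp_le[OF y] m(2,3)])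
        (use SS_real_bounds(1)[OF K] in \<open>auto simp: norm_mult\<close>)
  qed (use m x2 in \<open>auto intro: bounded_linear_vec_nth component_le_norm_cart\<close>)
  moreover have "(LBINT \<xi>. ?G \<xi> * exp ((- \<i> * of_real \<xi>) * of_real ((z - y) $ 1) + SS (of_real \<xi>) K * of_real ((z - y) $ 2))) = fourier k K i j l (x1 - z $ 1) x2 (z $ 2)" for z :: "real^2"
    unfolding fourier_def
  proof (rule Bochner_Integration.integral_cong[OF refl])
    fix \<xi> :: real
    show "?G \<xi> * exp ((- \<i> * of_real \<xi>) * of_real ((z - y) $ 1) + SS (of_real \<xi>) K * of_real ((z - y) $ 2)) = fourier_term k K i j l (x1 - z $ 1) x2 (z $ 2) \<xi>"
      by (simp add: fourier_term_def mult.assoc flip: exp_add) (simp add: algebra_simps)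
  qed
  moreover have "(LBINT \<xi>. ?G \<xi> * (- \<i> * of_real \<xi>)) = - \<i> * fourier k K (Suc i) j l (x1 - y $ 1) x2 (y $ 2)"
  proof -
    have "(\<lambda>\<xi>. ?G \<xi> * (- \<i> * of_real \<xi>)) = (\<lambda>\<xi>. - \<i> * fourier_term k K (Suc i) j l (x1 - y $ 1) x2 (y $ 2) \<xi>)"
      by (simp add: fourier_term_def fun_eq_iff)
    then show ?thesis by (simp only: fourier_def integral_mult_right_zero)
  qed
  moreover have "(LBINT \<xi>. ?G \<xi> * SS (of_real \<xi>) K) = fourier k K i j (Suc l) (x1 - y $ 1) x2 (y $ 2)"
    unfolding fourier_def by (rule Bochner_Integration.integral_cong[OF refl]) (simp add: fourier_term_def)
  ultimately show ?thesis by (simp only:)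
qed

section \<open>Errors that are negligible in the far field\<close>

text \<open>
  A shift by at most \<open>r / 2\<close> keeps at least half of the distance, so powers of \<open>r'\<close> and of \<open>r\<close> are interchangeable in
  error bounds.
\<close>
lemma distance_shift_le:
  fixes r c s b1 b2 R :: real
  assumes cs: "c\<^sup>2 + s\<^sup>2 = 1" and b: "b1\<^sup>2 + b2\<^sup>2 \<le> R\<^sup>2" and R: "0 \<le> R" and r: "2 * R \<le> r"
  shows "r / 2 \<le> sqrt ((r * c - b1)\<^sup>2 + (r * s - b2)\<^sup>2)"
proof -
  let ?z = "Complex (r * c) (r * s)" and ?b = "Complex b1 b2"
  have "(r * c)\<^sup>2 + (r * s)\<^sup>2 = r\<^sup>2 * (c\<^sup>2 + s\<^sup>2)" by (simp add: power_mult_distrib distrib_left)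
  then have "cmod ?z = r" unfolding cs using R r by (simp add: cmod_def)
  moreover have "cmod ?b \<le> R" using real_sqrt_le_mono[OF b] R by (simp add: cmod_def)
  ultimately have "r - R \<le> cmod (?z - ?b)" using norm_triangle_ineq2[of ?z ?b] by linarith
  then show ?thesis using r by (simp add: cmod_def)
qed

lemma fourier_far_field:
  assumes k: "0 < k" "k < K" and R: "0 \<le> R"
  shows "\<exists>C\<ge>0. \<exists>r0>0. \<forall>r c s b1 b2 Y. r0 \<le> r \<longrightarrow> c\<^sup>2 + s\<^sup>2 = 1 \<longrightarrow> b1\<^sup>2 + b2\<^sup>2 \<le> R\<^sup>2 \<longrightarrow> b2 < r * s \<longrightarrow> Y \<in> {-R..0} \<longrightarrow>
    cmod (fourier k K i j l (r * c - b1) (r * s - b2) Y - far k r * exp (- \<i> * of_real (k * (c * b1 + s * b2))) * symbol k K i j l Y c s) \<le> C * r powr (-3/2)"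
proof -
  obtain C1 r1 where C1: "0 \<le> C1" "0 < r1" "\<And>r c s Y. r1 \<le> r \<Longrightarrow> 0 < s \<Longrightarrow> c\<^sup>2 + s\<^sup>2 = 1 \<Longrightarrow> - R \<le> Y \<Longrightarrow> Y \<le> 0 \<Longrightarrow>
    cmod (fourier k K i j l (r * c) (r * s) Y - far k r * symbol k K i j l Y c s) \<le> C1 * r powr (-3/2)"
    using fourier_asymptotics[OF k R, of i j l] by blast
  obtain C2 where C2: "0 \<le> C2" "\<And>r c s b1 b2 Y r'. 2 * R + 1 \<le> r \<Longrightarrow> c\<^sup>2 + s\<^sup>2 = 1 \<Longrightarrow> b1\<^sup>2 + b2\<^sup>2 \<le> R\<^sup>2 \<Longrightarrow> Y \<in> {-R..0} \<Longrightarrow>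
    r' = sqrt ((r * c - b1)\<^sup>2 + (r * s - b2)\<^sup>2) \<Longrightarrow>
    cmod (far k r' * symbol k K i j l Y ((r * c - b1) / r') ((r * s - b2) / r')
       - far k r * exp (- \<i> * of_real (k * (c * b1 + s * b2))) * symbol k K i j l Y c s) \<le> C2 * r powr (-3/2)"
    using far_field_shift[OF k(1) R bounded_lipschitz_symbol[OF k R, of i j l]] by blast
  define q :: real where "q = (1/2) powr (-3/2)"
  have q: "0 \<le> q" by (simp add: q_def)
  show ?thesis
  proof (rule exI[of _ "C1 * q + C2"], rule conjI, use C1(1) C2(1) q in simp, rule exI[of _ "2 * R + 1 + 2 * r1"], rule conjI, use R C1(2) in simp, intro allI impI)
    fix r c s b1 b2 Y
    assume r: "2 * R + 1 + 2 * r1 \<le> r" and cs: "c\<^sup>2 + s\<^sup>2 = 1" and b: "b1\<^sup>2 + b2\<^sup>2 \<le> R\<^sup>2" and s: "b2 < r * s" and Y: "Y \<in> {-R..0}"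
    define r' where "r' = sqrt ((r * c - b1)\<^sup>2 + (r * s - b2)\<^sup>2)"
    have rr: "r / 2 \<le> r'"
      using distance_shift_le[OF cs b R, of r] r C1(2) by (simp add: r'_def)
    have r0: "0 < r" using r R C1(2) by simp
    have rp: "0 < r'" "r1 \<le> r'" using rr r R C1(2) r0 by auto
    have "r' powr (-3/2) \<le> (r / 2) powr (-3/2)" using rr r0 by (intro powr_mono2') auto
    also have "\<dots> = q * r powr (-3/2)" using r0 powr_mult[of "1/2" r "-3/2"] by (simp add: q_def)
    finally have pw: "r' powr (-3/2) \<le> q * r powr (-3/2)" .
    have c': "((r * c - b1) / r')\<^sup>2 + ((r * s - b2) / r')\<^sup>2 = 1"
    proof -
      have "r'\<^sup>2 = (r * c - b1)\<^sup>2 + (r * s - b2)\<^sup>2" by (simp add: r'_def)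
      moreover have "r'\<^sup>2 \<noteq> 0" using rp by simp
      ultimately show ?thesis unfolding power_divide add_divide_distrib[symmetric] by simp
    qed
    have e: "r' * ((r * c - b1) / r') = r * c - b1" "r' * ((r * s - b2) / r') = r * s - b2" using rp by auto
    have "cmod (fourier k K i j l (r * c - b1) (r * s - b2) Y - far k r' * symbol k K i j l Y ((r * c - b1) / r') ((r * s - b2) / r')) \<le> C1 * r' powr (-3/2)"
      using C1(3)[OF rp(2) _ c', of Y] Y rp(1) s unfolding e by simp
    also have "\<dots> \<le> C1 * (q * r powr (-3/2))" using pw C1(1) by (rule mult_left_mono)
    finally have 1: "cmod (fourier k K i j l (r * c - b1) (r * s - b2) Y - far k r' * symbol k K i j l Y ((r * c - b1) / r') ((r * s - b2) / r')) \<le> C1 * (q * r powr (-3/2))" .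
    have "2 * R + 1 \<le> r" using r C1(2) by simp
    from norm_diff_triangle_le[OF 1 C2(2)[OF this cs b Y r'_def]]
    show "cmod (fourier k K i j l (r * c - b1) (r * s - b2) Y - far k r * exp (- \<i> * of_real (k * (c * b1 + s * b2))) * symbol k K i j l Y c s) \<le> (C1 * q + C2) * r powr (-3/2)"
      by (simp add: algebra_simps)
  qed
qed

text \<open>
  Error terms of order \<open>r powr (-3/2)\<close>, uniformly in the upper directions \<open>(c, s)\<close> and in the sources \<open>(b1, b2)\<close> of norm
  at most \<open>R\<close> with vertical coordinate in \<open>S\<close>; the set \<open>S\<close> separates sources above and below the interface.
\<close>
definition negligible :: "real \<Rightarrow> real set \<Rightarrow> (real \<Rightarrow> real \<Rightarrow> real \<Rightarrow> real \<Rightarrow> real \<Rightarrow> complex) \<Rightarrow> bool" where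
  "negligible R S E \<longleftrightarrow> (\<exists>C\<ge>0. \<exists>r0>0. \<forall>r c s b1 b2. r0 \<le> r \<longrightarrow> 0 < s \<longrightarrow> c\<^sup>2 + s\<^sup>2 = 1 \<longrightarrow> b1\<^sup>2 + b2\<^sup>2 \<le> R\<^sup>2 \<longrightarrow> b2 \<in> S \<longrightarrow>
     cmod (E r c s b1 b2) \<le> C * r powr (-3/2))"

lemma negligibleI:
  assumes "0 \<le> C" "0 < r0" "\<And>r c s b1 b2. r0 \<le> r \<Longrightarrow> 0 < s \<Longrightarrow> c\<^sup>2 + s\<^sup>2 = 1 \<Longrightarrow> b1\<^sup>2 + b2\<^sup>2 \<le> R\<^sup>2 \<Longrightarrow> b2 \<in> S \<Longrightarrow>
     cmod (E r c s b1 b2) \<le> C * r powr (-3/2)"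
  shows "negligible R S E"
  unfolding negligible_def using assms by blast

lemma negligible_add:
  assumes "negligible R S E" "negligible R S F"
  shows "negligible R S (\<lambda>r c s b1 b2. E r c s b1 b2 + F r c s b1 b2)"
proof -
  obtain C1 r1 where 1: "0 \<le> C1" "0 < r1" "\<And>r c s b1 b2. r1 \<le> r \<Longrightarrow> 0 < s \<Longrightarrow> c\<^sup>2 + s\<^sup>2 = 1 \<Longrightarrow> b1\<^sup>2 + b2\<^sup>2 \<le> R\<^sup>2 \<Longrightarrow> b2 \<in> S \<Longrightarrow>
     cmod (E r c s b1 b2) \<le> C1 * r powr (-3/2)" using assms(1) unfolding negligible_def by blast
  obtain C2 r2 where 2: "0 \<le> C2" "0 < r2" "\<And>r c s b1 b2. r2 \<le> r \<Longrightarrow> 0 < s \<Longrightarrow> c\<^sup>2 + s\<^sup>2 = 1 \<Longrightarrow> b1\<^sup>2 + b2\<^sup>2 \<le> R\<^sup>2 \<Longrightarrow> b2 \<in> S \<Longrightarrow>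
     cmod (F r c s b1 b2) \<le> C2 * r powr (-3/2)" using assms(2) unfolding negligible_def by blast
  show ?thesis
  proof (rule negligibleI[of "C1 + C2" "r1 + r2"])
    fix r c s b1 b2 :: real assume a: "r1 + r2 \<le> r" and b: "0 < s" "c\<^sup>2 + s\<^sup>2 = 1" "b1\<^sup>2 + b2\<^sup>2 \<le> R\<^sup>2" "b2 \<in> S"
    show "cmod (E r c s b1 b2 + F r c s b1 b2) \<le> (C1 + C2) * r powr (-3/2)"
      unfolding distrib_right by (rule norm_triangle_mono) (use a b 1 2 in auto)
  qed (use 1 2 in auto)
qed

lemma negligible_scale:
  assumes "negligible R S E"
  shows "negligible R S (\<lambda>r c s b1 b2. z * E r c s b1 b2)"
proof -
  obtain C r0 where 1: "0 \<le> C" "0 < r0" "\<And>r c s b1 b2. r0 \<le> r \<Longrightarrow> 0 < s \<Longrightarrow> c\<^sup>2 + s\<^sup>2 = 1 \<Longrightarrow> b1\<^sup>2 + b2\<^sup>2 \<le> R\<^sup>2 \<Longrightarrow> b2 \<in> S \<Longrightarrow>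
     cmod (E r c s b1 b2) \<le> C * r powr (-3/2)" using assms(1) unfolding negligible_def by blast
  show ?thesis
    by (rule negligibleI[of "cmod z * C" r0]) (use 1 in \<open>auto simp: norm_mult mult.assoc intro!: mult_left_mono\<close>)
qed

lemma negligible_diff:
  assumes "negligible R S E" "negligible R S F"
  shows "negligible R S (\<lambda>r c s b1 b2. E r c s b1 b2 - F r c s b1 b2)"
  using negligible_add[OF assms(1) negligible_scale[OF assms(2), of "-1"]] by simp

text \<open>
  For the reflected wave the source is replaced by its mirror image \<open>(b1, - b2)\<close>.
\<close>
lemma negligible_fourier_reflected:
  assumes k: "0 < k" "k < K" and R: "0 \<le> R"
  shows "negligible R {0<..} (\<lambda>r c s b1 b2. fourier k K i j l (r * c - b1) (r * s + b2) 0
     - far k r * exp (- \<i> * of_real (k * (c * b1 - s * b2))) * symbol k K i j l 0 c s)"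
proof -
  obtain C r0 where C: "0 \<le> C" "0 < r0" "\<And>r c s b1 b2 Y. r0 \<le> r \<Longrightarrow> c\<^sup>2 + s\<^sup>2 = 1 \<Longrightarrow> b1\<^sup>2 + b2\<^sup>2 \<le> R\<^sup>2 \<Longrightarrow> b2 < r * s \<Longrightarrow> Y \<in> {-R..0} \<Longrightarrow>
    cmod (fourier k K i j l (r * c - b1) (r * s - b2) Y - far k r * exp (- \<i> * of_real (k * (c * b1 + s * b2))) * symbol k K i j l Y c s) \<le> C * r powr (-3/2)"
    using fourier_far_field[OF k R, of i j l] by blast
  show ?thesis
  proof (rule negligibleI[OF C(1,2)])
    fix r c s b1 b2 :: real assume a: "r0 \<le> r" "0 < s" "c\<^sup>2 + s\<^sup>2 = 1" "b1\<^sup>2 + b2\<^sup>2 \<le> R\<^sup>2" "b2 \<in> {0<..}"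
    have "0 < r * s" using a(1,2) C(2) by simp
    then have "- b2 < r * s" using a(5) by simp
    then show "cmod (fourier k K i j l (r * c - b1) (r * s + b2) 0 - far k r * exp (- \<i> * of_real (k * (c * b1 - s * b2))) * symbol k K i j l 0 c s) \<le> C * r powr (-3/2)"
      using C(3)[of r c s b1 "- b2" 0] a R by simp
  qed
qed

text \<open>
  For the transmitted wave only the horizontal coordinate of the source shifts the observation point; the depth enters
  through the amplitude as \<open>Y = b2\<close>.
\<close>
lemma negligible_fourier_transmitted:
  assumes k: "0 < k" "k < K" and R: "0 \<le> R"
  shows "negligible R {..<0} (\<lambda>r c s b1 b2. fourier k K i j l (r * c - b1) (r * s) b2
     - far k r * exp (- \<i> * of_real (k * (c * b1))) * symbol k K i j l b2 c s)"
proof -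
  obtain C r0 where C: "0 \<le> C" "0 < r0" "\<And>r c s b1 b2 Y. r0 \<le> r \<Longrightarrow> c\<^sup>2 + s\<^sup>2 = 1 \<Longrightarrow> b1\<^sup>2 + b2\<^sup>2 \<le> R\<^sup>2 \<Longrightarrow> b2 < r * s \<Longrightarrow> Y \<in> {-R..0} \<Longrightarrow>
    cmod (fourier k K i j l (r * c - b1) (r * s - b2) Y - far k r * exp (- \<i> * of_real (k * (c * b1 + s * b2))) * symbol k K i j l Y c s) \<le> C * r powr (-3/2)"
    using fourier_far_field[OF k R, of i j l] by blast
  show ?thesis
  proof (rule negligibleI[OF C(1,2)])
    fix r c s b1 b2 :: real assume a: "r0 \<le> r" "0 < s" "c\<^sup>2 + s\<^sup>2 = 1" "b1\<^sup>2 + b2\<^sup>2 \<le> R\<^sup>2" "b2 \<in> {..<0}"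
    have 1: "0 < r * s" using a(1,2) C(2) by simp
    have 2: "b1\<^sup>2 + 0\<^sup>2 \<le> R\<^sup>2" "b2\<^sup>2 \<le> R\<^sup>2" by (rule order_trans[OF _ a(4)], simp)+
    have "\<bar>b2\<bar> \<le> R" using 2(2) R by (metis abs_le_square_iff abs_of_nonneg)
    then show "cmod (fourier k K i j l (r * c - b1) (r * s) b2 - far k r * exp (- \<i> * of_real (k * (c * b1))) * symbol k K i j l b2 c s) \<le> C * r powr (-3/2)"
      using C(3)[of r c s b1 0 b2] a 1 2 by simp
  qed
qed

text \<open>
  The direct wave and its gradient: a radial function with the asymptotics of \<open>far\<close>, multiplied by an amplitude depending
  on the direction from the source.
\<close>
lemma negligible_direct:
  assumes k: "0 < k" "k < K" and R: "0 \<le> R"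
    and h: "\<exists>C\<ge>0. \<forall>r>0. cmod (h r - far k r) \<le> C * r powr (-3/2)"
  shows "negligible R S (\<lambda>r c s b1 b2. h (sqrt ((r * c - b1)\<^sup>2 + (r * s - b2)\<^sup>2))
      * symbol k K i j 0 0 ((r * c - b1) / sqrt ((r * c - b1)\<^sup>2 + (r * s - b2)\<^sup>2)) ((r * s - b2) / sqrt ((r * c - b1)\<^sup>2 + (r * s - b2)\<^sup>2))
     - far k r * exp (- \<i> * of_real (k * (c * b1 + s * b2))) * symbol k K i j 0 0 c s)"
proof -
  obtain C1 where C1: "0 \<le> C1" "\<And>r. 0 < r \<Longrightarrow> cmod (h r - far k r) \<le> C1 * r powr (-3/2)" using h by blast
  obtain C2 where C2: "0 \<le> C2" "\<And>r c s b1 b2 Y r'. 2 * R + 1 \<le> r \<Longrightarrow> c\<^sup>2 + s\<^sup>2 = 1 \<Longrightarrow> b1\<^sup>2 + b2\<^sup>2 \<le> R\<^sup>2 \<Longrightarrow> Y \<in> {-R..0} \<Longrightarrow>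
    r' = sqrt ((r * c - b1)\<^sup>2 + (r * s - b2)\<^sup>2) \<Longrightarrow>
    cmod (far k r' * symbol k K i j 0 Y ((r * c - b1) / r') ((r * s - b2) / r')
       - far k r * exp (- \<i> * of_real (k * (c * b1 + s * b2))) * symbol k K i j 0 Y c s) \<le> C2 * r powr (-3/2)"
    using far_field_shift[OF k(1) R bounded_lipschitz_symbol[OF k R, of i j 0]] by blast
  obtain M where M: "0 \<le> M" "\<And>c s. \<bar>c\<bar> \<le> 1 \<Longrightarrow> \<bar>s\<bar> \<le> 1 \<Longrightarrow> cmod (symbol k K i j 0 0 c s) \<le> M"
  proof -
    obtain M L where "0 \<le> M" "\<And>Y c s c' s'. Y \<in> {-R..0} \<Longrightarrow> c \<in> {-1..1} \<Longrightarrow> s \<in> {-1..1} \<Longrightarrow> c' \<in> {-1..1} \<Longrightarrow> s' \<in> {-1..1} \<Longrightarrow>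
       cmod (symbol k K i j 0 Y c s) \<le> M \<and> cmod (symbol k K i j 0 Y c s - symbol k K i j 0 Y c' s') \<le> L * (\<bar>c - c'\<bar> + \<bar>s - s'\<bar>)"
      using bounded_lipschitz_symbol[OF k R, of i j 0] unfolding bounded_lipschitz_def by meson
    note B = this
    show thesis
    proof (rule that[OF B(1)])
      fix c s :: real assume "\<bar>c\<bar> \<le> 1" "\<bar>s\<bar> \<le> 1"
      then show "cmod (symbol k K i j 0 0 c s) \<le> M" using B(2)[of 0 c s c s] R by (auto simp: abs_le_iff)
    qed
  qed
  define q :: real where "q = (1/2) powr (-3/2)"
  have q: "0 \<le> q" by (simp add: q_def)
  show ?thesis
  proof (rule negligibleI[of "C1 * q * M + C2" "2 * R + 1"])
    fix r c s b1 b2 :: real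
    assume r: "2 * R + 1 \<le> r" and s: "0 < s" and cs: "c\<^sup>2 + s\<^sup>2 = 1" and b: "b1\<^sup>2 + b2\<^sup>2 \<le> R\<^sup>2"
    define r' where "r' = sqrt ((r * c - b1)\<^sup>2 + (r * s - b2)\<^sup>2)"
    have rr: "r / 2 \<le> r'" using distance_shift_le[OF cs b R, of r] r by (simp add: r'_def)
    have r0: "0 < r" using r R by simp
    have rp: "0 < r'" using rr r0 by auto
    have "r' powr (-3/2) \<le> (r / 2) powr (-3/2)" using rr r0 by (intro powr_mono2') auto
    also have "\<dots> = q * r powr (-3/2)" using r0 powr_mult[of "1/2" r "-3/2"] by (simp add: q_def)
    finally have pw: "r' powr (-3/2) \<le> q * r powr (-3/2)" .
    have rs: "r'\<^sup>2 = (r * c - b1)\<^sup>2 + (r * s - b2)\<^sup>2" by (simp add: r'_def)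
    have le1: "\<bar>(r * c - b1) / r'\<bar> \<le> 1" "\<bar>(r * s - b2) / r'\<bar> \<le> 1"
    proof -
      have "\<bar>r * c - b1\<bar> \<le> r'" "\<bar>r * s - b2\<bar> \<le> r'" unfolding r'_def
        by (rule real_sqrt_ge_abs1, rule real_sqrt_ge_abs2)
      then show "\<bar>(r * c - b1) / r'\<bar> \<le> 1" "\<bar>(r * s - b2) / r'\<bar> \<le> 1" using rp by (simp_all add: abs_divide)
    qed
    let ?s = "symbol k K i j 0 0 ((r * c - b1) / r') ((r * s - b2) / r')"
    have "cmod (h r' * ?s - far k r' * ?s) = cmod (h r' - far k r') * cmod ?s" by (simp add: norm_mult flip: left_diff_distrib)
    also have "\<dots> \<le> (C1 * (q * r powr (-3/2))) * M"
    proof (intro mult_mono M(2) le1)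
      show "cmod (h r' - far k r') \<le> C1 * (q * r powr (-3/2))"
        using C1(2)[OF rp] mult_left_mono[OF pw C1(1)] by linarith
    qed (use C1(1) q in auto)
    finally have 1: "cmod (h r' * ?s - far k r' * ?s) \<le> (C1 * (q * r powr (-3/2))) * M" .
    have "(0::real) \<in> {-R..0}" using R by simp
    from norm_diff_triangle_le[OF 1 C2(2)[OF r cs b this r'_def]]
    show "cmod (h (sqrt ((r * c - b1)\<^sup>2 + (r * s - b2)\<^sup>2))
      * symbol k K i j 0 0 ((r * c - b1) / sqrt ((r * c - b1)\<^sup>2 + (r * s - b2)\<^sup>2)) ((r * s - b2) / sqrt ((r * c - b1)\<^sup>2 + (r * s - b2)\<^sup>2))
     - far k r * exp (- \<i> * of_real (k * (c * b1 + s * b2))) * symbol k K i j 0 0 c s) \<le> (C1 * q * M + C2) * r powr (-3/2)"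
      unfolding r'_def[symmetric] by (simp add: algebra_simps)
  qed (use C1(1) C2(1) M(1) q R in auto)
qed

section \<open>The Green function in terms of the Fourier integrals\<close>

text \<open>
  The Green function with the reflection quotient \<open>(S - T) / (S + T)\<close> expanded as
  \<open>(S\<^sup>2 - 2 S T + T\<^sup>2) / (K\<^sup>2 - k\<^sup>2)\<close>; the next definition uses \<open>1 / (S + T) = (S - T) / (K\<^sup>2 - k\<^sup>2)\<close> in the same way.
\<close>
definition green_upper :: "real \<Rightarrow> real \<Rightarrow> real^2 \<Rightarrow> real^2 \<Rightarrow> complex" where
  "green_upper k K x y = \<i> / 4 * hankel1_0 (k * norm (x - y))
     + 1 / (4 * of_real pi * of_real (K\<^sup>2 - k\<^sup>2)) *
       (fourier k K 0 2 0 (x $ 1 - y $ 1) (x $ 2 + y $ 2) 0 - 2 * fourier k K 0 1 1 (x $ 1 - y $ 1) (x $ 2 + y $ 2) 0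
         + fourier k K 0 0 2 (x $ 1 - y $ 1) (x $ 2 + y $ 2) 0)"

definition green_lower :: "real \<Rightarrow> real \<Rightarrow> real^2 \<Rightarrow> real^2 \<Rightarrow> complex" where
  "green_lower k K x y = 1 / (2 * of_real pi * of_real (K\<^sup>2 - k\<^sup>2)) *
       (fourier k K 0 2 0 (x $ 1 - y $ 1) (x $ 2) (y $ 2) - fourier k K 0 1 1 (x $ 1 - y $ 1) (x $ 2) (y $ 2))"

lemma SS_squared:
  assumes a: "0 < a" shows "(SS (of_real \<xi>) a)\<^sup>2 = of_real (\<xi>\<^sup>2 - a\<^sup>2)"
proof (cases "a \<le> \<bar>\<xi>\<bar>")
  case True
  then have "a\<^sup>2 \<le> \<xi>\<^sup>2" using a by (metis abs_le_square_iff abs_of_pos)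
  then show ?thesis using True a by (simp add: SS_of_real flip: of_real_power)
next
  case False
  then have "\<xi>\<^sup>2 \<le> a\<^sup>2" using a by (metis abs_le_square_iff abs_of_pos less_imp_le not_le)
  then show ?thesis using False a by (simp add: SS_of_real power_mult_distrib flip: of_real_power)
qed

lemma reflection_quotient:
  assumes k: "0 < k" "k < K"
  defines "a \<equiv> \<lambda>\<xi>. SS (of_real \<xi>) k" and "b \<equiv> \<lambda>\<xi>. SS (of_real \<xi>) K"
  shows "a \<xi> + b \<xi> \<noteq> 0" "1 / (a \<xi> + b \<xi>) = (a \<xi> - b \<xi>) / of_real (K\<^sup>2 - k\<^sup>2)"
    "(a \<xi> - b \<xi>) / (a \<xi> + b \<xi>) = ((a \<xi>)\<^sup>2 - 2 * (a \<xi> * b \<xi>) + (b \<xi>)\<^sup>2) / of_real (K\<^sup>2 - k\<^sup>2)"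
proof -
  have K: "0 < K" using k by simp
  define D where "D = complex_of_real (K\<^sup>2 - k\<^sup>2)"
  have D: "D \<noteq> 0" using k power_strict_mono[of k K 2] unfolding D_def of_real_eq_0_iff by simp
  have p: "(a \<xi> - b \<xi>) * (a \<xi> + b \<xi>) = D"
  proof -
    have "(a \<xi> - b \<xi>) * (a \<xi> + b \<xi>) = (a \<xi>)\<^sup>2 - (b \<xi>)\<^sup>2" by (simp add: power2_eq_square algebra_simps)
    then show ?thesis unfolding a_def b_def SS_squared[OF k(1)] SS_squared[OF K] D_def by simp
  qed
  then show n: "a \<xi> + b \<xi> \<noteq> 0" using D by auto
  show 1: "1 / (a \<xi> + b \<xi>) = (a \<xi> - b \<xi>) / of_real (K\<^sup>2 - k\<^sup>2)"
    using n D p unfolding D_def[symmetric] by (simp add: divide_eq_eq eq_divide_eq)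
  have "(a \<xi> - b \<xi>) / (a \<xi> + b \<xi>) = (a \<xi> - b \<xi>) * (1 / (a \<xi> + b \<xi>))" by simp
  also have "\<dots> = ((a \<xi>)\<^sup>2 - 2 * (a \<xi> * b \<xi>) + (b \<xi>)\<^sup>2) / of_real (K\<^sup>2 - k\<^sup>2)"
    unfolding 1 times_divide_eq_right by (rule arg_cong[where f = "\<lambda>z. z / _"]) (simp add: power2_eq_square algebra_simps)
  finally show "(a \<xi> - b \<xi>) / (a \<xi> + b \<xi>) = ((a \<xi>)\<^sup>2 - 2 * (a \<xi> * b \<xi>) + (b \<xi>)\<^sup>2) / of_real (K\<^sup>2 - k\<^sup>2)" .
qed

lemma green_eq_upper:
  assumes k: "0 < k" "k < K" and x: "0 < x $ 2" and y: "0 < y $ 2"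
  shows "green k K x y = green_upper k K x y"
proof -
  let ?T = "\<lambda>j l. fourier_term k K 0 j l (x $ 1 - y $ 1) (x $ 2 + y $ 2) 0"
  let ?D = "complex_of_real (K\<^sup>2 - k\<^sup>2)"
  have i: "integrable lborel (?T j l)" for j l by (rule integrable_fourier_term) (use k x y in auto)
  have "(LBINT \<xi>. (SS (of_real \<xi>) k - SS (of_real \<xi>) K) / (SS (of_real \<xi>) k + SS (of_real \<xi>) K)
            * (exp (- SS (of_real \<xi>) k * of_real \<bar>x $ 2 + y $ 2\<bar>) / SS (of_real \<xi>) k)
            * exp (\<i> * of_real (\<xi> * (x $ 1 - y $ 1)))) = (LBINT \<xi>. (?T 2 0 \<xi> - 2 * ?T 1 1 \<xi> + ?T 0 2 \<xi>) / ?D)"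
  proof (rule Bochner_Integration.integral_cong[OF refl])
    fix \<xi> :: real
    have e: "exp (SS (of_real \<xi>) K * of_real 0 - SS (of_real \<xi>) k * of_real (x $ 2 + y $ 2) + \<i> * of_real (\<xi> * (x $ 1 - y $ 1)))
       = exp (- SS (of_real \<xi>) k * of_real \<bar>x $ 2 + y $ 2\<bar>) * exp (\<i> * of_real (\<xi> * (x $ 1 - y $ 1)))"
      using x y by (simp flip: exp_add)
    show "(SS (of_real \<xi>) k - SS (of_real \<xi>) K) / (SS (of_real \<xi>) k + SS (of_real \<xi>) K)
            * (exp (- SS (of_real \<xi>) k * of_real \<bar>x $ 2 + y $ 2\<bar>) / SS (of_real \<xi>) k)
            * exp (\<i> * of_real (\<xi> * (x $ 1 - y $ 1))) = (?T 2 0 \<xi> - 2 * ?T 1 1 \<xi> + ?T 0 2 \<xi>) / ?D"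
      unfolding fourier_term_def e reflection_quotient(3)[OF k]
      by (simp add: add_divide_distrib diff_divide_distrib ring_distribs mult_ac)
  qed
  also have "\<dots> = (fourier k K 0 2 0 (x $ 1 - y $ 1) (x $ 2 + y $ 2) 0 - 2 * fourier k K 0 1 1 (x $ 1 - y $ 1) (x $ 2 + y $ 2) 0
         + fourier k K 0 0 2 (x $ 1 - y $ 1) (x $ 2 + y $ 2) 0) / ?D"
    unfolding fourier_def by (simp add: i del: of_real_diff of_real_power)
  finally show ?thesis using y unfolding green_def green_upper_def upper_half_plane_def by simp
qed

text \<open>
  The monomials carry a factor \<open>S / S\<close>, which is \<open>1\<close> except at the two zeros \<open>\<xi> = \<plusminus> k\<close> of \<open>S\<close>; hence the integrands agree
  almost everywhere only.
\<close>
lemma green_eq_lower: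
  assumes k: "0 < k" "k < K" and x: "0 < x $ 2" and y: "y $ 2 < 0"
  shows "green k K x y = green_lower k K x y"
proof -
  let ?T = "\<lambda>j l. fourier_term k K 0 j l (x $ 1 - y $ 1) (x $ 2) (y $ 2)"
  let ?D = "complex_of_real (K\<^sup>2 - k\<^sup>2)"
  have K: "0 < K" using k by simp
  have i: "integrable lborel (?T j l)" for j l by (rule integrable_fourier_term) (use k x y in auto)
  have "(LBINT \<xi>. exp (SS (of_real \<xi>) K * of_real (y $ 2) - SS (of_real \<xi>) k * of_real (x $ 2))
            / (SS (of_real \<xi>) k + SS (of_real \<xi>) K)
            * exp (\<i> * of_real (\<xi> * (x $ 1 - y $ 1)))) = (LBINT \<xi>. (?T 2 0 \<xi> - ?T 1 1 \<xi>) / ?D)"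
  proof (rule integral_cong_AE)
    show "(\<lambda>\<xi>. exp (SS (of_real \<xi>) K * of_real (y $ 2) - SS (of_real \<xi>) k * of_real (x $ 2))
            / (SS (of_real \<xi>) k + SS (of_real \<xi>) K) * exp (\<i> * of_real (\<xi> * (x $ 1 - y $ 1)))) \<in> borel_measurable lborel"
      using k(1) K by measurable
    show "(\<lambda>\<xi>. (?T 2 0 \<xi> - ?T 1 1 \<xi>) / ?D) \<in> borel_measurable lborel" using k(1) K by measurable
    show "AE \<xi> in lborel. exp (SS (of_real \<xi>) K * of_real (y $ 2) - SS (of_real \<xi>) k * of_real (x $ 2))
            / (SS (of_real \<xi>) k + SS (of_real \<xi>) K) * exp (\<i> * of_real (\<xi> * (x $ 1 - y $ 1))) = (?T 2 0 \<xi> - ?T 1 1 \<xi>) / ?D"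
      using AE_lborel_singleton[of k] AE_lborel_singleton[of "-k"]
    proof eventually_elim
      case (elim \<xi>)
      let ?a = "SS (of_real \<xi>) k" and ?b = "SS (of_real \<xi>) K"
      have "\<xi>\<^sup>2 - k\<^sup>2 \<noteq> 0" using elim by (simp add: power2_eq_iff)
      then have a: "?a \<noteq> 0" using SS_squared[OF k(1), of \<xi>] by (metis of_real_eq_0_iff zero_power2)
      have e: "exp (?b * of_real (y $ 2) - ?a * of_real (x $ 2) + \<i> * of_real (\<xi> * (x $ 1 - y $ 1)))
        = exp (?b * of_real (y $ 2) - ?a * of_real (x $ 2)) * exp (\<i> * of_real (\<xi> * (x $ 1 - y $ 1)))" by (rule exp_add)
      have "exp (?b * of_real (y $ 2) - ?a * of_real (x $ 2)) / (?a + ?b) * exp (\<i> * of_real (\<xi> * (x $ 1 - y $ 1)))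
        = (1 / (?a + ?b)) * (exp (?b * of_real (y $ 2) - ?a * of_real (x $ 2)) * exp (\<i> * of_real (\<xi> * (x $ 1 - y $ 1))))" by simp
      also have "\<dots> = (?T 2 0 \<xi> - ?T 1 1 \<xi>) / ?D"
        unfolding fourier_term_def e reflection_quotient(2)[OF k] using a
        by (simp add: diff_divide_distrib ring_distribs mult_ac power2_eq_square)
      finally show ?case .
    qed
  qed
  also have "\<dots> = (fourier k K 0 2 0 (x $ 1 - y $ 1) (x $ 2) (y $ 2) - fourier k K 0 1 1 (x $ 1 - y $ 1) (x $ 2) (y $ 2)) / ?D"
    unfolding fourier_def by (simp add: i del: of_real_diff of_real_power)
  finally show ?thesis using y unfolding green_def green_lower_def upper_half_plane_def by simp
qed

text \<open>
  Differentiation with respect to \<open>y\<close> multiplies the Fourier integrands by \<open>- \<i> \<xi>\<close> and by \<open>- S\<close> above or \<open>T\<close> below the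
  interface.
\<close>
definition green_gradient :: "real \<Rightarrow> real \<Rightarrow> real^2 \<Rightarrow> real^2 \<Rightarrow> complex^2" where
  "green_gradient k K x y =
    (if 0 < y $ 2 then
       (let d = norm (x - y); F = (\<lambda>i j l. fourier k K i j l (x $ 1 - y $ 1) (x $ 2 + y $ 2) 0) in vector
        [- (\<i> / 4 * of_real k * hankel1_deriv (k * d)) * of_real ((x $ 1 - y $ 1) / d)
           - \<i> / (4 * of_real pi * of_real (K\<^sup>2 - k\<^sup>2)) * (F 1 2 0 - 2 * F 1 1 1 + F 1 0 2),
         - (\<i> / 4 * of_real k * hankel1_deriv (k * d)) * of_real ((x $ 2 - y $ 2) / d)
           - 1 / (4 * of_real pi * of_real (K\<^sup>2 - k\<^sup>2)) * (F 0 3 0 - 2 * F 0 2 1 + F 0 1 2)])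
     else
       (let F = (\<lambda>i j l. fourier k K i j l (x $ 1 - y $ 1) (x $ 2) (y $ 2)) in vector
        [- \<i> / (2 * of_real pi * of_real (K\<^sup>2 - k\<^sup>2)) * (F 1 2 0 - F 1 1 1),
         1 / (2 * of_real pi * of_real (K\<^sup>2 - k\<^sup>2)) * (F 0 2 1 - F 0 1 2)]))"

lemma has_derivative_hankel_norm:
  fixes x y :: "real^2"
  assumes k: "0 < k" and xy: "x \<noteq> y"
  shows "((\<lambda>y. hankel1_0 (k * norm (x - y))) has_derivative
     (\<lambda>h. of_real (h $ 1) * (- (of_real k * hankel1_deriv (k * norm (x - y)) * of_real ((x $ 1 - y $ 1) / norm (x - y))))
        + of_real (h $ 2) * (- (of_real k * hankel1_deriv (k * norm (x - y)) * of_real ((x $ 2 - y $ 2) / norm (x - y)))))) (at y)"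
proof -
  let ?d = "norm (x - y)"
  have d: "0 < ?d" using xy by simp
  have n: "((\<lambda>y. k * norm (x - y)) has_derivative (\<lambda>h. k * ((- h) \<bullet> sgn (x - y)))) (at y)"
  proof (rule has_derivative_mult_right)
    have "((\<lambda>y. x - y) has_derivative (\<lambda>h. - h)) (at y)" by (auto intro!: derivative_eq_intros)
    from has_derivative_compose[OF this has_derivative_norm[of "x - y"]]
    show "((\<lambda>y. norm (x - y)) has_derivative (\<lambda>h. (- h) \<bullet> sgn (x - y))) (at y)" using xy by simp
  qed
  have "(hankel1_0 has_derivative (\<lambda>t. t *\<^sub>R hankel1_deriv (k * ?d))) (at (k * ?d))"
    using hankel1_has_deriv[of "k * ?d"] k d by (simp add: has_vector_derivative_def)
  from has_derivative_compose[OF n this]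
  have "((\<lambda>y. hankel1_0 (k * norm (x - y))) has_derivative (\<lambda>h. (k * ((- h) \<bullet> sgn (x - y))) *\<^sub>R hankel1_deriv (k * ?d))) (at y)" .
  moreover have "(k * ((- h) \<bullet> sgn (x - y))) *\<^sub>R hankel1_deriv (k * ?d)
     = of_real (h $ 1) * (- (of_real k * hankel1_deriv (k * ?d) * of_real ((x $ 1 - y $ 1) / ?d)))
        + of_real (h $ 2) * (- (of_real k * hankel1_deriv (k * ?d) * of_real ((x $ 2 - y $ 2) / ?d)))" for h :: "real^2"
  proof -
    have s: "(- h) \<bullet> sgn (x - y) = - (h $ 1 * ((x $ 1 - y $ 1) / ?d)) - h $ 2 * ((x $ 2 - y $ 2) / ?d)"
      by (simp add: inner_vec_def sum_2 sgn_div_norm divide_inverse mult.commute)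
    show ?thesis unfolding s scaleR_conv_of_real by (simp add: algebra_simps)
  qed
  ultimately show ?thesis by (simp only:)
qed

lemma open_half_planes: "open {y::real^2. 0 < y $ 2}" "open {y::real^2. y $ 2 < 0}"
  by (rule open_Collect_less; auto intro: continuous_intros)+

lemma green_has_gradient:
  fixes x y :: "real^2"
  assumes k: "0 < k" "k < K" and x: "0 < x $ 2" and y: "y $ 2 \<noteq> 0" and xy: "x \<noteq> y"
  shows "has_gradient (green k K x) (green_gradient k K x y) y"
proof (cases "0 < y $ 2")
  case True
  have sx: "0 < x $ 2 + y $ 2" using x True by simp
  note [derivative_intros] = has_derivative_hankel_norm[OF k(1) xy] has_derivative_fourier_upper[OF k sx]
  let ?D = "4 * complex_of_real pi * of_real (K\<^sup>2 - k\<^sup>2)"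
  have "(green_upper k K x has_derivative (\<lambda>h. of_real (h $ 1) * green_gradient k K x y $ 1 + of_real (h $ 2) * green_gradient k K x y $ 2)) (at y)"
    unfolding green_upper_def[abs_def]
    by (rule derivative_eq_intros refl)+
      (use True in \<open>simp add: green_gradient_def Let_def fun_eq_iff numeral_2_eq_2 numeral_3_eq_3 algebra_simps add_divide_distrib diff_divide_distrib\<close>)
  then have "(green k K x has_derivative (\<lambda>h. of_real (h $ 1) * green_gradient k K x y $ 1 + of_real (h $ 2) * green_gradient k K x y $ 2)) (at y)"
    by (rule has_derivative_transform_within_open[OF _ open_half_planes(1)]) (use True green_eq_upper[OF k x] in auto)
  then show ?thesis by (simp add: has_gradient_def)
next
  case False
  then have y': "y $ 2 < 0" using y by simp
  note [derivative_intros] = has_derivative_fourier_lower[OF k x y']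
  have "(green_lower k K x has_derivative (\<lambda>h. of_real (h $ 1) * green_gradient k K x y $ 1 + of_real (h $ 2) * green_gradient k K x y $ 2)) (at y)"
    unfolding green_lower_def[abs_def]
    by (rule derivative_eq_intros refl)+
      (use False in \<open>simp add: green_gradient_def Let_def fun_eq_iff numeral_2_eq_2 algebra_simps add_divide_distrib diff_divide_distrib\<close>)
  then have "(green k K x has_derivative (\<lambda>h. of_real (h $ 1) * green_gradient k K x y $ 1 + of_real (h $ 2) * green_gradient k K x y $ 2)) (at y)"
    by (rule has_derivative_transform_within_open[OF _ open_half_planes(2)]) (use y' green_eq_lower[OF k x] in auto)
  then show ?thesis by (simp add: has_gradient_def)
qed

section \<open>Comparison with the far-field patterns\<close>

lemma negligible_cong:
  assumes E: "negligible R S E" and eq: "\<And>r c s b1 b2. 0 < r \<Longrightarrow> 0 < s \<Longrightarrow> b2 \<in> S \<Longrightarrow> F r c s b1 b2 = E r c s b1 b2"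
  shows "negligible R S F"
proof -
  obtain C r0 where 1: "0 \<le> C" "0 < r0" "\<And>r c s b1 b2. r0 \<le> r \<Longrightarrow> 0 < s \<Longrightarrow> c\<^sup>2 + s\<^sup>2 = 1 \<Longrightarrow> b1\<^sup>2 + b2\<^sup>2 \<le> R\<^sup>2 \<Longrightarrow> b2 \<in> S \<Longrightarrow>
     cmod (E r c s b1 b2) \<le> C * r powr (-3/2)" using E unfolding negligible_def by blast
  show ?thesis by (rule negligibleI[OF 1(1,2)]) (use 1 eq in auto)
qed

lemma negligible_Un:
  assumes "negligible R S E" "negligible R T E" shows "negligible R (S \<union> T) E"
proof -
  obtain C1 r1 where 1: "0 \<le> C1" "0 < r1" "\<And>r c s b1 b2. r1 \<le> r \<Longrightarrow> 0 < s \<Longrightarrow> c\<^sup>2 + s\<^sup>2 = 1 \<Longrightarrow> b1\<^sup>2 + b2\<^sup>2 \<le> R\<^sup>2 \<Longrightarrow> b2 \<in> S \<Longrightarrow>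
     cmod (E r c s b1 b2) \<le> C1 * r powr (-3/2)" using assms(1) unfolding negligible_def by blast
  obtain C2 r2 where 2: "0 \<le> C2" "0 < r2" "\<And>r c s b1 b2. r2 \<le> r \<Longrightarrow> 0 < s \<Longrightarrow> c\<^sup>2 + s\<^sup>2 = 1 \<Longrightarrow> b1\<^sup>2 + b2\<^sup>2 \<le> R\<^sup>2 \<Longrightarrow> b2 \<in> T \<Longrightarrow>
     cmod (E r c s b1 b2) \<le> C2 * r powr (-3/2)" using assms(2) unfolding negligible_def by blast
  show ?thesis
  proof (rule negligibleI[of "max C1 C2" "max r1 r2"])
    fix r c s b1 b2 :: real assume a: "max r1 r2 \<le> r" and b: "0 < s" "c\<^sup>2 + s\<^sup>2 = 1" "b1\<^sup>2 + b2\<^sup>2 \<le> R\<^sup>2" "b2 \<in> S \<union> T"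
    have "cmod (E r c s b1 b2) \<le> C1 * r powr (-3/2) \<or> cmod (E r c s b1 b2) \<le> C2 * r powr (-3/2)" using 1(3) 2(3) a b by auto
    moreover have "C1 * r powr (-3/2) \<le> max C1 C2 * r powr (-3/2)" "C2 * r powr (-3/2) \<le> max C1 C2 * r powr (-3/2)"
      by (intro mult_right_mono; simp)+
    ultimately show "cmod (E r c s b1 b2) \<le> max C1 C2 * r powr (-3/2)" by linarith
  qed (use 1 2 in auto)
qed

text \<open>
  The main terms in unified form. With \<open>P\<close> and \<open>M\<close> the values of the two vertical wave numbers at the stationary point,
  \<open>(P - M)\<^sup>2 / N\<close> and \<open>2 P (P - M) / N\<close> are the reflection and transmission coefficients. The parameters \<open>\<alpha>\<close>, \<open>\<beta>\<close>, \<open>\<gamma>\<close>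
  are all \<open>1\<close> for the Green function; for a partial derivative they are the factors that it produces in the direct, the
  reflected and the transmitted wave.
\<close>
definition far_pattern :: "real \<Rightarrow> real \<Rightarrow> complex \<Rightarrow> complex \<Rightarrow> complex \<Rightarrow> real \<Rightarrow> real \<Rightarrow> real \<Rightarrow> real \<Rightarrow> real \<Rightarrow> complex" where
  "far_pattern k K \<alpha> \<beta> \<gamma> r c s b1 b2 =
     (let P = - \<i> * of_real (k * s); M = - \<i> * of_real (sqrt (K\<^sup>2 - k\<^sup>2 * c\<^sup>2)); N = of_real (K\<^sup>2 - k\<^sup>2) in
      far k r / (4 * of_real pi) *
      (if 0 < b2 then \<alpha> * exp (- \<i> * of_real (k * (c * b1 + s * b2))) + \<beta> * ((P - M)\<^sup>2 / N) * exp (- \<i> * of_real (k * (c * b1 - s * b2)))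
       else \<gamma> * (2 * P * (P - M) / N) * (exp (- \<i> * of_real (k * (c * b1))) * exp (- \<i> * of_real (sqrt (K\<^sup>2 - k\<^sup>2 * c\<^sup>2) * b2)))))"

lemma far_pattern_pos:
  assumes "0 < b2" "z0 = 1 / (4 * of_real pi)" "z1 = 1 / (4 * of_real pi * of_real (K\<^sup>2 - k\<^sup>2))"
  shows "far_pattern k K \<alpha> \<beta> \<gamma> r c s b1 b2 =
     z0 * (\<alpha> * far k r * exp (- \<i> * of_real (k * (c * b1 + s * b2))))
     + z1 * (\<beta> * (- \<i> * of_real (k * s) - - \<i> * of_real (sqrt (K\<^sup>2 - k\<^sup>2 * c\<^sup>2)))\<^sup>2 * far k r * exp (- \<i> * of_real (k * (c * b1 - s * b2))))"
  unfolding far_pattern_def Let_def assms(2,3) if_P[OF assms(1)] by (simp add: distrib_left mult_ac)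

lemma far_pattern_neg:
  assumes "b2 < 0" "z2 = 1 / (2 * of_real pi * of_real (K\<^sup>2 - k\<^sup>2))"
  shows "far_pattern k K \<alpha> \<beta> \<gamma> r c s b1 b2 =
     z2 * (\<gamma> * (- \<i> * of_real (k * s)) * (- \<i> * of_real (k * s) - - \<i> * of_real (sqrt (K\<^sup>2 - k\<^sup>2 * c\<^sup>2)))
       * far k r * exp (- \<i> * of_real (k * (c * b1))) * exp (- \<i> * of_real (sqrt (K\<^sup>2 - k\<^sup>2 * c\<^sup>2) * b2)))"
proof -
  define N where "N = complex_of_real (K\<^sup>2 - k\<^sup>2)"
  have b: "\<not> 0 < b2" using assms(1) by simp
  show ?thesis unfolding far_pattern_def Let_def assms(2) if_not_P[OF b] N_def[symmetric]
    by (cases "N = 0") (simp_all add: field_simps)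
qed

lemma hankel_far:
  assumes k: "0 < k"
  shows "\<exists>C\<ge>0. \<forall>r>0. cmod (\<i> * of_real pi * hankel1_0 (k * r) - far k r) \<le> C * r powr (-3/2)"
    and "\<exists>C\<ge>0. \<forall>r>0. cmod (of_real pi * hankel1_deriv (k * r) - far k r) \<le> C * r powr (-3/2)"
proof -
  obtain C where C: "0 \<le> C"
    "\<And>r. 0 < r \<Longrightarrow> cmod (\<i> / 4 * hankel1_0 (k * r) - far k r / (4 * of_real pi)) \<le> C * r powr (-3/2)"
    "\<And>r. 0 < r \<Longrightarrow> cmod (\<i> / 4 * of_real k * hankel1_deriv (k * r) - \<i> * of_real k * (far k r / (4 * of_real pi))) \<le> C * r powr (-3/2)"
    using hankel_asymptotics[OF k] by blast
  show "\<exists>C\<ge>0. \<forall>r>0. cmod (\<i> * of_real pi * hankel1_0 (k * r) - far k r) \<le> C * r powr (-3/2)"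
  proof (rule exI[of _ "4 * pi * C"], intro conjI allI impI)
    fix r :: real assume r: "0 < r"
    have "\<i> * of_real pi * hankel1_0 (k * r) - far k r = of_real (4 * pi) * (\<i> / 4 * hankel1_0 (k * r) - far k r / (4 * of_real pi))"
      by (simp add: right_diff_distrib)
    then show "cmod (\<i> * of_real pi * hankel1_0 (k * r) - far k r) \<le> 4 * pi * C * r powr (-3/2)"
      using mult_left_mono[OF C(2)[OF r], of "4 * pi"] by (simp only: norm_mult norm_of_real mult.assoc) simp
  qed (use C(1) in simp)
  show "\<exists>C\<ge>0. \<forall>r>0. cmod (of_real pi * hankel1_deriv (k * r) - far k r) \<le> C * r powr (-3/2)"
  proof (rule exI[of _ "4 * pi / k * C"], intro conjI allI impI)
    fix r :: real assume r: "0 < r"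
    have "of_real pi * hankel1_deriv (k * r) - far k r
       = of_real (4 * pi / k) * (- \<i> * (\<i> / 4 * of_real k * hankel1_deriv (k * r) - \<i> * of_real k * (far k r / (4 * of_real pi))))"
      using k by (simp add: right_diff_distrib)
    then have "cmod (of_real pi * hankel1_deriv (k * r) - far k r)
       = 4 * pi / k * cmod (\<i> / 4 * of_real k * hankel1_deriv (k * r) - \<i> * of_real k * (far k r / (4 * of_real pi)))"
      using k by (simp only: norm_mult norm_of_real norm_minus_cancel norm_ii mult_1) simp
    then show "cmod (of_real pi * hankel1_deriv (k * r) - far k r) \<le> 4 * pi / k * C * r powr (-3/2)"
      using mult_left_mono[OF C(3)[OF r], of "4 * pi / k"] k by (simp add: mult.assoc)
  qed (use C(1) k in simp)
qed

lemma norm_plane: "norm (v :: real^2) = sqrt ((v $ 1)\<^sup>2 + (v $ 2)\<^sup>2)"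
  by (simp add: norm_vec_def L2_set_def sum_2)

text \<open>
  Each monomial contributes the value of its symbol, and the symbols recombine to the reflection and transmission
  coefficients by the same algebra that split the Green function into monomials.
\<close>
lemma green_error:
  fixes k K R :: real
  assumes k: "0 < k" "k < K" and R: "0 \<le> R"
  shows "negligible R ({0<..} \<union> {..<0}) (\<lambda>r c s b1 b2. green k K (vector [r * c, r * s]) (vector [b1, b2]) - far_pattern k K 1 1 1 r c s b1 b2)"
    (is "negligible R _ ?E")
proof (rule negligible_Un)
  note F = negligible_fourier_reflected[OF k R] and T = negligible_fourier_transmitted[OF k R]
  define z0 where "z0 = 1 / (4 * complex_of_real pi)"
  define z1 where "z1 = 1 / (4 * complex_of_real pi * of_real (K\<^sup>2 - k\<^sup>2))"
  define z2 where "z2 = 1 / (2 * complex_of_real pi * of_real (K\<^sup>2 - k\<^sup>2))"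
  show "negligible R {0<..} ?E"
  proof (rule negligible_cong[OF negligible_add[OF
        negligible_scale[OF negligible_direct[OF k R hankel_far(1)[OF k(1)], where i = 0 and j = 0], where z = z0]
        negligible_scale[OF negligible_add[OF negligible_diff[OF F[where i = 0 and j = 2 and l = 0]
          negligible_scale[OF F[where i = 0 and j = 1 and l = 1], where z = 2]] F[where i = 0 and j = 0 and l = 2]], where z = z1]]], goal_cases)
    case (1 r c s b1 b2)
    have g: "green k K (vector [r * c, r * s]) (vector [b1, b2]) = green_upper k K (vector [r * c, r * s]) (vector [b1, b2])"
      by (rule green_eq_upper[OF k]) (use 1 in auto)
    have b: "0 < b2" using 1 by simp
    have z: "\<i> / 4 = z0 * (\<i> * of_real pi)" by (simp add: z0_def)
    show ?case
      unfolding g green_upper_def far_pattern_pos[OF b z0_def z1_def] z1_def[symmetric] z norm_plane symbol_def vector_minus_component vector_2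
      by (simp add: power2_eq_square algebra_simps)
  qed
  show "negligible R {..<0} ?E"
  proof (rule negligible_cong[OF negligible_scale[OF negligible_diff[OF T[where i = 0 and j = 2 and l = 0] T[where i = 0 and j = 1 and l = 1]], where z = z2]], goal_cases)
    case (1 r c s b1 b2)
    have g: "green k K (vector [r * c, r * s]) (vector [b1, b2]) = green_lower k K (vector [r * c, r * s]) (vector [b1, b2])"
      by (rule green_eq_lower[OF k]) (use 1 in auto)
    have b: "b2 < 0" using 1 by simp
    show ?case
      unfolding g green_lower_def far_pattern_neg[OF b z2_def] z2_def[symmetric] symbol_def vector_2
      by (simp add: power2_eq_square algebra_simps)
  qed
qed

lemma green_gradient_error:
  fixes k K R :: real
  assumes k: "0 < k" "k < K" and R: "0 \<le> R"
  shows "negligible R ({0<..} \<union> {..<0}) (\<lambda>r c s b1 b2. green_gradient k K (vector [r * c, r * s]) (vector [b1, b2]) $ 1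
      - far_pattern k K (- \<i> * of_real (k * c)) (- \<i> * of_real (k * c)) (- \<i> * of_real (k * c)) r c s b1 b2)"
      (is "negligible R _ ?E1")
    and "negligible R ({0<..} \<union> {..<0}) (\<lambda>r c s b1 b2. green_gradient k K (vector [r * c, r * s]) (vector [b1, b2]) $ 2
      - far_pattern k K (- \<i> * of_real (k * s)) (\<i> * of_real (k * s)) (- \<i> * of_real (sqrt (K\<^sup>2 - k\<^sup>2 * c\<^sup>2))) r c s b1 b2)"
      (is "negligible R _ ?E2")
proof -
  note F = negligible_fourier_reflected[OF k R] and T = negligible_fourier_transmitted[OF k R]
  define z0 where "z0 = 1 / (4 * complex_of_real pi)"
  define z1 where "z1 = 1 / (4 * complex_of_real pi * of_real (K\<^sup>2 - k\<^sup>2))"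
  define z2 where "z2 = 1 / (2 * complex_of_real pi * of_real (K\<^sup>2 - k\<^sup>2))"
  have z: "\<i> / 4 * of_real k * h = z0 * (\<i> * (of_real k * (of_real pi * h)))" for h by (simp add: z0_def)
  have zi: "\<i> / (4 * complex_of_real pi * of_real (K\<^sup>2 - k\<^sup>2)) = \<i> * z1" "- \<i> / (2 * complex_of_real pi * of_real (K\<^sup>2 - k\<^sup>2)) = - \<i> * z2"
    by (simp_all add: z1_def z2_def)
  show "negligible R ({0<..} \<union> {..<0}) ?E1"
  proof (rule negligible_Un)
    show "negligible R {0<..} ?E1"
    proof (rule negligible_cong[OF negligible_add[OF
          negligible_scale[OF negligible_direct[OF k R hankel_far(2)[OF k(1)], where i = 1 and j = 0], where z = "- \<i> * z0"]
          negligible_scale[OF negligible_add[OF negligible_diff[OF F[where i = 1 and j = 2 and l = 0]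
            negligible_scale[OF F[where i = 1 and j = 1 and l = 1], where z = 2]] F[where i = 1 and j = 0 and l = 2]], where z = "- \<i> * z1"]]], goal_cases)
      case (1 r c s b1 b2)
      then have b: "0 < b2" by simp
      define d where "d = sqrt ((r * c - b1)\<^sup>2 + (r * s - b2)\<^sup>2)"
      show ?case
        unfolding green_gradient_def Let_def vector_2 if_P[OF b] far_pattern_pos[OF b z0_def z1_def] zi z norm_plane symbol_def vector_minus_component d_def[symmetric]
        by (simp add: power2_eq_square algebra_simps add_divide_distrib diff_divide_distrib)
    qed
    show "negligible R {..<0} ?E1"
    proof (rule negligible_cong[OF negligible_scale[OF negligible_diff[OF T[where i = 1 and j = 2 and l = 0] T[where i = 1 and j = 1 and l = 1]], where z = "- \<i> * z2"]], goal_cases)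
      case (1 r c s b1 b2)
      then have b: "b2 < 0" "\<not> 0 < b2" by auto
      show ?case
        unfolding green_gradient_def Let_def vector_2 if_not_P[OF b(2)] far_pattern_neg[OF b(1) z2_def] zi symbol_def
        by (simp add: power2_eq_square algebra_simps)
    qed
  qed
  show "negligible R ({0<..} \<union> {..<0}) ?E2"
  proof (rule negligible_Un)
    show "negligible R {0<..} ?E2"
    proof (rule negligible_cong[OF negligible_add[OF
          negligible_scale[OF negligible_direct[OF k R hankel_far(2)[OF k(1)], where i = 0 and j = 1], where z = z0]
          negligible_scale[OF negligible_add[OF negligible_diff[OF F[where i = 0 and j = 3 and l = 0]
            negligible_scale[OF F[where i = 0 and j = 2 and l = 1], where z = 2]] F[where i = 0 and j = 1 and l = 2]], where z = "- z1"]]], goal_cases)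
      case (1 r c s b1 b2)
      then have b: "0 < b2" by simp
      define d where "d = sqrt ((r * c - b1)\<^sup>2 + (r * s - b2)\<^sup>2)"
      show ?case
        unfolding green_gradient_def Let_def vector_2 if_P[OF b] far_pattern_pos[OF b z0_def z1_def] z1_def[symmetric] z norm_plane symbol_def vector_minus_component d_def[symmetric]
        by (simp add: power2_eq_square power3_eq_cube algebra_simps add_divide_distrib diff_divide_distrib)
    qed
    show "negligible R {..<0} ?E2"
    proof (rule negligible_cong[OF negligible_scale[OF negligible_diff[OF T[where i = 0 and j = 2 and l = 1] T[where i = 0 and j = 1 and l = 2]], where z = z2]], goal_cases)
      case (1 r c s b1 b2)
      then have b: "b2 < 0" "\<not> 0 < b2" by auto
      show ?case
        unfolding green_gradient_def Let_def vector_2 if_not_P[OF b(2)] far_pattern_neg[OF b(1) z2_def] z2_def[symmetric] symbol_def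
        by (simp add: power2_eq_square algebra_simps)
    qed
  qed
qed

text \<open>
  The prefactors of the two patterns in terms of \<open>far\<close>; that of the gradient has the additional factor \<open>- \<i> k\<close> of the
  derivative of a plane wave.
\<close>
lemma far_prefactor:
  assumes k: "0 < k" and r: "0 < r"
  shows "exp (\<i> * of_real (k * r)) / of_real (sqrt r) * (exp (\<i> * of_real (pi / 4)) / of_real (sqrt (8 * pi * k))) = far k r / (4 * of_real pi)"
    and "exp (\<i> * of_real (k * r)) / of_real (sqrt r) * (exp (- \<i> * of_real (pi / 4)) * of_real (sqrt (k / (8 * pi))))
      = - \<i> * of_real k * (far k r / (4 * of_real pi))"
proof -
  have e4: "exp (\<i> * of_real (pi / 4)) = (1 + \<i>) / of_real (sqrt 2)"
  proof -
    have "sqrt 2 / 2 = 1 / sqrt 2" by (simp add: field_simps)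
    then show ?thesis unfolding cis_conv_exp[symmetric] by (simp add: complex_eq_iff cos_45 sin_45 Re_divide_of_real Im_divide_of_real)
  qed
  have q: "1 / (sqrt r * (sqrt 2 * sqrt (8 * pi * k))) = sqrt (pi / (k * r)) / (4 * pi)"
  proof -
    have "sqrt 2 * sqrt (8 * pi * k) = 4 * sqrt (pi * k)"
      unfolding real_sqrt_mult[symmetric] by (rule real_sqrt_unique) (use k in \<open>auto simp: power_mult_distrib\<close>)
    moreover have "sqrt (pi / (k * r)) = pi / (sqrt (pi * k) * sqrt r)"
    proof -
      have "sqrt (pi / (k * r)) = sqrt (pi * pi / (pi * k * r))" using k r by simp
      then show ?thesis unfolding real_sqrt_divide real_sqrt_mult[of "pi * k" r] by simp
    qed
    ultimately show ?thesis using k r by (simp add: field_simps)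
  qed
  have "exp (\<i> * of_real (k * r)) / of_real (sqrt r) * (exp (\<i> * of_real (pi / 4)) / of_real (sqrt (8 * pi * k)))
     = (1 + \<i>) * exp (\<i> * of_real (k * r)) * of_real (1 / (sqrt r * (sqrt 2 * sqrt (8 * pi * k))))"
    unfolding e4 by simp
  then show 1: "exp (\<i> * of_real (k * r)) / of_real (sqrt r) * (exp (\<i> * of_real (pi / 4)) / of_real (sqrt (8 * pi * k))) = far k r / (4 * of_real pi)"
    unfolding q far_def by simp
  have "exp (- \<i> * of_real (pi / 4)) = - \<i> * exp (\<i> * of_real (pi / 4))"
  proof -
    have "exp (- \<i> * of_real (pi / 4)) = cis (- (pi / 4))" by (simp add: cis_conv_exp)
    then show ?thesis unfolding cis_conv_exp[symmetric] by (simp add: complex_eq_iff cos_45 sin_45)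
  qed
  moreover have "sqrt (k / (8 * pi)) = k / sqrt (8 * pi * k)"
  proof -
    have "sqrt (k / (8 * pi)) = sqrt (k * k / (8 * pi * k))" using k by simp
    then show ?thesis using k unfolding real_sqrt_divide by simp
  qed
  ultimately show "exp (\<i> * of_real (k * r)) / of_real (sqrt r) * (exp (- \<i> * of_real (pi / 4)) * of_real (sqrt (k / (8 * pi))))
      = - \<i> * of_real k * (far k r / (4 * of_real pi))"
    unfolding 1[symmetric] by simp
qed

text \<open>
  The coefficients are stated with wave numbers divided by \<open>k\<close>; rescaling and the relation
  \<open>(P - M) (P + M) = K\<^sup>2 - k\<^sup>2\<close> remove the denominators.
\<close>
lemma layer_coefficients:
  assumes k: "0 < k" "k < K"
  defines "P \<equiv> \<lambda>\<theta>. - \<i> * complex_of_real (k * sin \<theta>)" and "M \<equiv> \<lambda>\<theta>. - \<i> * complex_of_real (sqrt (K\<^sup>2 - k\<^sup>2 * (cos \<theta>)\<^sup>2))"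
  assumes s: "0 < sin \<theta>"
  shows "SS (of_real (cos \<theta>)) (K / k) = M \<theta> / of_real k"
    and "refl_coeff (K / k) \<theta> = (P \<theta> - M \<theta>)\<^sup>2 / of_real (K\<^sup>2 - k\<^sup>2)"
    and "trans_coeff (K / k) \<theta> = 2 * P \<theta> * (P \<theta> - M \<theta>) / of_real (K\<^sup>2 - k\<^sup>2)"
proof -
  define q where "q = sqrt (K\<^sup>2 - k\<^sup>2 * (cos \<theta>)\<^sup>2)"
  have kK: "k\<^sup>2 < K\<^sup>2" using k power_strict_mono[of k K 2] by simp
  have c: "k\<^sup>2 * (cos \<theta>)\<^sup>2 \<le> k\<^sup>2" by (simp add: cos_squared_eq mult_left_le)
  have q: "0 < q" "q\<^sup>2 = K\<^sup>2 - k\<^sup>2 * (cos \<theta>)\<^sup>2" using c kK by (auto simp: q_def)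
  show S: "SS (of_real (cos \<theta>)) (K / k) = M \<theta> / of_real k"
  proof -
    have "1 < K / k" using k by simp
    then have n: "\<not> K / k \<le> \<bar>cos \<theta>\<bar>" using abs_cos_le_one[of \<theta>] by linarith
    have "(K / k)\<^sup>2 - (cos \<theta>)\<^sup>2 = (K\<^sup>2 - k\<^sup>2 * (cos \<theta>)\<^sup>2) / k\<^sup>2" using k by (simp add: field_simps)
    then have "sqrt ((K / k)\<^sup>2 - (cos \<theta>)\<^sup>2) = q / k" using k by (simp add: q_def real_sqrt_divide)
    then show ?thesis using n k by (simp add: SS_of_real M_def q_def)
  qed
  have PM: "P \<theta> = - \<i> * of_real (k * sin \<theta>)" "M \<theta> = - \<i> * of_real q" by (simp_all add: P_def M_def q_def)
  have N0: "complex_of_real (K\<^sup>2 - k\<^sup>2) \<noteq> 0" using kK unfolding of_real_eq_0_iff by simp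
  have N: "(P \<theta> - M \<theta>) * (P \<theta> + M \<theta>) = of_real (K\<^sup>2 - k\<^sup>2)"
  proof -
    have "(P \<theta> - M \<theta>) * (P \<theta> + M \<theta>) = of_real (q\<^sup>2 - k\<^sup>2 * (sin \<theta>)\<^sup>2)"
      unfolding PM by (simp add: power2_eq_square algebra_simps)
    also have "q\<^sup>2 - k\<^sup>2 * (sin \<theta>)\<^sup>2 = K\<^sup>2 - k\<^sup>2" unfolding q(2) by (simp add: sin_squared_eq algebra_simps)
    finally show ?thesis .
  qed
  have nz: "P \<theta> + M \<theta> \<noteq> 0" using N N0 by auto
  have R: "refl_coeff (K / k) \<theta> = (P \<theta> - M \<theta>) / (P \<theta> + M \<theta>)"
  proof -
    have "\<i> * of_real (sin \<theta>) = - P \<theta> / of_real k" using k by (simp add: P_def)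
    then have "refl_coeff (K / k) \<theta> = ((- P \<theta> + M \<theta>) / of_real k) / ((- P \<theta> - M \<theta>) / of_real k)"
      unfolding refl_coeff_def S by (simp only: add_divide_distrib diff_divide_distrib)
    also have "\<dots> = (- (P \<theta> - M \<theta>)) / (- (P \<theta> + M \<theta>))" using k by simp
    finally show ?thesis unfolding minus_divide_divide .
  qed
  have R2: "refl_coeff (K / k) \<theta> * of_real (K\<^sup>2 - k\<^sup>2) = (P \<theta> - M \<theta>)\<^sup>2"
    unfolding R N[symmetric] using nz by (simp add: power2_eq_square)
  then show "refl_coeff (K / k) \<theta> = (P \<theta> - M \<theta>)\<^sup>2 / of_real (K\<^sup>2 - k\<^sup>2)" using N0 by (simp add: eq_divide_eq)
  have "trans_coeff (K / k) \<theta> * of_real (K\<^sup>2 - k\<^sup>2) = (P \<theta> - M \<theta>)\<^sup>2 + (P \<theta> - M \<theta>) * (P \<theta> + M \<theta>)"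
    unfolding trans_coeff_def distrib_right R2 N by simp
  also have "\<dots> = 2 * P \<theta> * (P \<theta> - M \<theta>)" by (simp add: power2_eq_square algebra_simps)
  finally show "trans_coeff (K / k) \<theta> = 2 * P \<theta> * (P \<theta> - M \<theta>) / of_real (K\<^sup>2 - k\<^sup>2)" using N0 by (simp add: eq_divide_eq)
qed

lemma main_terms:
  fixes y :: "real^2"
  assumes k: "0 < k" "k < K" and r: "0 < r" and \<theta>: "0 < sin \<theta>"
  defines "A \<equiv> exp (\<i> * of_real (k * r)) / of_real (sqrt r)"
  shows "A * G_inf k K \<theta> y = far_pattern k K 1 1 1 r (cos \<theta>) (sin \<theta>) (y $ 1) (y $ 2)"
    and "(A *s H_inf k K \<theta> y) $ 1 = far_pattern k K (- \<i> * of_real (k * cos \<theta>)) (- \<i> * of_real (k * cos \<theta>)) (- \<i> * of_real (k * cos \<theta>)) r (cos \<theta>) (sin \<theta>) (y $ 1) (y $ 2)"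
    and "(A *s H_inf k K \<theta> y) $ 2 = far_pattern k K (- \<i> * of_real (k * sin \<theta>)) (\<i> * of_real (k * sin \<theta>)) (- \<i> * of_real (sqrt (K\<^sup>2 - k\<^sup>2 * (cos \<theta>)\<^sup>2))) r (cos \<theta>) (sin \<theta>) (y $ 1) (y $ 2)"
proof -
  define q where "q = sqrt (K\<^sup>2 - k\<^sup>2 * (cos \<theta>)\<^sup>2)"
  define \<rho> where "\<rho> = refl_coeff (K / k) \<theta>"
  define \<tau> where "\<tau> = trans_coeff (K / k) \<theta>"
  define Q where "Q = far k r / (4 * of_real pi)"
  define W where "W = exp (- \<i> * of_real (k * (cos \<theta> * y $ 1))) * exp (- \<i> * of_real (q * y $ 2))"
  have up: "y \<in> upper_half_plane \<longleftrightarrow> 0 < y $ 2" by (simp add: upper_half_plane_def)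
  have d: "direction \<theta> \<bullet> y = cos \<theta> * y $ 1 + sin \<theta> * y $ 2" "direction \<theta> \<bullet> reflect y = cos \<theta> * y $ 1 - sin \<theta> * y $ 2"
    by (simp_all add: inner_vec_def sum_2 direction_def reflect_def)
  have E: "exp (- \<i> * of_real k * (of_real (y $ 1 * cos \<theta>) + \<i> * of_real (y $ 2) * SS (of_real (cos \<theta>)) (K / k)))
     = W"
    unfolding W_def layer_coefficients(1)[OF k \<theta>] q_def[symmetric] exp_add[symmetric]
    by (rule arg_cong[where f = exp]) (use k in \<open>simp add: field_simps\<close>)
  have fp: "far_pattern k K \<alpha> \<beta> \<gamma> r (cos \<theta>) (sin \<theta>) (y $ 1) (y $ 2) = Q *
      (if 0 < y $ 2 then \<alpha> * exp (- \<i> * of_real (k * (cos \<theta> * y $ 1 + sin \<theta> * y $ 2))) + \<beta> * \<rho> * exp (- \<i> * of_real (k * (cos \<theta> * y $ 1 - sin \<theta> * y $ 2)))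
       else \<gamma> * \<tau> * W)" for \<alpha> \<beta> \<gamma>
    unfolding far_pattern_def Let_def \<rho>_def \<tau>_def Q_def W_def q_def layer_coefficients(2,3)[OF k \<theta>] ..
  note pre = far_prefactor[OF k(1) r, folded A_def Q_def]
  show "A * G_inf k K \<theta> y = far_pattern k K 1 1 1 r (cos \<theta>) (sin \<theta>) (y $ 1) (y $ 2)"
    unfolding G_inf_def Let_def up d E \<rho>_def[symmetric] \<tau>_def[symmetric] mult.assoc[symmetric] pre(1) fp by simp
  have h: "A * (exp (- \<i> * of_real (pi / 4)) * of_real (sqrt (k / (8 * pi))) * z) = - \<i> * of_real k * Q * z" for z
    using pre(2) by (simp only: mult.assoc[symmetric])
  show "(A *s H_inf k K \<theta> y) $ 1 = far_pattern k K (- \<i> * of_real (k * cos \<theta>)) (- \<i> * of_real (k * cos \<theta>)) (- \<i> * of_real (k * cos \<theta>)) r (cos \<theta>) (sin \<theta>) (y $ 1) (y $ 2)"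
    unfolding H_inf_def Let_def up d E \<rho>_def[symmetric] \<tau>_def[symmetric] vector_smult_component h fp
    by (simp add: algebra_simps)
  show "(A *s H_inf k K \<theta> y) $ 2 = far_pattern k K (- \<i> * of_real (k * sin \<theta>)) (\<i> * of_real (k * sin \<theta>)) (- \<i> * of_real (sqrt (K\<^sup>2 - k\<^sup>2 * (cos \<theta>)\<^sup>2))) r (cos \<theta>) (sin \<theta>) (y $ 1) (y $ 2)"
    unfolding H_inf_def Let_def up d E \<rho>_def[symmetric] \<tau>_def[symmetric] vector_smult_component h fp
    unfolding layer_coefficients(1)[OF k \<theta>] q_def[symmetric]
    using k by (simp add: algebra_simps)
qed

text \<open>
  The remainders are defined as the difference between the exact quantities and the main terms, where \<open>\<phi> x\<close> is the
  polar angle of \<open>x\<close>. The asymptotic relations then hold by definition and by the differentiability of the Green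
  function, and the bounds are the three negligibility statements, with the two components of the gradient added up.
\<close>
theorem theorem2p1:
  fixes kp km R0 :: real
  assumes "0 < kp" and "kp < km" and "0 < R0"
  shows "\<exists>(G_Res :: real^2 \<Rightarrow> real^2 \<Rightarrow> complex) (H_Res :: real^2 \<Rightarrow> real^2 \<Rightarrow> complex^2).
    (\<forall>x \<in> upper_half_plane. \<forall>\<theta> \<in> {0<..<pi}. \<forall>y \<in> upper_half_disc R0 \<union> lower_half_disc R0.
       x = norm x *\<^sub>R direction \<theta> \<longrightarrow> x \<noteq> y \<longrightarrow>
         green kp km x y =
           exp (\<i> * of_real (kp * norm x)) / of_real (sqrt (norm x)) * G_inf kp km \<theta> y + G_Res x y
         \<and> has_gradient (\<lambda>y. green kp km x y)
             ((exp (\<i> * of_real (kp * norm x)) / of_real (sqrt (norm x))) *s H_inf kp km \<theta> y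
               + H_Res x y) y)
    \<and> (\<exists>C > 0. \<exists>r0 > 0.
       \<forall>x \<in> upper_half_plane. \<forall>y \<in> upper_half_disc R0 \<union> lower_half_disc R0.
         norm x \<ge> r0 \<longrightarrow>
           norm (G_Res x y) \<le> C * norm x powr (- 3 / 2)
           \<and> norm (H_Res x y) \<le> C * norm x powr (- 3 / 2))"
proof -
  let ?A = "\<lambda>x. exp (\<i> * of_real (kp * norm (x :: real^2))) / of_real (sqrt (norm x))"
  define \<phi> where "\<phi> x = arccos (x $ 1 / norm x)" for x :: "real^2"
  define G_Res where "G_Res x y = green kp km x y - ?A x * G_inf kp km (\<phi> x) y" for x y
  define H_Res where "H_Res x y = green_gradient kp km x y - ?A x *s H_inf kp km (\<phi> x) y" for x y
  have y2: "y $ 2 \<noteq> 0" "y $ 2 \<in> {0<..} \<union> {..<0}" "(y $ 1)\<^sup>2 + (y $ 2)\<^sup>2 \<le> R0\<^sup>2" if "y \<in> upper_half_disc R0 \<union> lower_half_disc R0" for y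
  proof -
    show "y $ 2 \<noteq> 0" "y $ 2 \<in> {0<..} \<union> {..<0}"
      using that by (auto simp: upper_half_disc_def lower_half_disc_def upper_half_plane_def lower_half_plane_def)
    have "norm y < R0" using that by (auto simp: upper_half_disc_def lower_half_disc_def)
    then have "(norm y)\<^sup>2 \<le> R0\<^sup>2" by (intro power_mono) auto
    then show "(y $ 1)\<^sup>2 + (y $ 2)\<^sup>2 \<le> R0\<^sup>2" by (simp add: norm_plane)
  qed
  have polar: "0 < norm x" "0 < sin (\<phi> x)" "x = vector [norm x * cos (\<phi> x), norm x * sin (\<phi> x)]" if x: "x \<in> upper_half_plane" for x
  proof -
    have x2: "0 < x $ 2" using x by (simp add: upper_half_plane_def)
    then show n: "0 < norm x" by auto
    have n2: "(norm x)\<^sup>2 = (x $ 1)\<^sup>2 + (x $ 2)\<^sup>2" by (simp add: norm_plane)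
    have s2: "1 - (x $ 1 / norm x)\<^sup>2 = (x $ 2 / norm x)\<^sup>2"
    proof -
      have "(x $ 1 / norm x)\<^sup>2 + (x $ 2 / norm x)\<^sup>2 = (norm x)\<^sup>2 / (norm x)\<^sup>2"
        unfolding power_divide add_divide_distrib[symmetric] n2[symmetric] ..
      then show ?thesis using n by simp
    qed
    have c1: "\<bar>x $ 1 / norm x\<bar> \<le> 1" using n component_le_norm_cart[of x 1] by (simp add: abs_divide)
    then have c: "cos (\<phi> x) = x $ 1 / norm x" by (simp add: \<phi>_def cos_arccos_abs)
    have "sin (\<phi> x) = sqrt (1 - (x $ 1 / norm x)\<^sup>2)" using c1 by (simp add: \<phi>_def sin_arccos_abs)
    then have s: "sin (\<phi> x) = x $ 2 / norm x" unfolding s2 using x2 n by simp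
    show "0 < sin (\<phi> x)" using s x2 n by simp
    show "x = vector [norm x * cos (\<phi> x), norm x * sin (\<phi> x)]" using n unfolding c s by (simp add: vec_eq_iff forall_2)
  qed
  have angle: "\<phi> x = \<theta>" if x: "x \<in> upper_half_plane" and \<theta>: "\<theta> \<in> {0<..<pi}" and d: "x = norm x *\<^sub>R direction \<theta>" for x \<theta>
  proof -
    have "x $ 1 = norm x * cos \<theta>" by (subst d) (simp add: direction_def)
    then have "x $ 1 / norm x = cos \<theta>" using polar(1)[OF x] by (simp add: field_simps)
    then show ?thesis using \<theta> by (simp add: \<phi>_def arccos_cos)
  qed
  have R0: "0 \<le> R0" using assms(3) by simp
  obtain C1 r1 where 1: "0 \<le> C1" "0 < r1" "\<And>r c s b1 b2. r1 \<le> r \<Longrightarrow> 0 < s \<Longrightarrow> c\<^sup>2 + s\<^sup>2 = 1 \<Longrightarrow> b1\<^sup>2 + b2\<^sup>2 \<le> R0\<^sup>2 \<Longrightarrow> b2 \<in> {0<..} \<union> {..<0} \<Longrightarrow>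
     cmod (green kp km (vector [r * c, r * s]) (vector [b1, b2]) - far_pattern kp km 1 1 1 r c s b1 b2) \<le> C1 * r powr (-3/2)"
    using green_error[OF assms(1,2) R0] unfolding negligible_def by blast
  obtain C2 r2 where 2: "0 \<le> C2" "0 < r2" "\<And>r c s b1 b2. r2 \<le> r \<Longrightarrow> 0 < s \<Longrightarrow> c\<^sup>2 + s\<^sup>2 = 1 \<Longrightarrow> b1\<^sup>2 + b2\<^sup>2 \<le> R0\<^sup>2 \<Longrightarrow> b2 \<in> {0<..} \<union> {..<0} \<Longrightarrow>
     cmod (green_gradient kp km (vector [r * c, r * s]) (vector [b1, b2]) $ 1 - far_pattern kp km (- \<i> * of_real (kp * c)) (- \<i> * of_real (kp * c)) (- \<i> * of_real (kp * c)) r c s b1 b2) \<le> C2 * r powr (-3/2)"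
    using green_gradient_error(1)[OF assms(1,2) R0] unfolding negligible_def by blast
  obtain C3 r3 where 3: "0 \<le> C3" "0 < r3" "\<And>r c s b1 b2. r3 \<le> r \<Longrightarrow> 0 < s \<Longrightarrow> c\<^sup>2 + s\<^sup>2 = 1 \<Longrightarrow> b1\<^sup>2 + b2\<^sup>2 \<le> R0\<^sup>2 \<Longrightarrow> b2 \<in> {0<..} \<union> {..<0} \<Longrightarrow>
     cmod (green_gradient kp km (vector [r * c, r * s]) (vector [b1, b2]) $ 2 - far_pattern kp km (- \<i> * of_real (kp * s)) (\<i> * of_real (kp * s)) (- \<i> * of_real (sqrt (km\<^sup>2 - kp\<^sup>2 * c\<^sup>2))) r c s b1 b2) \<le> C3 * r powr (-3/2)"
    using green_gradient_error(2)[OF assms(1,2) R0] unfolding negligible_def by blast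
  have vec: "vector [y $ 1, y $ 2] = y" for y :: "real^2" by (simp add: vec_eq_iff forall_2)
  have "\<forall>x \<in> upper_half_plane. \<forall>\<theta> \<in> {0<..<pi}. \<forall>y \<in> upper_half_disc R0 \<union> lower_half_disc R0.
       x = norm x *\<^sub>R direction \<theta> \<longrightarrow> x \<noteq> y \<longrightarrow>
         green kp km x y = ?A x * G_inf kp km \<theta> y + G_Res x y
         \<and> has_gradient (\<lambda>y. green kp km x y) (?A x *s H_inf kp km \<theta> y + H_Res x y) y"
  proof (intro ballI impI conjI)
    fix x \<theta> y assume a: "x \<in> upper_half_plane" "\<theta> \<in> {0<..<pi}" "y \<in> upper_half_disc R0 \<union> lower_half_disc R0" "x = norm x *\<^sub>R direction \<theta>" "x \<noteq> y"
    note e = angle[OF a(1,2,4)]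
    show "green kp km x y = ?A x * G_inf kp km \<theta> y + G_Res x y" unfolding G_Res_def e by simp
    have "?A x *s H_inf kp km \<theta> y + H_Res x y = green_gradient kp km x y" unfolding H_Res_def e by simp
    moreover have "has_gradient (green kp km x) (green_gradient kp km x y) y"
      by (rule green_has_gradient[OF assms(1,2) _ y2(1)[OF a(3)] a(5)]) (use a(1) in \<open>simp add: upper_half_plane_def\<close>)
    ultimately show "has_gradient (\<lambda>y. green kp km x y) (?A x *s H_inf kp km \<theta> y + H_Res x y) y" by simp
  qed
  moreover have "\<exists>C > 0. \<exists>r0 > 0. \<forall>x \<in> upper_half_plane. \<forall>y \<in> upper_half_disc R0 \<union> lower_half_disc R0. norm x \<ge> r0 \<longrightarrow>
           norm (G_Res x y) \<le> C * norm x powr (- 3 / 2) \<and> norm (H_Res x y) \<le> C * norm x powr (- 3 / 2)"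
  proof (rule exI[of _ "C1 + C2 + C3 + 1"], rule conjI, use 1(1) 2(1) 3(1) in simp, rule exI[of _ "r1 + r2 + r3"], rule conjI, use 1(2) 2(2) 3(2) in simp, intro ballI impI)
    fix x y assume x: "x \<in> upper_half_plane" and y: "y \<in> upper_half_disc R0 \<union> lower_half_disc R0" and r: "r1 + r2 + r3 \<le> norm x"
    have r': "r1 \<le> norm x" "r2 \<le> norm x" "r3 \<le> norm x" using r 1(2) 2(2) 3(2) by auto
    note p = polar[OF x]
    have cs: "(cos (\<phi> x))\<^sup>2 + (sin (\<phi> x))\<^sup>2 = 1" by simp
    note m = main_terms[OF assms(1,2) p(1,2), of y]
    have G: "cmod (G_Res x y) \<le> C1 * norm x powr (-3/2)"
      using 1(3)[OF r'(1) p(2) cs y2(3,2)[OF y]] unfolding p(3)[symmetric] vec m(1)[symmetric] G_Res_def .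
    have H1: "cmod (H_Res x y $ 1) \<le> C2 * norm x powr (-3/2)"
      using 2(3)[OF r'(2) p(2) cs y2(3,2)[OF y]] unfolding p(3)[symmetric] vec m(2)[symmetric] H_Res_def vector_minus_component .
    have H2: "cmod (H_Res x y $ 2) \<le> C3 * norm x powr (-3/2)"
      using 3(3)[OF r'(3) p(2) cs y2(3,2)[OF y]] unfolding p(3)[symmetric] vec m(3)[symmetric] H_Res_def vector_minus_component .
    have "norm (H_Res x y) \<le> cmod (H_Res x y $ 1) + cmod (H_Res x y $ 2)"
      using L2_set_le_sum[of UNIV "\<lambda>i. cmod (H_Res x y $ i)"] unfolding norm_vec_def sum_2 by simp
    then have H: "norm (H_Res x y) \<le> (C2 + C3) * norm x powr (-3/2)" using H1 H2 by (simp add: distrib_right)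
    have "C1 * norm x powr (-3/2) \<le> (C1 + C2 + C3 + 1) * norm x powr (-3/2)" "(C2 + C3) * norm x powr (-3/2) \<le> (C1 + C2 + C3 + 1) * norm x powr (-3/2)"
      using 1(1) 2(1) 3(1) by (auto intro!: mult_right_mono)
    then show "norm (G_Res x y) \<le> (C1 + C2 + C3 + 1) * norm x powr (- 3 / 2) \<and> norm (H_Res x y) \<le> (C1 + C2 + C3 + 1) * norm x powr (- 3 / 2)"
      using G H by linarith
  qed
  ultimately show ?thesis by blast
qed

end
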